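(* Let $k\ge 6$ be an integer and let $G$ be a finite simple $2$-connected graph containing a non-separating induced odd cycle. If the minimum degree of $G$ is at least $k$, then $G$ contains $k$ cycles of consecutive lengths (i.e. there is an integer $\ell$ such that $G$ contains a cycle of length $\ell+i$ for each $i\in\{0,\dots,k-1\}$), unless $G$ is the complete graph $K_{k+1}$.
   Context: All graphs are finite, simple and undirected; the length of a cycle is its number of edges. A cycle $C$ in a connected graph $G$ is non-separating if $G-V(C)$ is connected; it is induced if $G[V(C)]=C$; it is odd if it has odd length. *)

theory Defs
  imports "Graph_Theory.Graph_Theory"
begin

text \<open>
  Finite simple undirected graphs are the locale \<^locale>\<open>graph\<close>: finite, loopfree, symmetric
  digraphs without parallel arcs, every undirected edge being a pair of opposite arcs.
\<close>

text \<open>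
  A cycle of an undirected graph is a directed cycle of the symmetric digraph with at least three
  arcs: the closed walk \<open>a, b, a\<close> is a directed cycle but not an undirected one. The list \<open>p\<close> has
  one arc for each edge of the cycle, so the length of the cycle is \<open>length p\<close>.
\<close>

definition ucycle :: "('a,'b) pre_digraph \<Rightarrow> 'b list \<Rightarrow> bool" where
  "ucycle G p \<longleftrightarrow> pre_digraph.cycle G p \<and> 3 \<le> length p"

definition cycle_verts :: "('a,'b) pre_digraph \<Rightarrow> 'b list \<Rightarrow> 'a set" where
  "cycle_verts G p = tail G ` set p"

text \<open>The cycle as an undirected subgraph, hence with both orientations of each of its edges.\<close>

definition cycle_graph :: "('a,'b) pre_digraph \<Rightarrow> 'b list \<Rightarrow> ('a,'b) pre_digraph" where
  "cycle_graph G p =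
    \<lparr> verts = cycle_verts G p,
      arcs = {e \<in> arcs G. \<exists>f \<in> set p. (tail G e, head G e) = (tail G f, head G f)
                                   \<or> (tail G e, head G e) = (head G f, tail G f)},
      tail = tail G, head = head G \<rparr>"

definition delete_verts :: "('a,'b) pre_digraph \<Rightarrow> 'a set \<Rightarrow> ('a,'b) pre_digraph" where
  "delete_verts G X = G \<restriction> (verts G - X)"

definition nonseparating_cycle :: "('a,'b) pre_digraph \<Rightarrow> 'b list \<Rightarrow> bool" where
  "nonseparating_cycle G p \<longleftrightarrow> ucycle G p \<and> connected (delete_verts G (cycle_verts G p))"

definition induced_cycle :: "('a,'b) pre_digraph \<Rightarrow> 'b list \<Rightarrow> bool" where
  "induced_cycle G p \<longleftrightarrow> ucycle G p \<and> G \<restriction> cycle_verts G p = cycle_graph G p"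

definition odd_cycle :: "('a,'b) pre_digraph \<Rightarrow> 'b list \<Rightarrow> bool" where
  "odd_cycle G p \<longleftrightarrow> ucycle G p \<and> odd (length p)"

definition vertex_connected :: "nat \<Rightarrow> ('a,'b) pre_digraph \<Rightarrow> bool" where
  "vertex_connected n G \<longleftrightarrow> n < card (verts G) \<and>
    (\<forall>X \<subseteq> verts G. card X < n \<longrightarrow> connected (delete_verts G X))"

text \<open>In a symmetric digraph without parallel arcs the out-degree of a vertex is its number of
  neighbours.\<close>

definition min_degree :: "('a,'b) pre_digraph \<Rightarrow> nat" where
  "min_degree G = Min (out_degree G ` verts G)"

end

theory Submission
  imports Defs
begin

text \<open>
  A graph with two roots \<open>x\<close>, \<open>y\<close> that is 2-connected relative to the roots and whose inner vertices
  have degree at least \<open>d\<close>, one of them possibly excepted, has \<open>x\<close>-\<open>y\<close> paths whose lengths run through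
  an interval of length \<open>d - 2\<close> without missing two consecutive numbers; in the triangle-free case with
  \<open>d \<ge> 5\<close> and no exception the interval has length \<open>d - 1\<close>. Both are proved by induction: reduce at
  small cuts, contract the neighbourhood of \<open>x\<close>, or delete a triangle or a four-cycle at \<open>x\<close>, which
  lowers \<open>d\<close> by as much as the two routes around the deleted cycle gain.

  If \<open>G\<close> contains a triangle, take a maximum clique of size at least four, a diamond, or a triangle,
  and contract two parts of it to the roots of a component of the rest: paths inside this core have
  enough consecutive lengths to close the gaps. If \<open>G\<close> is triangle-free, take a shortest non-separating
  induced odd cycle. Its complement has an end part \<open>F\<close> behind a gate \<open>b\<close>; minimality implies that a vertex
  of \<open>F\<close> has at most two neighbours on the cycle, at distance two. The two arcs between nearly antipodal
  vertices of the cycle have lengths differing by one, and combined with the paths through \<open>F\<close> they give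
  all consecutive lengths.
\<close>

text \<open>A rooted graph can be promised lengths only up to single gaps, since a bipartite one has
  paths of one parity; the other parity must come from the triangle or the odd cycle. The accounting
  trades degree for lengths: cutting out a core costs a vertex of the rest \<open>j\<close> degrees
  and leaves span \<open>k - j - 2\<close>, so the core has to return \<open>j + 2\<close>
  consecutive lengths.

  The exceptional vertex makes the induction close. At a cut \<open>x\<close>, \<open>b\<close>,
  \<open>g\<close>, taking two of the vertices as roots and forgetting the third costs a degree.
  Keeping \<open>b\<close> as an inner vertex costs nothing, but no degree bound is then available
  for \<open>b\<close>. The same device absorbs a single vertex that a deletion damages too much.

  In the triangle-free statement a cut of three vertices yields two pieces of span
  \<open>d - 3\<close> each, and \<open>d - 3 + (d - 3)\<close> reaches \<open>d - 1\<close> only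
  for \<open>d \<ge> 5\<close>. That statement is applied with \<open>d = k - 1\<close>, which asks
  for \<open>k \<ge> 6\<close>.\<close>

section \<open>Paths with prescribed inner vertices\<close>

text \<open>The set \<open>U\<close> consists of exactly the inner vertices, so that such a path has length \<open>card U + 1\<close>.\<close>
inductive exact_path :: "('a \<Rightarrow> 'a \<Rightarrow> bool) \<Rightarrow> 'a set \<Rightarrow> 'a \<Rightarrow> 'a \<Rightarrow> bool" for E where
  base: "E x y \<Longrightarrow> x \<noteq> y \<Longrightarrow> exact_path E {} x y"
| step: "E x w \<Longrightarrow> exact_path E U w y \<Longrightarrow> x \<notin> insert w U \<Longrightarrow> x \<noteq> y \<Longrightarrow> exact_path E (insert w U) x y"

lemma exact_path_facts:
  assumes "exact_path E U x y" shows "finite U" "x \<notin> U" "y \<notin> U" "x \<noteq> y"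
  using assms by (induction) auto

lemma exact_path_first:
  assumes "exact_path E U x y"
  shows "(U = {} \<and> E x y) \<or> (\<exists>w\<in>U. E x w \<and> exact_path E (U - {w}) w y)"
  using assms
proof cases
  case (step w U')
  then have "w \<notin> U'" using exact_path_facts by metis
  then have "U - {w} = U'" using step by auto
  then show ?thesis using step by auto
qed auto

lemma exact_path_concat:
  assumes "exact_path E U x c" "exact_path E W c y" "U \<inter> W = {}" "x \<notin> W" "y \<notin> U" "x \<noteq> y"
  shows "exact_path E (insert c (U \<union> W)) x y"
  using assms
proof (induction)
  case (base x c)
  then show ?case by (simp add: exact_path.step)
next
  case (step x w U c)
  have "exact_path E (insert c (U \<union> W)) w y" using step by auto
  moreover have "x \<notin> insert w (insert c (U \<union> W))" using step by auto
  ultimately have "exact_path E (insert w (insert c (U \<union> W))) x y" using step exact_path.step by metis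
  then show ?case by (simp add: insert_commute)
qed

lemma exact_path_sym:
  assumes "\<And>u v. E u v \<Longrightarrow> E v u" "exact_path E U x y" shows "exact_path E U y x"
  using assms(2)
proof (induction)
  case (base x y) then show ?case using assms(1) by (auto intro: exact_path.base)
next
  case (step x w U y)
  have "exact_path E {} w x" using step assms(1) by (auto intro: exact_path.base)
  from exact_path_concat[OF step(5) this] have "exact_path E (insert w (U \<union> {})) y x" using step by auto
  then show ?case by simp
qed

lemma exact_path_split:
  assumes "exact_path E U x y" "q \<in> U"
  shows "\<exists>U1 U2. U = insert q (U1 \<union> U2) \<and> q \<notin> U1 \<and> q \<notin> U2 \<and> U1 \<inter> U2 = {} \<and> exact_path E U1 x q \<and> exact_path E U2 q y"
  using assms
proof (induction)
  case (base x y) then show ?case by simp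
next
  case (step x w U y)
  show ?case
  proof (cases "q = w")
    case True
    have "exact_path E {} x q" using step True by (auto intro: exact_path.base)
    moreover have "q \<notin> U" using exact_path_facts[OF step(2)] True by auto
    ultimately show ?thesis using step True by (intro exI[of _ "{}"] exI[of _ U]) auto
  next
    case False
    then obtain U1 U2 where U: "U = insert q (U1 \<union> U2)" "q \<notin> U1" "q \<notin> U2" "U1 \<inter> U2 = {}" "exact_path E U1 w q" "exact_path E U2 q y"
      using step by auto
    have w: "w \<notin> U" using exact_path_facts[OF step(2)] by auto
    have "exact_path E (insert w U1) x q" using step(1) U(5) step(3) U(1) by (intro exact_path.step) auto
    moreover have "insert w U = insert q (insert w U1 \<union> U2)" using U(1) by auto
    moreover have "q \<notin> insert w U1" "insert w U1 \<inter> U2 = {}" using U w False by auto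
    ultimately show ?thesis using U(3,6) by blast
  qed
qed

lemma exact_path_cong:
  assumes "exact_path E U x y" "\<And>u v. u \<in> insert x (insert y U) \<Longrightarrow> v \<in> insert x (insert y U) \<Longrightarrow> E u v \<Longrightarrow> E' u v"
  shows "exact_path E' U x y"
  using assms
proof (induction)
  case (base x y) then show ?case by (auto intro: exact_path.base)
next
  case (step x w U y)
  have "E' x w" using step by auto
  moreover have "exact_path E' U w y" using step by auto
  ultimately show ?case using step by (auto intro: exact_path.step)
qed

text \<open>The start \<open>v\<close> need not lie in \<open>W\<close>. With a root as start,
  \<open>reach E W y\<close> is the root together with all parts of \<open>W\<close> that are
  attached to it.\<close>

definition reach :: "('a \<Rightarrow> 'a \<Rightarrow> bool) \<Rightarrow> 'a set \<Rightarrow> 'a \<Rightarrow> 'a set" where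
  "reach E W v = {u. (\<lambda>a b. E a b \<and> b \<in> W)\<^sup>*\<^sup>* v u}"

lemma reach_self [simp]: "v \<in> reach E W v" by (simp add: reach_def)

lemma reach_step: "u \<in> reach E W v \<Longrightarrow> E u w \<Longrightarrow> w \<in> W \<Longrightarrow> w \<in> reach E W v"
  unfolding reach_def by (auto intro: rtranclp.rtrancl_into_rtrancl)

lemma reach_least:
  assumes "v \<in> S" "\<And>u w. u \<in> S \<Longrightarrow> E u w \<Longrightarrow> w \<in> W \<Longrightarrow> w \<in> S"
  shows "reach E W v \<subseteq> S"
proof
  fix u assume "u \<in> reach E W v"
  then have "(\<lambda>a b. E a b \<and> b \<in> W)\<^sup>*\<^sup>* v u" by (simp add: reach_def)
  then show "u \<in> S" by (induction) (use assms in auto)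
qed

lemma reach_sub: "reach E W v \<subseteq> insert v W"
  by (rule reach_least) auto

text \<open>Induction along the walk: whenever it returns to a vertex of the path built so far, the
  path is cut there, so the walk becomes simple.\<close>

lemma reach_exact_path:
  assumes "u \<in> reach E W v" "u \<noteq> v"
  shows "\<exists>U. U \<subseteq> reach E W v \<inter> W - {u, v} \<and> exact_path E U v u"
proof -
  have "(\<lambda>a b. E a b \<and> b \<in> W)\<^sup>*\<^sup>* v u" using assms by (simp add: reach_def)
  then have "u = v \<or> (\<exists>U. U \<subseteq> reach E W v \<inter> W - {u, v} \<and> exact_path E U v u)"
  proof (induction)
    case base then show ?case by simp
  next
    case (step a b)
    have a: "a \<in> reach E W v" using step(1) by (simp add: reach_def)
    have b: "b \<in> reach E W v" using step a by (auto intro: reach_step)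
    show ?case
    proof (cases "b = v")
      case False
      show ?thesis
      proof (cases "a = v")
        case True
        then have "exact_path E {} v b" using step False by (auto intro: exact_path.base)
        then show ?thesis by blast
      next
        case av: False
        then obtain U where U: "U \<subseteq> reach E W v \<inter> W - {a, v}" "exact_path E U v a" using step by auto
        show ?thesis
        proof (cases "b \<in> U")
          case True
          from exact_path_split[OF U(2) True] obtain U1 U2 where "U = insert b (U1 \<union> U2)" "b \<notin> U1" "exact_path E U1 v b" by auto
          then show ?thesis using U by blast
        next
          case bU: False
          have aW: "a \<in> W" using a av reach_sub by fastforce
          show ?thesis
          proof (cases "a = b")
            case True then show ?thesis using U by blast
          next
            case False
            then have "exact_path E {} a b" using step by (auto intro: exact_path.base)
            from exact_path_concat[OF U(2) this] have "exact_path E (insert a U) v b" using bU \<open>b \<noteq> v\<close> by auto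
            then show ?thesis using U a aW av False bU by (intro disjI2 exI[of _ "insert a U"]) auto
          qed
        qed
      qed
    qed auto
  qed
  then show ?thesis using assms by auto
qed

text \<open>The target lies outside \<open>W\<close>, typically a root or a deleted vertex, and is
  met through the last edge only.\<close>

lemma reach_to_neighbour:
  assumes "z \<in> reach E W v" "E z y" "y \<notin> W" "y \<noteq> v"
  shows "\<exists>U. U \<subseteq> reach E W v \<inter> W - {v} \<and> exact_path E U v y"
proof (cases "z = v")
  case True
  then have "exact_path E {} v y" using assms by (auto intro: exact_path.base)
  then show ?thesis by blast
next
  case False
  then obtain U where U: "U \<subseteq> reach E W v \<inter> W - {z, v}" "exact_path E U v z" using reach_exact_path[OF assms(1)] by auto
  have zW: "z \<in> W" using assms(1) False reach_sub by fastforce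
  then have "exact_path E {} z y" using assms by (auto intro: exact_path.base)
  from exact_path_concat[OF U(2) this] have "exact_path E (insert z U) v y" using U assms by auto
  then show ?thesis using U assms(1) zW False by (intro exI[of _ "insert z U"]) auto
qed

text \<open>Otherwise the reached set without \<open>F\<close> would be closed under steps.
  Connectedness is used mostly in this cut form.\<close>

lemma reach_crossing:
  assumes "\<And>u v. E u v \<Longrightarrow> E v u" "F \<subseteq> reach E W v" "F \<noteq> {}" "v \<notin> F"
  shows "\<exists>f\<in>F. \<exists>u\<in>reach E W v - F. E f u"
proof (rule ccontr)
  assume c: "\<not> ?thesis"
  have "reach E W v \<subseteq> reach E W v - F"
  proof (rule reach_least)
    fix u w assume "u \<in> reach E W v - F" "E u w" "w \<in> W"
    then show "w \<in> reach E W v - F" using c assms(1) reach_step[of u E W v w] by blast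
  qed (use assms in auto)
  then show False using assms by auto
qed

lemma reach_crossing2:
  assumes "\<And>u v. E u v \<Longrightarrow> E v u" "F \<subseteq> reach E W v" "F \<noteq> {}" "F \<noteq> reach E W v" "v \<in> W"
  shows "\<exists>f\<in>F. \<exists>u\<in>reach E W v - F. E f u"
proof (cases "v \<in> F")
  case True
  show ?thesis
  proof (rule ccontr)
    assume c: "\<not> ?thesis"
    have "reach E W v \<subseteq> F"
    proof (rule reach_least)
      fix u w assume "u \<in> F" "E u w" "w \<in> W"
      then show "w \<in> F" using c assms reach_step[of u E W v w] by blast
    qed (use True in auto)
    then show False using assms by auto
  qed
next
  case False then show ?thesis using reach_crossing[of E F W v] assms by blast
qed

section \<open>Neighbourhoods, degrees and sets of path lengths\<close>

definition nbhd :: "('a \<Rightarrow> 'a \<Rightarrow> bool) \<Rightarrow> 'a set \<Rightarrow> 'a set \<Rightarrow> 'a set" where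
  "nbhd E V F = {w \<in> V. w \<notin> F \<and> (\<exists>f\<in>F. E f w)}"

definition degree_in :: "('a \<Rightarrow> 'a \<Rightarrow> bool) \<Rightarrow> 'a set \<Rightarrow> 'a \<Rightarrow> nat" where
  "degree_in E V v = card {w \<in> V. E v w}"

text \<open>The shape of all degree estimates after a modification: \<open>B\<close> survives,
  \<open>Q\<close> contains the lost neighbours, and \<open>X\<close> collects those gained through
  a contracted root.\<close>

lemma degree_in_loss:
  assumes "{w \<in> V. E v w} \<subseteq> B \<union> Q" "B \<subseteq> {w \<in> V'. E' v w}" "X \<subseteq> {w \<in> V'. E' v w}" "B \<inter> X = {}"
    "finite V'" "finite Q" "card Q \<le> card X + j"
  shows "degree_in E V v \<le> degree_in E' V' v + j"
proof -
  have f: "finite {w \<in> V'. E' v w}" using assms(5) by simp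
  have fB: "finite B" "finite X" using finite_subset[OF _ f] assms by blast+
  have "card {w \<in> V. E v w} \<le> card (B \<union> Q)" by (rule card_mono) (use assms fB in auto)
  also have "\<dots> \<le> card B + card Q" by (rule card_Un_le)
  also have "\<dots> \<le> card B + card X + j" using assms by simp
  also have "card B + card X = card (B \<union> X)" using card_Un_disjoint[OF fB assms(4)] by simp
  also have "card (B \<union> X) \<le> card {w \<in> V'. E' v w}" by (rule card_mono[OF f]) (use assms in auto)
  finally show ?thesis by (simp add: degree_in_def)
qed

definition path_lengths :: "('a \<Rightarrow> 'a \<Rightarrow> bool) \<Rightarrow> 'a set \<Rightarrow> 'a \<Rightarrow> 'a \<Rightarrow> nat set" where
  "path_lengths E I x y = {n. \<exists>U. U \<subseteq> I \<and> exact_path E U x y \<and> n = Suc (card U)}"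

lemma path_lengthsI: "U \<subseteq> I \<Longrightarrow> exact_path E U x y \<Longrightarrow> n = Suc (card U) \<Longrightarrow> n \<in> path_lengths E I x y"
  by (auto simp: path_lengths_def)

lemma path_lengths_sym: "(\<And>u v. E u v \<Longrightarrow> E v u) \<Longrightarrow> path_lengths E I x y = path_lengths E I y x"
  by (auto simp: path_lengths_def intro: exact_path_sym)

text \<open>Spans add up under sumsets, and adding the two lengths \<open>t\<close> and \<open>t + 1\<close> to all elements closes the gaps.\<close>
definition spans :: "nat set \<Rightarrow> nat \<Rightarrow> bool" where
  "spans A m \<longleftrightarrow> (\<exists>a b. a \<in> A \<and> b \<in> A \<and> a + m \<le> b \<and> (\<forall>n. a \<le> n \<and> n < b \<longrightarrow> n \<in> A \<or> Suc n \<in> A))"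

lemma spans_mono: "spans A m \<Longrightarrow> A \<subseteq> B \<Longrightarrow> m' \<le> m \<Longrightarrow> spans B m'"
  unfolding spans_def by (meson add_le_mono le_refl le_trans subsetD)

text \<open>With the bottom \<open>c\<close> of the second interval fixed, the sums run through the
  first interval; with the top \<open>b\<close> of the first fixed, they run through the second. The
  two runs meet at \<open>b + c\<close>.\<close>

lemma spans_sum:
  assumes "spans A m" "spans B g" "\<And>a b. a \<in> A \<Longrightarrow> b \<in> B \<Longrightarrow> a + b \<in> C"
  shows "spans C (m + g)"
proof -
  obtain a b where 1: "a \<in> A" "b \<in> A" "a + m \<le> b" "\<And>n. a \<le> n \<Longrightarrow> n < b \<Longrightarrow> n \<in> A \<or> Suc n \<in> A"
    using assms(1) unfolding spans_def by auto
  obtain c d where 2: "c \<in> B" "d \<in> B" "c + g \<le> d" "\<And>n. c \<le> n \<Longrightarrow> n < d \<Longrightarrow> n \<in> B \<or> Suc n \<in> B"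
    using assms(2) unfolding spans_def by auto
  have "n \<in> C \<or> Suc n \<in> C" if n: "a + c \<le> n" "n < b + d" for n
  proof (cases "n < b + c")
    case True
    then have "n - c \<in> A \<or> Suc (n - c) \<in> A" using n 1(4)[of "n - c"] by auto
    then show ?thesis using assms(3)[OF _ 2(1)] n by (metis add_Suc le_add_diff_inverse2 le_add2 le_trans)
  next
    case False
    then have "n - b \<in> B \<or> Suc (n - b) \<in> B" using n 2(4)[of "n - b"] by auto
    then show ?thesis using assms(3)[OF 1(2)] n False
      by (metis add_Suc_right le_add1 le_add_diff_inverse le_trans not_less)
  qed
  then show ?thesis unfolding spans_def using 1 2 assms(3)
    by (intro exI[of _ "a + c"] exI[of _ "b + d"]) auto
qed

lemma spans_shift: "spans A m \<Longrightarrow> (\<And>n. n \<in> A \<Longrightarrow> n + k \<in> B) \<Longrightarrow> spans B m"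
  using spans_sum[of A m "{k}" 0 B] unfolding spans_def[of "{k}"] by auto

lemma spans_0: "a \<in> A \<Longrightarrow> spans A 0"
  unfolding spans_def by (intro exI[of _ a]) auto

lemma spans_pair1: "a \<in> A \<Longrightarrow> Suc a \<in> A \<Longrightarrow> spans A 1"
  unfolding spans_def by (intro exI[of _ a] exI[of _ "Suc a"]) (auto simp: less_Suc_eq_le)

lemma spans_pair2: "a \<in> A \<Longrightarrow> Suc (Suc a) \<in> A \<Longrightarrow> spans A 2"
  unfolding spans_def by (intro exI[of _ a] exI[of _ "Suc (Suc a)"]) (auto simp: less_Suc_eq_le le_Suc_eq)

text \<open>The gain from a detour: two routes around a triangle differ in length by one as here,
  two routes around a four-cycle by two as in \<open>spans_thick2\<close>.\<close>

lemma spans_thick1: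
  assumes "spans A m" "\<And>n. n \<in> A \<Longrightarrow> n + k \<in> B" "\<And>n. n \<in> A \<Longrightarrow> n + Suc k \<in> B"
  shows "spans B (m + 1)"
  by (rule spans_sum[OF assms(1) spans_pair1[of k "{k, Suc k}"]]) (use assms in auto)

lemma spans_thick2:
  assumes "spans A m" "\<And>n. n \<in> A \<Longrightarrow> n + k \<in> B" "\<And>n. n \<in> A \<Longrightarrow> n + Suc (Suc k) \<in> B"
  shows "spans B (m + 2)"
  by (rule spans_sum[OF assms(1) spans_pair2[of k "{k, Suc (Suc k)}"]]) (use assms in auto)

text \<open>All edges at \<open>x\<close> are discarded and replaced by edges to \<open>S\<close>.
  With \<open>S\<close> the neighbourhood of a set \<open>Z\<close> this is the contraction of
  \<open>Z\<close>, under the existing name \<open>x\<close>, so no new vertex is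
  introduced.\<close>

definition reroot :: "('a \<Rightarrow> 'a \<Rightarrow> bool) \<Rightarrow> 'a \<Rightarrow> 'a set \<Rightarrow> 'a \<Rightarrow> 'a \<Rightarrow> bool" where
  "reroot E x S u w = (if u = x then w \<noteq> x \<and> w \<in> S else if w = x then u \<in> S else E u w)"

lemma reroot_first:
  assumes "exact_path (reroot E x S) U x y"
  shows "(U = {} \<and> y \<in> S) \<or> (\<exists>w\<in>U. w \<in> S \<and> exact_path E (U - {w}) w y)"
proof -
  have f: "x \<notin> U" "y \<noteq> x" using exact_path_facts[OF assms] by auto
  from exact_path_first[OF assms] show ?thesis
  proof (elim disjE bexE conjE)
    fix w assume w: "w \<in> U" "reroot E x S x w" "exact_path (reroot E x S) (U - {w}) w y"
    have "exact_path E (U - {w}) w y"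
      by (rule exact_path_cong[OF w(3)]) (use f w in \<open>auto simp: reroot_def split: if_splits\<close>)
    then show ?thesis using w by (auto simp: reroot_def)
  qed (auto simp: reroot_def)
qed

text \<open>The first edge of the contracted path comes from some \<open>a\<close> in
  \<open>Z\<close>; replacing the root by this \<open>a\<close> keeps the inner vertices and hence
  the length, and \<open>Z \<inter> U = {}\<close> keeps the path simple.\<close>

lemma reroot_root:
  assumes "exact_path (reroot E x {w. \<exists>a\<in>Z. E a w}) U x y" "Z \<inter> U = {}" "y \<notin> Z"
  shows "\<exists>a\<in>Z. exact_path E U a y"
  using reroot_first[OF assms(1)]
proof (elim disjE bexE conjE)
  fix w assume w: "w \<in> U" "w \<in> {w. \<exists>a\<in>Z. E a w}" "exact_path E (U - {w}) w y"
  then obtain a where a: "a \<in> Z" "E a w" by auto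
  have "exact_path E (insert w (U - {w})) a y" using a w assms by (intro exact_path.step) auto
  then show ?thesis using a w by (auto simp: insert_absorb)
next
  assume "U = {}" "y \<in> {w. \<exists>a\<in>Z. E a w}"
  then show ?thesis using assms by (auto intro: exact_path.base)
qed

section \<open>Two-rooted graphs and 2-connectedness relative to the roots\<close>

locale two_rooted =
  fixes E :: "'a \<Rightarrow> 'a \<Rightarrow> bool" and I :: "'a set" and x y :: 'a
  assumes fin: "finite I" and xI: "x \<notin> I" and yI: "y \<notin> I" and xy: "x \<noteq> y"
    and sym: "\<And>u v. E u v \<Longrightarrow> E v u" and irr: "\<And>u. \<not> E u u"
begin

abbreviation "nb F \<equiv> nbhd E (insert x (insert y I)) F"

lemma swap: "two_rooted E I y x"
  using fin xI yI xy sym irr by unfold_locales auto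

lemma finite_nb: "finite (nb F)" using fin by (auto simp: nbhd_def)

end

lemma card_le1I: "S \<subseteq> {a} \<Longrightarrow> card S \<le> 1"
  using card_mono[of "{a}" S] by auto

lemma card_le2I: "S \<subseteq> {a, b} \<Longrightarrow> card S \<le> 2"
  using card_mono[of "{a, b}" S] card_insert_le_m1[of 2 "{b}" a] by auto

lemma card_ge2I: "a \<in> S \<Longrightarrow> b \<in> S \<Longrightarrow> a \<noteq> b \<Longrightarrow> finite S \<Longrightarrow> 2 \<le> card S"
  using card_mono[of S "{a, b}"] by auto

lemma card_ge2E:
  assumes "2 \<le> card S" obtains a b where "a \<in> S" "b \<in> S" "a \<noteq> b"
proof -
  have "\<not> card S \<le> 1" using assms by simp
  then have "S \<noteq> {}" by auto
  then obtain a where a: "a \<in> S" by auto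
  then have "\<not> S \<subseteq> {a}" using card_le1I[of S a] assms by auto
  then show ?thesis using a that by auto
qed

text \<open>For nonempty \<open>I\<close> this is 2-connectedness after joining the roots by an
  edge. The neighbourhood form is chosen because it passes to smaller configurations by mere
  counting.\<close>

locale two_rooted_conn = two_rooted +
  assumes cut2: "\<And>F. F \<subseteq> I \<Longrightarrow> F \<noteq> {} \<Longrightarrow> 2 \<le> card (nbhd E (insert x (insert y I)) F)"
begin

lemma swap2: "two_rooted_conn E I y x"
proof -
  interpret s: two_rooted E I y x by (rule swap)
  show ?thesis by unfold_locales (use cut2 in \<open>simp add: insert_commute\<close>)
qed

lemma no_one_cut: assumes "F \<subseteq> I" "F \<noteq> {}" "nb F \<subseteq> {c}" shows False
  using cut2[OF assms(1,2)] card_le1I[OF assms(3)] by simp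

text \<open>The component of \<open>v\<close> in \<open>I\<close> cannot have \<open>x\<close> as
  its only neighbour.\<close>

lemma path_to_y: assumes "v \<in> I" shows "\<exists>U. U \<subseteq> I - {v} \<and> exact_path E U v y"
proof -
  let ?Z = "reach E I v"
  have Z: "?Z \<subseteq> I" using reach_sub[of E I v] assms by auto
  have "\<exists>z\<in>?Z. E z y"
  proof (rule ccontr)
    assume c: "\<not> ?thesis"
    have "nb ?Z \<subseteq> {x}" using c reach_step[of _ E I v] by (auto simp: nbhd_def)
    then show False using no_one_cut[OF Z] by (metis empty_iff reach_self)
  qed
  then obtain z where "z \<in> ?Z" "E z y" by auto
  from reach_to_neighbour[OF this] obtain U where "U \<subseteq> ?Z \<inter> I - {v} \<and> exact_path E U v y" using yI assms by auto
  then show ?thesis by blast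
qed

text \<open>An \<open>x\<close>-\<open>y\<close> path through \<open>v\<close>, kept as two halves
  leaving \<open>v\<close>, because the halves are what is rerouted when \<open>v\<close> moves
  along an edge.\<close>

definition "disjoint_paths_through v \<longleftrightarrow> (\<exists>A B. A \<subseteq> I - {v} \<and> B \<subseteq> I - {v} \<and> A \<inter> B = {} \<and> exact_path E A v x \<and> exact_path E B v y)"

lemma disjoint_paths_throughI:
  assumes "exact_path E A v x" "exact_path E B v y" "A \<subseteq> I - {v}" "B \<subseteq> I - {v}" "A \<inter> B = {}" shows "disjoint_paths_through v"
  using assms unfolding disjoint_paths_through_def by blast

text \<open>If \<open>v\<close> lies on one half, the segment back to \<open>p\<close> is joined to
  the other half. Otherwise the component of \<open>v\<close> off \<open>p\<close> and both halves
  has a neighbour besides \<open>p\<close>, which is a root or lies on a half. Branching off there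
  replaces the beginning of that half, and the other half is entered through
  \<open>p\<close>.\<close>

lemma disjoint_paths_through_step:
  assumes "disjoint_paths_through p" "E p v" "v \<in> I" "p \<in> I" shows "disjoint_paths_through v"
proof -
  from assms obtain A B where AB: "A \<subseteq> I - {p}" "B \<subseteq> I - {p}" "A \<inter> B = {}" "exact_path E A p x" "exact_path E B p y"
    unfolding disjoint_paths_through_def by auto
  have vp: "v \<noteq> p" using assms irr by auto
  have vxy: "v \<noteq> x" "v \<noteq> y" using assms xI yI by auto
  have evp: "E v p" using assms sym by auto
  have xyn: "x \<notin> A" "x \<notin> B" "y \<notin> A" "y \<notin> B" using AB xI yI by auto
  consider "v \<in> A" | "v \<in> B" | "v \<notin> A" "v \<notin> B" by auto
  then show ?thesis
  proof cases
    case 1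
    from exact_path_split[OF AB(4) 1] obtain A1 A2 where A: "A = insert v (A1 \<union> A2)" "v \<notin> A1" "v \<notin> A2" "A1 \<inter> A2 = {}"
      "exact_path E A1 p v" "exact_path E A2 v x" by auto
    have "exact_path E (insert p (A1 \<union> B)) v y"
      by (rule exact_path_concat[OF exact_path_sym[OF sym A(5)] AB(5)]) (use A AB xyn vxy in auto)
    from disjoint_paths_throughI[OF A(6) this] show ?thesis using A(1-4) AB(1-3) vp assms(4) 1 by blast
  next
    case 2
    from exact_path_split[OF AB(5) 2] obtain A1 A2 where A: "B = insert v (A1 \<union> A2)" "v \<notin> A1" "v \<notin> A2" "A1 \<inter> A2 = {}"
      "exact_path E A1 p v" "exact_path E A2 v y" by auto
    have "exact_path E (insert p (A1 \<union> A)) v x"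
      by (rule exact_path_concat[OF exact_path_sym[OF sym A(5)] AB(4)]) (use A AB xyn vxy in auto)
    from disjoint_paths_throughI[OF this A(6)] show ?thesis using A(1-4) AB(1-3) vp assms(4) 2 by blast
  next
    case 3
    define W where "W = I - {p} - A - B"
    have vW: "v \<in> W" using 3 assms vp W_def by auto
    have ZW: "reach E W v \<subseteq> W" using reach_sub[of E W v] vW by auto
    have "\<exists>z\<in>reach E W v. \<exists>q\<in>A \<union> B \<union> {x,y}. E z q"
    proof (rule ccontr)
      assume c: "\<not> ?thesis"
      have "nb (reach E W v) \<subseteq> {p}"
      proof
        fix w assume "w \<in> nb (reach E W v)"
        then obtain z where w: "w \<in> insert x (insert y I)" "w \<notin> reach E W v" "z \<in> reach E W v" "E z w" by (auto simp: nbhd_def)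
        then have "w \<notin> W" using reach_step[of z E W v w] by auto
        then show "w \<in> {p}" using c w W_def by auto
      qed
      moreover have "reach E W v \<noteq> {}" using reach_self[of v E W] by blast
      moreover have "reach E W v \<subseteq> I" using ZW W_def by blast
      ultimately show False using no_one_cut[of "reach E W v"] by blast
    qed
    then obtain z q where zq: "z \<in> reach E W v" "E z q" "q \<in> A \<union> B \<union> {x,y}" by auto
    have "q \<notin> W" "q \<noteq> v" using zq 3 vxy xI yI W_def by auto
    from reach_to_neighbour[OF zq(1,2) this] obtain C where C: "C \<subseteq> W - {v}" "exact_path E C v q" using ZW by blast
    have Cd: "C \<inter> A = {}" "C \<inter> B = {}" "p \<notin> C" "C \<subseteq> I - {v}" using C W_def by auto
    have pB: "exact_path E (insert p B) v y" using exact_path.step[OF evp AB(5)] vp 3 vxy by auto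
    have pA: "exact_path E (insert p A) v x" using exact_path.step[OF evp AB(4)] vp 3 vxy by auto
    from zq(3) consider "q = x" | "q = y" | "q \<in> A" | "q \<in> B" by auto
    then show ?thesis
    proof cases
      case 1
      then have "exact_path E C v x" using C by simp
      from disjoint_paths_throughI[OF this pB] show ?thesis using Cd AB(1-3) vp 3 assms(4) by blast
    next
      case 2
      then have "exact_path E C v y" using C by simp
      from disjoint_paths_throughI[OF pA this] show ?thesis using Cd AB(1-3) vp 3 assms(4) by blast
    next
      case q: 3
      from exact_path_split[OF AB(4) q] obtain A1 A2 where A: "A = insert q (A1 \<union> A2)" "q \<notin> A1" "q \<notin> A2" "A1 \<inter> A2 = {}"
        "exact_path E A1 p q" "exact_path E A2 q x" by auto
      have "exact_path E (insert q (C \<union> A2)) v x"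
        by (rule exact_path_concat[OF C(2) A(6)]) (use A AB xyn vxy Cd 3 xI in auto)
      from disjoint_paths_throughI[OF this pB] show ?thesis using Cd AB(1-3) vp 3 assms(4) A(1-4) by blast
    next
      case q: 4
      from exact_path_split[OF AB(5) q] obtain A1 A2 where A: "B = insert q (A1 \<union> A2)" "q \<notin> A1" "q \<notin> A2" "A1 \<inter> A2 = {}"
        "exact_path E A1 p q" "exact_path E A2 q y" by auto
      have "exact_path E (insert q (C \<union> A2)) v y"
        by (rule exact_path_concat[OF C(2) A(6)]) (use A AB xyn vxy Cd 3 yI in auto)
      from disjoint_paths_throughI[OF pA this] show ?thesis using Cd AB(1-3) vp 3 assms(4) A(1-4) by blast
    qed
  qed
qed

text \<open>The vertices failing the property form a set with no neighbour at all: inner neighbours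
  are excluded by \<open>disjoint_paths_through_step\<close>, the roots by \<open>path_to_y\<close>
  and its mirror image.\<close>

lemma disjoint_paths_through_all: assumes "v \<in> I" shows "disjoint_paths_through v"
proof (rule ccontr)
  assume n: "\<not> disjoint_paths_through v"
  define F where "F = {v\<in>I. \<not> disjoint_paths_through v}"
  interpret s: two_rooted_conn E I y x by (rule swap2)
  have bx: "disjoint_paths_through f" if f: "f \<in> I" "E f x" for f
  proof -
    obtain U where "U \<subseteq> I - {f}" "exact_path E U f y" using path_to_y[OF f(1)] by auto
    moreover have "exact_path E {} f x" using f xI by (auto intro: exact_path.base)
    ultimately show ?thesis unfolding disjoint_paths_through_def by blast
  qed
  have by': "disjoint_paths_through f" if f: "f \<in> I" "E f y" for f
  proof -
    obtain U where "U \<subseteq> I - {f}" "exact_path E U f x" using s.path_to_y[OF f(1)] by auto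
    moreover have "exact_path E {} f y" using f yI by (auto intro: exact_path.base)
    ultimately show ?thesis unfolding disjoint_paths_through_def by blast
  qed
  have "nb F = {}"
  proof (rule ccontr)
    assume "nb F \<noteq> {}"
    then obtain w f where w: "w \<in> insert x (insert y I)" "w \<notin> F" "f \<in> F" "E f w" unfolding nbhd_def by blast
    then have f: "f \<in> I" "\<not> disjoint_paths_through f" by (auto simp: F_def)
    show False
    proof (cases "w \<in> I")
      case True
      then have "disjoint_paths_through w" using w F_def by auto
      then show False using disjoint_paths_through_step[of w f] f True w sym by auto
    next
      case False then show False using bx by' f w by auto
    qed
  qed
  moreover have "F \<noteq> {}" "F \<subseteq> I" using n assms F_def by auto
  ultimately show False using cut2[of F] by simp
qed

text \<open>Shrinking \<open>F\<close> to one vertex \<open>f\<close> adjacent to \<open>c\<close>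
  and \<open>c'\<close> preserves 2-connectedness, so some \<open>x\<close>-\<open>y\<close> path
  runs through \<open>f\<close>, necessarily via \<open>c\<close> and \<open>c'\<close>. The
  constant \<open>k\<close> counts the edges of this path that are not at \<open>f\<close>.\<close>

lemma two_cut_shift:
  assumes F: "F \<subseteq> I" "F \<noteq> {}" and c: "nb F = {c, c'}" "c \<noteq> c'"
  shows "\<exists>k. \<forall>n\<in>path_lengths E F c c'. n + k \<in> path_lengths E I x y"
proof -
  obtain f where f: "f \<in> F" using F by auto
  define J where "J = insert f (I - F)"
  define E0 where "E0 = reroot E f {c, c'}"
  have cF: "c \<notin> F" "c' \<notin> F" "c \<in> insert x (insert y I)" "c' \<in> insert x (insert y I)" using c by (auto simp: nbhd_def)
  have fI: "f \<in> I" "f \<noteq> x" "f \<noteq> y" "f \<noteq> c" "f \<noteq> c'" using f F xI yI cF by auto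
  have E0s: "E0 u v \<Longrightarrow> E0 v u" for u v unfolding E0_def reroot_def using sym by (auto split: if_splits)
  have e0: "E0 u v = E u v" if "u \<noteq> f" "v \<noteq> f" for u v using that by (auto simp: E0_def reroot_def)
  have e0f: "E0 u f \<longleftrightarrow> u \<in> {c, c'}" "E0 f u \<longleftrightarrow> u \<in> {c,c'}" for u using fI by (auto simp: E0_def reroot_def)
  interpret q: two_rooted E0 J x y
    by unfold_locales (use fin xI yI xy E0s irr fI in \<open>auto simp: J_def E0_def reroot_def\<close>)
  interpret q: two_rooted_conn E0 J x y
  proof unfold_locales
    fix F2 assume F2: "F2 \<subseteq> J" "F2 \<noteq> {}"
    let ?n = "nbhd E0 (insert x (insert y J)) F2"
    have fn: "finite ?n" using q.finite_nb by auto
    show "2 \<le> card ?n"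
    proof (cases "f \<in> F2")
      case True
      \<comment> \<open>\<open>f\<close> stands for all of \<open>F\<close>, so it is expanded
        before \<open>cut2\<close> of the original graph is applied.\<close>
      let ?F3 = "(F2 - {f}) \<union> F"
      have F3: "?F3 \<subseteq> I" "?F3 \<noteq> {}" using F2 F f by (auto simp: J_def)
      have "nb ?F3 \<subseteq> ?n"
      proof
        fix w assume "w \<in> nb ?F3"
        then obtain g where w: "w \<in> insert x (insert y I)" "w \<notin> ?F3" "g \<in> ?F3" "E g w" by (auto simp: nbhd_def)
        then have wf: "w \<noteq> f" "w \<notin> F" using f by auto
        have wJ: "w \<in> insert x (insert y J)" "w \<notin> F2" using w wf by (auto simp: J_def)
        show "w \<in> ?n"
        proof (cases "g \<in> F")
          case True
          then have "w \<in> nb F" using w wf by (auto simp: nbhd_def)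
          then have "E0 f w" using c e0f by auto
          then show ?thesis using wJ \<open>f \<in> F2\<close> by (auto simp: nbhd_def)
        next
          case False
          then have "E0 g w" using w wf e0 f by auto
          then show ?thesis using wJ w False by (auto simp: nbhd_def)
        qed
      qed
      then show ?thesis using cut2[OF F3] card_mono[OF fn] by (meson le_trans)
    next
      case False
      then have F2I: "F2 \<subseteq> I - F" using F2 by (auto simp: J_def)
      have key: "w \<in> ?n" if "w \<in> insert x (insert y I)" "w \<notin> F2" "w \<notin> F" "g \<in> F2" "E g w" for w g
      proof -
        have "w \<noteq> f" using that f by auto
        moreover have "g \<noteq> f" using that False by auto
        ultimately show ?thesis using that e0[of g w] by (auto simp: nbhd_def J_def)
      qed
      show ?thesis
      proof (cases "\<exists>g\<in>F2. \<exists>h\<in>F. E g h")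
        case False
        have "nb F2 \<subseteq> ?n"
        proof
          fix w assume "w \<in> nb F2"
          then obtain g where "w \<in> insert x (insert y I)" "w \<notin> F2" "g \<in> F2" "E g w" by (auto simp: nbhd_def)
          moreover have "w \<notin> F" using False calculation by auto
          ultimately show "w \<in> ?n" using key by blast
        qed
        then show ?thesis using cut2[of F2] F2 F2I card_mono[OF fn] by (meson Diff_subset le_trans subset_trans)
      next
        case True
        then obtain g h where gh: "g \<in> F2" "h \<in> F" "E g h" by auto
        then have "g \<in> nb F" using F2I sym by (auto simp: nbhd_def)
        then have gc: "g \<in> {c,c'}" using c by auto
        then have fn1: "f \<in> ?n" using gh False e0f by (auto simp: nbhd_def J_def)
        \<comment> \<open>One neighbour is \<open>f\<close>. There is a second one, because
          otherwise \<open>F2\<close> and \<open>F\<close> together would see at most the vertex of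
          \<open>{c, c'}\<close> other than \<open>g\<close>.\<close>
        have "\<exists>w\<in>nb (F2 \<union> F). \<exists>g\<in>F2. E g w"
        proof (rule ccontr)
          assume c2: "\<not> ?thesis"
          have "nb (F2 \<union> F) \<subseteq> nb F - {g}" using c2 gh by (auto simp: nbhd_def)
          moreover obtain c0 where "nb F - {g} \<subseteq> {c0}" using c gc by blast
          ultimately show False using no_one_cut[of "F2 \<union> F" c0] F F2I by blast
        qed
        then obtain w g where "w \<in> nb (F2 \<union> F)" "g \<in> F2" "E g w" by auto
        then have "w \<in> ?n" "w \<noteq> f" using key[of w g] f by (auto simp: nbhd_def)
        then show ?thesis using fn1 card_ge2I[OF _ _ _ fn] by auto
      qed
    qed
  qed
  have "q.disjoint_paths_through f" by (rule q.disjoint_paths_through_all) (simp add: J_def)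
  then obtain A B where AB: "A \<subseteq> J - {f}" "B \<subseteq> J - {f}" "A \<inter> B = {}" "exact_path E0 A f x" "exact_path E0 B f y"
    unfolding q.disjoint_paths_through_def by blast
  have ABI: "A \<subseteq> I - F" "B \<subseteq> I - F" using AB by (auto simp: J_def)
  have fst: "(\<exists>c1\<in>{c,c'}. (C = {} \<and> c1 = r) \<or> (c1 \<in> C \<and> exact_path E (C - {c1}) c1 r))"
    if "exact_path E0 C f r" "C \<subseteq> I - F" for C r
    using reroot_first[OF that(1)[unfolded E0_def]] by blast
  obtain c1 where c1: "c1 \<in> {c,c'}" "(A = {} \<and> c1 = x) \<or> (c1 \<in> A \<and> exact_path E (A - {c1}) c1 x)" using fst[OF AB(4) ABI(1)] by auto
  obtain c2 where c2: "c2 \<in> {c,c'}" "(B = {} \<and> c2 = y) \<or> (c2 \<in> B \<and> exact_path E (B - {c2}) c2 y)" using fst[OF AB(5) ABI(2)] by auto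
  have xyn: "x \<notin> A" "x \<notin> B" "y \<notin> A" "y \<notin> B" "x \<notin> F" "y \<notin> F" using ABI F xI yI by auto
  have c12: "c1 \<noteq> c2" using c1(2) c2(2) AB xyn xy by auto
  have eq: "path_lengths E F c c' = path_lengths E F c1 c2"
  proof -
    have "(c1 = c \<and> c2 = c') \<or> (c1 = c' \<and> c2 = c)" using c1(1) c2(1) c12 by auto
    then show ?thesis using path_lengths_sym[of E F c c'] sym by auto
  qed
  have finAB: "finite A" "finite B" using exact_path_facts(1)[OF AB(4)] exact_path_facts(1)[OF AB(5)] by auto
  have "n + (card A + card B) \<in> path_lengths E I x y" if n: "n \<in> path_lengths E F c1 c2" for n
  proof -
    obtain U where U: "U \<subseteq> F" "exact_path E U c1 c2" "n = Suc (card U)" using n by (auto simp: path_lengths_def)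
    have dis: "U \<inter> A = {}" "U \<inter> B = {}" using U ABI by auto
    have 1: "exact_path E (A \<union> U) x c2"
    proof (cases "A = {}")
      case True then show ?thesis using c1 U by auto
    next
      case False
      then have c1A: "c1 \<in> A" "exact_path E (A - {c1}) c1 x" using c1 by auto
      have "exact_path E (insert c1 ((A - {c1}) \<union> U)) x c2"
        by (rule exact_path_concat[OF exact_path_sym[OF sym c1A(2)] U(2)])
          (use dis U xyn c2 AB c12 xy in auto)
      moreover have "insert c1 ((A - {c1}) \<union> U) = A \<union> U" using c1A by auto
      ultimately show ?thesis by simp
    qed
    have 2: "exact_path E (A \<union> U \<union> B) x y"
    proof (cases "B = {}")
      case True then show ?thesis using c2 1 by auto
    next
      case False
      then have c2B: "c2 \<in> B" "exact_path E (B - {c2}) c2 y" using c2 by auto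
      have "exact_path E (insert c2 ((A \<union> U) \<union> (B - {c2}))) x y"
        by (rule exact_path_concat[OF 1 c2B(2)])
          (use dis U xyn c2 AB c12 xy in auto)
      moreover have "insert c2 ((A \<union> U) \<union> (B - {c2})) = A \<union> U \<union> B" using c2B by auto
      ultimately show ?thesis by simp
    qed
    have "finite U" using exact_path_facts(1)[OF U(2)] .
    then have "card (A \<union> U \<union> B) = card A + card U + card B"
      using finAB dis AB(3) by (subst card_Un_disjoint, auto)+
    then show ?thesis using 2 U ABI F by (intro path_lengthsI[of "A \<union> U \<union> B"]) auto
  qed
  then show ?thesis using eq by auto
qed

section \<open>Contracting the neighbourhood of a root\<close>

lemma root_has_neighbour: assumes "I \<noteq> {}" shows "\<exists>a\<in>I. E x a"
proof (rule ccontr)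
  assume c: "\<not> ?thesis"
  have "nb I \<subseteq> {y}" using c sym by (auto simp: nbhd_def)
  then show False using no_one_cut[of I] assms by blast
qed

text \<open>If every non-neighbour of \<open>x\<close> sees at most one neighbour of \<open>x\<close>, the neighbourhood of \<open>x\<close> can be
  contracted into \<open>x\<close> without lowering any degree.\<close>
lemma contract_root:
  assumes one: "\<And>w. w \<in> I \<Longrightarrow> \<not> E x w \<Longrightarrow> card {a\<in>I. E x a \<and> E w a} \<le> 1"
    and v: "v \<in> I" "\<not> E x v" "v \<noteq> s"
  shows "\<exists>E' I' y'. two_rooted_conn E' I' x y' \<and> I' \<subset> I \<and> (\<forall>u\<in>I'. \<forall>w\<in>I'. E' u w = E u w)
    \<and> (\<forall>v\<in>I'. degree_in E (insert x (insert y I)) v \<le> degree_in E' (insert x (insert y' I')) v)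
    \<and> (\<exists>v\<in>I'. v \<noteq> s) \<and> (\<exists>k. \<forall>n\<in>path_lengths E' I' x y'. n + k \<in> path_lengths E I x y)"
proof -
  define N where "N = {a\<in>I. E x a}"
  define W where "W = I - N"
  \<comment> \<open>\<open>Y\<close> is the part of the non-neighbours of \<open>x\<close> attached
    to \<open>y\<close>. If it contains a vertex other than \<open>s\<close>, it becomes the new
    inner set; otherwise the component of \<open>v\<close> does, and \<open>y\<close> is replaced by
    a neighbour of \<open>x\<close>.\<close>
  define Y where "Y = reach E W y \<inter> W"
  have WI: "W \<subseteq> I" "N \<subseteq> I" "W \<inter> N = {}" "I = W \<union> N" by (auto simp: W_def N_def)
  have xW: "x \<notin> W" "y \<notin> W" "x \<notin> N" "y \<notin> N" using xI yI WI by auto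
  have nx: "\<not> E x w" "\<not> E w x" if "w \<in> W" for w using that sym by (auto simp: W_def N_def)
  have one': "card {a\<in>N. E w a} \<le> 1" if "w \<in> W" for w
  proof -
    have "{a\<in>N. E w a} = {a\<in>I. E x a \<and> E w a}" by (auto simp: N_def)
    then show ?thesis using one[of w] that nx WI by auto
  qed
  have Nne: "N \<noteq> {}" using root_has_neighbour v by (auto simp: N_def)
  have fN: "finite N" "finite W" using fin WI finite_subset by auto
  have rY: "reach E W y = insert y Y" using reach_sub[of E W y] by (auto simp: Y_def)
  have Ycl: "u \<in> Y" if "w \<in> insert y Y" "E w u" "u \<in> W" for u w
    using that reach_step[of w E W y u] unfolding rY using xW(2) by auto
  show ?thesis
  proof (cases "Y \<subseteq> {s}")
    case False
    define S where "S = {w. \<exists>a\<in>N. E a w}"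
    define E' where "E' = reroot E x S"
    have YW: "Y \<subseteq> W" by (auto simp: Y_def)
    have E's: "E' u v \<Longrightarrow> E' v u" for u v unfolding E'_def reroot_def using sym by (auto split: if_splits)
    have ee: "E' u w = E u w" if "u \<noteq> x" "w \<noteq> x" for u w using that by (auto simp: E'_def reroot_def)
    have ex: "E' u x \<longleftrightarrow> u \<in> S" if "u \<noteq> x" for u using that by (auto simp: E'_def reroot_def)
    interpret q: two_rooted E' Y x y
      by unfold_locales (use fN YW xW xy E's irr finite_subset in \<open>auto simp: E'_def reroot_def\<close>)
    have q2: "two_rooted_conn E' Y x y"
    proof unfold_locales
      fix F assume F: "F \<subseteq> Y" "F \<noteq> {}"
      let ?n = "nbhd E' (insert x (insert y Y)) F"
      have xF: "x \<notin> F" "y \<notin> F" using F YW xW by auto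
      obtain f u where fu: "f \<in> F" "u \<in> reach E W y - F" "E f u"
        using reach_crossing[of E F W y] sym F rY xF by blast
      have "E' f u" using fu rY ee[of f u] xF YW xW xy by auto
      then have un: "u \<in> ?n" using fu rY by (auto simp: nbhd_def)
      show "2 \<le> card ?n"
      proof (cases "\<exists>f\<in>F. f \<in> S")
        case True
        then obtain f where "f \<in> F" "f \<in> S" "f \<noteq> x" using xF by auto
        then have "x \<in> ?n" using ex[of f] xF by (auto simp: nbhd_def)
        moreover have "u \<noteq> x" using fu rY YW xW xy by auto
        ultimately show ?thesis using un card_ge2I[OF _ _ _ q.finite_nb] by blast
      next
        case False
        have "nb F \<subseteq> ?n"
        proof
          fix w assume "w \<in> nb F"
          then obtain g where w: "w \<in> insert x (insert y I)" "w \<notin> F" "g \<in> F" "E g w" by (auto simp: nbhd_def)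
          have gW: "g \<in> W" using w F YW by auto
          have "w \<noteq> x" using nx[OF gW] w by auto
          moreover have "w \<notin> N" using False w sym by (auto simp: S_def)
          ultimately have "w \<in> insert y Y" using w Ycl[of g w] F WI by auto
          then show "w \<in> ?n" using w ee[of g w] \<open>w \<noteq> x\<close> xF by (auto simp: nbhd_def)
        qed
        then show ?thesis using cut2[of F] F YW WI card_mono[OF q.finite_nb] by (meson le_trans subset_trans)
      qed
    qed
    have deg: "degree_in E (insert x (insert y I)) u \<le> degree_in E' (insert x (insert y Y)) u" if u: "u \<in> Y" for u
    proof -
      have uW: "u \<in> W" "u \<noteq> x" using u YW xW by auto
      let ?B = "{w\<in>insert y Y. E u w}" and ?A = "{a\<in>N. E u a}"
      let ?X = "if ?A = {} then {} else {x}"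
      have 1: "{w\<in>insert x (insert y I). E u w} \<subseteq> ?B \<union> ?A"
        using nx[OF uW(1)] Ycl[of u] u WI by auto
      have B: "?B \<subseteq> {w\<in>insert x (insert y Y). E' u w}"
      proof
        fix w assume w: "w \<in> ?B"
        then have "w \<noteq> x" using YW xW xy by auto
        then show "w \<in> {w\<in>insert x (insert y Y). E' u w}" using w ee[OF uW(2)] by auto
      qed
      have X: "?X \<subseteq> {w\<in>insert x (insert y Y). E' u w}"
      proof (cases "?A = {}")
        case False
        then obtain a where "a \<in> N" "E a u" using sym[of u] by blast
        then have "u \<in> S" by (auto simp: S_def)
        then show ?thesis using ex[OF uW(2)] by simp
      qed simp
      have card: "card ?A \<le> card ?X + 0"
      proof (cases "?A = {}")
        case False then show ?thesis using one'[OF uW(1)] by (auto split: if_splits)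
      qed (simp only:, simp)
      have dj: "?B \<inter> ?X = {}" using YW xW xy by (auto split: if_splits)
      from degree_in_loss[where E=E and E'=E' and v=u, OF 1 B X dj _ _ card] have "degree_in E (insert x (insert y I)) u \<le> degree_in E' (insert x (insert y Y)) u + 0"
        using fN finite_subset[OF YW fN(2)] by auto
      then show ?thesis by simp
    qed
    have lift: "n + 1 \<in> path_lengths E I x y" if n: "n \<in> path_lengths E' Y x y" for n
    proof -
      obtain U where U: "U \<subseteq> Y" "exact_path E' U x y" "n = Suc (card U)" using n by (auto simp: path_lengths_def)
      have "N \<inter> U = {}" using U YW WI by auto
      from reroot_root[OF U(2)[unfolded E'_def S_def] this] obtain a where a: "a \<in> N" "exact_path E U a y" using xW by auto
      have "a \<notin> U" "finite U" using exact_path_facts[OF a(2)] by auto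
      moreover have "exact_path E (insert a U) x y" using a U xW YW xy by (intro exact_path.step) (auto simp: N_def)
      ultimately show ?thesis using U a YW WI by (intro path_lengthsI[of "insert a U"]) auto
    qed
    have "Y \<subset> I" using YW WI Nne by auto
    moreover have "\<forall>u\<in>Y. \<forall>w\<in>Y. E' u w = E u w" using ee YW xW(1) by (metis subsetD)
    moreover have "\<exists>v\<in>Y. v \<noteq> s" using False by auto
    ultimately show ?thesis using q2 deg lift by blast
  next
    case True
    \<comment> \<open>Since \<open>v\<close> is not in \<open>Y\<close>, its component is cut off
      from \<open>y\<close> among the non-neighbours and sees only neighbours of
      \<open>x\<close>.\<close>
    define V1 where "V1 = reach E (W - Y) v"
    have vW: "v \<in> W - Y" using v True by (auto simp: W_def N_def)
    have V1W: "V1 \<subseteq> W - Y" using reach_sub[of E "W - Y" v] vW by (auto simp: V1_def)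
    define A where "A = nb V1"
    have V1nb: "w \<in> A \<and> w \<in> N" if w: "w \<in> insert x (insert y I)" "u \<in> V1" "E u w" "w \<notin> V1" for u w
    proof -
      have uW: "u \<in> W" "u \<notin> Y" using w V1W by auto
      have "w \<noteq> x" using nx[OF uW(1)] w by auto
      moreover have "w \<noteq> y" using Ycl[of y u] uW w sym by auto
      moreover have "w \<notin> Y" using Ycl[of w u] uW w sym by auto
      moreover have "w \<notin> W - Y" using reach_step[of u E "W - Y" v w] w by (auto simp: V1_def)
      ultimately have "w \<in> N" using w WI by auto
      then show ?thesis using w by (auto simp: A_def nbhd_def)
    qed
    have AN: "A \<subseteq> N" using V1nb by (auto simp: A_def nbhd_def)
    have V1I: "V1 \<subseteq> I" "V1 \<noteq> {}" using V1W WI reach_self[of v E "W - Y"] unfolding V1_def by blast+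
    define Z where "Z = reach E (I - V1 - A) y"
    have Zs: "Z \<subseteq> insert y (I - V1 - A)" using reach_sub[of E "I - V1 - A" y] by (auto simp: Z_def)
    \<comment> \<open>One of these neighbours, \<open>a0\<close>, leads on to \<open>y\<close>
      outside \<open>V1\<close> and \<open>A\<close>, as otherwise \<open>I - Z\<close> would hang
      on \<open>x\<close> alone. It becomes the second root, and the others are contracted into
      \<open>x\<close>.\<close>
    have "\<exists>a\<in>A. \<exists>z\<in>Z. E z a"
    proof (rule ccontr)
      assume c: "\<not> ?thesis"
      have "nb (I - Z) \<subseteq> {x}"
      proof
        fix w assume "w \<in> nb (I - Z)"
        then obtain f where w: "w \<in> insert x (insert y I)" "w \<notin> I - Z" "f \<in> I" "f \<notin> Z" "E f w" by (auto simp: nbhd_def)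
        show "w \<in> {x}"
        proof (rule ccontr)
          assume "w \<notin> {x}"
          then have wZ: "w \<in> Z" using w reach_self[of y E "I - V1 - A"] by (auto simp: Z_def)
          then have "f \<notin> I - V1 - A" using w reach_step[of w E "I - V1 - A" y f] sym by (auto simp: Z_def)
          then have "f \<in> V1" using w c wZ sym by auto
          then have "w \<in> A \<or> w \<in> V1" using V1nb[of w f] w by auto
          then show False using wZ Zs AN V1I yI xW by auto
        qed
      qed
      moreover have "I - Z \<subseteq> I" "I - Z \<noteq> {}" using V1I Zs yI by auto
      ultimately show False using no_one_cut by blast
    qed
    then obtain a0 z where a0: "a0 \<in> A" "z \<in> Z" "E z a0" by auto
    have a0n: "a0 \<notin> I - V1 - A" "a0 \<noteq> y" "a0 \<noteq> x" "a0 \<in> I" "a0 \<notin> V1" using a0 AN xW WI by (auto simp: A_def nbhd_def)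
    from reach_to_neighbour[OF a0(2)[unfolded Z_def] a0(3) a0n(1,2)] obtain U0 where
      U0: "U0 \<subseteq> I - V1 - A" "exact_path E U0 y a0" by blast
    have U0': "exact_path E U0 a0 y" using exact_path_sym[OF sym U0(2)] .
    have fU0: "finite U0" using exact_path_facts[OF U0'] by auto
    define S where "S = {w. \<exists>a\<in>A - {a0}. E a w}"
    define E' where "E' = reroot E x S"
    have xV1: "x \<notin> V1" "y \<notin> V1" "x \<notin> A" "y \<notin> A" "V1 \<inter> A = {}" using V1I xI yI AN xW by (auto simp: A_def nbhd_def)
    have E's: "E' u v \<Longrightarrow> E' v u" for u v unfolding E'_def reroot_def using sym by (auto split: if_splits)
    have ee: "E' u w = E u w" if "u \<noteq> x" "w \<noteq> x" for u w using that by (auto simp: E'_def reroot_def)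
    have ex: "E' u x \<longleftrightarrow> u \<in> S" if "u \<noteq> x" for u using that by (auto simp: E'_def reroot_def)
    interpret q: two_rooted E' V1 x a0
      by unfold_locales (use finite_subset[OF V1I(1) fin] xV1 a0n E's irr in \<open>auto simp: E'_def reroot_def\<close>)
    have A2: "2 \<le> card A" using cut2[OF V1I] by (simp add: A_def)
    have q2: "two_rooted_conn E' V1 x a0"
    proof unfold_locales
      fix F assume F: "F \<subseteq> V1" "F \<noteq> {}"
      let ?n = "nbhd E' (insert x (insert a0 V1)) F"
      have xF: "x \<notin> F" "a0 \<notin> F" using F xV1 a0n by auto
      have key: "(w \<in> V1 \<and> w \<in> ?n) \<or> (w \<in> A \<and> (x \<in> ?n \<or> w = a0 \<and> a0 \<in> ?n))" if w: "w \<in> nb F" for w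
      proof -
        obtain g where g: "w \<in> insert x (insert y I)" "w \<notin> F" "g \<in> F" "E g w" using w by (auto simp: nbhd_def)
        have gx: "g \<noteq> x" using g xF by auto
        show ?thesis
        proof (cases "w \<in> V1")
          case True
          then show ?thesis using g ee[OF gx, of w] xV1 by (auto simp: nbhd_def)
        next
          case False
          then have wA: "w \<in> A" using V1nb[of w g] g F by auto
          show ?thesis
          proof (cases "w = a0")
            case True then show ?thesis using wA g ee[OF gx, of w] a0n by (auto simp: nbhd_def)
          next
            case False
            then have "g \<in> S" using wA g sym by (auto simp: S_def)
            then show ?thesis using wA ex[OF gx] g xF by (auto simp: nbhd_def)
          qed
        qed
      qed
      show "2 \<le> card ?n"
      proof (cases "F = V1")
        case True
        obtain a1 where a1: "a1 \<in> A" "a1 \<noteq> a0" using A2 by (metis card_ge2E)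
        have "x \<in> ?n" using key[of a1] a1 True xV1 by (auto simp: A_def)
        moreover have "a0 \<in> ?n \<or> x \<in> ?n" using key[of a0] a0 True by (auto simp: A_def)
        moreover have "a0 \<in> ?n"
        proof -
          obtain g where "g \<in> V1" "E g a0" using a0 by (auto simp: A_def nbhd_def)
          then show ?thesis using True ee[of g a0] xV1 a0n by (auto simp: nbhd_def)
        qed
        ultimately show ?thesis using card_ge2I[OF _ _ _ q.finite_nb] a0n by blast
      next
        case False
        obtain f u where fu: "f \<in> F" "u \<in> V1 - F" "E f u"
          using reach_crossing2[of E F "W - Y" v] sym F False vW unfolding V1_def by blast
        have un: "u \<in> ?n" using fu ee[of f u] xF xV1 by (auto simp: nbhd_def)
        have "u \<in> nb F" using fu V1I by (auto simp: nbhd_def)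
        then obtain w where w: "w \<in> nb F" "w \<noteq> u" using cut2[of F] F V1I card_ge2E by (metis subset_trans)
        have "u \<noteq> x" "u \<noteq> a0" using fu xV1 a0n by auto
        then show ?thesis using key[OF w(1)] w un card_ge2I[OF _ _ _ q.finite_nb] by metis
      qed
    qed
    have deg: "degree_in E (insert x (insert y I)) u \<le> degree_in E' (insert x (insert a0 V1)) u" if u: "u \<in> V1" for u
    proof -
      have uW: "u \<in> W" "u \<noteq> x" using u V1W xW by auto
      let ?B = "{w\<in>V1. E u w}" and ?A = "{a\<in>A. E u a}"
      \<comment> \<open>At most one neighbour of \<open>x\<close> is seen by \<open>u\<close>; it is
        either the root \<open>a0\<close> or represented by \<open>x\<close>, so no degree is
        lost.\<close>
      let ?X = "if ?A = {} then {} else if E u a0 then {a0} else {x}"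
      have 1: "{w\<in>insert x (insert y I). E u w} \<subseteq> ?B \<union> ?A"
        using V1nb[OF _ u] by auto
      have Aone: "card ?A \<le> 1"
      proof -
        have "?A \<subseteq> {a\<in>N. E u a}" using AN by auto
        then show ?thesis using one'[OF uW(1)] card_mono[of "{a\<in>N. E u a}" ?A] fN by auto
      qed
      have B: "?B \<subseteq> {w\<in>insert x (insert a0 V1). E' u w}"
      proof
        fix w assume w: "w \<in> ?B"
        then have "w \<noteq> x" using xV1 by auto
        then show "w \<in> {w\<in>insert x (insert a0 V1). E' u w}" using w ee[OF uW(2)] by auto
      qed
      have X: "?X \<subseteq> {w\<in>insert x (insert a0 V1). E' u w}"
      proof (cases "?A \<noteq> {} \<and> \<not> E u a0")
        case True
        then obtain a where "a \<in> A - {a0}" "E a u" using sym[of u] by blast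
        then have "u \<in> S" by (auto simp: S_def)
        then show ?thesis using True ex[OF uW(2)] by simp
      next
        case False
        then show ?thesis using ee[OF uW(2), of a0] a0n by auto
      qed
      have card: "card ?A \<le> card ?X + 0"
      proof (cases "?A = {}")
        case False then show ?thesis using Aone by (auto split: if_splits)
      qed (simp only:, simp)
      have dj: "?B \<inter> ?X = {}" using xV1 a0n by (auto split: if_splits)
      from degree_in_loss[where E=E and E'=E' and v=u, OF 1 B X dj _ _ card] have "degree_in E (insert x (insert y I)) u \<le> degree_in E' (insert x (insert a0 V1)) u + 0"
        using finite_subset[OF V1I(1) fin] finite_subset[OF AN fN(1)] by auto
      then show ?thesis by simp
    qed
    have lift: "n + (card U0 + 2) \<in> path_lengths E I x y" if n: "n \<in> path_lengths E' V1 x a0" for n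
    proof -
      obtain U where U: "U \<subseteq> V1" "exact_path E' U x a0" "n = Suc (card U)" using n by (auto simp: path_lengths_def)
      have "(A - {a0}) \<inter> U = {}" using U xV1 by auto
      from reroot_root[OF U(2)[unfolded E'_def S_def] this] obtain a where a: "a \<in> A" "a \<noteq> a0" "exact_path E U a a0" by auto
      have aU: "a \<notin> U" "finite U" using exact_path_facts[OF a(3)] by auto
      have 1: "exact_path E (insert a U) x a0" using a U xV1 a0n AN by (intro exact_path.step) (auto simp: N_def)
      have 2: "exact_path E (insert a0 (insert a U \<union> U0)) x y"
      proof (rule exact_path_concat[OF 1 U0'])
        show "insert a U \<inter> U0 = {}" using U(1) U0(1) a(1) by blast
        show "x \<notin> U0" using U0(1) xI by blast
        show "y \<notin> insert a U" using U(1) a(1) xV1 by blast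
      qed (rule xy)
      have "insert a U \<inter> U0 = {}" "a0 \<notin> insert a U \<union> U0" using U(1) U0(1) a(1,2) a0n a0(1) by blast+
      then have "card (insert a0 (insert a U \<union> U0)) = Suc (Suc (card U) + card U0)"
        using aU fU0 by (simp add: card_Un_disjoint del: Un_insert_left)
      moreover have "insert a0 (insert a U \<union> U0) \<subseteq> I" using U(1) U0(1) a(1) AN WI V1I a0n by blast
      ultimately show ?thesis using 2 U(3) by (intro path_lengthsI[of "insert a0 (insert a U \<union> U0)"]) auto
    qed
    have "V1 \<subset> I" using V1I V1W WI Nne by auto
    moreover have "\<forall>u\<in>V1. \<forall>w\<in>V1. E' u w = E u w" using ee xV1 by metis
    moreover have "\<exists>v\<in>V1. v \<noteq> s" using v reach_self[of v E "W - Y"] V1_def by blast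
    ultimately show ?thesis using q2 deg lift by blast
  qed
qed

end

section \<open>Two-rooted graphs with one exceptional vertex\<close>

lemma card_diff1_ge2: assumes "3 \<le> card A" shows "2 \<le> card (A - {r})"
proof -
  have "card A - 1 \<le> card (A - {r})" by (simp add: diff_card_le_card_Diff[of "{r}", simplified])
  then show ?thesis using assms by simp
qed

section \<open>Operations on sets of path lengths\<close>

lemma path_lengths_1: "E u v \<Longrightarrow> u \<noteq> v \<Longrightarrow> 1 \<in> path_lengths E A u v"
  by (rule path_lengthsI[of "{}"]) (auto intro: exact_path.base)

lemma path_lengths_mono: "A \<subseteq> B \<Longrightarrow> path_lengths E A u v \<subseteq> path_lengths E B u v"
  by (auto simp: path_lengths_def)

lemma path_lengths_concat:
  assumes "m \<in> path_lengths E A x c" "n \<in> path_lengths E B c y" "A \<inter> B = {}" "x \<notin> B" "y \<notin> A" "x \<noteq> y" "insert c (A \<union> B) \<subseteq> I"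
  shows "m + n \<in> path_lengths E I x y"
proof -
  obtain U where U: "U \<subseteq> A" "exact_path E U x c" "m = Suc (card U)" using assms(1) by (auto simp: path_lengths_def)
  obtain W where W: "W \<subseteq> B" "exact_path E W c y" "n = Suc (card W)" using assms(2) by (auto simp: path_lengths_def)
  have d: "U \<inter> W = {}" using U W assms by blast
  have "exact_path E (insert c (U \<union> W)) x y" by (rule exact_path_concat[OF U(2) W(2) d]) (use U W assms in auto)
  moreover have "card (insert c (U \<union> W)) = Suc (card U + card W)"
    using exact_path_facts[OF U(2)] exact_path_facts[OF W(2)] d by (simp add: card_Un_disjoint)
  ultimately show ?thesis using U(1,3) W(1,3) assms(7) by (intro path_lengthsI[of "insert c (U \<union> W)"]) auto
qed

lemma path_lengths_step:
  assumes "E x w" "n \<in> path_lengths E B w y" "x \<noteq> w" "x \<notin> B" "x \<noteq> y" "insert w B \<subseteq> I"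
  shows "Suc n \<in> path_lengths E I x y"
  using path_lengths_concat[OF path_lengths_1[of E x w "{}"] assms(2)] assms by auto

lemma reach_path_lengths:
  assumes "z \<in> reach E W v" "E z y" "y \<notin> W" "y \<noteq> v" "reach E W v \<inter> W - {v} \<subseteq> B"
  shows "\<exists>m. m \<in> path_lengths E B v y"
proof -
  obtain U where "U \<subseteq> reach E W v \<inter> W - {v}" "exact_path E U v y" using reach_to_neighbour[OF assms(1-4)] by blast
  then have "Suc (card U) \<in> path_lengths E B v y" using assms(5) by (intro path_lengthsI[of U]) auto
  then show ?thesis by blast
qed

lemma reroot_path_lengths:
  assumes "n \<in> path_lengths (reroot E x S) J x y"
  shows "(n = 1 \<and> y \<in> S) \<or> (\<exists>w\<in>J \<inter> S. \<exists>m. n = Suc m \<and> m \<in> path_lengths E (J - {w}) w y)"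
proof -
  obtain U where U: "U \<subseteq> J" "exact_path (reroot E x S) U x y" "n = Suc (card U)" using assms by (auto simp: path_lengths_def)
  from reroot_first[OF U(2)] show ?thesis
  proof (elim disjE bexE conjE)
    fix w assume w: "w \<in> U" "w \<in> S" "exact_path E (U - {w}) w y"
    have "card U = Suc (card (U - {w}))" using card.remove[OF exact_path_facts(1)[OF U(2)] w(1)] .
    then have "card U \<in> path_lengths E (J - {w}) w y" using w U by (intro path_lengthsI[of "U - {w}"]) auto
    then show ?thesis using w U by auto
  qed (use U in auto)
qed

lemma reroot_path_lengths_root:
  assumes "n \<in> path_lengths (reroot E x {w. \<exists>a\<in>Z. E a w}) J x y" "Z \<inter> J = {}" "y \<notin> Z"
  shows "\<exists>a\<in>Z. n \<in> path_lengths E J a y"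
proof -
  obtain U where U: "U \<subseteq> J" "exact_path (reroot E x {w. \<exists>a\<in>Z. E a w}) U x y" "n = Suc (card U)" using assms by (auto simp: path_lengths_def)
  from reroot_root[OF U(2)] obtain a where "a \<in> Z" "exact_path E U a y" using assms U by auto
  then show ?thesis using U by (auto intro: path_lengthsI)
qed

lemma reroot_sym: "(\<And>u v. E u v \<Longrightarrow> E v u) \<Longrightarrow> reroot E x S u v \<Longrightarrow> reroot E x S v u"
  unfolding reroot_def by (auto split: if_splits)

context two_rooted begin

lemma reroot_two_rooted: assumes "J \<subseteq> I" shows "two_rooted (reroot E x S) J x y"
proof
  show "finite J" using assms fin finite_subset by auto
  show "reroot E x S u v \<Longrightarrow> reroot E x S v u" for u v by (rule reroot_sym[OF sym])
  show "\<not> reroot E x S u u" for u using irr by (simp add: reroot_def)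
qed (use assms xI yI xy in auto)

text \<open>Cut conditions change only in two ways: deleted vertices disappear from the
  neighbourhood, and \<open>x\<close> counts exactly when \<open>F\<close> meets
  \<open>S\<close>.\<close>

lemma reroot_nbhd:
  assumes "J \<subseteq> I" "F \<subseteq> J"
  shows "nbhd (reroot E x S) (insert x (insert y J)) F = (nb F \<inter> insert y J) \<union> (if F \<inter> S = {} then {} else {x})"
proof -
  have x: "x \<notin> J" "x \<notin> F" using assms xI by auto
  then have F: "f \<noteq> x" if "f \<in> F" for f using that by auto
  have 1: "reroot E x S f w = E f w" if "f \<in> F" "w \<noteq> x" for f w using that F by (auto simp: reroot_def)
  have 2: "reroot E x S f x = (f \<in> S)" if "f \<in> F" for f using that F by (auto simp: reroot_def)
  show ?thesis (is "?L = ?R")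
  proof (rule set_eqI)
    fix w
    show "w \<in> ?L \<longleftrightarrow> w \<in> ?R"
    proof (cases "w = x")
      case True
      then show ?thesis using 2 x xy unfolding nbhd_def by auto
    next
      case False
      then have "(\<exists>f\<in>F. reroot E x S f w) = (\<exists>f\<in>F. E f w)" using 1 by auto
      then show ?thesis using False assms unfolding nbhd_def by auto
    qed
  qed
qed

text \<open>\<open>Q\<close> contains the neighbours that disappear, including \<open>x\<close>
  where relevant. One of them is refunded when \<open>v\<close> is adjacent to the new root, which
  is the summand \<open>1\<close>.\<close>

lemma reroot_degree:
  assumes "J \<subseteq> I" "v \<in> J" "\<And>w. w \<in> insert x (insert y I) \<Longrightarrow> E v w \<Longrightarrow> w \<in> insert y J \<or> w \<in> Q"
    and "finite Q" "card {w\<in>Q. E v w} \<le> (if v \<in> S then 1 else 0) + j"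
  shows "degree_in E (insert x (insert y I)) v \<le> degree_in (reroot E x S) (insert x (insert y J)) v + j"
proof -
  have x: "x \<notin> J" "v \<noteq> x" using assms xI by auto
  have fJ: "finite J" using assms fin finite_subset by auto
  let ?B = "{w\<in>insert y J. E v w}" and ?X = "if v \<in> S then {x} else {}"
  show ?thesis
  proof (rule degree_in_loss[where B="?B" and X="?X" and Q="{w\<in>Q. E v w}"])
    show "?B \<subseteq> {w \<in> insert x (insert y J). reroot E x S v w}"
    proof
      fix w assume "w \<in> ?B"
      moreover then have "w \<noteq> x" using x xy by auto
      ultimately show "w \<in> {w \<in> insert x (insert y J). reroot E x S v w}" using x by (auto simp: reroot_def)
    qed
    show "?X \<subseteq> {w \<in> insert x (insert y J). reroot E x S v w}" using x by (auto simp: reroot_def)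
    show "?B \<inter> ?X = {}" using x xy by auto
    show "{w \<in> insert x (insert y I). E v w} \<subseteq> ?B \<union> {w\<in>Q. E v w}" using assms(3) by blast
  qed (use fJ assms in auto)
qed

end

text \<open>The exceptional vertex \<open>s\<close> need not belong to \<open>I\<close>. The last clause is needed because the statement fails when \<open>I = {s, c}\<close> and \<open>s\<close> hangs on \<open>c\<close>.\<close>
definition weak_rooted :: "nat \<Rightarrow> ('a \<Rightarrow> 'a \<Rightarrow> bool) \<Rightarrow> 'a set \<Rightarrow> 'a \<Rightarrow> 'a \<Rightarrow> 'a \<Rightarrow> bool" where
  "weak_rooted d E I x y s \<longleftrightarrow> two_rooted E I x y \<and> (\<forall>v\<in>I. v \<noteq> s \<longrightarrow> d \<le> degree_in E (insert x (insert y I)) v)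
    \<and> (\<forall>F\<subseteq>I. \<not> F \<subseteq> {s} \<longrightarrow> 2 \<le> card (nbhd E (insert x (insert y I)) F)) \<and> (\<exists>v\<in>I. v \<noteq> s)
    \<and> (3 \<le> d \<longrightarrow> (\<forall>c. I = {s, c} \<longrightarrow> c \<noteq> s \<longrightarrow> 2 \<le> card (nbhd E (insert x (insert y I)) {s})))"

text \<open>A minimal counterexample: two-vertex cuts and an exceptional vertex of small degree have been
  removed by the induction hypothesis \<open>IH\<close>.\<close>
locale weak_rooted_min = two_rooted_conn E I x y for E :: "'a \<Rightarrow> 'a \<Rightarrow> bool" and I x y +
  fixes s :: 'a and d :: nat
  assumes deg: "\<And>v. v \<in> I \<Longrightarrow> v \<noteq> s \<Longrightarrow> d \<le> degree_in E (insert x (insert y I)) v"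
    and cut3: "\<And>F. F \<subset> I \<Longrightarrow> \<not> F \<subseteq> {s} \<Longrightarrow> 3 \<le> card (nbhd E (insert x (insert y I)) F)"
    and sdeg: "s \<in> I \<Longrightarrow> 2 \<le> card {w\<in>I. E s w}"
    and nons: "\<exists>v\<in>I. v \<noteq> s"
    and IH: "\<And>d' (E' :: 'a \<Rightarrow> 'a \<Rightarrow> bool) I' x' y' s'. card I' < card I \<Longrightarrow> weak_rooted d' E' I' x' y' s' \<Longrightarrow> spans (path_lengths E' I' x' y') (d' - 2)"
begin

section \<open>Minimal counterexamples: cuts of three vertices\<close>

lemma swap_weak: "weak_rooted_min E I y x s d"
proof -
  interpret q: two_rooted_conn E I y x by (rule swap2)
  show ?thesis
    by unfold_locales (use deg cut3 sdeg nons IH in \<open>simp_all add: insert_commute\<close>)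
qed

lemma path_lengths_commute: "path_lengths E A u v = path_lengths E A v u" by (rule path_lengths_sym) (rule sym)

lemma no_two_cut: assumes "F \<subset> I" "\<not> F \<subseteq> {s}" "nb F \<subseteq> {a, b}" shows False
  using cut3[OF assms(1,2)] card_le2I[OF assms(3)] by simp

lemma card_psubset_I: "F \<subset> I \<Longrightarrow> card F < card I" using fin by (simp add: psubset_card_mono)

lemma degree_le_card: assumes "v \<in> I" "v \<noteq> s" "\<And>w. w \<in> insert x (insert y I) \<Longrightarrow> E v w \<Longrightarrow> w \<in> S" "finite S"
  shows "d \<le> card S"
proof -
  have "card {w\<in>insert x (insert y I). E v w} \<le> card S" by (rule card_mono) (use assms in auto)
  then show ?thesis using deg[OF assms(1,2)] by (simp add: degree_in_def)
qed

text \<open>Two of the neighbours become roots and the edges to \<open>r\<close> are forgotten, so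
  \<open>d\<close> drops by one; by \<open>cut3\<close> two neighbours remain besides
  \<open>r\<close>. The degenerate shape \<open>F = {s, c}\<close> is settled by \<open>sdeg\<close>
  if \<open>r\<close> is not in \<open>I\<close> and by \<open>star\<close> otherwise.\<close>

lemma spans_three_neighbours:
  assumes F: "F \<subset> I" "\<not> F \<subseteq> {s}" "nb F \<subseteq> {p, q, r}" and pq: "p \<notin> F" "q \<notin> F" "p \<noteq> q"
    "p \<in> insert x (insert y I)" "q \<in> insert x (insert y I)"
    and star: "\<And>c. F = {s, c} \<Longrightarrow> c \<noteq> s \<Longrightarrow> r \<in> I \<Longrightarrow> 2 \<le> card (nbhd E (insert p (insert q F)) {s})"
  shows "spans (path_lengths E F p q) (d - 3)"
proof -
  have fF: "finite F" using F fin finite_subset by (metis psubsetE)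
  have nbin: "w \<in> F \<or> w \<in> {p,q,r}" if "w \<in> insert x (insert y I)" "f \<in> F" "E f w" for w f
    using that F(3) by (auto simp: nbhd_def)
  have two_rooted_F: "two_rooted E F p q" using fF pq sym irr by unfold_locales auto
  have dF: "d - 1 \<le> degree_in E (insert p (insert q F)) v" if v: "v \<in> F" "v \<noteq> s" for v
  proof -
    have "degree_in E (insert x (insert y I)) v \<le> degree_in E (insert p (insert q F)) v + 1"
      by (rule degree_in_loss[where B="{w\<in>insert p (insert q F). E v w}" and Q="{r}" and X="{}"])
        (use nbin[OF _ v(1)] fF in auto)
    then show ?thesis using deg[of v] v F(1) by auto
  qed
  have sub: "nb F' - {r} \<subseteq> nbhd E (insert p (insert q F)) F'" if "F' \<subseteq> F" for F'
    using that nbin by (auto simp: nbhd_def)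
  have fn: "finite (nbhd E (insert p (insert q F)) F')" for F' using fF by (auto simp: nbhd_def)
  have "weak_rooted (d - 1) E F p q s"
    unfolding weak_rooted_def
  proof (intro conjI allI impI ballI)
    fix F' assume F': "F' \<subseteq> F" "\<not> F' \<subseteq> {s}"
    have "3 \<le> card (nb F')" by (rule cut3) (use F' F in auto)
    then have "2 \<le> card (nb F' - {r})" by (rule card_diff1_ge2)
    then show "2 \<le> card (nbhd E (insert p (insert q F)) F')" using card_mono[OF fn sub[OF F'(1)]] by simp
  next
    fix c assume c: "F = {s, c}" "c \<noteq> s"
    show "2 \<le> card (nbhd E (insert p (insert q F)) {s})"
    proof (cases "r \<in> I")
      case False
      have "{w\<in>I. E s w} \<subseteq> nbhd E (insert p (insert q F)) {s}"
        using nbin[of _ s] c False irr by (auto simp: nbhd_def)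
      then show ?thesis using sdeg c F(1) card_mono[OF fn] by (meson insertI1 le_trans psubsetE subsetD)
    qed (use star c in auto)
  qed (use two_rooted_F dF F in auto)
  from IH[OF card_psubset_I[OF F(1)] this] show ?thesis by (simp add: numeral_3_eq_3 numeral_2_eq_2)
qed

text \<open>The gate \<open>b\<close> stays inside the part as its exceptional vertex, so no other
  vertex loses a degree. There is room for one exception only, whence
  \<open>s \<notin> F\<close>.\<close>

lemma spans_gate_exceptional:
  assumes d4: "4 \<le> d" and F: "F \<noteq> {}" "s \<notin> F" "nb F \<subseteq> {x, b, g}" and b: "b \<in> I" "b \<notin> F" "insert b F \<subset> I"
    and g: "g \<in> insert y I" "g \<notin> F" "g \<noteq> b"
  shows "spans (path_lengths E (insert b F) x g) (d - 2)"
proof -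
  have FI: "F \<subset> I" using b by auto
  have fF: "finite F" using FI fin finite_subset by (metis psubsetE)
  have gx: "g \<noteq> x" using g xI xy by auto
  have nbin: "w \<in> F \<or> w \<in> {x,b,g}" if "w \<in> insert x (insert y I)" "f \<in> F" "E f w" for w f
    using that F(3) by (auto simp: nbhd_def)
  have two_rooted_F: "two_rooted E (insert b F) x g" using fF g gx b FI xI sym irr by unfold_locales auto
  have ns: "\<not> F' \<subseteq> {s}" if "F' \<subseteq> F" "F' \<noteq> {}" for F' using that F by auto
  have fn: "finite (nbhd E (insert x (insert g (insert b F))) F')" for F' using fF by (auto simp: nbhd_def)
  have "weak_rooted d E (insert b F) x g b"
    unfolding weak_rooted_def
  proof (intro conjI allI impI ballI)
    fix v assume v: "v \<in> insert b F" "v \<noteq> b"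
    have "degree_in E (insert x (insert y I)) v \<le> degree_in E (insert x (insert g (insert b F))) v + 0"
      by (rule degree_in_loss[where B="{w\<in>insert x (insert g (insert b F)). E v w}" and Q="{}" and X="{}"])
        (use nbin[of _ v] v fF in auto)
    moreover have "v \<noteq> s" "v \<in> I" using v F FI by auto
    ultimately show "d \<le> degree_in E (insert x (insert g (insert b F))) v" using deg[of v] by auto
  next
    fix F' assume F': "F' \<subseteq> insert b F" "\<not> F' \<subseteq> {b}"
    define F3 where "F3 = F' - {b}"
    have F3: "F3 \<subseteq> F" "F3 \<noteq> {}" using F' by (auto simp: F3_def)
    have "3 \<le> card (nb F3)" by (rule cut3) (use F3 FI ns in auto)
    then have "2 \<le> card (nb F3 - {b})" by (rule card_diff1_ge2)
    moreover have "nb F3 - {b} \<subseteq> nbhd E (insert x (insert g (insert b F))) F'"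
      using nbin F3 by (auto simp: nbhd_def F3_def)
    ultimately show "2 \<le> card (nbhd E (insert x (insert g (insert b F))) F')" using card_mono[OF fn] by (meson le_trans)
  next
    show "\<exists>v\<in>insert b F. v \<noteq> b" using F b by auto
  next
    fix c assume c: "insert b F = {b, c}" "c \<noteq> b"
    have cF: "c \<in> F" using c by blast
    have "F \<subseteq> insert b F - {b}" using b(2) by blast
    then have Fc: "F \<subseteq> {c}" unfolding c(1) by blast
    have "w \<in> {x, b, g}" if "w \<in> insert x (insert y I)" "E c w" for w using nbin[OF that(1) cF that(2)] Fc irr[of c] that(2) by blast
    moreover have "c \<in> I" "c \<noteq> s" using cF F(2) FI by auto
    ultimately have "d \<le> card {x, b, g}" by (intro degree_le_card[of c]) auto
    also have "\<dots> \<le> 3" by (simp add: card_insert_if)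
    finally show "2 \<le> card (nbhd E (insert x (insert g (insert b F))) {b})" using d4 by simp
  qed (use two_rooted_F in auto)
  from IH[OF card_psubset_I[OF b(3)] this] show ?thesis .
qed

text \<open>If \<open>g\<close> could not reach \<open>y\<close>, the vertices it reaches together
  with \<open>F\<close> would be cut off by \<open>x\<close> and \<open>b\<close> alone, against
  \<open>cut3\<close>.\<close>

lemma path_away:
  assumes "F \<subset> I" "\<not> F \<subseteq> {s}" "nb F \<subseteq> {x, b, g}" "b \<in> I" "b \<notin> F" "g \<in> I" "g \<notin> F" "b \<noteq> g"
  shows "\<exists>m. m \<in> path_lengths E (I - F - {b, g}) g y"
proof -
  let ?W = "I - F - {b}"
  let ?Z = "reach E ?W g"
  have Z: "?Z \<subseteq> ?W" using reach_sub[of E ?W g] assms by auto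
  have "\<exists>z\<in>?Z. E z y"
  proof (rule ccontr)
    assume c: "\<not> ?thesis"
    have "nb (?Z \<union> F) \<subseteq> {x, b}"
    proof
      fix w assume "w \<in> nb (?Z \<union> F)"
      then obtain f where w: "w \<in> insert x (insert y I)" "w \<notin> ?Z" "w \<notin> F" "f \<in> ?Z \<union> F" "E f w" by (auto simp: nbhd_def)
      show "w \<in> {x, b}"
      proof (cases "f \<in> F")
        case True
        then have "w \<in> nb F" using w by (auto simp: nbhd_def)
        then show ?thesis using assms(3) w(2) reach_self[of g E ?W] by blast
      next
        case False
        then have "f \<in> ?Z" using w by auto
        moreover then have "w \<notin> ?W" using reach_step[of f E ?W g w] w by auto
        ultimately show ?thesis using w(1,3,5) c by blast
      qed
    qed
    moreover have "?Z \<union> F \<subset> I" "\<not> ?Z \<union> F \<subseteq> {s}" using Z assms by auto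
    ultimately show False using no_two_cut by blast
  qed
  then obtain z where "z \<in> ?Z" "E z y" by auto
  from reach_path_lengths[OF this, of "I - F - {b, g}"] show ?thesis using yI assms by auto
qed

text \<open>The contraction loses no degree and leaves a vertex other than \<open>s\<close>, so the
  induction hypothesis applies with the same \<open>d\<close>.\<close>

lemma spans_contract:
  assumes "\<And>w. w \<in> I \<Longrightarrow> \<not> E x w \<Longrightarrow> card {a\<in>I. E x a \<and> E w a} \<le> 1" "v \<in> I" "\<not> E x v" "v \<noteq> s"
  shows "spans (path_lengths E I x y) (d - 2)"
proof -
  from contract_root[OF assms] obtain E' I' y' k where c: "two_rooted_conn E' I' x y'" "I' \<subset> I"
    "\<And>v. v \<in> I' \<Longrightarrow> degree_in E (insert x (insert y I)) v \<le> degree_in E' (insert x (insert y' I')) v"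
    "\<exists>v\<in>I'. v \<noteq> s" "\<And>n. n \<in> path_lengths E' I' x y' \<Longrightarrow> n + k \<in> path_lengths E I x y" by metis
  interpret q: two_rooted_conn E' I' x y' by (rule c)
  have "weak_rooted d E' I' x y' s" unfolding weak_rooted_def
  proof (intro conjI allI impI ballI)
    fix v assume "v \<in> I'" "v \<noteq> s"
    then show "d \<le> degree_in E' (insert x (insert y' I')) v" using deg[of v] c(3)[of v] c(2) by (meson le_trans psubsetD)
  next
    fix F assume "F \<subseteq> I'" "\<not> F \<subseteq> {s}" then show "2 \<le> card (q.nb F)" by (intro q.cut2) auto
  next
    fix c assume "I' = {s, c}" then show "2 \<le> card (q.nb {s})" by (intro q.cut2) auto
  qed (use c q.two_rooted_axioms in auto)
  from IH[OF card_psubset_I[OF c(2)] this] show ?thesis using spans_shift c(5) by blast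
qed

end

lemma spans_concat:
  assumes "spans (path_lengths E A x c) m" "spans (path_lengths E B c y) n" "A \<inter> B = {}" "x \<notin> B" "y \<notin> A" "x \<noteq> y" "insert c (A \<union> B) \<subseteq> I"
  shows "spans (path_lengths E I x y) (m + n)"
  using spans_sum[OF assms(1,2), of "path_lengths E I x y"] path_lengths_concat[OF _ _ assms(3-7)] by blast

lemma irrefl_path_lengths_1: "(\<And>u. \<not> E u u) \<Longrightarrow> E u v \<Longrightarrow> 1 \<in> path_lengths E A u v"
  using path_lengths_1[of E u v A] by metis

lemma irrefl_path_lengths_2:
  assumes irr: "\<And>u. \<not> E u u" and "E u w" "E w v" "u \<noteq> v" "w \<in> A" shows "2 \<in> path_lengths E A u v"
proof -
  have "u \<noteq> w" using assms by auto
  then have "Suc 1 \<in> path_lengths E A u v" using path_lengths_step[of E u w 1 "{}" v A] irrefl_path_lengths_1[of E w v "{}", OF irr] assms by auto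
  then show ?thesis by (simp add: numeral_2_eq_2)
qed

lemma irrefl_path_lengths_3:
  assumes irr: "\<And>u. \<not> E u u" and "E u w" "E w z" "E z v" "u \<noteq> v" "u \<noteq> z" "w \<noteq> v" "w \<in> A" "z \<in> A"
  shows "3 \<in> path_lengths E A u v"
proof -
  have "u \<noteq> w" using assms by auto
  then have "Suc 2 \<in> path_lengths E A u v" using path_lengths_step[of E u w 2 "{z}" v A] irrefl_path_lengths_2[of E w z v "{z}", OF irr] assms by auto
  then show ?thesis by (simp add: numeral_3_eq_3)
qed

lemmas (in two_rooted) path_lengths_edge = irrefl_path_lengths_1[of E, OF irr]
lemmas (in two_rooted) path_lengths_two = irrefl_path_lengths_2[of E, OF irr]
lemmas (in two_rooted) path_lengths_three = irrefl_path_lengths_3[of E, OF irr]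

section \<open>Both sides of a three-vertex cut, and triangles at a root\<close>

context weak_rooted_min begin

text \<open>A span of \<open>d - 3\<close> through \<open>F\<close> up to \<open>g\<close> should be
  followed by one from \<open>g\<close> to \<open>y\<close> through the rest \<open>K\<close>. There
  the edges to \<open>x\<close> are forgotten, and \<open>b\<close>, which may lose its neighbours
  in \<open>F\<close>, is the exception. The obstruction is a part of \<open>K\<close> around
  \<open>b\<close> that hangs on one vertex. Either it can be removed, or the roles of
  \<open>b\<close> and \<open>g\<close> can be exchanged, or \<open>y\<close> has so few neighbours
  that contraction at \<open>y\<close> is possible, which is the second alternative.\<close>

lemma spans_both_sides:
  assumes d4: "4 \<le> d" and F: "F \<subset> I" "\<not> F \<subseteq> {s}" "s \<in> F \<or> s \<notin> I" "nb F \<subseteq> {x, b, g}"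
    and bg: "b \<in> I" "b \<notin> F" "g \<in> I" "g \<notin> F" "b \<noteq> g"
    and star: "\<And>c. F = {s, c} \<Longrightarrow> c \<noteq> s \<Longrightarrow> 2 \<le> card (nbhd E (insert x (insert g F)) {s})"
    and rest: "I - F - {b, g} \<noteq> {}"
  shows "spans (path_lengths E I x y) (d - 3 + (d - 3)) \<or>
    ((\<forall>w\<in>I. \<not> E y w \<longrightarrow> card {a\<in>I. E y a \<and> E w a} \<le> 1) \<and> (\<exists>v\<in>I. \<not> E y v \<and> v \<noteq> s))"
proof -
  have p1: "spans (path_lengths E F x g) (d - 3)"
    by (rule spans_three_neighbours[OF F(1,2), of x g b]) (use F bg xI star in auto)
  define K where "K = I - F - {g}"
  have bK: "b \<in> K" using bg by (auto simp: K_def)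
  have KI: "K \<subset> I" using bg by (auto simp: K_def)
  have KF: "K \<inter> F = {}" "g \<notin> K" "x \<notin> K" "y \<notin> K" "s \<notin> K" using F bg xI yI by (auto simp: K_def)
  have fK: "finite K" using KI fin finite_subset by (metis psubsetE)
  have gy: "g \<noteq> y" "g \<noteq> x" using bg yI xI by auto
  have Fn: "w \<in> {b, g}" if "w \<in> I" "w \<notin> F" "f \<in> F" "E f w \<or> E w f" for w f
  proof -
    have "w \<in> nb F" using that sym[of w f] by (auto simp: nbhd_def)
    then show ?thesis using F(4) that xI by auto
  qed
  have Fy: "\<not> E f y" "\<not> E y f" if "f \<in> F" for f
  proof -
    have "y \<notin> nb F" using F(4) bg yI xy by auto
    then show "\<not> E f y" "\<not> E y f" using that F(1) yI sym[of y f] by (auto simp: nbhd_def)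
  qed
  let ?nO = "nbhd E (insert g (insert y K))"
  have KFn: "w = x \<or> w \<in> insert g (insert y K)" if "w \<in> insert x (insert y I)" "h \<in> K" "h \<noteq> b" "E h w" for w h
  proof (cases "w \<in> F")
    case True
    then have "h \<in> {b, g}" using Fn[of h w] that KI KF by blast
    then show ?thesis using that KF by blast
  next
    case False
    then show ?thesis using that by (auto simp: K_def)
  qed
  have fnO: "finite (?nO H)" for H using fK by (auto simp: nbhd_def)
  have A: "2 \<le> card (?nO H)" if H: "H \<subseteq> K" "H \<noteq> {}" "b \<notin> H" for H
  proof -
    have "3 \<le> card (nb H)" by (rule cut3) (use H KI KF in auto)
    then have "2 \<le> card (nb H - {x})" by (rule card_diff1_ge2)
    moreover have "nb H - {x} \<subseteq> ?nO H"
    proof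
      fix w assume "w \<in> nb H - {x}"
      then obtain h where w: "w \<in> insert x (insert y I)" "w \<notin> H" "h \<in> H" "E h w" "w \<noteq> x" by (auto simp: nbhd_def)
      then have "w \<in> insert g (insert y K)" using KFn[of w h] H by blast
      then show "w \<in> ?nO H" using w by (auto simp: nbhd_def)
    qed
    ultimately show ?thesis using card_mono[OF fnO] by (meson le_trans)
  qed
  have comb: "spans (path_lengths E I x y) (d - 3 + (d - 3))" if "spans (path_lengths E K' g y) (d - 3)" "K' \<subseteq> K" for K'
    by (rule spans_concat[OF p1 that(1)]) (use that(2) KF KI F(1) bg xI yI xy in auto)
  have dK: "d - 1 \<le> degree_in E (insert g (insert y K')) v"
    if v: "v \<in> K'" "v \<noteq> b" and K': "K' \<subseteq> K" "\<And>w. w \<in> K - K' \<Longrightarrow> \<not> E v w" for v K'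
  proof -
    have "degree_in E (insert x (insert y I)) v \<le> degree_in E (insert g (insert y K')) v + 1"
    proof (rule degree_in_loss[where B="{w\<in>insert g (insert y K'). E v w}" and Q="{x}" and X="{}"])
      show "{w \<in> insert x (insert y I). E v w} \<subseteq> {w \<in> insert g (insert y K'). E v w} \<union> {x}"
        using KFn[of _ v] v K' by blast
    qed (use K' fK finite_subset in auto)
    moreover have "v \<in> I" "v \<noteq> s" using v K' KI KF by auto
    ultimately show ?thesis using deg[of v] by auto
  qed
  show ?thesis
  proof (cases "\<forall>H\<subseteq>K. b \<in> H \<longrightarrow> 2 \<le> card (?nO H)")
    case True
    have full: "2 \<le> card (?nO H)" if "H \<subseteq> K" "H \<noteq> {}" for H using that A True by blast
    have "weak_rooted (d - 1) E K g y b" unfolding weak_rooted_def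
    proof (intro conjI allI impI ballI)
      show "two_rooted E K g y" by unfold_locales (use fK KF gy irr in \<open>auto intro: sym\<close>)
      show "\<exists>v\<in>K. v \<noteq> b" using rest by (auto simp: K_def)
    qed (use dK[of _ K] full in auto)
    from IH[OF card_psubset_I[OF KI] this] have "spans (path_lengths E K g y) (d - 3)" by (simp add: numeral_3_eq_3 numeral_2_eq_2)
    then show ?thesis using comb[of K] by auto
  next
    case False
    \<comment> \<open>The sets around \<open>b\<close> that violate the cut condition for the roots
      \<open>g\<close> and \<open>y\<close>. A largest one, \<open>H\<close>, is cut off, and
      maximality makes the remainder satisfy the condition.\<close>
    define HS where "HS = {H. H \<subseteq> K \<and> b \<in> H \<and> \<not> 2 \<le> card (?nO H)}"
    have "HS \<noteq> {}" using False by (auto simp: HS_def)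
    moreover have "finite HS" by (rule finite_subset[of _ "Pow K"]) (auto simp: HS_def fK)
    ultimately have mx: "Max (card ` HS) \<in> card ` HS" "\<And>H'. H' \<in> HS \<Longrightarrow> card H' \<le> Max (card ` HS)"
      by (auto intro: Max_in)
    then obtain H where H: "H \<in> HS" "\<And>H'. H' \<in> HS \<Longrightarrow> card H' \<le> card H" by auto
    have HK: "H \<subseteq> K" "b \<in> H" "\<not> 2 \<le> card (?nO H)" using H by (auto simp: HS_def)
    have fH: "finite H" using HK fK finite_subset by auto
    have notx: "\<not> nb (H \<union> F) \<subseteq> {x, g}"
    proof
      assume "nb (H \<union> F) \<subseteq> {x, g}"
      moreover have "H \<union> F \<subset> I" using HK KI F bg KF by blast
      moreover have "\<not> H \<union> F \<subseteq> {s}" using F by auto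
      ultimately show False using no_two_cut by blast
    qed
    have nbHF: "w = x \<or> w = g \<or> w \<in> ?nO H" if "w \<in> nb (H \<union> F)" for w
    proof -
      from that obtain f where w: "w \<in> insert x (insert y I)" "w \<notin> H" "w \<notin> F" "f \<in> H \<union> F" "E f w" by (auto simp: nbhd_def)
      show ?thesis
      proof (cases "f \<in> F")
        case True
        then show ?thesis using Fn[of w f] Fy[of f] w HK by blast
      next
        case False
        then have "f \<in> H" using w by auto
        moreover have "w = x \<or> w \<in> insert g (insert y K)" using w by (auto simp: K_def)
        ultimately show ?thesis using w by (auto simp: nbhd_def)
      qed
    qed
    have "?nO H \<noteq> {}" using nbHF notx by blast
    then obtain c where c0: "c \<in> ?nO H" by auto
    have nOH: "?nO H = {c}"
    proof -
      have "w = c" if "w \<in> ?nO H" for w using card_ge2I[OF that c0 _ fnO] HK by blast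
      then show ?thesis using c0 by blast
    qed
    have cg: "c \<noteq> g" using nbHF notx nOH by blast
    have cK: "c \<in> insert y K" "c \<notin> H" using c0 cg by (auto simp: nbhd_def)
    have Hn: "w = c" if "w \<in> insert g (insert y K)" "w \<notin> H" "h \<in> H" "E h w \<or> E w h" for w h
    proof -
      have "w \<in> ?nO H" using that sym[of w h] by (auto simp: nbhd_def)
      then show ?thesis using nOH by auto
    qed
    define K2 where "K2 = K - H"
    have K2: "K2 \<subseteq> K" "b \<notin> K2" "K2 \<subset> I" "finite K2" using HK KI fK by (auto simp: K2_def)
    have rgK2: "two_rooted E K2 g y" by unfold_locales (use K2 KF gy irr in \<open>auto intro: sym\<close>)
    have K2n: "?nO H2 \<subseteq> nbhd E (insert g (insert y K2)) H2" if "H2 \<subseteq> K2" "c \<notin> H2" for H2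
    proof
      fix w assume "w \<in> ?nO H2"
      then obtain h where w: "w \<in> insert g (insert y K)" "w \<notin> H2" "h \<in> H2" "E h w" by (auto simp: nbhd_def)
      have "h \<in> K" "h \<notin> H" using w that by (auto simp: K2_def)
      then have "w \<notin> H" using Hn[of h w] w that by blast
      then show "w \<in> nbhd E (insert g (insert y K2)) H2" using w by (auto simp: nbhd_def K2_def)
    qed
    have fn2: "finite (nbhd E (insert g (insert y K2)) H2)" for H2 using K2 by (auto simp: nbhd_def)
    have cutK2: "2 \<le> card (nbhd E (insert g (insert y K2)) H2)" if H2: "H2 \<subseteq> K2" "H2 \<noteq> {}" for H2
    proof (cases "c \<in> H2")
      case False
      have "2 \<le> card (?nO H2)" using A[of H2] H2 K2 by blast
      then show ?thesis using card_mono[OF fn2 K2n[OF H2(1) False]] by simp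
    next
      case True
      show ?thesis
      proof (rule ccontr)
        assume c2: "\<not> ?thesis"
        \<comment> \<open>A violating \<open>H2\<close> containing \<open>c\<close> could be added
          to \<open>H\<close>.\<close>
        have "?nO (H \<union> H2) \<subseteq> nbhd E (insert g (insert y K2)) H2"
        proof
          fix w assume "w \<in> ?nO (H \<union> H2)"
          then obtain h where w: "w \<in> insert g (insert y K)" "w \<notin> H" "w \<notin> H2" "h \<in> H \<union> H2" "E h w" by (auto simp: nbhd_def)
          have "h \<notin> H" using Hn[of w h] w True by blast
          then show "w \<in> nbhd E (insert g (insert y K2)) H2" using w by (auto simp: nbhd_def K2_def)
        qed
        then have "card (?nO (H \<union> H2)) \<le> card (nbhd E (insert g (insert y K2)) H2)" by (rule card_mono[OF fn2])
        then have "H \<union> H2 \<in> HS" using c2 HK H2 K2 by (auto simp: HS_def)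
        then have "card (H \<union> H2) \<le> card H" using H by auto
        moreover have "card H < card (H \<union> H2)"
          by (rule psubset_card_mono) (use fH H2 K2 True cK finite_subset[OF H2(1)] in auto)
        ultimately show False by simp
      qed
    qed
    have dgK2: "d - 1 \<le> degree_in E (insert g (insert y K2)) v" if v: "v \<in> K2" "v \<noteq> c" for v
    proof (rule dK)
      fix w assume "w \<in> K - K2"
      then have "w \<in> H" by (auto simp: K2_def)
      then show "\<not> E v w" using Hn[of v w] v K2 by (auto simp: K2_def)
    qed (use v K2 in auto)
    show ?thesis
    proof (cases "K2 \<subseteq> {c}")
      case False
      have "weak_rooted (d - 1) E K2 g y c" unfolding weak_rooted_def
      proof (intro conjI allI impI ballI)
        fix c1 assume "K2 = {c, c1}" then show "2 \<le> card (nbhd E (insert g (insert y K2)) {c})" by (intro cutK2) auto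
      next
        fix F' assume "F' \<subseteq> K2" "\<not> F' \<subseteq> {c}" then show "2 \<le> card (nbhd E (insert g (insert y K2)) F')" by (intro cutK2) auto
      qed (use rgK2 dgK2 False in auto)
      from IH[OF card_psubset_I[OF K2(3)] this] have "spans (path_lengths E K2 g y) (d - 3)" by (simp add: numeral_3_eq_3 numeral_2_eq_2)
      then show ?thesis using comb[of K2] K2 by auto
    next
      case K2c: True
      show ?thesis
      proof (cases "c = y")
        case True
        \<comment> \<open>All of \<open>K\<close> hangs on \<open>y\<close>, so \<open>g\<close> has
          no neighbour in \<open>K\<close> and the graph falls apart at \<open>b\<close>: a span
          through \<open>G2\<close> from \<open>x\<close> to \<open>b\<close> and one through
          \<open>F'\<close> from \<open>b\<close> to \<open>y\<close> are added.\<close>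
        have KH: "K = H" using K2c True KF HK by (auto simp: K2_def)
        define F' where "F' = K - {b}"
        have F'ne: "F' \<noteq> {}" using rest by (auto simp: F'_def K_def)
        have F'I: "F' \<subset> I" "\<not> F' \<subseteq> {s}" using KI KF F'ne by (auto simp: F'_def)
        have gH: "\<not> E h g" "\<not> E g h" if "h \<in> K" for h using Hn[of g h] cg KF KH that by blast+
        have nbF': "nb F' \<subseteq> {b, y, x}"
        proof
          fix w assume "w \<in> nb F'"
          then obtain h where w: "w \<in> insert x (insert y I)" "w \<notin> F'" "h \<in> F'" "E h w" by (auto simp: nbhd_def)
          then have "w = x \<or> w \<in> insert g (insert y K)" using KFn[of w h] by (auto simp: F'_def)
          then show "w \<in> {b, y, x}" using w gH[of h] by (auto simp: F'_def)
        qed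
        have q1: "spans (path_lengths E F' b y) (d - 3)"
          by (rule spans_three_neighbours[OF F'I nbF']) (use bg yI xI KF in \<open>auto simp: F'_def\<close>)
        define G2 where "G2 = insert g F"
        have G2: "G2 \<subset> I" "\<not> G2 \<subseteq> {s}" using F bg by (auto simp: G2_def)
        have nbG2: "nb G2 \<subseteq> {x, b, y}"
        proof
          fix w assume "w \<in> nb G2"
          then obtain h where w: "w \<in> insert x (insert y I)" "w \<notin> G2" "h \<in> G2" "E h w" by (auto simp: nbhd_def)
          show "w \<in> {x, b, y}"
          proof (cases "w \<in> I")
            case True
            then have "w \<in> K" using w by (auto simp: G2_def K_def)
            then show ?thesis using w gH[of w] Fn[of w h] True by (auto simp: G2_def)
          qed (use w in auto)
        qed
        have q2: "spans (path_lengths E G2 x b) (d - 3)"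
          by (rule spans_three_neighbours[OF G2 nbG2]) (use bg xI yI F in \<open>auto simp: G2_def\<close>)
        have "spans (path_lengths E I x y) (d - 3 + (d - 3))"
        proof (rule spans_concat[OF q2 q1])
          show "G2 \<inter> F' = {}" using KF by (auto simp: G2_def F'_def)
          show "insert b (G2 \<union> F') \<subseteq> I" using F'I G2 bg by blast
        qed (use F'I G2 xI yI xy in auto)
        then show ?thesis by auto
      next
        case False
        have cKH: "c \<in> K" "K = insert c H" using cK False K2c HK by (auto simp: K2_def)
        have cgn: "c \<noteq> b" using cK HK by auto
        \<comment> \<open>Here \<open>y\<close> sees only \<open>g\<close> and \<open>c\<close>, and
          no vertex sees both of these, which is the contraction condition at
          \<open>y\<close>.\<close>
        have Ny: "w \<in> {g, c}" if "w \<in> I" "E y w" for w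
        proof (rule ccontr)
          assume "w \<notin> {g, c}"
          moreover have "w \<notin> F" using Fy that by auto
          ultimately have "w \<in> H" using that cKH by (auto simp: K_def)
          then show False using Hn[of y w] that False KF HK by blast
        qed
        have nob: "\<not> (E w g \<and> E w c)" if "w \<in> I" "w \<noteq> g" "w \<noteq> c" for w
        proof (cases "w \<in> F")
          case True
          then show ?thesis using Fn[of c w] cKH KI KF cgn cg by blast
        next
          case w: False
          then have "w \<in> H" using that cKH by (auto simp: K_def)
          then show ?thesis using Hn[of g w] KF HK cg by blast
        qed
        have "card {a\<in>I. E y a \<and> E w a} \<le> 1" if "w \<in> I" for w
        proof -
          have nn: "\<not> (E w g \<and> E w c)" using nob[OF that] irr[of w] by (cases "w = g \<or> w = c") auto
          show ?thesis
          proof (cases "E w g")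
            case True
            then have "{a\<in>I. E y a \<and> E w a} \<subseteq> {g}" using Ny nn by auto
            then show ?thesis by (rule card_le1I)
          next
            case False
            then have "{a\<in>I. E y a \<and> E w a} \<subseteq> {c}" using Ny by auto
            then show ?thesis by (rule card_le1I)
          qed
        qed
        moreover obtain v where "v \<in> F" "v \<noteq> s" using F by auto
        ultimately show ?thesis using Fy F(1) by blast
      qed
    qed
  qed
qed

text \<open>Delete \<open>b\<close> and leave at \<open>x\<close> only the set \<open>M\<close> of
  common neighbours of \<open>x\<close> and \<open>b\<close>. A vertex of \<open>M\<close> loses
  \<open>b\<close> but keeps \<open>x\<close>, any other loses at most one of the two, so
  \<open>d\<close> drops by one. A path leaving \<open>x\<close> into \<open>M\<close> can take the
  detour over \<open>b\<close>, which regains one. The bulk of the proof treats the cuts this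
  deletion may create.\<close>

lemma spans_triangle_at_root:
  assumes d4: "4 \<le> d" and b: "b \<in> I" "E x b" and u: "u \<in> I" "E x u" "E b u"
  shows "spans (path_lengths E I x y) (d - 2)"
proof -
  define J where "J = I - {b}"
  define M where "M = {u\<in>I. E x u \<and> E b u}"
  let ?E = "reroot E x M"
  let ?n = "nbhd ?E (insert x (insert y J))"
  have JI: "J \<subseteq> I" "J \<subset> I" "b \<notin> J" "x \<notin> J" "y \<notin> J" using b xI yI by (auto simp: J_def)
  have bx: "b \<noteq> x" "b \<noteq> y" using b xI yI by auto
  have MJ: "M \<subseteq> J" "u \<in> M" using u irr by (auto simp: M_def J_def)
  have Mf: "E x w" "E b w" "w \<in> I" if "w \<in> M" for w using that by (auto simp: M_def)
  have two: "2 \<in> path_lengths E A x w" if "w \<in> M" "b \<in> A" for w A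
    by (rule path_lengths_two[of x b]) (use Mf[OF that(1)] b that xI in auto)
  show ?thesis
  proof (cases "\<forall>F\<subseteq>J. \<not> F \<subseteq> {s} \<longrightarrow> 2 \<le> card (?n F)")
    case True
    show ?thesis
    proof (cases "\<exists>c. J = {s, c} \<and> c \<noteq> s")
      case True
      then obtain c where c: "J = {s, c}" "c \<noteq> s" by auto
      \<comment> \<open>The shape forbidden for the induction hypothesis: degrees force
        \<open>d = 4\<close>, and \<open>x c y\<close> and \<open>x b s c y\<close> give the lengths
        2 and 4.\<close>
      have I3: "I = {b, s, c}" using c b by (auto simp: J_def)
      have sb: "s \<noteq> b" "c \<noteq> b" using c JI by auto
      have cI: "c \<in> I" "s \<in> I" using I3 by auto
      have sub: "{w\<in>insert x (insert y I). E c w} \<subseteq> {x, y, b, s}" using I3 irr by auto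
      have "d \<le> card {w\<in>insert x (insert y I). E c w}" using deg[OF cI(1) c(2)] by (simp add: degree_in_def)
      moreover have "card {x, y, b, s} \<le> 4" by (simp add: card_insert_if)
      ultimately have eq: "{w\<in>insert x (insert y I). E c w} = {x, y, b, s}" and dd: "d = 4"
        using card_seteq[OF _ sub] d4 card_mono[OF _ sub] by auto
      have "E c x" "E c y" "E c b" "E c s" using eq by blast+
      moreover have "{w\<in>I. E s w} \<subseteq> {b, c}" using I3 irr by auto
      then have "{w\<in>I. E s w} = {b, c}" using sdeg[OF cI(2)] card_seteq[of "{b,c}" "{w\<in>I. E s w}"] sb by auto
      then have "E s b" by blast
      ultimately have e: "E x c" "E c y" "E b s" "E s c" using sym by blast+
      have cs: "c \<noteq> x" "c \<noteq> y" "s \<noteq> x" "s \<noteq> y" using cI xI yI by auto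
      have 1: "1 \<in> path_lengths E {} c y" by (rule path_lengths_edge[OF e(2)])
      have "Suc 1 \<in> path_lengths E I x y" using path_lengths_step[OF e(1) 1] cs cI xy by auto
      moreover have 2: "Suc 1 \<in> path_lengths E {c} s y" using path_lengths_step[OF e(4) 1] cs c by auto
      have 3: "Suc (Suc 1) \<in> path_lengths E {s, c} b y" using path_lengths_step[OF e(3) 2] cs c sb bx by auto
      have "Suc (Suc (Suc 1)) \<in> path_lengths E I x y" using path_lengths_step[OF b(2) 3] cs c sb bx xy I3 by auto
      ultimately have "spans (path_lengths E I x y) 2" by (rule spans_pair2)
      then show ?thesis using dd by simp
    next
      case star: False
      have "weak_rooted (d - 1) ?E J x y s" unfolding weak_rooted_def
      proof (intro conjI allI impI ballI)
        show "two_rooted ?E J x y" by (rule reroot_two_rooted) (rule JI)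
        show "\<exists>v\<in>J. v \<noteq> s"
        proof (rule ccontr)
          assume "\<not> ?thesis"
          then have J: "J \<subseteq> {s}" "u = s" "b \<noteq> s" using MJ JI by auto
          then have I: "I \<subseteq> {b, s}" by (auto simp: J_def)
          have "d \<le> card {x, y, s}" by (rule degree_le_card[of b]) (use b I J irr in auto)
          also have "\<dots> \<le> 3" by (simp add: card_insert_if)
          finally show False using d4 by simp
        qed
      next
        fix v assume v: "v \<in> J" "v \<noteq> s"
        have "degree_in E (insert x (insert y I)) v \<le> degree_in ?E (insert x (insert y J)) v + 1"
        proof (rule reroot_degree[OF JI(1) v(1), of "{x, b}"])
          show "card {w \<in> {x, b}. E v w} \<le> (if v \<in> M then 1 else 0) + 1"
          proof (cases "v \<in> M")
            case True
            have "card {w \<in> {x, b}. E v w} \<le> 2" by (rule card_le2I) auto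
            then show ?thesis using True by simp
          next
            case False
            then have "\<not> E v x \<or> \<not> E v b" using v JI sym[of v] by (auto simp: M_def)
            then have "{w \<in> {x, b}. E v w} \<subseteq> {x} \<or> {w \<in> {x, b}. E v w} \<subseteq> {b}" by auto
            then show ?thesis using card_le1I False by auto
          qed
        qed (auto simp: J_def)
        then show "d - 1 \<le> degree_in ?E (insert x (insert y J)) v" using deg[of v] v JI by auto
      qed (use True star in auto)
      from IH[OF card_psubset_I[OF JI(2)] this] have q: "spans (path_lengths ?E J x y) (d - 3)" by (simp add: numeral_3_eq_3 numeral_2_eq_2)
      have "spans (path_lengths E I x y) (d - 3 + 1)"
      proof (rule spans_thick1[OF q, of 0])
        fix n assume n: "n \<in> path_lengths ?E J x y"
        obtain w m where w: "w \<in> J" "w \<in> M" "n = Suc m" "m \<in> path_lengths E (J - {w}) w y"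
          using reroot_path_lengths[OF n] MJ JI by blast
        have wx: "w \<noteq> x" "w \<noteq> b" "w \<in> I" using w JI by auto
        show "n + 0 \<in> path_lengths E I x y"
          using path_lengths_step[OF Mf(1)[OF w(2)] w(4), of I] w wx JI xI xy by auto
        have "2 + m \<in> path_lengths E I x y"
          by (rule path_lengths_concat[OF two[OF w(2), of "{b}"] w(4)]) (use w wx JI xI xy b bx in auto)
        then show "n + Suc 0 \<in> path_lengths E I x y" using w by simp
      qed
      then show ?thesis using d4 by (rule_tac spans_mono) auto
    qed
  next
    case False
    \<comment> \<open>A set violating the cut condition sees only \<open>x\<close>, \<open>b\<close>
      and one further vertex \<open>g\<close>, and it avoids \<open>M\<close>.\<close>
    then obtain F where F: "F \<subseteq> J" "\<not> F \<subseteq> {s}" "\<not> 2 \<le> card (?n F)" by auto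
    have nF: "?n F = (nb F \<inter> insert y J) \<union> (if F \<inter> M = {} then {} else {x})" by (rule reroot_nbhd[OF JI(1) F(1)])
    have fn: "finite (?n F)" using two_rooted.finite_nb[OF reroot_two_rooted[OF JI(1)]] .
    have one: "p = q" if "p \<in> ?n F" "q \<in> ?n F" for p q using card_ge2I[OF that _ fn] F by blast
    have FI: "F \<subset> I" "b \<notin> F" using F JI by auto
    have nbhd: "nb F \<subseteq> {x, b} \<union> (nb F \<inter> insert y J)" by (auto simp: nbhd_def J_def)
    have ne: "nb F \<inter> insert y J \<noteq> {}" using no_two_cut[OF FI(1) F(2), of x b] nbhd by blast
    then obtain g where g: "g \<in> nb F" "g \<in> insert y J" by auto
    have gx: "g \<noteq> x" using g JI xy by auto
    have FM: "F \<inter> M = {}"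
    proof (rule ccontr)
      assume "F \<inter> M \<noteq> {}"
      then have "x \<in> ?n F" "g \<in> ?n F" using nF g by auto
      then show False using one gx by blast
    qed
    have nbF: "nb F \<subseteq> {x, b, g}"
    proof
      fix w assume w: "w \<in> nb F"
      show "w \<in> {x, b, g}"
      proof (cases "w \<in> insert y J")
        case True then show ?thesis using one[of w g] nF w g by blast
      qed (use w nbhd in blast)
    qed
    have gF: "g \<notin> F" "g \<noteq> b" using g JI bx by (auto simp: nbhd_def)
    have uF: "u \<notin> F" "u \<noteq> b" "u \<noteq> x" "u \<noteq> y" using FM MJ JI u xI yI by auto
    have starF: "2 \<le> card (nbhd E (insert x (insert g F)) {s})" if c: "F = {s, c}" "c \<noteq> s" for c
    proof -
      have cF: "c \<in> F" "c \<in> I" "c \<notin> M" using c FI FM by auto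
      have "w \<in> {x, b, g, s}" if "w \<in> insert x (insert y I)" "E c w" for w
      proof (cases "w \<in> F")
        case True then show ?thesis using c that irr by auto
      next
        case False
        then have "w \<in> nb F" using that cF by (auto simp: nbhd_def)
        then show ?thesis using nbF by auto
      qed
      moreover have "\<not> E c x \<or> \<not> E c b" using cF sym[of c] by (auto simp: M_def)
      ultimately have "(\<forall>w\<in>insert x (insert y I). E c w \<longrightarrow> w \<in> {b, g, s}) \<or> (\<forall>w\<in>insert x (insert y I). E c w \<longrightarrow> w \<in> {x, g, s})" by blast
      then have "d \<le> card {b, g, s} \<or> d \<le> card {x, g, s}" using degree_le_card[OF cF(2) c(2), of "{b, g, s}"] degree_le_card[OF cF(2) c(2), of "{x, g, s}"] by blast
      moreover have "card {b, g, s} \<le> 3" "card {x, g, s} \<le> 3" by (simp_all add: card_insert_if)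
      ultimately show ?thesis using d4 by auto
    qed
    show ?thesis
    proof (cases "g = y")
      case True
      have q: "spans (path_lengths E F b y) (d - 3)"
        by (rule spans_three_neighbours[OF FI(1) F(2), of b y x]) (use nbF True FI b bx yI xI in auto)
      have "spans (path_lengths E I x y) (d - 3 + 1)"
      proof (rule spans_thick1[OF q, of 1])
        fix n assume n: "n \<in> path_lengths E F b y"
        have "1 + n \<in> path_lengths E I x y"
          by (rule path_lengths_concat[OF path_lengths_edge[OF b(2), of "{}"] n]) (use b bx xI yI FI xy in auto)
        then show "n + 1 \<in> path_lengths E I x y" by simp
        have "2 \<in> path_lengths E {u} x b" by (rule path_lengths_two[of x u]) (use u sym[of b u] bx in auto)
        then have "2 + n \<in> path_lengths E I x y"
          by (rule path_lengths_concat[OF _ n]) (use b bx xI yI FI xy u uF in auto)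
        then show "n + Suc 1 \<in> path_lengths E I x y" by simp
      qed
      then show ?thesis using d4 by (rule_tac spans_mono) auto
    next
      case gy: False
      then have gI: "g \<in> I" using g JI by auto
      show ?thesis
      proof (cases "s \<in> F")
        case sF: False
        have Fne: "F \<noteq> {}" using F by auto
        have bF: "insert b F \<subset> I" using FI b gI gF by blast
        have q: "spans (path_lengths E (insert b F) x g) (d - 2)"
          by (rule spans_gate_exceptional[OF d4 Fne sF nbF b(1) FI(2) bF]) (use gI gF in auto)
        obtain m where m: "m \<in> path_lengths E (I - F - {b, g}) g y"
          using path_away[OF FI(1) F(2) nbF b(1) FI(2) gI gF(1)] gF by auto
        have "spans (path_lengths E I x y) (d - 2 + 0)"
          by (rule spans_concat[OF q spans_0[OF m]]) (use b bx xI yI FI xy gI gF in auto)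
        then show ?thesis by simp
      next
        case sF: True
        show ?thesis
        proof (cases "I - F - {b, g} = {}")
          case False
          from spans_both_sides[OF d4 FI(1) F(2) disjI1[OF sF] nbF b(1) FI(2) gI gF(1) gF(2)[symmetric] starF False]
          show ?thesis
          proof
            assume "spans (path_lengths E I x y) (d - 3 + (d - 3))"
            then show ?thesis using d4 by (rule_tac spans_mono) auto
          next
            interpret w: weak_rooted_min E I y x s d by (rule swap_weak)
            assume "(\<forall>w\<in>I. \<not> E y w \<longrightarrow> card {a \<in> I. E y a \<and> E w a} \<le> 1) \<and> (\<exists>v\<in>I. \<not> E y v \<and> v \<noteq> s)"
            then show ?thesis using w.spans_contract path_lengths_commute[of I x y] by metis
          qed
        next
          case True
          \<comment> \<open>Nothing is left outside \<open>F\<close>, \<open>b\<close> and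
            \<open>g\<close>, so the third vertex of the triangle is \<open>g\<close>; the detour is
            then taken at the end of the path, by \<open>g y\<close> and
            \<open>g b y\<close>.\<close>
          have ug: "u = g" using True u uF by blast
          have q: "spans (path_lengths E F x g) (d - 3)"
            by (rule spans_three_neighbours[OF FI(1) F(2), of x g b]) (use nbF FI gF gI xI starF in auto)
          have gyE: "E g y"
          proof (rule ccontr)
            assume n: "\<not> E g y"
            have "nb (insert g F) \<subseteq> {x, b}"
              using nbF n True gy xy unfolding nbhd_def by blast
            moreover have "insert g F \<subset> I" using FI gI gF b by blast
            ultimately show False using no_two_cut[of "insert g F" x b] F by blast
          qed
          have byE: "E b y"
          proof (rule ccontr)
            assume n: "\<not> E b y"
            have "nb (insert b F) \<subseteq> {x, g}"
              using nbF n True bx xy unfolding nbhd_def by blast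
            moreover have "insert b F \<subset> I" using FI gI gF b by blast
            ultimately show False using no_two_cut[of "insert b F" x g] F by blast
          qed
          have "spans (path_lengths E I x y) (d - 3 + 1)"
          proof (rule spans_thick1[OF q, of 1])
            fix n assume n: "n \<in> path_lengths E F x g"
            have 1: "1 \<in> path_lengths E {} g y" by (rule path_lengths_edge[OF gyE])
            show "n + 1 \<in> path_lengths E I x y"
              by (rule path_lengths_concat[OF n 1]) (use FI xy gI yI in auto)
            have 2: "2 \<in> path_lengths E {b} g y"
              by (rule path_lengths_two[of g b]) (use u ug sym[of b u] gF gy byE in auto)
            have "n + 2 \<in> path_lengths E I x y"
              by (rule path_lengths_concat[OF n 2]) (use FI xy gI yI b bx in auto)
            then show "n + Suc 1 \<in> path_lengths E I x y" by simp
          qed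
          then show ?thesis using d4 by (rule_tac spans_mono) auto
        qed
      qed
    qed
  qed
qed

end

lemma card_filter_triple: "card {w\<in>{p, q, r}. P w} \<le> 3"
proof -
  have "card {w\<in>{p, q, r}. P w} \<le> card {p, q, r}" by (rule card_mono) auto
  also have "\<dots> \<le> 3" by (simp add: card_insert_if)
  finally show ?thesis .
qed

section \<open>Four-cycles at a root\<close>

context weak_rooted_min begin

lemma nb_swap: "nbhd E (insert y (insert x I)) F = nb F" by (simp add: insert_commute)

text \<open>By \<open>cl\<close> the part \<open>Fs\<close> does not see \<open>y\<close>. The name
  \<open>y\<close> is thus free to denote the vertex into which \<open>a\<close> and
  \<open>a'\<close> are contracted, and the lengths obtained belong to paths from \<open>x\<close>
  to \<open>a\<close> or \<open>a'\<close>.\<close>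

lemma spans_root_side:
  assumes d4: "4 \<le> d" and Fs: "Fs \<subseteq> I - {a, a', b}"
    and cl: "\<And>v w. v \<in> Fs \<Longrightarrow> w \<in> insert x (insert y I) \<Longrightarrow> E v w \<Longrightarrow> w \<in> Fs \<union> {x, a, a', b}"
    and ab: "a \<in> I" "a' \<in> I" "b \<in> I"
    and ind: "\<And>v. s \<in> Fs \<Longrightarrow> v \<in> Fs \<Longrightarrow> E v x \<Longrightarrow> \<not> E v a \<and> \<not> E v a'"
    and ns: "\<not> reach E Fs x - {x} \<subseteq> {s}"
    and loss: "\<And>v. v \<in> Fs \<Longrightarrow> v \<noteq> s \<Longrightarrow> card {w\<in>{a, a', b}. E v w} \<le> (if E a v \<or> E a' v then 1 else 0) + j"
  shows "\<exists>A. spans A (d - j - 2) \<and> (\<forall>n\<in>A. \<exists>z\<in>{a, a'}. n \<in> path_lengths E Fs x z)"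
proof -
  interpret w: weak_rooted_min E I y x s d by (rule swap_weak)
  define X where "X = reach E Fs x - {x}"
  define S where "S = {w. \<exists>z\<in>{a, a'}. E z w}"
  let ?E = "reroot E y S"
  have xFs: "x \<notin> Fs" "y \<notin> Fs" using Fs xI yI by auto
  have XF: "X \<subseteq> Fs" using reach_sub[of E Fs x] by (auto simp: X_def)
  have rX: "reach E Fs x = insert x X" by (auto simp: X_def)
  have XI: "X \<subset> I" "X \<subseteq> I" using XF Fs ab by auto
  have fX: "finite X" using XI fin finite_subset by auto
  have Xcl: "w \<in> X \<or> w \<in> {x, a, a', b}" if "v \<in> X" "w \<in> insert x (insert y I)" "E v w" for v w
  proof -
    have "w \<in> Fs \<union> {x, a, a', b}" using cl that XF by blast
    moreover have "w \<in> insert x X" if "w \<in> Fs" using reach_step[of v E Fs x w] that \<open>v \<in> X\<close> \<open>E v w\<close> rX by auto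
    ultimately show ?thesis by auto
  qed
  have Sv: "v \<in> S \<longleftrightarrow> E a v \<or> E a' v" for v by (auto simp: S_def)
  let ?n = "nbhd ?E (insert y (insert x X))"
  have rgX: "two_rooted ?E X y x" by (rule w.reroot_two_rooted[OF XI(2)])
  have fn: "finite (?n F)" for F using two_rooted.finite_nb[OF rgX] .
  have nF: "?n F = (nb F \<inter> insert x X) \<union> (if F \<inter> S = {} then {} else {y})" if "F \<subseteq> X" for F
    using w.reroot_nbhd[OF XI(2) that, of S] by (simp add: nb_swap)
  have con: "\<exists>u. u \<in> nb F \<inter> insert x X" if F: "F \<subseteq> X" "F \<noteq> {}" for F
  proof -
    have "x \<notin> F" using F XF xFs by auto
    then obtain f u where "f \<in> F" "u \<in> reach E Fs x - F" "E f u" using reach_crossing[of E F Fs x] sym F rX by blast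
    then have "u \<in> nb F \<inter> insert x X" using rX XI by (auto simp: nbhd_def)
    then show ?thesis by blast
  qed
  have "weak_rooted (d - j) ?E X y x s" unfolding weak_rooted_def
  proof (intro conjI allI impI ballI)
    show "two_rooted ?E X y x" by (rule rgX)
    show "\<exists>v\<in>X. v \<noteq> s" using ns by (auto simp: X_def)
  next
    fix v assume v: "v \<in> X" "v \<noteq> s"
    have "degree_in E (insert y (insert x I)) v \<le> degree_in ?E (insert y (insert x X)) v + j"
    proof (rule w.reroot_degree[OF XI(2) v(1), of "{a, a', b}"])
      show "card {w \<in> {a, a', b}. E v w} \<le> (if v \<in> S then 1 else 0) + j"
        using loss[of v] v XF by (auto simp: Sv)
      show "\<And>w. w \<in> insert y (insert x I) \<Longrightarrow> E v w \<Longrightarrow> w \<in> insert x X \<or> w \<in> {a, a', b}"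
        using Xcl[OF v(1)] by blast
    qed auto
    then show "d - j \<le> degree_in ?E (insert y (insert x X)) v" using w.deg[of v] v XI by auto
  next
    fix F assume F: "F \<subseteq> X" "\<not> F \<subseteq> {s}"
    obtain u where u: "u \<in> nb F \<inter> insert x X" using con[OF F(1)] F(2) by auto
    have un: "u \<in> ?n F" "u \<noteq> y" using u nF[OF F(1)] XF xFs xy by auto
    show "2 \<le> card (?n F)"
    proof (cases "F \<inter> S = {}")
      case False
      then have "y \<in> ?n F" using nF[OF F(1)] by auto
      then show ?thesis using card_ge2I[OF un(1) _ _ fn] un by blast
    next
      case True
      show ?thesis
      proof (rule ccontr)
        assume c: "\<not> ?thesis"
        have "nb F \<subseteq> {b, u}"
        proof
          fix w assume w: "w \<in> nb F"
          then obtain f where f: "w \<in> insert x (insert y I)" "w \<notin> F" "f \<in> F" "E f w" by (auto simp: nbhd_def)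
          have fS: "\<not> E f a" "\<not> E f a'" using True f sym[of f] by (auto simp: S_def)
          have "w \<in> X \<or> w \<in> {x, a, a', b}" using Xcl[of f w] f F by blast
          then have "w = b \<or> w \<in> insert x X" using f fS by auto
          then show "w \<in> {b, u}" using card_ge2I[OF un(1), of w, OF _ _ fn] c w nF[OF F(1)] by blast
        qed
        then show False using no_two_cut[of F b u] F XI by blast
      qed
    qed
  next
    \<comment> \<open>\<open>ind\<close> and the degree of \<open>c\<close> exclude an edge from
      \<open>c\<close> to \<open>x\<close>; so the connection to \<open>x\<close> runs over
      \<open>s\<close>, which therefore sees both \<open>x\<close> and \<open>c\<close>.\<close>
    fix c assume c: "X = {s, c}" "c \<noteq> s"
    have cX: "c \<in> X" "c \<in> Fs" "c \<in> I" "s \<in> X" using c XF XI by auto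
    have ncx: "\<not> E c x"
    proof
      assume e: "E c x"
      then have "\<not> E c a" "\<not> E c a'" using ind[OF _ cX(2)] cX(4) XF by auto
      then have "w \<in> {x, b, s}" if "w \<in> insert x (insert y I)" "E c w" for w using Xcl[OF cX(1) that] c that irr by auto
      then have "d \<le> card {x, b, s}" by (intro degree_le_card[OF cX(3) c(2)]) auto
      also have "\<dots> \<le> 3" by (simp add: card_insert_if)
      finally show False using d4 by simp
    qed
    have "x \<notin> {c}" using cX xI by auto
    then obtain u where "u \<in> reach E Fs x - {c}" "E c u" using reach_crossing[of E "{c}" Fs x] sym cX rX by blast
    then have sc: "E c s" using rX c ncx by auto
    have "x \<notin> {s}" using cX XI xI by auto
    have "x \<notin> {s, c}" using cX XI xI by auto
    then obtain f u where "f \<in> {s,c}" "u \<in> reach E Fs x - {s,c}" "E f u" using reach_crossing[of E "{s,c}" Fs x] sym c rX by blast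
    then have sx: "E s x" using rX c ncx by auto
    have sX: "{s} \<subseteq> X" using cX by simp
    have "x \<in> nb {s}" "c \<in> nb {s}" using sx sc sym cX c xI XI by (auto simp: nbhd_def)
    then have "x \<in> ?n {s}" "c \<in> ?n {s}" using nF[OF sX] cX by auto
    then show "2 \<le> card (?n {s})" using card_ge2I[of x "?n {s}" c] fn cX xI by auto
  qed
  from IH[OF card_psubset_I[OF XI(1)] this] have q: "spans (path_lengths ?E X y x) (d - j - 2)" .
  have "\<exists>z\<in>{a, a'}. n \<in> path_lengths E Fs x z" if n: "n \<in> path_lengths ?E X y x" for n
  proof -
    have "\<exists>z\<in>{a, a'}. n \<in> path_lengths E X z x"
      by (rule reroot_path_lengths_root[OF n[unfolded S_def]]) (use XF Fs ab xI in auto)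
    then show ?thesis using path_lengths_commute path_lengths_mono[OF XF] by blast
  qed
  then show ?thesis using q by blast
qed

text \<open>On the part \<open>Y\<close> attached to \<open>y\<close>, the vertices \<open>a\<close>
  and \<open>a'\<close> are merged into the root, while \<open>b\<close> and the old edges at
  \<open>x\<close> disappear, at a cost of \<open>j\<close>. A path entering \<open>Y\<close> from
  \<open>z\<close> in \<open>{a, a'}\<close> may begin with \<open>x z\<close> or with
  \<open>x z' b z\<close>, of lengths 1 and 3, whence \<open>+ 2\<close>. The hypotheses isolate
  what differs between the general and the triangle-free case.\<close>

lemma spans_square_general:
  assumes ab: "a \<in> I" "a' \<in> I" "b \<in> I" "a \<noteq> a'" "E x a" "E x a'" "E b a" "E b a'"
    and Y: "Y = reach E (I - {a, a', b}) y - {y}" and S: "S = {w. \<exists>z\<in>{a, a'}. E z w}"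
    and s': "\<And>v. v \<in> Y \<Longrightarrow> v \<noteq> s' \<Longrightarrow> v \<noteq> s" "\<exists>v\<in>Y. v \<noteq> s'"
    and loss: "\<And>v. v \<in> Y \<Longrightarrow> v \<noteq> s' \<Longrightarrow> card {w\<in>{x, a, a', b}. E v w} \<le> (if v \<in> S then 1 else 0) + j"
    and nobad: "\<And>F g. F \<subseteq> Y \<Longrightarrow> \<not> F \<subseteq> {s'} \<Longrightarrow> F \<inter> S = {} \<Longrightarrow> g \<in> insert y Y \<Longrightarrow> g \<notin> F \<Longrightarrow> nb F \<subseteq> {x, b, g} \<Longrightarrow> False"
    and star: "\<And>c. 3 \<le> d - j \<Longrightarrow> Y = {s', c} \<Longrightarrow> c \<noteq> s' \<Longrightarrow> 2 \<le> card (nbhd (reroot E x S) (insert x (insert y Y)) {s'})"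
  shows "spans (path_lengths E I x y) (d - j - 2 + 2)"
proof -
  let ?W = "I - {a, a', b}"
  let ?E = "reroot E x S"
  have xn: "x \<notin> ?W" "y \<notin> ?W" using xI yI by auto
  have YW: "Y \<subseteq> ?W" using reach_sub[of E ?W y] by (auto simp: Y)
  have rY: "reach E ?W y = insert y Y" by (auto simp: Y)
  have YI: "Y \<subset> I" "Y \<subseteq> I" using YW ab by auto
  have ba: "b \<noteq> a" "b \<noteq> a'" using ab irr by auto
  have xa: "x \<noteq> a" "x \<noteq> a'" "x \<noteq> b" "y \<noteq> a" "y \<noteq> a'" "y \<noteq> b" using ab xI yI by auto
  have Ycl: "w \<in> insert y Y \<or> w \<in> {x, a, a', b}" if "v \<in> Y" "w \<in> insert x (insert y I)" "E v w" for v w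
    using reach_step[of v E ?W y w] that rY by blast
  let ?n = "nbhd ?E (insert x (insert y Y))"
  have rgY: "two_rooted ?E Y x y" by (rule reroot_two_rooted[OF YI(2)])
  have fn: "finite (?n F)" for F using two_rooted.finite_nb[OF rgY] .
  have nF: "?n F = (nb F \<inter> insert y Y) \<union> (if F \<inter> S = {} then {} else {x})" if "F \<subseteq> Y" for F
    by (rule reroot_nbhd[OF YI(2) that])
  have "weak_rooted (d - j) ?E Y x y s'" unfolding weak_rooted_def
  proof (intro conjI allI impI ballI)
    fix v assume v: "v \<in> Y" "v \<noteq> s'"
    have "degree_in E (insert x (insert y I)) v \<le> degree_in ?E (insert x (insert y Y)) v + j"
      by (rule reroot_degree[OF YI(2) v(1), of "{x, a, a', b}"]) (use loss[OF v] Ycl[OF v(1)] in auto)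
    then show "d - j \<le> degree_in ?E (insert x (insert y Y)) v" using deg[of v] v YI s'(1)[OF v] by auto
  next
    fix F assume F: "F \<subseteq> Y" "\<not> F \<subseteq> {s'}"
    have "y \<notin> F" "F \<noteq> {}" using F YI yI by auto
    then obtain f u where fu: "f \<in> F" "u \<in> reach E ?W y - F" "E f u" using reach_crossing[of E F ?W y] sym F rY by blast
    then have un: "u \<in> nb F" "u \<in> insert y Y" "u \<noteq> x" using rY YI yI xI xy by (auto simp: nbhd_def)
    have un': "u \<in> ?n F" using un nF[OF F(1)] by auto
    show "2 \<le> card (?n F)"
    proof (cases "F \<inter> S = {}")
      case False
      then have "x \<in> ?n F" using nF[OF F(1)] by auto
      then show ?thesis using card_ge2I[OF un' _ _ fn] un by blast
    next
      case True
      show ?thesis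
      proof (rule ccontr)
        assume c: "\<not> ?thesis"
        have "nb F \<subseteq> {x, b, u}"
        proof
          fix w assume w: "w \<in> nb F"
          then obtain f where f: "w \<in> insert x (insert y I)" "w \<notin> F" "f \<in> F" "E f w" by (auto simp: nbhd_def)
          have fS: "\<not> E f a" "\<not> E f a'" using True f sym[of f] by (auto simp: S)
          have "w \<in> insert y Y \<or> w \<in> {x, a, a', b}" using Ycl[of f w] f F by blast
          then have "w \<in> {x, b} \<or> w \<in> insert y Y" using f fS by auto
          then show "w \<in> {x, b, u}" using card_ge2I[OF un', of w, OF _ _ fn] c w nF[OF F(1)] by blast
        qed
        then show False using nobad[OF F True un(2)] fu by blast
      qed
    qed
  qed (use rgY s' star in auto)
  from IH[OF card_psubset_I[OF YI(1)] this] have q: "spans (path_lengths ?E Y x y) (d - j - 2)" .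
  show ?thesis
  proof (rule spans_thick2[OF q, of 1])
    fix n assume n: "n \<in> path_lengths ?E Y x y"
    have "\<exists>z\<in>{a, a'}. n \<in> path_lengths E Y z y"
      by (rule reroot_path_lengths_root[OF n[unfolded S]]) (use YW xa in auto)
    then obtain z z' where z: "{z, z'} = {a, a'}" "n \<in> path_lengths E Y z y" by blast
    have zz: "z \<noteq> z'" "z \<in> I" "z' \<in> I" "z \<notin> Y" "z' \<notin> Y" "b \<notin> Y" "E x z" "E x z'" "E b z" "E b z'" "z \<noteq> x" "z' \<noteq> x" "z \<noteq> y" "z' \<noteq> y" "b \<noteq> z" "b \<noteq> z'"
      using z(1) ab YW xa ba by (auto simp: doubleton_eq_iff)
    have "1 + n \<in> path_lengths E I x y"
      by (rule path_lengths_concat[OF path_lengths_edge[OF zz(7), of "{}"] z(2)]) (use zz YI xI yI xy in auto)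
    then show "n + 1 \<in> path_lengths E I x y" by simp
    have 3: "3 \<in> path_lengths E {z', b} x z" by (rule path_lengths_three[of x z' b]) (use zz sym xa in auto)
    have "3 + n \<in> path_lengths E I x y"
      by (rule path_lengths_concat[OF 3 z(2)]) (use zz YI xI yI xy ab xa in auto)
    then show "n + Suc (Suc 1) \<in> path_lengths E I x y" by (simp add: numeral_3_eq_3)
  qed
qed

text \<open>If \<open>s\<close> is outside \<open>F\<close>, then \<open>b\<close> is kept as the
  exceptional vertex. Otherwise \<open>b\<close> separates \<open>F\<close> from the remaining inner
  vertices, and two spans of \<open>d - 3\<close> add up to at least \<open>d - 2\<close> because
  \<open>d \<ge> 4\<close>.\<close>

lemma spans_cut_at_y:
  assumes d4: "4 \<le> d" and F: "F \<subseteq> I" "\<not> F \<subseteq> {s}" "nb F \<subseteq> {x, b, y}" and b: "b \<in> I" "b \<notin> F"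
    and a: "a \<in> I" "a \<notin> F" "a \<noteq> b"
  shows "spans (path_lengths E I x y) (d - 2)"
proof -
  have FI: "F \<subset> I" using F a by auto
  have bx: "b \<noteq> x" "b \<noteq> y" using b xI yI by auto
  show ?thesis
  proof (cases "s \<in> F")
    case False
    have "insert b F \<subset> I" using F a b by blast
    moreover have "F \<noteq> {}" using F by auto
    ultimately have q: "spans (path_lengths E (insert b F) x y) (d - 2)"
      using spans_gate_exceptional[OF d4 _ False F(3) b(1,2)] F(1) yI bx(2) by blast
    have "path_lengths E (insert b F) x y \<subseteq> path_lengths E I x y" by (rule path_lengths_mono) (use F(1) b in auto)
    from spans_mono[OF q this] show ?thesis by simp
  next
    case True
    have q1: "spans (path_lengths E F b y) (d - 3)"
      by (rule spans_three_neighbours[OF FI F(2), of b y x]) (use F b bx yI xI in auto)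
    define G2 where "G2 = I - F - {b}"
    have nb2: "nb G2 \<subseteq> {x, b, y}"
    proof
      fix w assume "w \<in> nb G2"
      then obtain h where w: "w \<in> insert x (insert y I)" "w \<notin> G2" "h \<in> G2" "E h w" by (auto simp: nbhd_def)
      show "w \<in> {x, b, y}"
      proof (rule ccontr)
        assume "w \<notin> {x, b, y}"
        then have "w \<in> F" using w by (auto simp: G2_def)
        then have "h \<in> nb F" using w sym[of h w] by (auto simp: nbhd_def G2_def)
        then show False using F(3) w xI yI by (auto simp: G2_def)
      qed
    qed
    have G2: "G2 \<subset> I" "\<not> G2 \<subseteq> {s}" using b a True by (auto simp: G2_def)
    have q2: "spans (path_lengths E G2 x b) (d - 3)"
      by (rule spans_three_neighbours[OF G2 nb2]) (use b bx xI yI in \<open>auto simp: G2_def\<close>)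
    have "spans (path_lengths E I x y) (d - 3 + (d - 3))"
      by (rule spans_concat[OF q2 q1]) (use F b xI yI xy in \<open>auto simp: G2_def\<close>)
    then show ?thesis using d4 by (rule_tac spans_mono) auto
  qed
qed

text \<open>The merge costs two: by \<open>ind\<close> a neighbour of \<open>a\<close> or
  \<open>a'\<close> does not see \<open>x\<close>, so it loses at most three vertices and gains the
  root, and any other vertex loses at most \<open>x\<close> and \<open>b\<close>. The two routes
  around the four-cycle give two back. What remains are small cuts and the forbidden shape
  \<open>Y = {s, c}\<close>.\<close>

lemma spans_square:
  assumes d4: "4 \<le> d" and ind: "\<And>u v. u \<in> I \<Longrightarrow> v \<in> I \<Longrightarrow> E x u \<Longrightarrow> E x v \<Longrightarrow> \<not> E u v"
    and ab: "a \<in> I" "a' \<in> I" "b \<in> I" "a \<noteq> a'" "E x a" "E x a'" "E b a" "E b a'"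
    and ns: "\<not> reach E (I - {a, a', b}) y - {y} \<subseteq> {s}"
  shows "spans (path_lengths E I x y) (d - 2)"
proof -
  define W where "W = I - {a, a', b}"
  define Y where "Y = reach E W y - {y}"
  define S where "S = {w. \<exists>z\<in>{a, a'}. E z w}"
  have nsY: "\<not> Y \<subseteq> {s}" using ns by (simp add: Y_def W_def)
  have xn: "x \<notin> W" "y \<notin> W" using xI yI by (auto simp: W_def)
  have YW: "Y \<subseteq> W" using reach_sub[of E W y] by (auto simp: Y_def)
  have rY: "reach E W y = insert y Y" by (auto simp: Y_def)
  have WI: "W \<subset> I" "W \<subseteq> I" "a \<notin> W" "a' \<notin> W" "b \<notin> W" using ab by (auto simp: W_def)
  have ba: "b \<noteq> a" "b \<noteq> a'" using ab irr by auto
  have xa: "x \<noteq> a" "x \<noteq> a'" "x \<noteq> b" "y \<noteq> a" "y \<noteq> a'" "y \<noteq> b" using ab xI yI by auto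
  have nxb: "\<not> E x b" using ind[of b a] ab by auto
  have Ycl: "w \<in> insert y Y \<or> w \<in> {x, a, a', b}" if "v \<in> Y" "w \<in> insert x (insert y I)" "E v w" for v w
    using reach_step[of v E W y w] that rY by (auto simp: W_def)
  have ind2: "\<not> E v a \<and> \<not> E v a'" if "v \<in> I" "E v x" for v using ind[of v a] ind[of v a'] sym[OF that(2)] ab that by auto
  have Sv: "v \<in> S \<longleftrightarrow> E a v \<or> E a' v" for v by (auto simp: S_def)
  show ?thesis
  proof (cases "\<exists>F g. F \<subseteq> Y \<and> \<not> F \<subseteq> {s} \<and> F \<inter> S = {} \<and> g \<in> insert y Y \<and> g \<notin> F \<and> nb F \<subseteq> {x, b, g}")
    case True
    then obtain F g where F: "F \<subseteq> Y" "\<not> F \<subseteq> {s}" "F \<inter> S = {}" "nb F \<subseteq> {x, b, g}" and g: "g \<in> insert y Y" "g \<notin> F" by blast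
    have FI: "F \<subset> I" "F \<subseteq> I" "b \<notin> F" "a \<notin> F" "a' \<notin> F" using F YW WI by auto
    show ?thesis
    proof (cases "g = y")
      case True
      show ?thesis by (rule spans_cut_at_y[OF d4 FI(2) F(2) _ ab(3) FI(3) ab(1) FI(4) ba(1)[symmetric]]) (use F True in auto)
    next
      case gy: False
      then have gI: "g \<in> I" "g \<in> W" "g \<in> Y" using g YW WI by auto
      have gb: "g \<noteq> b" using gI WI by auto
      show ?thesis
      proof (cases "s \<in> F")
        case sF: False
        have Fne: "F \<noteq> {}" using F by auto
        have bF: "insert b F \<subset> I" using FI ab ba by blast
        have q: "spans (path_lengths E (insert b F) x g) (d - 2)"
          by (rule spans_gate_exceptional[OF d4 Fne sF F(4) ab(3) FI(3) bF]) (use gI g gb in auto)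
        obtain m where m: "m \<in> path_lengths E (I - F - {b, g}) g y"
          using path_away[OF FI(1) F(2) F(4) ab(3) FI(3) gI(1) g(2)] gb by auto
        have "spans (path_lengths E I x y) (d - 2 + 0)"
          by (rule spans_concat[OF q spans_0[OF m]]) (use ab xa xI yI FI xy gI g gb in auto)
        then show ?thesis by simp
      next
        case sF: True
        show ?thesis
        proof (cases "\<exists>c. F = {s, c} \<and> c \<noteq> s")
          case False
          have rest: "I - F - {b, g} \<noteq> {}" using ab FI ba gI WI by blast
          have starF: "\<And>c. F = {s, c} \<Longrightarrow> c \<noteq> s \<Longrightarrow> 2 \<le> card (nbhd E (insert x (insert g F)) {s})" using False by blast
          from spans_both_sides[OF d4 FI(1) F(2) disjI1[OF sF] F(4) ab(3) FI(3) gI(1) g(2) gb[symmetric] starF rest]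
          show ?thesis
          proof
            assume "spans (path_lengths E I x y) (d - 3 + (d - 3))"
            then show ?thesis using d4 by (rule_tac spans_mono) auto
          next
            interpret w: weak_rooted_min E I y x s d by (rule swap_weak)
            assume "(\<forall>w\<in>I. \<not> E y w \<longrightarrow> card {a \<in> I. E y a \<and> E w a} \<le> 1) \<and> (\<exists>v\<in>I. \<not> E y v \<and> v \<noteq> s)"
            then show ?thesis using w.spans_contract path_lengths_commute[of I x y] by metis
          qed
        next
          case True
          \<comment> \<open>Degrees force \<open>d = 4\<close> and make \<open>c\<close> adjacent to
            \<open>x\<close>, \<open>b\<close>, \<open>g\<close>, \<open>s\<close>. Then
            \<open>x c\<close> and \<open>x a b c\<close>, both continued over \<open>g\<close> to
            \<open>y\<close>, have lengths differing by two.\<close>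
          then obtain c where c: "F = {s, c}" "c \<noteq> s" by auto
          have cF: "c \<in> F" "c \<in> I" "c \<noteq> x" "c \<noteq> y" "c \<notin> {a, a', b}" using c FI xI yI by auto
          have sub: "{w\<in>insert x (insert y I). E c w} \<subseteq> {x, b, g, s}"
          proof
            fix w assume w: "w \<in> {w\<in>insert x (insert y I). E c w}"
            show "w \<in> {x, b, g, s}"
            proof (cases "w \<in> F")
              case True then show ?thesis using c w irr by auto
            next
              case False
              then have "w \<in> nb F" using w cF by (auto simp: nbhd_def)
              then show ?thesis using F(4) by auto
            qed
          qed
          have "d \<le> card {w\<in>insert x (insert y I). E c w}" using deg[OF cF(2) c(2)] by (simp add: degree_in_def)
          moreover have "card {x, b, g, s} \<le> 4" by (simp add: card_insert_if)
          ultimately have eq: "{w\<in>insert x (insert y I). E c w} = {x, b, g, s}" and dd: "d = 4"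
            using card_seteq[OF _ sub] d4 card_mono[OF _ sub] by auto
          have e: "E c x" "E c b" "E c g" using eq by blast+
          have e2: "E x c" "E b c" using e sym by auto
          let ?Z = "reach E (W - F) g"
          have Z: "?Z \<subseteq> W - F" using reach_sub[of E "W - F" g] gI g by auto
          have "\<exists>z\<in>?Z. E z y"
          proof (rule ccontr)
            assume n: "\<not> ?thesis"
            let ?G = "reach E W y \<inter> (?Z \<union> F)"
            have gZ: "g \<in> ?G" using gI rY by auto
            have "y \<notin> ?G" using Z F YW xn by auto
            then obtain f u where fu: "f \<in> ?G" "u \<in> reach E W y - ?G" "E f u"
              using reach_crossing[of E ?G W y] sym gZ by blast
            have uYy: "u \<in> insert y Y" "u \<notin> ?Z" "u \<notin> F" using fu rY by auto
            show False
            proof (cases "f \<in> F")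
              case True
              then have "u \<in> nb F" using fu uYy YW WI by (auto simp: nbhd_def)
              then have "u = g" using F(4) uYy YW WI xn xa xy by auto
              then show False using uYy by auto
            next
              case False
              then have "f \<in> ?Z" using fu by auto
              then show False using n reach_step[of f E "W - F" g u] fu uYy YW by auto
            qed
          qed
          then obtain z where "z \<in> ?Z" "E z y" by auto
          then obtain m where m: "m \<in> path_lengths E (W - F - {g}) g y"
            using reach_path_lengths[of z E "W - F" g y "W - F - {g}"] xn gy by auto
          have m1: "Suc m \<in> path_lengths E (W - F) c y"
            by (rule path_lengths_step[OF e(3) m]) (use cF g gI in auto)
          have "1 + Suc m \<in> path_lengths E I x y"
            by (rule path_lengths_concat[OF path_lengths_edge[OF e2(1), of "{}"] m1]) (use cF WI xn xy in auto)
          moreover have 3: "3 \<in> path_lengths E {a, b} x c"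
            by (rule path_lengths_three[of x a b]) (use ab sym e2 cF xa in auto)
          have "3 + Suc m \<in> path_lengths E I x y"
            by (rule path_lengths_concat[OF 3 m1]) (use cF WI xn xy ab xa in auto)
          ultimately have "spans (path_lengths E I x y) 2" by (intro spans_pair2[of "1 + Suc m"]) (simp_all add: numeral_3_eq_3)
          then show ?thesis using dd by simp
        qed
      qed
    qed
  next
    case nobad: False
    have loss: "card {w\<in>{x, a, a', b}. E v w} \<le> (if v \<in> S then 1 else 0) + 2" if v: "v \<in> I" for v
    proof (cases "v \<in> S")
      case True
      then have "E v a \<or> E v a'" using Sv sym[of a v] sym[of a' v] by blast
      then have "\<not> E v x" using ind2[OF v] by blast
      then have "{w\<in>{x, a, a', b}. E v w} = {w\<in>{a, a', b}. E v w}" by auto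
      then show ?thesis using card_filter_triple[of a a' b "E v"] True by simp
    next
      case False
      then have "\<not> E v a" "\<not> E v a'" using Sv sym[of v] by blast+
      then have "{w\<in>{x, a, a', b}. E v w} \<subseteq> {x, b}" by auto
      then show ?thesis using card_le2I[of "{w\<in>{x, a, a', b}. E v w}" x b] by simp
    qed
    show ?thesis
    proof (cases "\<exists>c. 3 \<le> d - 2 \<and> Y = {s, c} \<and> c \<noteq> s \<and> \<not> 2 \<le> card (nbhd (reroot E x S) (insert x (insert y Y)) {s})")
      case False
      have "spans (path_lengths E I x y) (d - 2 - 2 + 2)"
      proof (rule spans_square_general[OF ab _ S_def, of Y s])
        show "Y = reach E (I - {a, a', b}) y - {y}" by (simp add: Y_def W_def)
        show "\<exists>v\<in>Y. v \<noteq> s" using nsY by blast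
        show "card {w\<in>{x, a, a', b}. E v w} \<le> (if v \<in> S then 1 else 0) + 2" if "v \<in> Y" for v
          using loss that YW WI(2) by blast
        show False if "F \<subseteq> Y" "\<not> F \<subseteq> {s}" "F \<inter> S = {}" "g \<in> insert y Y" "g \<notin> F" "nb F \<subseteq> {x, b, g}" for F g
          using nobad that by blast
        show "2 \<le> card (nbhd (reroot E x S) (insert x (insert y Y)) {s})" if "3 \<le> d - 2" "Y = {s, c}" "c \<noteq> s" for c
          using False that by blast
      qed
      then show ?thesis using d4 by (rule_tac spans_mono) auto
    next
      case True
      \<comment> \<open>Here \<open>d = 5\<close>, the vertex \<open>c\<close> sees
        \<open>a\<close>, \<open>a'\<close>, \<open>b\<close>, \<open>y\<close> and
        \<open>s\<close>, while \<open>s\<close> sees neither \<open>a\<close> nor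
        \<open>a'\<close>. The required span of 3 is collected in the part \<open>Fs\<close> away
        from \<open>y\<close>.\<close>
      then obtain c where c: "3 \<le> d - 2" "Y = {s, c}" "c \<noteq> s" and small: "\<not> 2 \<le> card (nbhd (reroot E x S) (insert x (insert y Y)) {s})" by blast
      have cY: "c \<in> Y" "c \<in> W" "c \<in> I" "s \<in> Y" "s \<in> W" "s \<in> I" using c YW WI by auto
      have cc: "c \<noteq> x" "c \<noteq> y" "c \<noteq> a" "c \<noteq> a'" "c \<noteq> b" "s \<noteq> a" "s \<noteq> a'" "s \<noteq> b" "s \<noteq> x" "s \<noteq> y" using cY xn WI by auto
      have ncx: "\<not> E c x"
      proof
        assume e: "E c x"
        then have "w \<in> {x, b, y, s}" if "w \<in> insert x (insert y I)" "E c w" for w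
          using Ycl[OF cY(1) that] c that irr ind2[OF cY(3) e] by auto
        then have "d \<le> card {x, b, y, s}" by (intro degree_le_card[OF cY(3) c(3)]) auto
        also have "\<dots> \<le> 4" by (simp add: card_insert_if)
        finally show False using c by simp
      qed
      have sub: "{w\<in>insert x (insert y I). E c w} \<subseteq> {a, a', b, y, s}"
        using Ycl[OF cY(1)] c irr ncx by blast
      have "d \<le> card {w\<in>insert x (insert y I). E c w}" using deg[OF cY(3) c(3)] by (simp add: degree_in_def)
      moreover have "card {a, a', b, y, s} \<le> 5" by (simp add: card_insert_if)
      ultimately have eq: "{w\<in>insert x (insert y I). E c w} = {a, a', b, y, s}" and dd: "d = 5"
        using card_seteq[OF _ sub] c card_mono[OF _ sub] by auto
      have e: "E c a" "E c a'" "E c b" "E c y" "E c s" using eq by blast+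
      have e': "E a c" "E a' c" "E b c" "E s c" using e sym by blast+
      have nsS: "\<not> E a s" "\<not> E a' s"
      proof -
        have sY: "{s} \<subseteq> Y" using cY by auto
        have nn: "nbhd (reroot E x S) (insert x (insert y Y)) {s} = (nb {s} \<inter> insert y Y) \<union> (if {s} \<inter> S = {} then {} else {x})"
          by (rule reroot_nbhd) (use YW WI sY in auto)
        have "c \<in> nb {s}" using e' cY c by (auto simp: nbhd_def)
        then have "c \<in> nbhd (reroot E x S) (insert x (insert y Y)) {s}" using nn cY by auto
        moreover have "finite (nbhd (reroot E x S) (insert x (insert y Y)) {s})" using YW WI fin finite_subset[of Y I] by (auto simp: nbhd_def)
        ultimately have "x \<notin> nbhd (reroot E x S) (insert x (insert y Y)) {s}" using small card_ge2I[of c _ x] cc by metis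
        then have "s \<notin> S" using nn by (auto split: if_splits)
        then show "\<not> E a s" "\<not> E a' s" using Sv by auto
      qed
      define Fs where "Fs = W - Y"
      have Fsn: "x \<notin> Fs" "y \<notin> Fs" "a \<notin> Fs" "a' \<notin> Fs" "b \<notin> Fs" "c \<notin> Fs" "s \<notin> Fs" "Fs \<subseteq> I" "Fs \<subset> I" using WI xn cY by (auto simp: Fs_def)
      have cl: "w \<in> Fs \<union> {x, a, a', b}" if v: "v \<in> Fs" "w \<in> insert x (insert y I)" "E v w" for v w
      proof (rule ccontr)
        assume n: "w \<notin> Fs \<union> {x, a, a', b}"
        then have "w \<in> insert y Y" using v by (auto simp: Fs_def W_def)
        then have "v \<in> reach E W y" using reach_step[of w E W y v] rY sym[OF v(3)] v by (auto simp: Fs_def)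
        then show False using rY v Fsn by (auto simp: Fs_def)
      qed
      have Fne: "Fs \<noteq> {}"
      proof
        assume e0: "Fs = {}"
        then have WY: "W \<subseteq> {s, c}" using c by (auto simp: Fs_def)
        have "w \<in> {x, b, y, c}" if "w \<in> insert x (insert y I)" "E a w" for w
          using that WY nsS ind[OF ab(1,2,5,6)] irr[of a] by (auto simp: W_def)
        then have "d \<le> card {x, b, y, c}" by (intro degree_le_card[OF ab(1)]) (use cc in auto)
        also have "\<dots> \<le> 4" by (simp add: card_insert_if)
        finally show False using dd by simp
      qed
      show ?thesis
      proof (cases "reach E Fs x - {x} = {}")
        case False
        have FsI: "Fs \<subseteq> I - {a, a', b}" using Fsn by auto
        have "\<exists>A. spans A (d - 2 - 2) \<and> (\<forall>n\<in>A. \<exists>z\<in>{a, a'}. n \<in> path_lengths E Fs x z)"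
        proof (rule spans_root_side[OF d4 FsI cl ab(1-3)])
          show "\<not> reach E Fs x - {x} \<subseteq> {s}" using False reach_sub[of E Fs x] Fsn by auto
          show "\<And>v. v \<in> Fs \<Longrightarrow> E v x \<Longrightarrow> \<not> E v a \<and> \<not> E v a'" using ind2 Fsn by blast
          fix v assume v: "v \<in> Fs"
          show "card {w \<in> {a, a', b}. E v w} \<le> (if E a v \<or> E a' v then 1 else 0) + 2"
          proof (cases "E a v \<or> E a' v")
            case True then show ?thesis using card_filter_triple[of a a' b "E v"] by auto
          next
            case False
            then have "{w \<in> {a, a', b}. E v w} \<subseteq> {b}" using sym[of v] by auto
            then show ?thesis using card_le1I[of "{w \<in> {a, a', b}. E v w}" b] by auto
          qed
        qed
        then obtain A where A: "spans A (d - 2 - 2)" "\<And>n. n \<in> A \<Longrightarrow> \<exists>z\<in>{a, a'}. n \<in> path_lengths E Fs x z" by blast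
        have "spans (path_lengths E I x y) (d - 2 - 2 + 2)"
        proof (rule spans_thick2[OF A(1), of 2])
          fix n assume "n \<in> A"
          then obtain z z' where z: "{z, z'} = {a, a'}" "n \<in> path_lengths E Fs x z" using A(2) by blast
          have zz: "z \<noteq> z'" "z \<in> I" "z' \<in> I" "z \<notin> Fs" "z' \<notin> Fs" "E b z" "E b z'" "E z c" "E z' c" "z \<noteq> x" "z' \<noteq> x" "z \<noteq> y" "z' \<noteq> y" "b \<noteq> z" "b \<noteq> z'" "c \<noteq> z" "c \<noteq> z'"
            using z(1) ab Fsn xa ba e' cc by (auto simp: doubleton_eq_iff)
          have p2: "2 \<in> path_lengths E {c} z y" by (rule path_lengths_two[of z c]) (use zz e cc in auto)
          show "n + 2 \<in> path_lengths E I x y"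
            by (rule path_lengths_concat[OF z(2) p2]) (use zz Fsn cc cY xy in auto)
          have p3: "3 \<in> path_lengths E {z', c} b y" by (rule path_lengths_three[of b z' c]) (use zz e cc xa in auto)
          have p4: "Suc 3 \<in> path_lengths E {b, z', c} z y"
            by (rule path_lengths_step[OF _ p3]) (use zz sym[of b z] xa in auto)
          have "n + Suc 3 \<in> path_lengths E I x y"
            by (rule path_lengths_concat[OF z(2) p4]) (use zz Fsn cc cY xy ab xa in auto)
          then show "n + Suc (Suc 2) \<in> path_lengths E I x y" by (simp add: numeral_3_eq_3 numeral_2_eq_2)
        qed
        then show ?thesis using dd by (simp add: numeral_3_eq_3)
      next
        case True
        have nbF: "nb Fs \<subseteq> {a, a', b}"
        proof
          fix w assume "w \<in> nb Fs"
          then obtain f where w: "w \<in> insert x (insert y I)" "w \<notin> Fs" "f \<in> Fs" "E f w" by (auto simp: nbhd_def)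
          moreover have "w \<noteq> x"
          proof
            assume "w = x"
            then have "f \<in> reach E Fs x" using reach_step[of x E Fs x f] sym[of f x] w by auto
            then show False using True w Fsn by auto
          qed
          ultimately show "w \<in> {a, a', b}" using cl[OF w(3,1,4)] by blast
        qed
        \<comment> \<open>\<open>Fs\<close> sees only \<open>a\<close>, \<open>a'\<close> and
          \<open>b\<close>. From \<open>a'\<close> to \<open>y\<close> there are the routes over
          \<open>c\<close> and over \<open>b c\<close>, of lengths 2 and 3.\<close>
        have q: "spans (path_lengths E Fs a a') (d - 3)"
          by (rule spans_three_neighbours[OF Fsn(9) _ nbF]) (use Fne Fsn ab in auto)
        have "spans (path_lengths E I x y) (d - 3 + 1)"
        proof (rule spans_thick1[OF q, of 3])
          fix n assume n: "n \<in> path_lengths E Fs a a'"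
          have n1: "1 + n \<in> path_lengths E (insert a Fs) x a'"
            by (rule path_lengths_concat[OF path_lengths_edge[OF ab(5), of "{}"] n]) (use Fsn xa in auto)
          have p2: "2 \<in> path_lengths E {c} a' y" by (rule path_lengths_two[of a' c]) (use e e' cc xa in auto)
          have "1 + n + 2 \<in> path_lengths E I x y"
            by (rule path_lengths_concat[OF n1 p2]) (use Fsn cc cY xy xa ab in auto)
          then show "n + 3 \<in> path_lengths E I x y" by (simp add: numeral_3_eq_3 numeral_2_eq_2)
          have p3: "3 \<in> path_lengths E {b, c} a' y" by (rule path_lengths_three[of a' b c]) (use e e' cc xa ab sym[of b a'] in auto)
          have "1 + n + 3 \<in> path_lengths E I x y"
            by (rule path_lengths_concat[OF n1 p3]) (use Fsn cc cY xy xa ab ba in auto)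
          then show "n + Suc 3 \<in> path_lengths E I x y" by (simp add: add.commute)
        qed
        then show ?thesis using dd by (simp add: numeral_3_eq_3)
      qed
    qed
  qed
qed

text \<open>The case complementary to \<open>spans_square\<close>: off the four-cycle,
  \<open>y\<close> reaches at most \<open>s\<close>. If \<open>y\<close> sees both \<open>a\<close>
  and \<open>a'\<close>, paths in the remaining part start at \<open>x\<close> or join
  \<open>a\<close> to \<open>a'\<close>, and are closed through the four-cycle. Otherwise
  \<open>y\<close> has just two neighbours, and either contraction at \<open>y\<close> or a
  four-cycle at \<open>y\<close> succeeds.\<close>

lemma spans_square_blocked:
  assumes d4: "4 \<le> d" and ind: "\<And>u v. u \<in> I \<Longrightarrow> v \<in> I \<Longrightarrow> E x u \<Longrightarrow> E x v \<Longrightarrow> \<not> E u v"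
    and indy: "\<And>u v. u \<in> I \<Longrightarrow> v \<in> I \<Longrightarrow> E y u \<Longrightarrow> E y v \<Longrightarrow> \<not> E u v"
    and ab: "a \<in> I" "a' \<in> I" "b \<in> I" "a \<noteq> a'" "E x a" "E x a'" "E b a" "E b a'"
    and ns: "reach E (I - {a, a', b}) y - {y} \<subseteq> {s}"
  shows "spans (path_lengths E I x y) (d - 2)"
proof -
  interpret w: weak_rooted_min E I y x s d by (rule swap_weak)
  define W where "W = I - {a, a', b}"
  define Y where "Y = reach E W y - {y}"
  define Fs where "Fs = W - Y"
  have nsY: "Y \<subseteq> {s}" using ns by (simp add: Y_def W_def)
  have xn: "x \<notin> W" "y \<notin> W" using xI yI by (auto simp: W_def)
  have YW: "Y \<subseteq> W" using reach_sub[of E W y] by (auto simp: Y_def)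
  have rY: "reach E W y = insert y Y" by (auto simp: Y_def)
  have WI: "W \<subset> I" "W \<subseteq> I" "a \<notin> W" "a' \<notin> W" "b \<notin> W" using ab by (auto simp: W_def)
  have ba: "b \<noteq> a" "b \<noteq> a'" using ab irr by auto
  have xa: "x \<noteq> a" "x \<noteq> a'" "x \<noteq> b" "y \<noteq> a" "y \<noteq> a'" "y \<noteq> b" using ab xI yI by auto
  have nxb: "\<not> E x b" "\<not> E b x" using ind[of b a] ab sym[of b x] by auto
  have naa: "\<not> E a a'" using ind[of a a'] ab by auto
  have ind2: "\<not> E v a \<and> \<not> E v a'" if "v \<in> I" "E v x" for v using ind[of v a] ind[of v a'] sym[OF that(2)] ab that by auto
  have WyY: "w \<in> Y" if "w \<in> W" "E y w" for w using reach_step[of y E W y w] that rY xn by auto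
  have Fsn: "x \<notin> Fs" "y \<notin> Fs" "a \<notin> Fs" "a' \<notin> Fs" "b \<notin> Fs" "Fs \<subseteq> I" "Fs \<subset> I" using WI xn by (auto simp: Fs_def)
  have cl: "w \<in> Fs \<union> {x, a, a', b}" if v: "v \<in> Fs" "w \<in> insert x (insert y I)" "E v w" for v w
  proof (rule ccontr)
    assume n: "w \<notin> Fs \<union> {x, a, a', b}"
    then have "w \<in> insert y Y" using v by (auto simp: Fs_def W_def)
    then have "v \<in> reach E W y" using reach_step[of w E W y v] rY sym[OF v(3)] v by (auto simp: Fs_def)
    then show False using rY v Fsn by (auto simp: Fs_def)
  qed
  have IW: "I = W \<union> {a, a', b}" using ab by (auto simp: W_def)
  show ?thesis
  proof (cases "E y a \<and> E y a'")
    case True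
    then have ya: "E y a" "E y a'" "E a y" "E a' y" using sym by blast+
    have nyb: "\<not> E y b" "\<not> E b y" using indy[of b a] ab ya sym[of b y] by auto
    have Fns: "\<not> Fs \<subseteq> {s}"
    proof
      assume "Fs \<subseteq> {s}"
      then have Is: "I \<subseteq> {a, a', b, s}" using nsY IW by (auto simp: Fs_def)
      show False
      proof (cases "b = s")
        case False
        have "w \<in> {a, a', s}" if "w \<in> insert x (insert y I)" "E b w" for w using that nxb nyb Is irr[of b] by auto
        then have "d \<le> card {a, a', s}" by (intro degree_le_card[OF ab(3) False]) auto
        also have "\<dots> \<le> 3" by (simp add: card_insert_if)
        finally show False using d4 by simp
      next
        case True
        have "w \<in> {x, b, y}" if "w \<in> insert x (insert y I)" "E a w" for w using that naa Is True irr[of a] by auto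
        then have "d \<le> card {x, b, y}" by (intro degree_le_card[OF ab(1)]) (use True ba in auto)
        also have "\<dots> \<le> 3" by (simp add: card_insert_if)
        finally show False using d4 by simp
      qed
    qed
    show ?thesis
    proof (cases "reach E Fs x - {x} \<subseteq> {s}")
      case False
      have FsI: "Fs \<subseteq> I - {a, a', b}" using Fsn by auto
      have "\<exists>A. spans A (d - 2 - 2) \<and> (\<forall>n\<in>A. \<exists>z\<in>{a, a'}. n \<in> path_lengths E Fs x z)"
      proof (rule spans_root_side[OF d4 FsI cl ab(1-3) _ False])
        show "\<And>v. v \<in> Fs \<Longrightarrow> E v x \<Longrightarrow> \<not> E v a \<and> \<not> E v a'" using ind2 Fsn by blast
        fix v assume v: "v \<in> Fs"
        show "card {w \<in> {a, a', b}. E v w} \<le> (if E a v \<or> E a' v then 1 else 0) + 2"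
        proof (cases "E a v \<or> E a' v")
          case True then show ?thesis using card_filter_triple[of a a' b "E v"] by auto
        next
          case False
          then have "{w \<in> {a, a', b}. E v w} \<subseteq> {b}" using sym[of v] by auto
          then show ?thesis using card_le1I[of "{w \<in> {a, a', b}. E v w}" b] by auto
        qed
      qed
      then obtain A where A: "spans A (d - 2 - 2)" "\<And>n. n \<in> A \<Longrightarrow> \<exists>z\<in>{a, a'}. n \<in> path_lengths E Fs x z" by blast
      have "spans (path_lengths E I x y) (d - 2 - 2 + 2)"
      proof (rule spans_thick2[OF A(1), of 1])
        fix n assume "n \<in> A"
        then obtain z z' where z: "{z, z'} = {a, a'}" "n \<in> path_lengths E Fs x z" using A(2) by blast
        have zz: "z \<noteq> z'" "z \<in> I" "z' \<in> I" "z \<notin> Fs" "z' \<notin> Fs" "E b z" "E b z'" "E z y" "E z' y" "z \<noteq> x" "z' \<noteq> x" "z \<noteq> y" "z' \<noteq> y" "b \<noteq> z" "b \<noteq> z'"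
          using z(1) ab Fsn xa ba ya by (auto simp: doubleton_eq_iff)
        show "n + 1 \<in> path_lengths E I x y"
          by (rule path_lengths_concat[OF z(2) path_lengths_edge[OF zz(8), of "{}"]]) (use zz Fsn xy in auto)
        have p3: "3 \<in> path_lengths E {b, z'} z y" by (rule path_lengths_three[of z b z']) (use zz sym[of b z] xa in auto)
        have "n + 3 \<in> path_lengths E I x y"
          by (rule path_lengths_concat[OF z(2) p3]) (use zz Fsn xy ab xa in auto)
        then show "n + Suc (Suc 1) \<in> path_lengths E I x y" by (simp add: numeral_3_eq_3 numeral_2_eq_2)
      qed
      then show ?thesis using d4 by (rule_tac spans_mono) auto
    next
      case Xs: True
      \<comment> \<open>No vertex of \<open>J\<close> other than \<open>s\<close> sees
        \<open>x\<close> or \<open>y\<close>, so \<open>a\<close> and \<open>a'\<close> serve as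
        roots without loss; the edges \<open>x a\<close> and \<open>a' y\<close> merely shift the
        lengths by two.\<close>
      define J where "J = I - {a, a'}"
      have JI: "J \<subset> I" "J \<subseteq> I" using ab by (auto simp: J_def)
      have fJ: "finite J" using JI fin finite_subset by auto
      have nxy: "\<not> E v x" "\<not> E v y" if v: "v \<in> J" "v \<noteq> s" for v
      proof -
        have "v = b \<or> v \<in> Fs" using v nsY IW by (auto simp: J_def Fs_def)
        moreover have "\<not> E v x" if "v \<in> Fs"
        proof
          assume "E v x"
          then have "v \<in> reach E Fs x" using reach_step[of x E Fs x v] that sym by auto
          then show False using Xs v that Fsn by auto
        qed
        moreover have "\<not> E v y" if "v \<in> Fs" using cl[OF that, of y] xa xy Fsn by auto
        ultimately show "\<not> E v x" "\<not> E v y" using nxb nyb by auto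
      qed
      let ?n = "nbhd E (insert a (insert a' J))"
      have fn: "finite (?n F)" for F using fJ by (auto simp: nbhd_def)
      have VJ: "insert x (insert y I) = insert x (insert y (insert a (insert a' J)))" using ab by (auto simp: J_def)
      have "weak_rooted d E J a a' s" unfolding weak_rooted_def
      proof (intro conjI allI impI ballI)
        show "two_rooted E J a a'" by unfold_locales (use fJ ab irr in \<open>auto simp: J_def intro: sym\<close>)
        show "\<exists>v\<in>J. v \<noteq> s" using Fns Fsn by (auto simp: J_def)
      next
        fix v assume v: "v \<in> J" "v \<noteq> s"
        have "degree_in E (insert x (insert y I)) v \<le> degree_in E (insert a (insert a' J)) v + 0"
          by (rule degree_in_loss[where B="{w\<in>insert a (insert a' J). E v w}" and Q="{}" and X="{}"])
            (use nxy[OF v] VJ fJ in auto)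
        then show "d \<le> degree_in E (insert a (insert a' J)) v" using deg[of v] v JI by auto
      next
        fix F assume F: "F \<subseteq> J" "\<not> F \<subseteq> {s}"
        define F2 where "F2 = F - {s}"
        have F2: "F2 \<subseteq> J" "\<not> F2 \<subseteq> {s}" using F by (auto simp: F2_def)
        have "3 \<le> card (nb F2)" by (rule cut3) (use F2 JI in auto)
        then have "2 \<le> card (nb F2 - {s})" by (rule card_diff1_ge2)
        moreover have "nb F2 - {s} \<subseteq> ?n F"
        proof
          fix w assume "w \<in> nb F2 - {s}"
          then obtain f where w: "w \<in> insert x (insert y I)" "w \<notin> F2" "f \<in> F2" "E f w" "w \<noteq> s" by (auto simp: nbhd_def)
          have "w \<noteq> x" "w \<noteq> y" using nxy[of f] w F2 by (auto simp: F2_def)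
          then show "w \<in> ?n F" using w VJ by (auto simp: nbhd_def F2_def)
        qed
        ultimately show "2 \<le> card (?n F)" using card_mono[OF fn] by (meson le_trans)
      next
        fix c assume c: "J = {s, c}" "c \<noteq> s"
        have cJ: "c \<in> J" "c \<in> I" using c JI by auto
        have "w \<in> {a, a', s}" if "w \<in> insert x (insert y I)" "E c w" for w
          using that nxy[OF cJ(1) c(2)] c VJ irr[of c] by auto
        then have "d \<le> card {a, a', s}" by (intro degree_le_card[OF cJ(2) c(2)]) auto
        also have "\<dots> \<le> 3" by (simp add: card_insert_if)
        finally show "2 \<le> card (?n {s})" using d4 by simp
      qed
      from IH[OF card_psubset_I[OF JI(1)] this] have q: "spans (path_lengths E J a a') (d - 2)" .
      show ?thesis
      proof (rule spans_shift[OF q, of 2])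
        fix n assume n: "n \<in> path_lengths E J a a'"
        have n1: "1 + n \<in> path_lengths E (insert a J) x a'"
          by (rule path_lengths_concat[OF path_lengths_edge[OF ab(5), of "{}"] n]) (use JI xI xa in auto)
        have "1 + n + 1 \<in> path_lengths E I x y"
          by (rule path_lengths_concat[OF n1 path_lengths_edge[OF ya(4), of "{}"]]) (use ab JI yI xy xa in auto)
        then show "n + 2 \<in> path_lengths E I x y" by simp
      qed
    qed
  next
    case nyy: False
    define Ny where "Ny = {w\<in>I. E y w}"
    have NyI: "Ny \<subseteq> {a, a', b} \<union> Y" using WyY IW by (auto simp: Ny_def)
    have NyI2: "Ny \<subseteq> I" by (auto simp: Ny_def)
    have two: "\<exists>p q. p \<in> Ny \<and> q \<in> Ny \<and> p \<noteq> q"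
    proof (rule ccontr)
      assume c: "\<not> ?thesis"
      obtain g where g: "g \<in> Ny" using w.root_has_neighbour ab by (auto simp: Ny_def)
      then have Nyg: "Ny \<subseteq> {g}" "g \<in> I" using c NyI2 by auto
      have "nb (I - {g}) \<subseteq> {x, g}" using Nyg sym by (auto simp: nbhd_def Ny_def)
      moreover have "I - {g} \<subset> I" using Nyg by auto
      moreover have "\<not> I - {g} \<subseteq> {s}" using ab ba by blast
      ultimately show False using no_two_cut by blast
    qed
    have one: "p = q" if "p \<in> Ny \<inter> {a, a', b}" "q \<in> Ny \<inter> {a, a', b}" for p q
      using that nyy indy[of b a] indy[of b a'] ab by (auto simp: Ny_def)
    obtain e where e: "e \<in> {a, a', b}" "e \<in> Ny" "s \<in> Ny" "s \<in> Y"
    proof -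
      obtain p q where pq: "p \<in> Ny" "q \<in> Ny" "p \<noteq> q" using two by auto
      have "p \<in> {a, a', b} \<or> p = s \<and> s \<in> Y" "q \<in> {a, a', b} \<or> q = s \<and> s \<in> Y" using pq NyI nsY by blast+
      then show ?thesis using one[of p q] pq that by blast
    qed
    have Nye: "Ny \<subseteq> {e, s}" using NyI nsY one e by blast
    have sW: "s \<in> W" "s \<in> I" "s \<noteq> a" "s \<noteq> a'" "s \<noteq> b" using e YW WI by auto
    have eI: "e \<in> I" "e \<noteq> s" "E y e" "E y s" using e NyI2 sW by (auto simp: Ny_def)
    show ?thesis
    proof (cases "\<forall>w\<in>I. \<not> E y w \<longrightarrow> card {a \<in> I. E y a \<and> E w a} \<le> 1")
      case True
      obtain v where v: "v \<in> {a, a', b}" "v \<noteq> e" using ab ba by blast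
      have "v \<notin> Ny" using one[of v e] v e by blast
      then have "v \<in> I" "\<not> E y v" "v \<noteq> s" using v ab sW by (auto simp: Ny_def)
      then show ?thesis using w.spans_contract True path_lengths_commute[of I x y] by metis
    next
      case False
      \<comment> \<open>\<open>w0\<close> closes a four-cycle \<open>y e w0 s\<close>, and this one
        is not blocked from \<open>x\<close>, because one of \<open>a\<close>, \<open>a'\<close>
        lies off it.\<close>
      then obtain w0 where w0: "w0 \<in> I" "\<not> E y w0" "2 \<le> card {a \<in> I. E y a \<and> E w0 a}" by force
      obtain p q where pq: "p \<in> {a \<in> I. E y a \<and> E w0 a}" "q \<in> {a \<in> I. E y a \<and> E w0 a}" "p \<noteq> q" using card_ge2E[OF w0(3)] .
      then have "p \<in> Ny" "q \<in> Ny" by (auto simp: Ny_def)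
      then have "{p, q} = {e, s}" using Nye pq(3) by blast
      then have w0e: "E w0 e" "E w0 s" using pq by (auto simp: doubleton_eq_iff)
      have "\<exists>q\<in>{a, a'}. q \<noteq> e \<and> q \<noteq> s \<and> q \<noteq> w0"
      proof (rule ccontr)
        assume c: "\<not> ?thesis"
        then have "a = e \<or> a = w0" "a' = e \<or> a' = w0" using sW by auto
        then have "(e = a \<and> w0 = a') \<or> (e = a' \<and> w0 = a)" using ab(4) by auto
        then show False using w0e naa sym by blast
      qed
      then obtain q where q: "q \<in> {a, a'}" "q \<noteq> e" "q \<noteq> s" "q \<noteq> w0" by blast
      have "q \<in> reach E (I - {e, s, w0}) x" by (rule reach_step[of x]) (use q ab in auto)
      then have nsx: "\<not> reach E (I - {e, s, w0}) x - {x} \<subseteq> {s}" using q xa by auto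
      have "spans (path_lengths E I y x) (d - 2)"
        by (rule w.spans_square[OF d4 indy eI(1) sW(2) w0(1) eI(2,3,4) w0e nsx])
      then show ?thesis using path_lengths_commute[of I x y] by simp
    qed
  qed
qed

text \<open>For span 1 a triangle or four-cycle at \<open>x\<close> suffices without induction: two
  routes around it are prolonged by one common path to \<open>y\<close>. If neither exists,
  \<open>spans_contract\<close> makes every vertex but \<open>s\<close> adjacent to
  \<open>x\<close>, and two neighbours of \<open>s\<close> then yield a four-cycle after
  all.\<close>

lemma spans_degree_three:
  assumes d3: "d = 3"
  shows "spans (path_lengths E I x y) 1"
proof -
  have spans_triangle_at_root: ?thesis if t: "b \<in> I" "u \<in> I" "E x b" "E x u" "E b u" for b u
  proof -
    define W where "W = I - {b, u}"
    define Z where "Z = reach E W y"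
    have bu: "b \<noteq> u" "b \<noteq> x" "u \<noteq> x" "b \<noteq> y" "u \<noteq> y" using t irr xI yI by auto
    have Zs: "Z \<subseteq> insert y W" using reach_sub[of E W y] by (simp add: Z_def)
    have "\<exists>z\<in>Z. E z b \<or> E z u"
    proof (rule ccontr)
      assume c: "\<not> ?thesis"
      have "nb (I - Z) \<subseteq> {x}"
      proof
        fix w assume "w \<in> nb (I - Z)"
        then obtain f where w: "w \<in> insert x (insert y I)" "w \<notin> I - Z" "f \<in> I" "f \<notin> Z" "E f w" by (auto simp: nbhd_def)
        show "w \<in> {x}"
        proof (rule ccontr)
          assume "w \<notin> {x}"
          then have wZ: "w \<in> Z" using w by (auto simp: Z_def)
          then have "f \<notin> W" using reach_step[of w E W y f] w sym[of f w] by (auto simp: Z_def)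
          then show False using c wZ w sym[of f w] by (auto simp: W_def)
        qed
      qed
      moreover have "I - Z \<noteq> {}" using t Zs bu by (auto simp: W_def)
      ultimately show False using no_one_cut[of "I - Z" x] by blast
    qed
    then obtain z q q' where z: "z \<in> Z" "E z q" "{q, q'} = {b, u}" by blast
    have qq: "q \<in> I" "q' \<in> I" "q \<noteq> q'" "E x q" "E x q'" "E q' q" "q \<noteq> y" "q' \<noteq> y" "q \<noteq> x" "q' \<noteq> x" "q \<notin> W" "q' \<notin> W"
      using z(3) t bu sym[of b u] by (auto simp: doubleton_eq_iff W_def)
    obtain m where "m \<in> path_lengths E W y q" using reach_path_lengths[of z E W y q W] z qq by (auto simp: Z_def)
    then have m: "m \<in> path_lengths E W q y" using path_lengths_commute by simp
    have "1 + m \<in> path_lengths E I x y"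
      by (rule path_lengths_concat[OF path_lengths_edge[OF qq(4), of "{}"] m]) (use qq xI xy in \<open>auto simp: W_def\<close>)
    moreover have "2 + m \<in> path_lengths E I x y"
      by (rule path_lengths_concat[OF path_lengths_two[of x q' q "{q'}"] m]) (use qq xI xy in \<open>auto simp: W_def\<close>)
    ultimately show ?thesis by (intro spans_pair1[of "1 + m"]) auto
  qed
  have c4: ?thesis if t: "a \<in> I" "a' \<in> I" "b \<in> I" "a \<noteq> a'" "E x a" "E x a'" "E b a" "E b a'" for a a' b
  proof -
    define W where "W = I - {a, a', b}"
    define Z where "Z = reach E W y"
    have bu: "b \<noteq> a" "b \<noteq> a'" "a \<noteq> x" "a' \<noteq> x" "b \<noteq> x" "b \<noteq> y" "a \<noteq> y" "a' \<noteq> y" using t irr xI yI by auto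
    have Zs: "Z \<subseteq> insert y W" using reach_sub[of E W y] by (simp add: Z_def)
    have "\<exists>z\<in>Z. E z a \<or> E z a'"
    proof (rule ccontr)
      assume c: "\<not> ?thesis"
      let ?F = "I - {b} - Z"
      have "nb ?F \<subseteq> {x, b}"
      proof
        fix w assume "w \<in> nb ?F"
        then obtain f where w: "w \<in> insert x (insert y I)" "w \<notin> ?F" "f \<in> I" "f \<noteq> b" "f \<notin> Z" "E f w" by (auto simp: nbhd_def)
        show "w \<in> {x, b}"
        proof (rule ccontr)
          assume "w \<notin> {x, b}"
          then have wZ: "w \<in> Z" using w by (auto simp: Z_def)
          then have "f \<notin> W" using reach_step[of w E W y f] w sym[of f w] by (auto simp: Z_def)
          then show False using c wZ w sym[of f w] by (auto simp: W_def)
        qed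
      qed
      moreover have "?F \<subset> I" using t by auto
      moreover have "a \<in> ?F" "a' \<in> ?F" using t Zs bu by (auto simp: W_def)
      then have "\<not> ?F \<subseteq> {s}" using t(4) by blast
      ultimately show False using no_two_cut by blast
    qed
    then obtain z q q' where z: "z \<in> Z" "E z q" "{q, q'} = {a, a'}" by blast
    have qq: "q \<in> I" "q' \<in> I" "q \<noteq> q'" "E x q" "E x q'" "E b q" "E q' b" "q \<noteq> y" "q' \<noteq> y" "q \<noteq> x" "q' \<noteq> x" "q \<notin> W" "q' \<notin> W" "b \<noteq> q" "b \<noteq> q'"
      using z(3) t bu sym[of b] by (auto simp: doubleton_eq_iff W_def)
    obtain m where "m \<in> path_lengths E W y q" using reach_path_lengths[of z E W y q W] z qq by (auto simp: Z_def)
    then have m: "m \<in> path_lengths E W q y" using path_lengths_commute by simp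
    have "1 + m \<in> path_lengths E I x y"
      by (rule path_lengths_concat[OF path_lengths_edge[OF qq(4), of "{}"] m]) (use qq xI xy in \<open>auto simp: W_def\<close>)
    moreover have "3 + m \<in> path_lengths E I x y"
      by (rule path_lengths_concat[OF path_lengths_three[of x q' b q "{q', b}"] m]) (use qq xI xy yI bu t in \<open>auto simp: W_def\<close>)
    ultimately have "spans (path_lengths E I x y) 2" by (intro spans_pair2[of "1 + m"]) (auto simp: numeral_3_eq_3)
    then show ?thesis by (rule spans_mono) auto
  qed
  show ?thesis
  proof (rule ccontr)
    assume n: "\<not> ?thesis"
    have one: "card {a \<in> I. E x a \<and> E w a} \<le> 1" if "w \<in> I" for w
    proof (rule ccontr)
      assume "\<not> ?thesis"
      then have "2 \<le> card {a \<in> I. E x a \<and> E w a}" by simp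
      from card_ge2E[OF this] obtain p q where "p \<in> {a \<in> I. E x a \<and> E w a}" "q \<in> {a \<in> I. E x a \<and> E w a}" "p \<noteq> q" .
      then show False using c4[of p q w] that n by auto
    qed
    have all: "E x v" if "v \<in> I" "v \<noteq> s" for v
      using spans_contract[of v] one that n d3 by auto
    obtain a where a: "a \<in> I" "a \<noteq> s" using nons by auto
    have sub: "w \<in> {x, y, s}" if "w \<in> insert x (insert y I)" "E a w" for w
      using that all[of w] spans_triangle_at_root[of a w] all[OF a] a n by auto
    have "{w\<in>insert x (insert y I). E a w} \<subseteq> {x, y, s}" using sub by auto
    moreover have "3 \<le> card {w\<in>insert x (insert y I). E a w}" using deg[OF a] d3 by (simp add: degree_in_def)
    moreover have "card {x, y, s} \<le> 3" by (simp add: card_insert_if)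
    ultimately have eq: "{w\<in>insert x (insert y I). E a w} = {x, y, s}" by (intro card_seteq) auto
    have as: "E a s" using eq by blast
    have sI: "s \<in> I"
    proof (rule ccontr)
      assume "s \<notin> I"
      then have "{w\<in>insert x (insert y I). E a w} \<subseteq> {x, y}" using sub by auto
      then show False using \<open>3 \<le> card {w\<in>insert x (insert y I). E a w}\<close> card_le2I by fastforce
    qed
    obtain p q where pq: "p \<in> {w\<in>I. E s w}" "q \<in> {w\<in>I. E s w}" "p \<noteq> q" using card_ge2E[OF sdeg[OF sI]] .
    have "p \<noteq> s" "q \<noteq> s" using pq irr by auto
    then have "E x p" "E x q" using all pq by auto
    then show False using c4[of p q s] pq sI n by auto
  qed
qed

text \<open>When neither a triangle nor a contraction at \<open>x\<close> is available, some
  \<open>b\<close> shares two neighbours with \<open>x\<close>, which is the four-cycle required. A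
  non-neighbour of \<open>x\<close> to start the contraction exists, because a vertex with
  neighbours among \<open>x\<close>, \<open>y\<close>, \<open>s\<close> only would have degree at
  most 3.\<close>

lemma spans_weak_rooted_min: assumes "3 \<le> d" shows "spans (path_lengths E I x y) (d - 2)"
proof (cases "d = 3")
  case True then show ?thesis using spans_degree_three by simp
next
  case False
  then have d4: "4 \<le> d" using assms by simp
  interpret w: weak_rooted_min E I y x s d by (rule swap_weak)
  show ?thesis
  proof (rule ccontr)
    assume n: "\<not> ?thesis"
    have ind: "\<not> E u v" if "u \<in> I" "v \<in> I" "E x u" "E x v" for u v
      using spans_triangle_at_root[OF d4 that(1,3,2,4)] n by auto
    have indy: "\<not> E u v" if "u \<in> I" "v \<in> I" "E y u" "E y v" for u v
      using w.spans_triangle_at_root[OF d4 that(1,3,2,4)] n path_lengths_commute[of I x y] by auto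
    have "\<exists>v\<in>I. v \<noteq> s \<and> \<not> E x v"
    proof (rule ccontr)
      assume c: "\<not> ?thesis"
      obtain a where a: "a \<in> I" "a \<noteq> s" using nons by auto
      have "w \<in> {x, y, s}" if "w \<in> insert x (insert y I)" "E a w" for w
        using that c ind[of a w] a by auto
      then have "d \<le> card {x, y, s}" by (intro degree_le_card[OF a]) auto
      also have "\<dots> \<le> 3" by (simp add: card_insert_if)
      finally show False using d4 by simp
    qed
    then obtain v where v: "v \<in> I" "v \<noteq> s" "\<not> E x v" by auto
    have "\<exists>w\<in>I. \<not> E x w \<and> 2 \<le> card {a\<in>I. E x a \<and> E w a}"
    proof (rule ccontr)
      assume "\<not> ?thesis"
      then have "\<And>w. w \<in> I \<Longrightarrow> \<not> E x w \<Longrightarrow> card {a\<in>I. E x a \<and> E w a} \<le> 1" by force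
      then show False using spans_contract[of v] v n by blast
    qed
    then obtain b where b: "b \<in> I" "2 \<le> card {a\<in>I. E x a \<and> E b a}" by auto
    from card_ge2E[OF b(2)] obtain a a' where "a \<in> {a\<in>I. E x a \<and> E b a}" "a' \<in> {a\<in>I. E x a \<and> E b a}" "a \<noteq> a'" .
    then have ab: "a \<in> I" "a' \<in> I" "b \<in> I" "a \<noteq> a'" "E x a" "E x a'" "E b a" "E b a'" using b by auto
    show False using spans_square[OF d4 ind ab] spans_square_blocked[OF d4 ind indy ab] n by blast
  qed
qed

end

text \<open>Induction on the number of inner vertices. An exceptional vertex with too few neighbours
  is deleted, and the neighbour \<open>c\<close> that loses a degree becomes exceptional. A part
  behind a two-vertex cut is a smaller rooted graph by itself. What survives is a
  \<open>weak_rooted_min\<close>.\<close>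

theorem weak_rooted_spans:
  fixes E :: "'a \<Rightarrow> 'a \<Rightarrow> bool"
  shows "weak_rooted d E I x y s \<Longrightarrow> spans (path_lengths E I x y) (d - 2)"
proof (induction "card I" arbitrary: d E I x y s rule: less_induct)
  case less
  note W = less.prems
  interpret two_rooted E I x y using W by (simp add: weak_rooted_def)
  have deg: "\<And>v. v \<in> I \<Longrightarrow> v \<noteq> s \<Longrightarrow> d \<le> degree_in E (insert x (insert y I)) v"
    and cut: "\<And>F. F \<subseteq> I \<Longrightarrow> \<not> F \<subseteq> {s} \<Longrightarrow> 2 \<le> card (nb F)"
    and nons: "\<exists>v\<in>I. v \<noteq> s"
    and star: "\<And>c. 3 \<le> d \<Longrightarrow> I = {s, c} \<Longrightarrow> c \<noteq> s \<Longrightarrow> 2 \<le> card (nb {s})"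
    using W by (auto simp: weak_rooted_def)
  have IH: "spans (path_lengths E' I' x' y') (d' - 2)" if "card I' < card I" "weak_rooted d' E' I' x' y' s'" for d' and E' :: "'a \<Rightarrow> 'a \<Rightarrow> bool" and I' x' y' s'
    by (rule less.hyps[OF that])
  have card_psubset_I: "F \<subset> I \<Longrightarrow> card F < card I" for F using fin by (simp add: psubset_card_mono)
  have Ids: "insert x (insert y (I - {s})) = insert x (insert y I) - {s}" if "s \<in> I" using that xI yI by auto
  have del: "nbhd E (insert x (insert y (I - {s}))) F = nb F - {s}" if "s \<in> I" for F
    unfolding Ids[OF that] by (auto simp: nbhd_def)
  have rgs: "two_rooted E (I - {s}) x y" by unfold_locales (use fin xI yI xy irr in \<open>auto intro: sym\<close>)
  have sub: "spans (path_lengths E I x y) m" if "spans (path_lengths E (I - {s}) x y) m" for m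
    using spans_mono[OF that path_lengths_mono[of "I - {s}" I]] by auto
  consider "d \<le> 2" | "3 \<le> d" "s \<in> I" "card (nb {s}) \<le> 1" | "3 \<le> d" "s \<in> I \<Longrightarrow> 2 \<le> card (nb {s})" by fastforce
  then show ?case
  proof cases
    case 1
    \<comment> \<open>For \<open>d \<le> 2\<close> the span is 0, so one path through the component
      of \<open>v\<close> is enough.\<close>
    obtain v where v: "v \<in> I" "v \<noteq> s" using nons by auto
    let ?Z = "reach E I v"
    have Z: "?Z \<subseteq> I" using reach_sub[of E I v] v by auto
    have nbZ: "nb ?Z \<subseteq> {x, y}" using reach_step[of _ E I v] by (auto simp: nbhd_def)
    have "v \<in> ?Z" by simp
    then have "2 \<le> card (nb ?Z)" using cut[OF Z] v by blast
    from card_ge2E[OF this] obtain p q where "p \<in> nb ?Z" "q \<in> nb ?Z" "p \<noteq> q" .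
    then have "x \<in> nb ?Z" "y \<in> nb ?Z" using nbZ by auto
    then obtain z1 z2 where z: "z1 \<in> ?Z" "E z1 x" "z2 \<in> ?Z" "E z2 y" by (auto simp: nbhd_def)
    have "?Z \<subseteq> reach E I x"
    proof (rule ccontr)
      assume c: "\<not> ?thesis"
      let ?F = "?Z \<inter> reach E I x"
      have "z1 \<in> ?F" using z Z reach_step[of x E I x z1] sym[OF z(2)] by auto
      then obtain f u where fu: "f \<in> ?F" "u \<in> ?Z - ?F" "E f u" using reach_crossing2[of E ?F I v] sym c v by blast
      then have "u \<in> reach E I x" using reach_step[of f E I x u] Z by blast
      then show False using fu by blast
    qed
    then have "z2 \<in> reach E I x" using z by auto
    from reach_path_lengths[OF this z(4), of I] obtain m where "m \<in> path_lengths E I x y" using yI xy by auto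
    then show ?thesis using spans_0 1 by (metis diff_is_0_eq)
  next
    case 2
    then obtain c where c: "nb {s} \<subseteq> {c}"
    proof (cases "nb {s} = {}")
      case False
      then obtain c where c0: "c \<in> nb {s}" by auto
      have "w = c" if "w \<in> nb {s}" for w using card_ge2I[OF that c0 _ finite_nb] 2 by auto
      then show ?thesis using that by blast
    qed (use that in auto)
    have ns: "\<not> E v s" "\<not> E s v" if "v \<in> insert x (insert y I)" "v \<noteq> c" for v
    proof -
      have "v \<notin> nb {s}" using that c by auto
      then show "\<not> E s v" using that irr by (auto simp: nbhd_def)
      then show "\<not> E v s" using sym by blast
    qed
    have cut': "2 \<le> card (nb F - {s})" if F: "F \<subseteq> I - {s}" "F \<noteq> {}" for F
    proof (cases "s \<in> nb F")
      case False
      have "2 \<le> card (nb F)" by (rule cut) (use F in auto)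
      then show ?thesis using False by simp
    next
      case True
      then obtain f where f: "f \<in> F" "E f s" by (auto simp: nbhd_def)
      then have tf_three_cut: "f = c" using ns[of f] F by auto
      have "nb (insert s F) \<subseteq> nb F - {s}"
        using ns f tf_three_cut by (auto simp: nbhd_def)
      moreover have "2 \<le> card (nb (insert s F))" by (rule cut) (use F 2 in auto)
      ultimately show ?thesis using card_mono[of "nb F - {s}" "nb (insert s F)"] finite_nb by auto
    qed
    have "weak_rooted d E (I - {s}) x y c" unfolding weak_rooted_def
    proof (intro conjI allI impI ballI)
      show "two_rooted E (I - {s}) x y" by (rule rgs)
      show "\<exists>v\<in>I - {s}. v \<noteq> c"
      proof (rule ccontr)
        assume n: "\<not> ?thesis"
        \<comment> \<open>The shape ruled out by the last clause of
          \<open>weak_rooted\<close>.\<close>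
        then have "I = {s, c}" "c \<noteq> s" using nons 2 by auto
        then show False using star 2 by fastforce
      qed
    next
      fix v assume v: "v \<in> I - {s}" "v \<noteq> c"
      have "{w\<in>insert x (insert y I). E v w} = {w\<in>insert x (insert y (I - {s})). E v w}"
        unfolding Ids[OF 2(2)] using ns[of v] v by auto
      then show "d \<le> degree_in E (insert x (insert y (I - {s}))) v" using deg[of v] v by (simp add: degree_in_def)
    next
      fix F assume "F \<subseteq> I - {s}" "\<not> F \<subseteq> {c}"
      then show "2 \<le> card (nbhd E (insert x (insert y (I - {s}))) F)" unfolding del[OF 2(2)] by (intro cut') auto
    next
      fix c1 assume "I - {s} = {c, c1}"
      then show "2 \<le> card (nbhd E (insert x (insert y (I - {s}))) {c})" unfolding del[OF 2(2)] by (intro cut') auto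
    qed
    from IH[OF card_psubset_I this] show ?thesis using sub 2 by blast
  next
    case 3
    have cut2: "2 \<le> card (nb F)" if F: "F \<subseteq> I" "F \<noteq> {}" for F
    proof (cases "F \<subseteq> {s}")
      case True
      then have "F = {s}" "s \<in> I" using F by auto
      then show ?thesis using 3 by auto
    qed (use cut F in auto)
    interpret two_rooted_conn E I x y by unfold_locales (rule cut2)
    show ?thesis
    proof (cases "\<exists>F. F \<subset> I \<and> \<not> F \<subseteq> {s} \<and> \<not> 3 \<le> card (nb F)")
      case True
      then obtain F where F: "F \<subset> I" "\<not> F \<subseteq> {s}" "\<not> 3 \<le> card (nb F)" by auto
      have FI: "F \<subseteq> I" "F \<noteq> {}" using F by auto
      have "card (nb F) = 2" using cut2[OF FI] F by simp
      then obtain c c' where c: "nb F = {c, c'}" "c \<noteq> c'" by (auto simp: card_2_iff)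
      have cF: "c \<notin> F" "c' \<notin> F" using c by (auto simp: nbhd_def)
      have nbin: "w \<in> insert c (insert c' F)" if "w \<in> insert x (insert y I)" "f \<in> F" "E f w" for w f
      proof (cases "w \<in> F")
        case False
        then have "w \<in> nb F" using that by (auto simp: nbhd_def)
        then show ?thesis using c by auto
      qed auto
      have c_in_V: "c \<in> insert x (insert y I)" "c' \<in> insert x (insert y I)" using c by (auto simp: nbhd_def)
      have nbeq: "nbhd E (insert c (insert c' F)) F' = nb F'" if "F' \<subseteq> F" for F'
      proof
        show "nb F' \<subseteq> nbhd E (insert c (insert c' F)) F'"
        proof
          fix w assume "w \<in> nb F'"
          then obtain f where w: "w \<in> insert x (insert y I)" "w \<notin> F'" "f \<in> F'" "E f w" by (auto simp: nbhd_def)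
          then have "w \<in> insert c (insert c' F)" using nbin[of w f] that by blast
          then show "w \<in> nbhd E (insert c (insert c' F)) F'" using w by (auto simp: nbhd_def)
        qed
        have "insert c (insert c' F) \<subseteq> insert x (insert y I)" using c_in_V FI(1) by blast
        then show "nbhd E (insert c (insert c' F)) F' \<subseteq> nb F'" unfolding nbhd_def by blast
      qed
      have VF: "insert c (insert c' F) \<subseteq> insert x (insert y I)" using c_in_V FI(1) by blast
      have fF: "finite F" using FI(1) fin finite_subset by auto
      have "weak_rooted d E F c c' s" unfolding weak_rooted_def
      proof (intro conjI allI impI ballI)
        show "two_rooted E F c c'" by unfold_locales (use fF cF c(2) irr in \<open>auto intro: sym\<close>)
      next
        fix v assume v: "v \<in> F" "v \<noteq> s"
        have "(w \<in> insert x (insert y I) \<and> E v w) = (w \<in> insert c (insert c' F) \<and> E v w)" for w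
          using nbin[of w v, OF _ v(1)] subsetD[OF VF, of w] by blast
        then have "{w\<in>insert x (insert y I). E v w} = {w\<in>insert c (insert c' F). E v w}" by (rule Collect_cong)
        moreover have "v \<in> I" using v FI by blast
        ultimately show "d \<le> degree_in E (insert c (insert c' F)) v" using deg[of v] v(2) unfolding degree_in_def by simp
      next
        fix F' assume F': "F' \<subseteq> F" "\<not> F' \<subseteq> {s}"
        have "2 \<le> card (nb F')" by (rule cut2) (use F' FI in auto)
        then show "2 \<le> card (nbhd E (insert c (insert c' F)) F')" using nbeq[OF F'(1)] by simp
      next
        show "\<exists>v\<in>F. v \<noteq> s" using F by auto
      next
        fix c1 assume c1: "F = {s, c1}"
        have "2 \<le> card (nb {s})" by (rule cut2) (use c1 FI in auto)
        then show "2 \<le> card (nbhd E (insert c (insert c' F)) {s})" using nbeq[of "{s}"] c1 by simp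
      qed
      from IH[OF card_psubset_I[OF F(1)] this] have q: "spans (path_lengths E F c c') (d - 2)" .
      from two_cut_shift[OF FI c] show ?thesis using spans_shift[OF q] by blast
    next
      case False
      then have cut3: "\<And>F. F \<subset> I \<Longrightarrow> \<not> F \<subseteq> {s} \<Longrightarrow> 3 \<le> card (nb F)" by auto
      show ?thesis
      proof (cases "s \<in> I \<and> \<not> 2 \<le> card {w\<in>I. E s w}")
        case False
        interpret weak_rooted_min E I x y s d
          by unfold_locales (use deg cut3 False nons IH in auto)
        show ?thesis by (rule spans_weak_rooted_min[OF 3(1)])
      next
        case True
        then have sI: "s \<in> I" by auto
        obtain c where c: "{w\<in>I. E s w} \<subseteq> {c}"
        proof (cases "{w\<in>I. E s w} = {}")
          case False
          then obtain c where c0: "c \<in> {w\<in>I. E s w}" by auto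
          have "w = c" if "w \<in> {w\<in>I. E s w}" for w using card_ge2I[OF that c0] fin True by auto
          then show ?thesis using that by blast
        qed (use that in auto)
        have ns: "\<not> E v s" "\<not> E s v" if "v \<in> I" "v \<noteq> c" for v using c that sym[of v s] by auto
        show ?thesis
        proof (cases "\<exists>v\<in>I - {s}. v \<noteq> c")
          case ex: True
          have cut': "2 \<le> card (nb F - {s})" if F: "F \<subseteq> I - {s}" "F \<noteq> {}" for F
            by (rule card_diff1_ge2[OF cut3]) (use F sI in auto)
          have "weak_rooted d E (I - {s}) x y c" unfolding weak_rooted_def
          proof (intro conjI allI impI ballI)
            show "two_rooted E (I - {s}) x y" by (rule rgs)
          next
            fix v assume v: "v \<in> I - {s}" "v \<noteq> c"
            have "{w\<in>insert x (insert y I). E v w} = {w\<in>insert x (insert y (I - {s})). E v w}"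
              unfolding Ids[OF sI] using ns[of v] v by auto
            then show "d \<le> degree_in E (insert x (insert y (I - {s}))) v" using deg[of v] v by (simp add: degree_in_def)
          next
            fix F assume "F \<subseteq> I - {s}" "\<not> F \<subseteq> {c}"
            then show "2 \<le> card (nbhd E (insert x (insert y (I - {s}))) F)" unfolding del[OF sI] by (intro cut') auto
          next
            fix c1 assume "I - {s} = {c, c1}"
            then show "2 \<le> card (nbhd E (insert x (insert y (I - {s}))) {c})" unfolding del[OF sI] by (intro cut') auto
          qed (use ex in auto)
          from IH[OF card_psubset_I this] show ?thesis using sub sI by blast
        next
          case nex: False
          obtain v0 where v0: "v0 \<in> I" "v0 \<noteq> s" using nons by auto
          then have vc: "v0 = c" using nex by auto
          then have I2: "c \<noteq> s" using v0 by auto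
          \<comment> \<open>With only two inner vertices \<open>d = 3\<close>; the path
            \<open>x c y\<close> and a path over both \<open>s\<close> and \<open>c\<close> have the
            lengths 2 and 3.\<close>
          have I1: "I = {s, c}"
          proof
            show "I \<subseteq> {s, c}" using nex by blast
            show "{s, c} \<subseteq> I" using v0 vc sI by blast
          qed
          have cI: "c \<in> I" "c \<noteq> x" "c \<noteq> y" "s \<noteq> x" "s \<noteq> y" using I1 v0(1) vc xI yI sI by blast+
          have sb: "{w\<in>insert x (insert y I). E c w} \<subseteq> {x, y, s}" unfolding I1 using irr[of c] by auto
          have dc: "d \<le> card {w\<in>insert x (insert y I). E c w}" using deg[OF cI(1) I2] by (simp add: degree_in_def)
          moreover have "card {x, y, s} \<le> 3" by (simp add: card_insert_if)
          ultimately have eq: "{w\<in>insert x (insert y I). E c w} = {x, y, s}" and dd: "d = 3"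
            using card_seteq[OF _ sb] 3 card_mono[OF _ sb] by auto
          have e: "E c x" "E c y" "E c s" using eq by blast+
          then have e': "E x c" "E y c" "E s c" using sym by blast+
          from 3(2)[OF sI] obtain p q where pq: "p \<in> nb {s}" "q \<in> nb {s}" "p \<noteq> q" using card_ge2E by blast
          then obtain w where w: "w \<in> nb {s}" "w \<noteq> c" by blast
          then have w: "w \<in> {x, y}" "E s w" unfolding I1 by (auto simp: nbhd_def)
          have "2 \<in> path_lengths E I x y" by (rule path_lengths_two[of x c]) (use e e' cI xy in auto)
          moreover have "3 \<in> path_lengths E I x y"
          proof (cases "w = x")
            case True
            show ?thesis by (rule path_lengths_three[of x s c]) (use True w e e' cI xy sI sym in auto)
          next
            case False
            show ?thesis by (rule path_lengths_three[of x c s]) (use False w e e' cI xy sI sym in auto)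
          qed
          ultimately have "spans (path_lengths E I x y) 1" by (intro spans_pair1[of 2]) auto
          then show ?thesis using dd by simp
        qed
      qed
    qed
  qed
qed

section \<open>Triangle-free two-rooted graphs\<close>

text \<open>Triangles through the roots are allowed, because contraction into a root creates them;
  only \<open>I\<close> has to be triangle-free.\<close>

definition tf_rooted :: "nat \<Rightarrow> ('a \<Rightarrow> 'a \<Rightarrow> bool) \<Rightarrow> 'a set \<Rightarrow> 'a \<Rightarrow> 'a \<Rightarrow> bool" where
  "tf_rooted d E I x y \<longleftrightarrow> two_rooted_conn E I x y \<and> I \<noteq> {} \<and> (\<forall>v\<in>I. d \<le> degree_in E (insert x (insert y I)) v)
    \<and> (\<forall>u\<in>I. \<forall>v\<in>I. \<forall>w\<in>I. E u v \<longrightarrow> E v w \<longrightarrow> \<not> E u w)"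

text \<open>An exceptional vertex outside \<open>I\<close> means that there is no exception, and it
  makes the results on \<open>weak_rooted_min\<close> available. \<open>IH1\<close> is the induction
  hypothesis for the stronger bound.\<close>

locale tf_rooted_min = weak_rooted_min E I x y s d for E :: "'a \<Rightarrow> 'a \<Rightarrow> bool" and I x y s d +
  assumes sI: "s \<notin> I" and d5: "5 \<le> d"
    and tf: "\<And>u v w. u \<in> I \<Longrightarrow> v \<in> I \<Longrightarrow> w \<in> I \<Longrightarrow> E u v \<Longrightarrow> E v w \<Longrightarrow> \<not> E u w"
    and IH1: "\<And>(E' :: 'a \<Rightarrow> 'a \<Rightarrow> bool) I' x' y'. card I' < card I \<Longrightarrow> tf_rooted d E' I' x' y' \<Longrightarrow> spans (path_lengths E' I' x' y') (d - 1)"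
begin

section \<open>Triangle-free case: cuts of three vertices and good four-cycles\<close>

lemma swap_tf: "tf_rooted_min E I y x s d"
proof -
  interpret w: weak_rooted_min E I y x s d by (rule swap_weak)
  show ?thesis
  proof unfold_locales
    show "s \<notin> I" by (rule sI)
    show "5 \<le> d" by (rule d5)
    show "\<not> E u w" if "u \<in> I" "v \<in> I" "w \<in> I" "E u v" "E v w" for u v w by (rule tf[OF that])
    show "spans (path_lengths E' I' x' y') (d - 1)" if "card I' < card I" "tf_rooted d E' I' x' y'"
      for E' :: "'a \<Rightarrow> 'a \<Rightarrow> bool" and I' x' y' by (rule IH1[OF that])
  qed
qed

lemma not_subset_exceptional: "F \<subseteq> I \<Longrightarrow> F \<noteq> {} \<Longrightarrow> \<not> F \<subseteq> {s}" using sI by auto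

lemma degree_le_card_tf: "v \<in> I \<Longrightarrow> (\<And>w. w \<in> insert x (insert y I) \<Longrightarrow> E v w \<Longrightarrow> w \<in> S) \<Longrightarrow> finite S \<Longrightarrow> d \<le> card S"
  using degree_le_card[of v S] sI by auto

lemma degree_not_le_four:
  assumes "v \<in> I" and S: "\<forall>w\<in>insert x (insert y I). E v w \<longrightarrow> w \<in> {p, q, r, t}" shows False
proof -
  have "d \<le> card {p, q, r, t}" by (rule degree_le_card_tf[OF assms(1)]) (use S in blast, simp)
  also have "\<dots> \<le> 4" by (simp add: card_insert_if)
  finally show False using d5 by simp
qed

lemma tf_contract:
  assumes "\<And>w. w \<in> I \<Longrightarrow> \<not> E x w \<Longrightarrow> card {a\<in>I. E x a \<and> E w a} \<le> 1" "v \<in> I" "\<not> E x v"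
  shows "spans (path_lengths E I x y) (d - 1)"
proof -
  have "v \<noteq> s" using assms sI by auto
  from contract_root[OF assms this] obtain E' I' y' k where c: "two_rooted_conn E' I' x y'" "I' \<subset> I"
    "\<And>u w. u \<in> I' \<Longrightarrow> w \<in> I' \<Longrightarrow> E' u w = E u w"
    "\<And>v. v \<in> I' \<Longrightarrow> degree_in E (insert x (insert y I)) v \<le> degree_in E' (insert x (insert y' I')) v"
    "\<exists>v\<in>I'. v \<noteq> s" "\<And>n. n \<in> path_lengths E' I' x y' \<Longrightarrow> n + k \<in> path_lengths E I x y" by metis
  have "tf_rooted d E' I' x y'" unfolding tf_rooted_def
  proof (intro conjI ballI impI)
    fix v assume v: "v \<in> I'"
    then have "v \<in> I" "v \<noteq> s" using c(2) sI by auto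
    then show "d \<le> degree_in E' (insert x (insert y' I')) v" using deg[of v] c(4)[OF v] by linarith
  next
    fix u v w assume a: "u \<in> I'" "v \<in> I'" "w \<in> I'" "E' u v" "E' v w"
    then have "u \<in> I" "v \<in> I" "w \<in> I" using c(2) by auto
    then show "\<not> E' u w" using a c(3) tf[of u v w] by simp
  qed (use c in auto)
  from IH1[OF card_psubset_I[OF c(2)] this] show ?thesis using spans_shift c(6) by blast
qed

text \<open>The cut yields a span of \<open>d - 3\<close> on each side or allows contraction at
  \<open>y\<close>, and \<open>d - 3 + (d - 3)\<close> is at least \<open>d - 1\<close> because
  \<open>d \<ge> 5\<close>. Three-vertex cuts with a nontrivial other side are thereby disposed of
  for the rest of the section.\<close>

lemma tf_three_cut:
  assumes F: "F \<subseteq> I" "F \<noteq> {}" "nb F \<subseteq> {x, b, g}" and b: "b \<in> I" "b \<notin> F"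
    and g: "g \<in> insert y I" "g \<notin> F" "g \<noteq> b" and rest: "I - F - {b, g} \<noteq> {}"
  shows "spans (path_lengths E I x y) (d - 1)"
proof -
  have FI: "F \<subset> I" "\<not> F \<subseteq> {s}" using F b not_subset_exceptional by auto
  have bx: "b \<noteq> x" "b \<noteq> y" using b xI yI by auto
  have d4: "4 \<le> d" using d5 by simp
  have fin: ?thesis if "spans (path_lengths E I x y) (d - 3 + (d - 3))" using spans_mono[OF that subset_refl, of "d - 1"] d5 by simp
  show ?thesis
  proof (cases "g = y")
    case True
    have q1: "spans (path_lengths E F b y) (d - 3)"
      by (rule spans_three_neighbours[OF FI, of b y x]) (use F b bx yI xI True in auto)
    define G2 where "G2 = I - F - {b}"
    have nb2: "nb G2 \<subseteq> {x, b, y}"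
    proof
      fix w assume "w \<in> nb G2"
      then obtain h where w: "w \<in> insert x (insert y I)" "w \<notin> G2" "h \<in> G2" "E h w" by (auto simp: nbhd_def)
      show "w \<in> {x, b, y}"
      proof (rule ccontr)
        assume "w \<notin> {x, b, y}"
        then have "w \<in> F" using w by (auto simp: G2_def)
        then have "h \<in> nb F" using w sym[of h w] by (auto simp: nbhd_def G2_def)
        then show False using F(3) w xI yI True by (auto simp: G2_def)
      qed
    qed
    have "G2 \<noteq> {}" using rest by (auto simp: G2_def)
    then have G2: "G2 \<subset> I" "\<not> G2 \<subseteq> {s}" using b not_subset_exceptional[of G2] by (auto simp: G2_def)
    have q2: "spans (path_lengths E G2 x b) (d - 3)"
      by (rule spans_three_neighbours[OF G2 nb2]) (use b bx xI yI in \<open>auto simp: G2_def\<close>)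
    have "spans (path_lengths E I x y) (d - 3 + (d - 3))"
      by (rule spans_concat[OF q2 q1]) (use F b xI yI xy in \<open>auto simp: G2_def\<close>)
    then show ?thesis by (rule fin)
  next
    case False
    then have gI: "g \<in> I" using g by auto
    let ?A = "(\<forall>w\<in>I. \<not> E y w \<longrightarrow> card {a \<in> I. E y a \<and> E w a} \<le> 1) \<and> (\<exists>v\<in>I. \<not> E y v \<and> v \<noteq> s)"
    have "spans (path_lengths E I x y) (d - 3 + (d - 3)) \<or> ?A"
      by (rule spans_both_sides[OF d4 FI disjI2[OF sI] F(3) b gI g(2) g(3)[symmetric] _ rest]) (use F(1) sI in blast)
    then show ?thesis
    proof (elim disjE)
      interpret w: tf_rooted_min E I y x s d by (rule swap_tf)
      assume ?A
      then show ?thesis using w.tf_contract path_lengths_commute[of I x y] by metis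
    qed (rule fin)
  qed
qed

text \<open>A four-cycle through \<open>x\<close> with opposite vertex \<open>b\<close>, for which deleting \<open>b\<close> and merging \<open>a\<close>, \<open>a'\<close> into the root
  costs at most one in the degree of all vertices except \<open>u\<close>.\<close>
definition "good_square a a' b \<longleftrightarrow> a \<in> I \<and> a' \<in> I \<and> b \<in> I \<and> a \<noteq> a' \<and> E x a \<and> E x a' \<and> E b a \<and> E b a'
  \<and> (\<forall>w\<in>I. E x w \<longrightarrow> E b w \<longrightarrow> w = a \<or> w = a') \<and> (\<exists>u. \<forall>w\<in>I. E x w \<longrightarrow> E w a \<longrightarrow> E w a' \<longrightarrow> w = u \<or> w = b)"

lemma good_squareD:
  assumes "good_square a a' b"
  shows "a \<in> I" "a' \<in> I" "b \<in> I" "a \<noteq> a'" "E x a" "E x a'" "E b a" "E b a'" "b \<noteq> a" "b \<noteq> a'" "\<not> E a a'"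
    "x \<noteq> a" "x \<noteq> a'" "x \<noteq> b" "y \<noteq> a" "y \<noteq> a'" "y \<noteq> b"
  using assms irr xI yI tf[of b a a'] by (auto simp: good_square_def)

text \<open>The merge now costs only one: a vertex of \<open>Y\<close> seeing \<open>b\<close> sees
  none of \<open>x\<close>, \<open>a\<close>, \<open>a'\<close>, and every other vertex except
  \<open>u\<close> misses one of these three. As \<open>u\<close> takes the place of the exceptional
  vertex, the weaker statement is applied, with \<open>d - 1\<close>, and the four-cycle adds
  two.\<close>

lemma tf_square:
  assumes su: "good_square a a' b" and ne: "reach E (I - {a, a', b}) y - {y} \<noteq> {}"
  shows "spans (path_lengths E I x y) (d - 1)"
proof (rule ccontr)
  assume n: "\<not> ?thesis"
  note ab = good_squareD[OF su]
  obtain u where u: "\<And>w. w \<in> I \<Longrightarrow> E x w \<Longrightarrow> E w a \<Longrightarrow> E w a' \<Longrightarrow> w = u \<or> w = b" using su by (auto simp: good_square_def)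
  have Mb: "\<And>w. w \<in> I \<Longrightarrow> E x w \<Longrightarrow> E b w \<Longrightarrow> w = a \<or> w = a'" using su by (auto simp: good_square_def)
  define Y where "Y = reach E (I - {a, a', b}) y - {y}"
  define S where "S = {w. \<exists>z\<in>{a, a'}. E z w}"
  have YW: "Y \<subseteq> I - {a, a', b}" using reach_sub[of E "I - {a, a', b}" y] by (auto simp: Y_def)
  have Sv: "v \<in> S \<longleftrightarrow> E v a \<or> E v a'" for v using sym by (auto simp: S_def)
  have Ycl: "w \<in> insert y Y \<or> w \<in> {x, a, a', b}" if "v \<in> Y" "w \<in> insert x (insert y I)" "E v w" for v w
    using reach_step[of v E "I - {a, a', b}" y w] that by (auto simp: Y_def)
  have vb: "\<not> E v x" "\<not> E v a" "\<not> E v a'" if "v \<in> Y" "E v b" for v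
  proof -
    have v: "v \<in> I" "v \<noteq> a" "v \<noteq> a'" using that YW by auto
    show "\<not> E v x" using Mb[of v] v sym[of v] that by blast
    show "\<not> E v a" "\<not> E v a'" using tf[of v b a] tf[of v b a'] v ab that by auto
  qed
  have nall: "\<not> (E v x \<and> E v a \<and> E v a')" if "v \<in> Y" "v \<noteq> u" for v
    using u[of v] that YW sym[of v x] by blast
  \<comment> \<open>The forbidden shape does not occur, because \<open>c\<close> would have at most
    four neighbours.\<close>
  have noYuc: False if c: "Y = {u, c}" "c \<noteq> u" for c
  proof -
    have cY: "c \<in> Y" "c \<in> I" using c YW by auto
    have 0: "w \<in> {x, a, a', b, y, u}" if "w \<in> insert x (insert y I)" "E c w" for w
      using Ycl[OF cY(1) that] c irr[of c] that by auto
    show False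
    proof (cases "E c b")
      case True
      then have "\<forall>w\<in>insert x (insert y I). E c w \<longrightarrow> w \<in> {b, y, u, u}" using 0 vb[OF cY(1) True] by blast
      then show False by (rule degree_not_le_four[OF cY(2)])
    next
      case False
      then have 1: "w = x \<or> w = a \<or> w = a' \<or> w = y \<or> w = u" if "w \<in> insert x (insert y I)" "E c w" for w using 0[OF that] that by auto
      consider "\<not> E c x" | "\<not> E c a" | "\<not> E c a'" using nall[OF cY(1) c(2)] by blast
      then show False
      proof cases
        assume "\<not> E c x"
        then show False by (intro degree_not_le_four[OF cY(2), of a a' y u]) (use 1 in blast)
      next
        assume "\<not> E c a"
        then show False by (intro degree_not_le_four[OF cY(2), of x a' y u]) (use 1 in blast)
      next
        assume "\<not> E c a'"
        then show False by (intro degree_not_le_four[OF cY(2), of x a y u]) (use 1 in blast)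
      qed
    qed
  qed
  have neY: "\<exists>v\<in>Y. v \<noteq> u"
  proof (rule ccontr)
    assume c: "\<not> ?thesis"
    then have Yu: "Y = {u}" using ne by (auto simp: Y_def)
    have uY: "u \<in> Y" "u \<in> I" using Yu YW by auto
    have 0: "w \<in> {x, a, a', b, y}" if "w \<in> insert x (insert y I)" "E u w" for w
      using Ycl[OF uY(1) that] Yu irr[of u] that by auto
    show False
    proof (cases "E u b")
      case True
      then have "\<forall>w\<in>insert x (insert y I). E u w \<longrightarrow> w \<in> {b, y, y, y}" using 0 vb[OF uY(1) True] by blast
      then show False by (rule degree_not_le_four[OF uY(2)])
    next
      case False
      then have "\<forall>w\<in>insert x (insert y I). E u w \<longrightarrow> w \<in> {x, a, a', y}" using 0 by blast
      then show False by (rule degree_not_le_four[OF uY(2)])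
    qed
  qed
  have "spans (path_lengths E I x y) (d - 1 - 2 + 2)"
  proof (rule spans_square_general[OF ab(1-8) Y_def S_def, of u 1])
    show "\<exists>v\<in>Y. v \<noteq> u" by (rule neY)
    show "v \<noteq> s" if "v \<in> Y" for v using that YW sI by auto
    show "card {w\<in>{x, a, a', b}. E v w} \<le> (if v \<in> S then 1 else 0) + 1" if v: "v \<in> Y" "v \<noteq> u" for v
    proof (cases "E v b")
      case True
      have "{w\<in>{x, a, a', b}. E v w} \<subseteq> {b}" using vb[OF v(1) True] by auto
      then show ?thesis using card_le1I[of "{w\<in>{x, a, a', b}. E v w}" b] by simp
    next
      case False
      show ?thesis
      proof (cases "v \<in> S")
        case vS: True
        have "\<exists>p q. {w\<in>{x, a, a', b}. E v w} \<subseteq> {p, q}" using nall[OF v] False by blast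
        then show ?thesis using card_le2I vS by fastforce
      next
        case vS: False
        have "{w\<in>{x, a, a', b}. E v w} \<subseteq> {x}" using vS False Sv by auto
        then show ?thesis using card_le1I[of "{w\<in>{x, a, a', b}. E v w}" x] by simp
      qed
    qed
    show False if F: "F \<subseteq> Y" "\<not> F \<subseteq> {u}" "F \<inter> S = {}" "g \<in> insert y Y" "g \<notin> F" "nb F \<subseteq> {x, b, g}" for F g
    proof -
      have "a \<in> I - F - {b, g}" using F YW ab by auto
      then have "I - F - {b, g} \<noteq> {}" by blast
      moreover have "F \<subseteq> I" "F \<noteq> {}" "b \<notin> F" "g \<in> insert y I" "g \<noteq> b" using F YW ab by auto
      ultimately show False using tf_three_cut[OF _ _ F(6) ab(3)] F(5) n by blast
    qed
    show "2 \<le> card (nbhd (reroot E x S) (insert x (insert y Y)) {u})" if "Y = {u, c}" "c \<noteq> u" for c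
      using noYuc[OF that] by simp
  qed
  moreover have "d - 1 - 2 + 2 = d - 1" using d5 by simp
  ultimately show False using n by simp
qed

text \<open>Paths run from \<open>x\<close> to \<open>a\<close> or \<open>a'\<close> in the part
  attached to \<open>x\<close> and end with \<open>z y\<close> or \<open>z b z' y\<close>.
  Triangle-freeness limits the loss to one, since a neighbour of \<open>b\<close> sees neither
  \<open>a\<close> nor \<open>a'\<close>.\<close>

lemma tf_square_root_side:
  assumes su: "good_square a a' b" and Y: "reach E (I - {a, a', b}) y - {y} = {}" and ya: "E y a" "E y a'"
    and X: "reach E (I - {a, a', b}) x - {x} \<noteq> {}"
  shows "spans (path_lengths E I x y) (d - 1)"
proof -
  note ab = good_squareD[OF su]
  define Fs where "Fs = I - {a, a', b}"
  have Fsn: "x \<notin> Fs" "y \<notin> Fs" "a \<notin> Fs" "a' \<notin> Fs" "b \<notin> Fs" "Fs \<subseteq> I" "s \<notin> Fs" using xI yI sI by (auto simp: Fs_def)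
  have cl: "w \<in> Fs \<union> {x, a, a', b}" if v: "v \<in> Fs" "w \<in> insert x (insert y I)" "E v w" for v w
  proof -
    have "w \<noteq> y"
    proof
      assume "w = y"
      then have "v \<in> reach E Fs y" using reach_step[of y E Fs y v] sym[of v y] v by auto
      then show False using Y v Fsn by (auto simp: Fs_def)
    qed
    then show ?thesis using v by (auto simp: Fs_def)
  qed
  have d4: "4 \<le> d" using d5 by simp
  have FsI: "Fs \<subseteq> I - {a, a', b}" by (simp add: Fs_def)
  have "\<exists>A. spans A (d - 1 - 2) \<and> (\<forall>n\<in>A. \<exists>z\<in>{a, a'}. n \<in> path_lengths E Fs x z)"
  proof (rule spans_root_side[OF d4 FsI cl ab(1-3)])
    show "\<not> reach E Fs x - {x} \<subseteq> {s}" using X reach_sub[of E Fs x] Fsn by (auto simp: Fs_def)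
    fix v assume v: "v \<in> Fs"
    have vI: "v \<in> I" using v Fsn by auto
    show "card {w \<in> {a, a', b}. E v w} \<le> (if E a v \<or> E a' v then 1 else 0) + 1"
    proof (cases "E v b")
      case True
      then have "\<not> E v a" "\<not> E v a'" using tf[of v b a] tf[of v b a'] vI ab by auto
      then have "{w \<in> {a, a', b}. E v w} \<subseteq> {b}" by auto
      then show ?thesis using card_le1I[of "{w \<in> {a, a', b}. E v w}" b] by simp
    next
      case False
      show ?thesis
      proof (cases "E a v \<or> E a' v")
        case True
        have "{w \<in> {a, a', b}. E v w} \<subseteq> {a, a'}" using False by auto
        then show ?thesis using card_le2I[of "{w \<in> {a, a', b}. E v w}" a a'] True by simp
      next
        case n2: False
        then have "{w \<in> {a, a', b}. E v w} \<subseteq> {b}" using sym[of v] by auto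
        then show ?thesis using card_le1I[of "{w \<in> {a, a', b}. E v w}" b] by simp
      qed
    qed
  qed (use Fsn in auto)
  then obtain A where A: "spans A (d - 1 - 2)" "\<And>n. n \<in> A \<Longrightarrow> \<exists>z\<in>{a, a'}. n \<in> path_lengths E Fs x z" by blast
  have ya': "E a y" "E a' y" using ya sym by blast+
  have "spans (path_lengths E I x y) (d - 1 - 2 + 2)"
  proof (rule spans_thick2[OF A(1), of 1])
    fix n assume "n \<in> A"
    then obtain z z' where z: "{z, z'} = {a, a'}" "n \<in> path_lengths E Fs x z" using A(2) by blast
    have zz: "z \<noteq> z'" "z \<in> I" "z' \<in> I" "z \<notin> Fs" "z' \<notin> Fs" "E b z" "E b z'" "E z y" "E z' y" "z \<noteq> x" "z' \<noteq> x" "z \<noteq> y" "z' \<noteq> y" "b \<noteq> z" "b \<noteq> z'"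
      using z(1) ab Fsn ya' by (auto simp: doubleton_eq_iff)
    show "n + 1 \<in> path_lengths E I x y"
      by (rule path_lengths_concat[OF z(2) path_lengths_edge[OF zz(8), of "{}"]]) (use zz Fsn xy in auto)
    have p3: "3 \<in> path_lengths E {b, z'} z y" by (rule path_lengths_three[of z b z']) (use zz sym[of b z] ab in auto)
    have "n + 3 \<in> path_lengths E I x y"
      by (rule path_lengths_concat[OF z(2) p3]) (use zz Fsn xy ab in auto)
    then show "n + Suc (Suc 1) \<in> path_lengths E I x y" by (simp add: numeral_3_eq_3 numeral_2_eq_2)
  qed
  then show ?thesis using d5 by (rule_tac spans_mono) auto
qed

text \<open>With a single neighbour \<open>g\<close> of \<open>y\<close>, the remaining inner
  vertices would be cut off by \<open>x\<close> and \<open>g\<close>.\<close>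

lemma y_two_neighbours: assumes "p \<in> I" "q \<in> I" "p \<noteq> q" shows "\<exists>u v. u \<in> I \<and> v \<in> I \<and> u \<noteq> v \<and> E y u \<and> E y v"
proof (rule ccontr)
  interpret w: weak_rooted_min E I y x s d by (rule swap_weak)
  assume c: "\<not> ?thesis"
  obtain g where g: "g \<in> I" "E y g" using w.root_has_neighbour assms by auto
  then have Nyg: "w = g" if "w \<in> I" "E y w" for w using c that by blast
  have "nb (I - {g}) \<subseteq> {x, g}" using Nyg sym by (auto simp: nbhd_def)
  moreover have "I - {g} \<subset> I" using g by auto
  moreover have "\<not> I - {g} \<subseteq> {s}" using not_subset_exceptional[of "I - {g}"] assms by auto
  ultimately show False using no_two_cut by blast
qed

text \<open>Contraction at \<open>y\<close> reduces to the case that \<open>y\<close> sees both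
  \<open>a\<close> and \<open>a'\<close>, and \<open>tf_square_root_side\<close> to the case that
  \<open>x\<close> sees nothing in \<open>Fs\<close>. Then \<open>Fs\<close> is attached to
  \<open>a\<close>, \<open>a'\<close>, \<open>b\<close> only, and the induction hypothesis is used
  with roots \<open>a\<close> and \<open>a'\<close>, or with roots \<open>b\<close> and the
  contraction of \<open>a\<close> and \<open>a'\<close>.\<close>

lemma tf_square_blocked:
  assumes su: "good_square a a' b" and Y: "reach E (I - {a, a', b}) y - {y} = {}"
  shows "spans (path_lengths E I x y) (d - 1)"
proof (rule ccontr)
  assume n: "\<not> ?thesis"
  interpret w: tf_rooted_min E I y x s d by (rule swap_tf)
  note ab = good_squareD[OF su]
  define Fs where "Fs = I - {a, a', b}"
  have Fsn: "x \<notin> Fs" "y \<notin> Fs" "a \<notin> Fs" "a' \<notin> Fs" "b \<notin> Fs" "Fs \<subseteq> I" "Fs \<subset> I" "s \<notin> Fs" using xI yI sI ab by (auto simp: Fs_def)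
  have fF: "finite Fs" using Fsn fin finite_subset by auto
  have Fy: "\<not> E v y" "\<not> E y v" if v: "v \<in> Fs" for v
  proof -
    show "\<not> E y v"
    proof
      assume "E y v"
      then have "v \<in> reach E Fs y" using reach_step[of y E Fs y v] v by auto
      then show False using Y v Fsn by (auto simp: Fs_def)
    qed
    then show "\<not> E v y" using sym by blast
  qed
  have IF: "I = Fs \<union> {a, a', b}" using ab by (auto simp: Fs_def)
  have bad: False if yb: "E y b" and e: "{e, e'} = {a, a'}" "E y e" "\<not> E y e'" for e e'
  proof -
    have "e = a \<or> e = a'" "e' = a \<or> e' = a'" using e(1) by blast+
    then have ee: "e \<in> I" "e' \<in> I" "E b e" using ab by blast+
    have "card {c\<in>I. E y c \<and> E v c} \<le> 1" if v: "v \<in> I" for v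
    proof -
      have e3: "c \<in> Fs \<or> c = b \<or> c = e \<or> c = e'" if "c \<in> I" for c using that e(1) unfolding IF by blast
      have "{c\<in>I. E y c \<and> E v c} \<subseteq> {b, e}" using e3 Fy(2) e(3) by blast
      moreover have "\<not> (E v b \<and> E v e)" using tf[OF v ab(3) ee(1)] ee(3) by blast
      ultimately have "{c\<in>I. E y c \<and> E v c} \<subseteq> {b} \<or> {c\<in>I. E y c \<and> E v c} \<subseteq> {e}" by blast
      then show ?thesis by (elim disjE) (rule card_le1I, assumption)+
    qed
    then have "spans (path_lengths E I y x) (d - 1)" using w.tf_contract[of e'] ee e by blast
    then show False using n path_lengths_commute[of I x y] by simp
  qed
  have ya: "E y a \<and> E y a'"
  proof (rule ccontr)
    assume c: "\<not> ?thesis"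
    obtain u v where uv: "u \<in> I" "v \<in> I" "u \<noteq> v" "E y u" "E y v" using y_two_neighbours[OF ab(1,2,4)] by blast
    have "u \<in> {a, a', b}" "v \<in> {a, a', b}" using uv Fy IF by blast+
    then have "E y b" "E y a \<or> E y a'" using c uv by auto
    then show False using bad[of a a'] bad[of a' a] c by blast
  qed
  then have ya: "E y a" "E y a'" "E a y" "E a' y" using sym by blast+
  have Fx: "\<not> E v x" "\<not> E x v" if v: "v \<in> Fs" for v
  proof -
    show "\<not> E x v"
    proof
      assume "E x v"
      then have "v \<in> reach E Fs x" using reach_step[of x E Fs x v] v by auto
      then have "reach E (I - {a, a', b}) x - {x} \<noteq> {}" using v Fsn by (auto simp: Fs_def)
      then show False using tf_square_root_side[OF su Y ya(1,2)] n by blast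
    qed
    then show "\<not> E v x" using sym by blast
  qed
  have Fne: "Fs \<noteq> {}"
  proof
    assume "Fs = {}"
    then have "w \<in> {x, b, y}" if "w \<in> insert x (insert y I)" "E a w" for w using that IF ab irr[of a] by auto
    then have "d \<le> card {x, b, y}" by (intro degree_le_card_tf[OF ab(1)]) auto
    also have "\<dots> \<le> 3" by (simp add: card_insert_if)
    finally show False using d5 by simp
  qed
  show False
  proof (cases "E x b \<or> E y b")
    case False
    define J where "J = I - {a, a'}"
    have JI: "J \<subset> I" "J \<subseteq> I" using ab by (auto simp: J_def)
    have fJ: "finite J" using JI fin finite_subset by auto
    have nxy: "\<not> E v x" "\<not> E v y" if "v \<in> J" for v
    proof -
      have "v = b \<or> v \<in> Fs" using that IF by (auto simp: J_def)
      then show "\<not> E v x" "\<not> E v y" using Fx Fy False sym[of b] by blast+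
    qed
    have VJ: "insert x (insert y I) = insert x (insert y (insert a (insert a' J)))" using ab by (auto simp: J_def)
    have nbeq: "nb F \<subseteq> nbhd E (insert a (insert a' J)) F" if "F \<subseteq> J" for F
      using that nxy VJ by (auto simp: nbhd_def)
    interpret q: two_rooted E J a a' by unfold_locales (use fJ ab irr in \<open>auto simp: J_def intro: sym\<close>)
    have "two_rooted_conn E J a a'"
    proof unfold_locales
      fix F assume F: "F \<subseteq> J" "F \<noteq> {}"
      have "2 \<le> card (nb F)" using cut2[of F] F JI by blast
      then show "2 \<le> card (q.nb F)" using card_mono[OF q.finite_nb nbeq[OF F(1)]] by linarith
    qed
    then have "tf_rooted d E J a a'" unfolding tf_rooted_def
    proof (intro conjI ballI impI)
      show "J \<noteq> {}" using ab by (auto simp: J_def)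
    next
      fix v assume v: "v \<in> J"
      have "degree_in E (insert x (insert y I)) v \<le> degree_in E (insert a (insert a' J)) v + 0"
        by (rule degree_in_loss[where B="{w\<in>insert a (insert a' J). E v w}" and Q="{}" and X="{}"])
          (use nxy[OF v] VJ fJ in auto)
      moreover have "v \<in> I" "v \<noteq> s" using v JI sI by auto
      ultimately show "d \<le> degree_in E (insert a (insert a' J)) v" using deg[of v] by simp
    next
      fix u v w assume "u \<in> J" "v \<in> J" "w \<in> J" "E u v" "E v w"
      then show "\<not> E u w" using tf[of u v w] JI by blast
    qed
    from IH1[OF card_psubset_I[OF JI(1)] this] have q: "spans (path_lengths E J a a') (d - 1)" .
    have "spans (path_lengths E I x y) (d - 1)"
    proof (rule spans_shift[OF q, of 2])
      fix n assume n: "n \<in> path_lengths E J a a'"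
      have n1: "1 + n \<in> path_lengths E (insert a J) x a'"
        by (rule path_lengths_concat[OF path_lengths_edge[OF ab(5), of "{}"] n]) (use JI xI ab in auto)
      have "1 + n + 1 \<in> path_lengths E I x y"
        by (rule path_lengths_concat[OF n1 path_lengths_edge[OF ya(4), of "{}"]]) (use ab JI yI xy in auto)
      then show "n + 2 \<in> path_lengths E I x y" by simp
    qed
    then show False using n by simp
  next
    case xyb: True
    show False
    proof (cases "\<exists>w\<in>Fs. E w a \<and> E w a'")
      case True
      then obtain w where w: "w \<in> Fs" "E w a" "E w a'" by auto
      have wI: "w \<in> I" using w Fsn by auto
      have wb: "\<not> E w b" using tf[of w b a] wI ab w by auto
      \<comment> \<open>A second common neighbour \<open>w\<close> of \<open>a\<close> and
        \<open>a'\<close> can take the place of \<open>b\<close>. The vertex \<open>b\<close>, which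
        sees \<open>x\<close> or \<open>y\<close>, then unblocks the new four-cycle on that
        side.\<close>
      have suw: "good_square a a' w" unfolding good_square_def
      proof (intro conjI ballI impI exI[of _ b])
        fix v assume "v \<in> I" "E x v" "E w v"
        then show "v = a \<or> v = a'" using IF Fx wb by blast
      next
        fix v assume "v \<in> I" "E x v" "E v a" "E v a'"
        then show "v = b \<or> v = w" using IF Fx ab irr[of a] irr[of a'] sym[of a' a] by blast
      qed (use ab wI w in auto)
      have bW: "b \<in> I - {a, a', w}" using ab w Fsn by auto
      show False
      proof (cases "reach E (I - {a, a', w}) y - {y} = {}")
        case False
        then show False using tf_square[OF suw] n by blast
      next
        case Yw: True
        have "\<not> E y b"
        proof
          assume "E y b"
          then have "b \<in> reach E (I - {a, a', w}) y" using reach_step[of y E "I - {a, a', w}" y b] bW by auto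
          then show False using Yw ab by auto
        qed
        then have "b \<in> reach E (I - {a, a', w}) x" using reach_step[of x E "I - {a, a', w}" x b] bW xyb by auto
        then have "reach E (I - {a, a', w}) x - {x} \<noteq> {}" using ab by auto
        then show False using tf_square_root_side[OF suw Yw ya(1,2)] n by blast
      qed
    next
      case nw: False
      define S where "S = {w. \<exists>z\<in>{a, a'}. E z w}"
      \<comment> \<open>As before, \<open>y\<close> only names the contraction of \<open>a\<close>
        and \<open>a'\<close>. Since these have no common neighbour in \<open>Fs\<close>, no degree
        is lost.\<close>
      let ?E = "reroot E y S"
      have Sv: "v \<in> S \<longleftrightarrow> E v a \<or> E v a'" for v using sym by (auto simp: S_def)
      interpret r: two_rooted E Fs y b by unfold_locales (use fF Fsn ab irr in \<open>auto intro: sym\<close>)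
      have two_rooted_F: "two_rooted ?E Fs y b" by (rule r.reroot_two_rooted[OF subset_refl])
      interpret q: two_rooted ?E Fs y b by (rule two_rooted_F)
      have Fcl: "w \<in> Fs \<or> w \<in> {a, a', b}" if "v \<in> Fs" "w \<in> insert x (insert y I)" "E v w" for v w
        using that Fx Fy IF by blast
      have nF: "q.nb F = (r.nb F \<inter> insert b Fs) \<union> (if F \<inter> S = {} then {} else {y})" if "F \<subseteq> Fs" for F
        by (rule r.reroot_nbhd[OF subset_refl that])
      have nbr: "nb F - {a, a'} \<subseteq> r.nb F \<inter> insert b Fs" if F: "F \<subseteq> Fs" for F
      proof
        fix w assume "w \<in> nb F - {a, a'}"
        then obtain f where f: "w \<in> insert x (insert y I)" "w \<notin> F" "f \<in> F" "E f w" "w \<notin> {a, a'}" by (auto simp: nbhd_def)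
        then have "w \<in> insert b Fs" using Fcl[of f w] F by blast
        then show "w \<in> r.nb F \<inter> insert b Fs" using f by (auto simp: nbhd_def)
      qed
      have "two_rooted_conn ?E Fs y b"
      proof unfold_locales
        fix F assume F: "F \<subseteq> Fs" "F \<noteq> {}"
        show "2 \<le> card (q.nb F)"
        proof (cases "F \<inter> S = {}")
          case True
          have "a \<notin> nb F" "a' \<notin> nb F" using True Sv by (auto simp: nbhd_def)
          then have "nb F \<subseteq> q.nb F" using nbr[OF F(1)] nF[OF F(1)] by blast
          moreover have "2 \<le> card (nb F)" using cut2[of F] F Fsn by blast
          ultimately show ?thesis using card_mono[OF q.finite_nb] by (meson le_trans)
        next
          case False
          have "\<not> nb F \<subseteq> {a, a'}" using no_two_cut[of F a a'] F Fsn not_subset_exceptional[of F] by blast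
          then obtain w where w: "w \<in> nb F" "w \<notin> {a, a'}" by blast
          then have "w \<in> q.nb F" "w \<in> insert b Fs" using nbr[OF F(1)] nF[OF F(1)] by blast+
          moreover have "y \<in> q.nb F" using nF[OF F(1)] False by auto
          moreover have "w \<noteq> y" using \<open>w \<in> insert b Fs\<close> Fsn ab by auto
          ultimately show ?thesis using card_ge2I[OF _ _ _ q.finite_nb] by blast
        qed
      qed
      then have "tf_rooted d ?E Fs y b" unfolding tf_rooted_def
      proof (intro conjI ballI impI)
        show "Fs \<noteq> {}" by (rule Fne)
      next
        fix v assume v: "v \<in> Fs"
        have vy: "v \<noteq> y" using v Fsn by auto
        have one: "card {w\<in>{a, a'}. E v w} \<le> 1"
        proof -
          have "{w\<in>{a, a'}. E v w} \<subseteq> {a} \<or> {w\<in>{a, a'}. E v w} \<subseteq> {a'}" using nw v by blast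
          then show ?thesis by (elim disjE) (rule card_le1I, assumption)+
        qed
        let ?X = "if v \<in> S then {y} else {}"
        have "degree_in E (insert x (insert y I)) v \<le> degree_in ?E (insert y (insert b Fs)) v + 0"
        proof (rule degree_in_loss[where B="{w\<in>insert b Fs. E v w}" and Q="{w\<in>{a, a'}. E v w}" and X="?X"])
          show "{w \<in> insert x (insert y I). E v w} \<subseteq> {w \<in> insert b Fs. E v w} \<union> {w \<in> {a, a'}. E v w}"
            using Fcl[OF v] by blast
          show "{w \<in> insert b Fs. E v w} \<subseteq> {w \<in> insert y (insert b Fs). ?E v w}"
            using vy Fsn ab by (auto simp: reroot_def)
          show "?X \<subseteq> {w \<in> insert y (insert b Fs). ?E v w}" using vy by (auto simp: reroot_def)
          show "{w \<in> insert b Fs. E v w} \<inter> ?X = {}" using Fsn ab by auto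
          show "card {w\<in>{a, a'}. E v w} \<le> card ?X + 0"
          proof (cases "v \<in> S")
            case True then show ?thesis using one by simp
          next
            case False
            then have "{w\<in>{a, a'}. E v w} = {}" using Sv by auto
            then show ?thesis by (simp only: card.empty)
          qed
        qed (use fF in auto)
        moreover have "v \<in> I" "v \<noteq> s" using v Fsn by auto
        ultimately show "d \<le> degree_in ?E (insert y (insert b Fs)) v" using deg[of v] by simp
      next
        fix u v w assume a: "u \<in> Fs" "v \<in> Fs" "w \<in> Fs" "?E u v" "?E v w"
        then have "u \<noteq> y" "v \<noteq> y" "w \<noteq> y" "u \<in> I" "v \<in> I" "w \<in> I" using Fsn by auto
        then show "\<not> ?E u w" using a tf[of u v w] by (simp add: reroot_def)
      qed
      from IH1[OF card_psubset_I[OF Fsn(7)] this] have q: "spans (path_lengths ?E Fs y b) (d - 1)" .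
      have "spans (path_lengths E I x y) (d - 1)"
      proof (rule spans_shift[OF q, of 2])
        fix n assume n0: "n \<in> path_lengths ?E Fs y b"
        have "\<exists>z\<in>{a, a'}. n \<in> path_lengths E Fs z b"
          by (rule reroot_path_lengths_root[OF n0[unfolded S_def]]) (use Fsn ab in auto)
        then obtain z where z: "z \<in> {a, a'}" "n \<in> path_lengths E Fs z b" by blast
        have zz: "z \<in> I" "E x z" "E z y" "z \<noteq> x" "z \<noteq> y" "z \<noteq> b" "z \<notin> Fs" using z(1) ab ya Fsn by auto
        \<comment> \<open>Depending on which root sees \<open>b\<close>, the path is completed to
          \<open>x b\<close> ... \<open>z y\<close> or to \<open>x z\<close> ...
          \<open>b y\<close>.\<close>
        show "n + 2 \<in> path_lengths E I x y"
        proof (cases "E x b")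
          case True
          have z': "n \<in> path_lengths E Fs b z" using z path_lengths_commute by simp
          have n1: "1 + n \<in> path_lengths E (insert b Fs) x z"
            by (rule path_lengths_concat[OF path_lengths_edge[OF True, of "{}"] z']) (use Fsn zz in auto)
          have "1 + n + 1 \<in> path_lengths E I x y"
            by (rule path_lengths_concat[OF n1 path_lengths_edge[OF zz(3), of "{}"]]) (use ab Fsn zz xy in auto)
          then show ?thesis by simp
        next
          case False
          then have byE: "E b y" using xyb sym by blast
          have n1: "1 + n \<in> path_lengths E (insert z Fs) x b"
            by (rule path_lengths_concat[OF path_lengths_edge[OF zz(2), of "{}"] z(2)]) (use Fsn zz ab in auto)
          have "1 + n + 1 \<in> path_lengths E I x y"
            by (rule path_lengths_concat[OF n1 path_lengths_edge[OF byE, of "{}"]]) (use ab Fsn zz xy in auto)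
          then show ?thesis by simp
        qed
      qed
      then show False using n by simp
    qed
  qed
qed

end

section \<open>Vertices sharing three neighbours with the root\<close>

context tf_rooted_min begin

text \<open>Call a vertex of \<open>M\<close> free if \<open>y\<close> reaches it without using
  \<open>b\<close> or another vertex of \<open>M\<close>. If all but one vertex \<open>m\<close>
  were not free, then \<open>x\<close>, \<open>b\<close> and \<open>m\<close> would separate what
  \<open>y\<close> does not reach, a cut excluded by \<open>tf_three_cut\<close>; \<open>y3\<close>
  guarantees that something remains on the side of \<open>y\<close>.\<close>

lemma two_free_common_neighbours:
  assumes n: "\<not> spans (path_lengths E I x y) (d - 1)" and b: "b \<in> I" and M: "M = {w\<in>I. E x w \<and> E b w}" and M3: "3 \<le> card M"
    and y3: "\<And>p q. \<exists>w\<in>I. E y w \<and> w \<noteq> p \<and> w \<noteq> q"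
  shows "\<exists>m\<in>M. \<exists>m'\<in>M. m \<noteq> m' \<and> (\<exists>z\<in>reach E (I - {b} - M) y. E z m) \<and> (\<exists>z\<in>reach E (I - {b} - M) y. E z m')"
proof -
  let ?W = "I - {b} - M"
  define Y0 where "Y0 = reach E ?W y"
  have Y0s: "Y0 \<subseteq> insert y ?W" unfolding Y0_def by (rule reach_sub)
  have yY: "y \<in> Y0" by (simp add: Y0_def)
  have st: "w \<in> Y0" if "u \<in> Y0" "E u w" "w \<in> I" "w \<noteq> b" "w \<notin> M" for u w
    using reach_step[of u E ?W y w] that by (auto simp: Y0_def)
  have MI: "M \<subseteq> I" "b \<notin> M" using irr[of b] by (auto simp: M)
  have key: "\<exists>m'\<in>M. m' \<noteq> m \<and> (\<exists>z\<in>Y0. E z m')" if m: "m \<in> M" for m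
  proof (rule ccontr)
    assume "\<not> ?thesis"
    then have c: "m' = m" if "m' \<in> M" "z \<in> Y0" "E z m'" for m' z using that by blast
    define F where "F = I - {b, m} - Y0"
    have mI: "m \<in> I" "m \<noteq> b" using m MI by auto
    have nbF: "nb F \<subseteq> {x, b, m}"
    proof
      fix w assume "w \<in> nb F"
      then obtain f where w: "w \<in> insert x (insert y I)" "w \<notin> F" "f \<in> F" "E f w" by (auto simp: nbhd_def)
      show "w \<in> {x, b, m}"
      proof (rule ccontr)
        assume k: "w \<notin> {x, b, m}"
        then have wY: "w \<in> Y0" using w(1,2) yY by (auto simp: F_def)
        have f: "f \<in> I" "f \<noteq> b" "f \<noteq> m" "f \<notin> Y0" using w(3) by (auto simp: F_def)
        have "E w f" using w(4) sym by blast
        then show False using st[OF wY _ f(1,2)] c[OF _ wY] f by blast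
      qed
    qed
    have "\<not> M \<subseteq> {m}" using M3 card_le1I[of M m] by linarith
    then obtain m1 where "m1 \<in> M" "m1 \<noteq> m" by blast
    then have "m1 \<in> F" using Y0s MI yI by (auto simp: F_def)
    then have Fne: "F \<noteq> {}" by blast
    obtain w where w: "w \<in> I" "E y w" "w \<noteq> b" "w \<noteq> m" using y3[of b m] by blast
    then have "w \<in> Y0" using st[OF yY] c[OF _ yY] by blast
    then have "w \<in> I - F - {b, m}" using w by (auto simp: F_def)
    then have rest: "I - F - {b, m} \<noteq> {}" by blast
    have "spans (path_lengths E I x y) (d - 1)"
      by (rule tf_three_cut[OF _ Fne nbF b _ _ _ mI(2) rest]) (use mI in \<open>auto simp: F_def\<close>)
    then show False using n by blast
  qed
  have "M \<noteq> {}" using M3 by auto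
  then obtain m1 where "m1 \<in> M" by blast
  from key[OF this] obtain m where m: "m \<in> M" "\<exists>z\<in>Y0. E z m" by blast
  from key[OF m(1)] obtain m' where m': "m' \<in> M" "m' \<noteq> m" "\<exists>z\<in>Y0. E z m'" by blast
  show ?thesis using m m' unfolding Y0_def by blast
qed

text \<open>\<open>H\<close> can be entered only from \<open>x\<close>, \<open>b\<close> or
  \<open>M\<close>, so the connection of \<open>y\<close> to a free \<open>m\<close> avoids
  \<open>H\<close> by itself.\<close>

lemma free_common_neighbour_path:
  assumes M: "M \<subseteq> I" and H: "H \<subseteq> I" "nb H \<subseteq> insert x (insert b M)"
    and b: "b \<in> I" and m: "m \<in> M" "z \<in> reach E (I - {b} - M) y" "E z m"
  shows "\<exists>k. k \<in> path_lengths E (I - {b} - M - H) m y"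
proof -
  let ?W = "I - {b} - M - H"
  have sub: "reach E (I - {b} - M) y \<subseteq> reach E ?W y"
  proof (rule reach_least)
    fix u w assume u: "u \<in> reach E ?W y" "E u w" "w \<in> I - {b} - M"
    have "w \<notin> H"
    proof
      assume w: "w \<in> H"
      have u1: "u \<in> insert y ?W" using u(1) reach_sub[of E ?W y] by blast
      then have u2: "u \<notin> H" "u \<in> insert x (insert y I)" using H(1) yI by auto
      then have "u \<in> nb H" using sym[OF u(2)] w by (auto simp: nbhd_def)
      then have "u \<in> insert x (insert b M)" using H(2) by blast
      then show False using u1 xI yI xy b M by auto
    qed
    then show "w \<in> reach E ?W y" using reach_step[OF u(1,2)] u(3) by blast
  qed simp
  have mI: "m \<in> I" "m \<noteq> y" using m M yI by auto
  have "\<exists>k. k \<in> path_lengths E ?W y m"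
    by (rule reach_path_lengths[of z E ?W y m]) (use m sub mI in auto)
  then show ?thesis using path_lengths_commute[of ?W y m] by simp
qed

lemma path_avoiding_common_neighbour:
  assumes n: "\<not> spans (path_lengths E I x y) (d - 1)" and M: "M \<subseteq> I" "b \<in> I" "b \<notin> M"
    and m: "m \<in> M" "z \<in> reach E (I - {b} - M) y" "E z m" and m': "m' \<in> M" "z' \<in> reach E (I - {b} - M) y" "E z' m'"
    and a: "a \<in> M" "a \<noteq> m" "a \<noteq> m'" "m \<noteq> m'"
    and F: "F \<subseteq> I" "F \<noteq> {}" "F \<inter> M = {}" "b \<notin> F" "nb F \<subseteq> {x, a, b, g}" and g: "g \<in> I" "g \<noteq> a" "g \<noteq> b" "g \<notin> F"
  shows "\<exists>u\<in>{m, m'}. u \<noteq> g \<and> (\<exists>k. k \<in> path_lengths E (I - F - {a, b, u, g}) g y)"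
proof -
  have ab: "a \<in> I" "a \<noteq> b" "m \<in> I" "m' \<in> I" "m \<noteq> b" "m' \<noteq> b" using a M m m' by blast+
  have gM: "\<exists>k. k \<in> path_lengths E (I - F - {a, b, u, g}) g y" if g1: "g \<in> M" "z1 \<in> reach E (I - {b} - M) y" "E z1 g" and u: "u \<in> M" for z1 u
  proof -
    have "nb F \<subseteq> insert x (insert b M)" using F(5) a(1) g1(1) by blast
    then obtain k where k: "k \<in> path_lengths E (I - {b} - M - F) g y" using free_common_neighbour_path[OF M(1) F(1) _ M(2) g1] by blast
    have "I - {b} - M - F \<subseteq> I - F - {a, b, u, g}" using a(1) g1(1) u by blast
    then have "path_lengths E (I - {b} - M - F) g y \<subseteq> path_lengths E (I - F - {a, b, u, g}) g y" by (rule path_lengths_mono)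
    then show ?thesis using k by blast
  qed
  show ?thesis
  proof (cases "g = m \<or> g = m'")
    case True
    then show ?thesis
    proof
      assume gm: "g = m"
      then have "\<exists>k. k \<in> path_lengths E (I - F - {a, b, m', g}) g y" by (intro gM[OF _ _ _ m'(1), of z]) (simp_all add: m)
      moreover have "m' \<noteq> g" using a(4) gm by simp
      ultimately show ?thesis by (intro bexI[of _ m'] conjI) simp_all
    next
      assume gm: "g = m'"
      then have "\<exists>k. k \<in> path_lengths E (I - F - {a, b, m, g}) g y" by (intro gM[OF _ _ _ m(1), of z']) (simp_all add: m')
      moreover have "m \<noteq> g" using a(4) gm by simp
      ultimately show ?thesis by (intro bexI[of _ m] conjI) simp_all
    qed
  next
    case gm: False
    let ?W = "I - F - {a, b, m, m'}"
    define Z where "Z = reach E ?W g"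
    have gW: "g \<in> ?W" using g gm by blast
    have ZW: "Z \<subseteq> ?W" using reach_sub[of E ?W g] gW by (auto simp: Z_def)
    have gZ: "g \<in> Z" by (simp add: Z_def)
    have gy: "g \<noteq> y" using g yI by auto
    show ?thesis
    proof (cases "\<exists>z\<in>Z. E z y")
      case True
      then obtain z1 where z1: "z1 \<in> reach E ?W g" "E z1 y" by (auto simp: Z_def)
      have "\<exists>k. k \<in> path_lengths E (I - F - {a, b, m, g}) g y"
        by (rule reach_path_lengths[OF z1]) (use yI gy in auto)
      moreover have "m \<noteq> g" using gm by blast
      ultimately show ?thesis by (intro bexI[of _ m] conjI) simp_all
    next
      case ny: False
      have nbH: "w \<in> {x, a, b} \<or> (w \<in> {m, m'} \<and> (\<exists>z\<in>Z. E z w))" if w0: "w \<in> nb (F \<union> Z)" for w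
      proof -
        obtain f where w: "w \<in> insert x (insert y I)" "w \<notin> F" "w \<notin> Z" "f \<in> F \<union> Z" "E f w" using w0 by (auto simp: nbhd_def)
        show ?thesis
        proof (cases "f \<in> F")
          case True
          then have "w \<in> nb F" using w by (auto simp: nbhd_def)
          then show ?thesis using F(5) w(3) gZ by blast
        next
          case False
          then have f: "f \<in> Z" using w by blast
          then have "w \<noteq> y" using ny w by blast
          moreover have "w \<notin> ?W" using reach_step[of f E ?W g w] f w by (auto simp: Z_def)
          ultimately show ?thesis using w(1,2,5) f by blast
        qed
      qed
      have FZ: "F \<union> Z \<subseteq> I" "F \<union> Z \<noteq> {}" using F ZW by auto
      have fin: "\<exists>u\<in>{m, m'}. u \<noteq> g \<and> (\<exists>k. k \<in> path_lengths E (I - F - {a, b, u, g}) g y)"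
        if v: "v \<in> M" "z2 \<in> reach E (I - {b} - M) y" "E z2 v" "z1 \<in> Z" "E z1 v" and vu: "{v, u} = {m, m'}" "v \<noteq> u" for v z1 z2 u
      proof -
        have u: "u \<in> {m, m'}" "u \<in> M" "u \<noteq> g" "v \<noteq> g" "v \<notin> ?W" "u \<notin> ?W" "v \<in> I" using vu gm m m' v M by auto
        have "nb (F \<union> Z) \<subseteq> insert x (insert b M)" using nbH a(1) m(1) m'(1) by blast
        then obtain k where k: "k \<in> path_lengths E (I - {b} - M - (F \<union> Z)) v y" using free_common_neighbour_path[OF M(1) FZ(1) _ M(2) v(1-3)] by blast
        obtain j where j: "j \<in> path_lengths E (Z - {g}) g v" using reach_path_lengths[OF v(4)[unfolded Z_def] v(5) u(5) u(4), of "Z - {g}"] by (auto simp: Z_def)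
        have "v \<notin> F" using v F(3) by blast
        have "j + k \<in> path_lengths E (I - F - {a, b, u, g}) g y"
        proof (rule path_lengths_concat[OF j k])
          show "insert v (Z - {g} \<union> (I - {b} - M - (F \<union> Z))) \<subseteq> I - F - {a, b, u, g}"
            using ZW gZ a u vu v M(3) \<open>v \<notin> F\<close> by auto
        qed (use gZ ZW yI gy in auto)
        then show ?thesis using u by blast
      qed
      have "\<exists>v\<in>{m, m'}. \<exists>z\<in>Z. E z v"
      proof (rule ccontr)
        assume "\<not> ?thesis"
        then have nb: "nb (F \<union> Z) \<subseteq> {x, a, b}" using nbH by blast
        have "m \<in> I - (F \<union> Z) - {a, b}" using ZW m F(3) ab a by blast
        then have rest: "I - (F \<union> Z) - {a, b} \<noteq> {}" by blast
        have "spans (path_lengths E I x y) (d - 1)"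
          by (rule tf_three_cut[OF FZ nb ab(1) _ _ _ _ rest]) (use ab F a ZW M in auto)
        then show False using n by blast
      qed
      then obtain v z1 where v: "v \<in> {m, m'}" "z1 \<in> Z" "E z1 v" by blast
      then show ?thesis using fin[OF m v(2), of m'] fin[OF m' v(2), of m] a(4) by blast
    qed
  qed
qed

text \<open>With roots \<open>a\<close> and \<open>g\<close> only one degree is lost on
  \<open>F\<close>, since a vertex off \<open>M\<close> sees at most one of \<open>x\<close> and
  \<open>b\<close>. The beginnings \<open>x a\<close> and \<open>x u b a\<close> differ by two, so
  the total is \<open>d - 3 + 2 = d - 1\<close>.\<close>

lemma tf_no_bad_set:
  assumes n: "\<not> spans (path_lengths E I x y) (d - 1)" and b: "b \<in> I" and M: "M = {w\<in>I. E x w \<and> E b w}"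
    and m: "m \<in> M" "z \<in> reach E (I - {b} - M) y" "E z m" and m': "m' \<in> M" "z' \<in> reach E (I - {b} - M) y" "E z' m'"
    and a: "a \<in> M" "a \<noteq> m" "a \<noteq> m'" "m \<noteq> m'"
    and F: "F \<subseteq> I" "F \<noteq> {}" "F \<inter> M = {}" "b \<notin> F" "nb F \<subseteq> {x, a, b, g}" and g: "g \<in> insert y I" "g \<noteq> a" "g \<noteq> b" "g \<notin> F"
  shows False
proof -
  have MI: "M \<subseteq> I" "b \<notin> M" using irr[of b] by (auto simp: M)
  have ab: "a \<in> I" "m \<in> I" "m' \<in> I" "E x a" "E b a" "a \<noteq> b" using a m m' M irr by auto
  have FI: "F \<subset> I" "a \<notin> F" "m \<notin> F" "m' \<notin> F" using F b a m m' by auto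
  have fF: "finite F" by (rule finite_subset[OF F(1) fin])
  have nbin: "w \<in> F \<or> w \<in> {x, a, b, g}" if "w \<in> insert x (insert y I)" "f \<in> F" "E f w" for w f
    using that F(5) by (auto simp: nbhd_def)
  interpret q: two_rooted E F a g by unfold_locales (use fF FI g irr in \<open>auto intro: sym\<close>)
  have "weak_rooted (d - 1) E F a g s" unfolding weak_rooted_def
  proof (intro conjI allI impI ballI)
    show "two_rooted E F a g" by (rule q.two_rooted_axioms)
  next
    fix v assume v: "v \<in> F" "v \<noteq> s"
    have vI: "v \<in> I" using v F by blast
    have one: "card {w\<in>{x, b}. E v w} \<le> 1"
    proof -
      have "\<not> (E v x \<and> E v b)" using sym[of v x] sym[of v b] F(3) v vI unfolding M by blast
      then have "{w\<in>{x, b}. E v w} \<subseteq> {x} \<or> {w\<in>{x, b}. E v w} \<subseteq> {b}" by blast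
      then show ?thesis by (elim disjE) (rule card_le1I, assumption)+
    qed
    have "degree_in E (insert x (insert y I)) v \<le> degree_in E (insert a (insert g F)) v + 1"
      by (rule degree_in_loss[where B="{w\<in>insert a (insert g F). E v w}" and Q="{w\<in>{x, b}. E v w}" and X="{}"])
        (use nbin[OF _ v(1)] fF one in auto)
    then show "d - 1 \<le> degree_in E (insert a (insert g F)) v" using deg[OF vI v(2)] by linarith
  next
    fix F' assume F': "F' \<subseteq> F" "\<not> F' \<subseteq> {s}"
    show "2 \<le> card (q.nb F')"
    proof (rule ccontr)
      assume k: "\<not> ?thesis"
      have "\<exists>c\<in>insert a (insert g F). c \<notin> F' \<and> q.nb F' \<subseteq> {c}"
      proof (cases "q.nb F' = {}")
        case True
        then show ?thesis using FI F' by blast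
      next
        case False
        then obtain c where c: "c \<in> q.nb F'" by blast
        then have "w = c" if "w \<in> q.nb F'" for w using card_ge2I[OF that c _ q.finite_nb] k by blast
        then show ?thesis using c by (auto simp: nbhd_def)
      qed
      then obtain c where c: "c \<in> insert a (insert g F)" "c \<notin> F'" "q.nb F' \<subseteq> {c}" by blast
      have c2: "c \<in> insert y I" "c \<noteq> b" using c(1) ab g F b by auto
      have nb': "nb F' \<subseteq> {x, b, c}"
      proof
        fix w assume "w \<in> nb F'"
        then obtain f where w: "w \<in> insert x (insert y I)" "w \<notin> F'" "f \<in> F'" "E f w" by (auto simp: nbhd_def)
        then have "w \<in> F \<or> w \<in> {x, a, b, g}" using nbin F' by blast
        then have "w \<in> {x, b} \<or> w \<in> q.nb F'" using w by (auto simp: nbhd_def)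
        then show "w \<in> {x, b, c}" using c(3) by blast
      qed
      have F2: "F' \<subseteq> I" "F' \<noteq> {}" "b \<notin> F'" using F' F by auto
      have "m \<in> I - F' - {b}" "m' \<in> I - F' - {b}" using FI F' ab m m' MI by blast+
      then have rest: "I - F' - {b, c} \<noteq> {}" using a(4) by blast
      show False using tf_three_cut[OF F2(1,2) nb' b F2(3) c2(1) c(2) c2(2) rest] n by blast
    qed
  next
    show "\<exists>v\<in>F. v \<noteq> s" using not_subset_exceptional[OF F(1,2)] by blast
  next
    fix c assume "F = {s, c}"
    then show "2 \<le> card (q.nb {s})" using F(1) sI by blast
  qed
  from weak_rooted_spans[OF this] have q: "spans (path_lengths E F a g) (d - 3)" by (simp add: numeral_3_eq_3 numeral_2_eq_2)
  have "\<exists>u k. u \<in> {m, m'} \<and> (\<forall>j\<in>path_lengths E F a g. \<forall>l P. l \<in> path_lengths E P x a \<longrightarrow> P \<subseteq> {b, u} \<longrightarrow> l + j + k \<in> path_lengths E I x y)"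
  proof (cases "g = y")
    case True
    have "l + j + 0 \<in> path_lengths E I x y" if "j \<in> path_lengths E F a g" "l \<in> path_lengths E P x a" "P \<subseteq> {b, m}" for j l P
    proof -
      have "l + j \<in> path_lengths E I x y"
        by (rule path_lengths_concat[OF that(2,1)[unfolded True]]) (use that(3) FI F b ab xI yI xy in auto)
      then show ?thesis by simp
    qed
    then show ?thesis by blast
  next
    case False
    then have gI: "g \<in> I" using g by auto
    obtain u k where u: "u \<in> {m, m'}" "u \<noteq> g" and k: "k \<in> path_lengths E (I - F - {a, b, u, g}) g y"
      using path_avoiding_common_neighbour[OF n MI(1) b MI(2) m m' a F gI g(2-4)] by blast
    have uI: "u \<in> I" "u \<notin> F" "u \<noteq> a" "u \<noteq> x" "u \<noteq> y" using u FI ab a xI yI by auto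
    have "l + j + k \<in> path_lengths E I x y" if "j \<in> path_lengths E F a g" "l \<in> path_lengths E P x a" "P \<subseteq> {b, u}" for j l P
    proof -
      have P: "P \<inter> F = {}" "g \<notin> P" "P \<subseteq> I" using that(3) uI F b g u by auto
      have "x \<noteq> g" using gI xI by auto
      have l: "l + j \<in> path_lengths E (insert a (P \<union> F)) x g"
        by (rule path_lengths_concat[OF that(2,1) P(1)]) (use P FI xI F \<open>x \<noteq> g\<close> in auto)
      show ?thesis
      proof (rule path_lengths_concat[OF l k])
        show "insert a (P \<union> F) \<inter> (I - F - {a, b, u, g}) = {}" using that(3) by blast
        show "insert g (insert a (P \<union> F) \<union> (I - F - {a, b, u, g})) \<subseteq> I" using P ab F gI by blast
        show "y \<notin> insert a (P \<union> F)" using P ab F yI by blast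
      qed (use xI xy in auto)
    qed
    then show ?thesis using u(1) by blast
  qed
  then obtain u k where u: "u \<in> {m, m'}"
    and l: "\<And>j l P. j \<in> path_lengths E F a g \<Longrightarrow> l \<in> path_lengths E P x a \<Longrightarrow> P \<subseteq> {b, u} \<Longrightarrow> l + j + k \<in> path_lengths E I x y" by blast
  have uM: "E x u" "E u b" "u \<noteq> a" using u m m' a sym unfolding M by blast+
  have p3: "3 \<in> path_lengths E {u, b} x a" by (rule path_lengths_three[of x u b a]) (use uM ab xI b in auto)
  have p1: "1 \<in> path_lengths E {} x a" by (rule path_lengths_edge[OF ab(4)])
  have "spans (path_lengths E I x y) (d - 3 + 2)"
  proof (rule spans_thick2[OF q, of "Suc k"])
    fix j assume j: "j \<in> path_lengths E F a g"
    show "j + Suc k \<in> path_lengths E I x y" using l[OF j p1] by simp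
    have "3 + j + k \<in> path_lengths E I x y" using l[OF j p3] by blast
    moreover have "j + Suc (Suc (Suc k)) = 3 + j + k" by simp
    ultimately show "j + Suc (Suc (Suc k)) \<in> path_lengths E I x y" by (simp only:)
  qed
  moreover have "d - 3 + 2 = d - 1" using d5 by simp
  ultimately show False using n by simp
qed

text \<open>The ends of the edge \<open>a b\<close> are deleted and \<open>x\<close> is attached to
  \<open>R\<close>. Each \<open>r\<close> in \<open>R\<close> is reached by \<open>x r\<close> and
  by a route of length 3 through \<open>a\<close> and \<open>b\<close>. Since \<open>a\<close> and
  \<open>b\<close> have no common neighbour in \<open>I\<close>, only one degree is lost, except
  possibly at \<open>t\<close>, the exceptional vertex. Cuts created by the deletion are excluded by
  \<open>tf_three_cut\<close> and \<open>tf_no_bad_set\<close>.\<close>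

lemma tf_no_three_common_neighbours:
  assumes n: "\<not> spans (path_lengths E I x y) (d - 1)" and b: "b \<in> I" and M: "M = {w\<in>I. E x w \<and> E b w}" and M3: "3 \<le> card M"
    and y3: "\<And>p q. \<exists>w\<in>I. E y w \<and> w \<noteq> p \<and> w \<noteq> q"
    and RA: "\<And>a. a \<in> M \<Longrightarrow> \<exists>R t. M - {a} \<subseteq> R \<and> R \<subseteq> {w\<in>I - {a, b}. E x w} \<and> (\<forall>r\<in>R. E b r \<or> (E x b \<and> E a r))
      \<and> (\<forall>w\<in>I - {a, b}. w \<noteq> t \<longrightarrow> E x w \<longrightarrow> E a w \<longrightarrow> w \<in> R)"
  shows False
proof -
  obtain m m' z z' where m: "m \<in> M" "z \<in> reach E (I - {b} - M) y" "E z m"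
    and m': "m' \<in> M" "z' \<in> reach E (I - {b} - M) y" "E z' m'" and mm: "m \<noteq> m'"
    using two_free_common_neighbours[OF n b M M3 y3] by blast
  have "\<not> M \<subseteq> {m, m'}" using M3 card_le2I[of M m m'] by linarith
  then obtain a where a: "a \<in> M" "a \<noteq> m" "a \<noteq> m'" by blast
  obtain R t where R: "M - {a} \<subseteq> R" "R \<subseteq> {w\<in>I - {a, b}. E x w}" "\<And>r. r \<in> R \<Longrightarrow> E b r \<or> (E x b \<and> E a r)"
    "\<And>w. w \<in> I - {a, b} \<Longrightarrow> w \<noteq> t \<Longrightarrow> E x w \<Longrightarrow> E a w \<Longrightarrow> w \<in> R" using RA[OF a(1)] by blast
  have MI: "M \<subseteq> I" "b \<notin> M" using irr[of b] by (auto simp: M)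
  have ab: "a \<in> I" "m \<in> I" "m' \<in> I" "E x a" "E b a" "a \<noteq> b" "m \<noteq> b" "m' \<noteq> b" using a m m' M irr by auto
  have eab: "E a b" using ab sym by blast
  have nxy: "a \<noteq> x" "b \<noteq> x" "a \<noteq> y" "b \<noteq> y" using ab b xI yI by auto
  have Mind: "\<not> E u v" if "u \<in> M" "v \<in> M" for u v using that tf[of u b v] sym[of b u] b unfolding M by blast
  define J where "J = I - {a, b}"
  have JI: "J \<subseteq> I" "J \<subset> I" using b by (auto simp: J_def)
  have mJ: "m \<in> J" "m' \<in> J" using a ab by (auto simp: J_def)
  let ?E = "reroot E x R"
  interpret q: two_rooted ?E J x y by (rule reroot_two_rooted[OF JI(1)])
  have nF: "q.nb F = (nb F \<inter> insert y J) \<union> (if F \<inter> R = {} then {} else {x})" if "F \<subseteq> J" for F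
    by (rule reroot_nbhd[OF JI(1) that])
  have "weak_rooted (d - 1) ?E J x y t" unfolding weak_rooted_def
  proof (intro conjI allI impI ballI)
    show "two_rooted ?E J x y" by (rule q.two_rooted_axioms)
  next
    fix v assume v: "v \<in> J" "v \<noteq> t"
    have vI: "v \<in> I" "v \<in> I - {a, b}" "v \<noteq> s" using v JI sI by (auto simp: J_def)
    have nab: "\<not> (E v a \<and> E v b)" using tf[OF vI(1) ab(1) b] eab by blast
    have "card {w\<in>{x, a, b}. E v w} \<le> (if v \<in> R then 1 else 0) + 1"
    proof (cases "v \<in> R")
      case True
      have "{w\<in>{x, a, b}. E v w} \<subseteq> {x, a} \<or> {w\<in>{x, a, b}. E v w} \<subseteq> {x, b}" using nab by blast
      then have "card {w\<in>{x, a, b}. E v w} \<le> 2" by (elim disjE) (rule card_le2I, assumption)+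
      then show ?thesis using True by simp
    next
      case False
      have "\<not> (E v x \<and> E v a)" using R(4)[OF vI(2) v(2)] False sym[of v x] sym[of v a] by blast
      moreover have "\<not> (E v x \<and> E v b)"
      proof
        assume "E v x \<and> E v b"
        then have "v \<in> M" using sym[of v x] sym[of v b] vI unfolding M by blast
        then show False using R(1) False vI by blast
      qed
      ultimately have "{w\<in>{x, a, b}. E v w} \<subseteq> {x} \<or> {w\<in>{x, a, b}. E v w} \<subseteq> {a} \<or> {w\<in>{x, a, b}. E v w} \<subseteq> {b}" using nab by blast
      then have "card {w\<in>{x, a, b}. E v w} \<le> 1" by (elim disjE) (rule card_le1I, assumption)+
      then show ?thesis by simp
    qed
    then have "degree_in E (insert x (insert y I)) v \<le> degree_in ?E (insert x (insert y J)) v + 1"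
      by (intro reroot_degree[OF JI(1) v(1), of "{x, a, b}"]) (auto simp: J_def)
    then show "d - 1 \<le> degree_in ?E (insert x (insert y J)) v" using deg[OF vI(1,3)] by linarith
  next
    fix F assume F: "F \<subseteq> J" "\<not> F \<subseteq> {t}"
    have Fne: "F \<noteq> {}" and FI: "F \<subseteq> I" and Fab: "a \<notin> F" "b \<notin> F" using F by (auto simp: J_def)
    show "2 \<le> card (q.nb F)"
    proof (rule ccontr)
      assume k: "\<not> ?thesis"
      then have un: "u = v" if "u \<in> q.nb F" "v \<in> q.nb F" for u v using card_ge2I[OF that _ q.finite_nb] by blast
      have nbJ: "w \<in> {x, a, b} \<or> w \<in> q.nb F" if "w \<in> nb F" for w
      proof -
        have "w \<in> insert x (insert y I)" using that by (simp add: nbhd_def)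
        then have "w \<in> {x, a, b} \<or> w \<in> insert y J" by (auto simp: J_def)
        then show ?thesis using that unfolding nF[OF F(1)] by blast
      qed
      show False
      proof (cases "F \<inter> R = {}")
        case False
        then have "x \<in> q.nb F" unfolding nF[OF F(1)] by simp
        then have nb: "nb F \<subseteq> {x, a, b}" using nbJ un by blast
        have "I - F - {a, b} \<noteq> {}"
        proof
          assume e: "I - F - {a, b} = {}"
          obtain w where w: "w \<in> I" "E y w" "w \<noteq> a" "w \<noteq> b" using y3[of a b] by blast
          then have "w \<in> F" using e by blast
          moreover have "y \<notin> F" using FI yI by blast
          moreover have "E w y" using w sym by blast
          ultimately have "y \<in> nb F" by (auto simp: nbhd_def)
          then show False using nb nxy xy by blast
        qed
        then show False using tf_three_cut[OF FI Fne nb ab(1) Fab(1), OF _ Fab(2) ab(6)[symmetric]] n b by blast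
      next
        case True
        have xn: "x \<notin> q.nb F" unfolding nF[OF F(1)] using True nbhd_def[of E] xI xy JI by auto
        have "\<exists>g\<in>insert y J. g \<notin> F \<and> q.nb F \<subseteq> {g}"
        proof (cases "q.nb F = {}")
          case True
          then show ?thesis using FI yI by blast
        next
          case False
          then obtain g where g: "g \<in> q.nb F" by blast
          then have "g \<in> insert y J" "g \<notin> F" using xn by (auto simp: nbhd_def)
          then show ?thesis using un[OF _ g] by blast
        qed
        then obtain g where g: "g \<in> insert y J" "g \<notin> F" "q.nb F \<subseteq> {g}" by blast
        have nb: "nb F \<subseteq> {x, a, b, g}" using nbJ g(3) by blast
        have g2: "g \<in> insert y I" "g \<noteq> a" "g \<noteq> b" using g(1) nxy by (auto simp: J_def)
        have "F \<inter> M = {}" using True R(1) Fab by blast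
        then show False using tf_no_bad_set[OF n b M m m' a mm FI Fne _ Fab(2) nb g2 g(2)] by blast
      qed
    qed
  next
    show "\<exists>v\<in>J. v \<noteq> t" using mJ mm by (cases "m = t") auto
  next
    fix c assume c: "J = {t, c}"
    have mt: "m = t \<or> m = c" "m' = t \<or> m' = c" using mJ unfolding c by blast+
    have I4: "w = a \<or> w = b \<or> w = m \<or> w = m'" if "w \<in> I" for w
    proof -
      have "w = a \<or> w = b \<or> w \<in> J" using that by (auto simp: J_def)
      then show ?thesis using mt mm unfolding c by blast
    qed
    have "\<forall>w\<in>insert x (insert y I). E m w \<longrightarrow> w \<in> {x, y, b, b}"
      using I4 Mind[OF m(1) a(1)] Mind[OF m(1) m'(1)] irr[of m] by blast
    from degree_not_le_four[OF ab(2) this] show "2 \<le> card (q.nb {t})" by blast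
  qed
  from weak_rooted_spans[OF this] have q: "spans (path_lengths ?E J x y) (d - 3)" by (simp add: numeral_3_eq_3 numeral_2_eq_2)
  have "spans (path_lengths E I x y) (d - 3 + 2)"
  proof (rule spans_thick2[OF q, of 0])
    fix j assume j: "j \<in> path_lengths ?E J x y"
    have "y \<notin> R" using R(2) yI by blast
    then obtain r k where r: "r \<in> J" "r \<in> R" "j = Suc k" "k \<in> path_lengths E (J - {r}) r y" using reroot_path_lengths[OF j] by blast
    have reroot: "E x r" "r \<in> I" "r \<noteq> x" "r \<noteq> y" "r \<noteq> a" "r \<noteq> b" using R(2) r xI yI by auto
    have "1 + k \<in> path_lengths E I x y"
      by (rule path_lengths_concat[OF path_lengths_edge[OF reroot(1), of "{}"] r(4)]) (use JI reroot xI xy in auto)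
    then show "j + 0 \<in> path_lengths E I x y" using r(3) by simp
    have "3 \<in> path_lengths E {a, b} x r"
    proof (cases "E b r")
      case True
      show ?thesis by (rule path_lengths_three[of x a b]) (use True ab eab reroot nxy in auto)
    next
      case False
      then have "E x b" "E a r" using R(3)[OF r(2)] by auto
      then show ?thesis by (intro path_lengths_three[of x b a]) (use ab reroot nxy in auto)
    qed
    then have "3 + k \<in> path_lengths E I x y"
    proof (rule path_lengths_concat[OF _ r(4)])
      show "insert r ({a, b} \<union> (J - {r})) \<subseteq> I" using JI reroot ab b by blast
      show "{a, b} \<inter> (J - {r}) = {}" by (auto simp: J_def)
    qed (use JI xI xy nxy in auto)
    moreover have "j + Suc (Suc 0) = 3 + k" using r(3) by simp
    ultimately show "j + Suc (Suc 0) \<in> path_lengths E I x y" by (simp only:)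
  qed
  moreover have "d - 3 + 2 = d - 1" using d5 by simp
  ultimately show False using n by simp
qed

text \<open>\<open>M b\<close> is the set of common neighbours of \<open>x\<close> and
  \<open>b\<close>; some \<open>M b\<close> has two elements, as otherwise contraction at
  \<open>x\<close> succeeds. Three elements contradict \<open>tf_no_three_common_neighbours\<close>,
  and exactly two give a good four-cycle. The vertices \<open>b\<close> adjacent to \<open>x\<close>
  come before the others: once they are excluded, \<open>M a\<close> has at most one element for
  every \<open>a\<close> adjacent to \<open>x\<close>, which bounds the exceptions in the remaining
  case.\<close>

lemma tf_configuration:
  assumes n: "\<not> spans (path_lengths E I x y) (d - 1)"
    and y3: "(\<forall>p q. \<exists>w\<in>I. E y w \<and> w \<noteq> p \<and> w \<noteq> q) \<or> (\<exists>p q. \<forall>w\<in>I. E x w \<longrightarrow> w = p \<or> w = q)"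
  shows False
proof -
  define M where "M b = {w\<in>I. E x w \<and> E b w}" for b
  have fM: "finite (M b)" for b using fin by (simp add: M_def)
  have big: "\<exists>w\<in>I. E y w \<and> w \<noteq> p \<and> w \<noteq> q" if "3 \<le> card (M b)" for b p q
    using y3
  proof
    assume "\<exists>p q. \<forall>w\<in>I. E x w \<longrightarrow> w = p \<or> w = q"
    then obtain p' q' where "M b \<subseteq> {p', q'}" by (auto simp: M_def)
    then show ?thesis using card_le2I[of "M b" p' q'] that by linarith
  qed blast
  have nsuit: "\<not> good_square a a' b" for a a' b
    using tf_square[of a a' b] tf_square_blocked[of a a' b] n by blast
  have two: False if b: "b \<in> I" "card (M b) = 2"
    and ac: "\<And>a. a \<in> M b \<Longrightarrow> \<exists>u. \<forall>w\<in>M a. w = u \<or> w = b" for b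
  proof -
    obtain a a' where a: "M b = {a, a'}" "a \<noteq> a'" using b(2) by (auto simp: card_2_iff)
    have aM: "a \<in> M b" "a' \<in> M b" using a by auto
    obtain u where u: "\<forall>w\<in>M a. w = u \<or> w = b" using ac[OF aM(1)] by blast
    have "good_square a a' b" unfolding good_square_def
    proof (intro conjI ballI impI exI[of _ u])
      fix w assume "w \<in> I" "E x w" "E b w"
      then have "w \<in> M b" by (simp add: M_def)
      then show "w = a \<or> w = a'" using a by blast
    next
      fix w assume "w \<in> I" "E x w" "E w a" "E w a'"
      then have "w \<in> M a" using sym[of w a] by (simp add: M_def)
      then show "w = u \<or> w = b" using u by blast
    qed (use aM a(2) b(1) in \<open>auto simp: M_def\<close>)
    then show False using nsuit by blast
  qed
  show False
  proof (cases "\<exists>b\<in>I. E x b \<and> 3 \<le> card (M b)")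
    case True
    then obtain b where b: "b \<in> I" "E x b" "3 \<le> card (M b)" by blast
    show False
    proof (rule tf_no_three_common_neighbours[OF n b(1) M_def b(3) big[OF b(3)]])
      fix a assume a: "a \<in> M b"
      show "\<exists>R t. M b - {a} \<subseteq> R \<and> R \<subseteq> {w\<in>I - {a, b}. E x w} \<and> (\<forall>r\<in>R. E b r \<or> (E x b \<and> E a r))
        \<and> (\<forall>w\<in>I - {a, b}. w \<noteq> t \<longrightarrow> E x w \<longrightarrow> E a w \<longrightarrow> w \<in> R)"
        by (rule exI[of _ "{w\<in>I - {a, b}. E x w \<and> (E a w \<or> E b w)}"]) (use b irr[of b] in \<open>auto simp: M_def\<close>)
    qed
  next
    case nA: False
    show False
    proof (cases "\<exists>b\<in>I. E x b \<and> 2 \<le> card (M b)")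
      case True
      then obtain b where b: "b \<in> I" "E x b" "2 \<le> card (M b)" by blast
      then have "card (M b) = 2" using nA by force
      then show False
      proof (rule two[OF b(1)])
        fix a assume a: "a \<in> M b"
        then have "\<not> 3 \<le> card (M a)" and ba: "b \<in> M a" using nA sym[of b a] b by (auto simp: M_def)
        then have "\<not> 2 \<le> card (M a - {b})" using card.remove[OF fM ba] by linarith
        then have u1: "u = v" if "u \<in> M a - {b}" "v \<in> M a - {b}" for u v
          using card_ge2I[OF that] fM by blast
        show "\<exists>u. \<forall>w\<in>M a. w = u \<or> w = b"
        proof (cases "M a - {b} = {}")
          case False
          then obtain u where "u \<in> M a - {b}" by blast
          then show ?thesis using u1 by blast
        qed blast
      qed
    next
      case nB: False
      have un: "\<exists>t. \<forall>w\<in>M a. w = t" if a: "a \<in> I" "E x a" for a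
      proof (cases "M a = {}")
        case False
        then obtain t where t: "t \<in> M a" by blast
        have "w = t" if "w \<in> M a" for w using card_ge2I[OF that t _ fM] nB a by blast
        then show ?thesis by blast
      qed blast
      have "\<exists>v\<in>I. \<not> E x v"
      proof (rule ccontr)
        assume c: "\<not> ?thesis"
        obtain v where v: "v \<in> I" using nons by blast
        obtain t where "\<forall>w\<in>M v. w = t" using un[of v] c v by blast
        then have "\<forall>w\<in>insert x (insert y I). E v w \<longrightarrow> w \<in> {x, y, t, t}" using c unfolding M_def by blast
        then show False by (rule degree_not_le_four[OF v])
      qed
      then obtain v where v: "v \<in> I" "\<not> E x v" by blast
      then obtain b where b: "b \<in> I" "\<not> E x b" "\<not> card {w\<in>I. E x w \<and> E b w} \<le> 1" using tf_contract[OF _ v] n by blast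
      have b2: "2 \<le> card (M b)" using b(3) unfolding M_def by linarith
      show False
      proof (cases "3 \<le> card (M b)")
        case True
        show False
        proof (rule tf_no_three_common_neighbours[OF n b(1) M_def True big[OF True]])
          fix a assume a: "a \<in> M b"
          then obtain t where t: "\<forall>w\<in>M a. w = t" using un[of a] by (auto simp: M_def)
          show "\<exists>R t. M b - {a} \<subseteq> R \<and> R \<subseteq> {w\<in>I - {a, b}. E x w} \<and> (\<forall>r\<in>R. E b r \<or> (E x b \<and> E a r))
            \<and> (\<forall>w\<in>I - {a, b}. w \<noteq> t \<longrightarrow> E x w \<longrightarrow> E a w \<longrightarrow> w \<in> R)"
            by (rule exI[of _ "M b - {a}"], rule exI[of _ t]) (use t[unfolded M_def] irr[of b] in \<open>unfold M_def, blast\<close>)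
        qed
      next
        case False
        show False
        proof (rule two[OF b(1)])
          show "card (M b) = 2" using False b2 by linarith
          fix a assume "a \<in> M b"
          then show "\<exists>u. \<forall>w\<in>M a. w = u \<or> w = b" using un[of a] unfolding M_def by blast
        qed
      qed
    qed
  qed
qed

text \<open>The preceding argument wants \<open>y\<close> to have three neighbours or
  \<open>x\<close> to have at most two, and one of the two orders of the roots meets this.\<close>

lemma spans_tf_rooted_min: "spans (path_lengths E I x y) (d - 1)"
proof (rule ccontr)
  assume n: "\<not> ?thesis"
  interpret w: tf_rooted_min E I y x s d by (rule swap_tf)
  have n': "\<not> spans (path_lengths E I y x) (d - 1)" using n path_lengths_commute[of I x y] by simp
  show False
  proof (cases "\<forall>p q. \<exists>w\<in>I. E y w \<and> w \<noteq> p \<and> w \<noteq> q")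
    case True
    then show False using tf_configuration[OF n] by blast
  next
    case False
    then have "\<exists>p q. \<forall>w\<in>I. E y w \<longrightarrow> w = p \<or> w = q" by blast
    then show False using w.tf_configuration[OF n'] by blast
  qed
qed

end

text \<open>Two-vertex cuts are handled by shifting as before. The root \<open>x\<close> is entered
  as exceptional vertex of \<open>tf_rooted_min\<close>, where it lies outside \<open>I\<close> as
  required.\<close>

theorem tf_rooted_spans:
  fixes E :: "'a \<Rightarrow> 'a \<Rightarrow> bool"
  assumes "5 \<le> d" "tf_rooted d E I x y"
  shows "spans (path_lengths E I x y) (d - 1)"
  using assms(2)
proof (induction "card I" arbitrary: E I x y rule: less_induct)
  case less
  note T = less.prems
  interpret two_rooted_conn E I x y using T by (simp add: tf_rooted_def)
  have Ine: "I \<noteq> {}" and dgr: "\<And>v. v \<in> I \<Longrightarrow> d \<le> degree_in E (insert x (insert y I)) v"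
    and spans_triangle_at_root: "\<And>u v w. u \<in> I \<Longrightarrow> v \<in> I \<Longrightarrow> w \<in> I \<Longrightarrow> E u v \<Longrightarrow> E v w \<Longrightarrow> \<not> E u w"
    using T unfolding tf_rooted_def by blast+
  show ?case
  proof (cases "\<exists>F. F \<subset> I \<and> F \<noteq> {} \<and> \<not> 3 \<le> card (nb F)")
    case True
    then obtain F where F: "F \<subset> I" "F \<noteq> {}" "\<not> 3 \<le> card (nb F)" by blast
    have FI: "F \<subseteq> I" using F by blast
    have "card (nb F) = 2" using cut2[OF FI F(2)] F(3) by linarith
    then obtain c c' where c: "nb F = {c, c'}" "c \<noteq> c'" by (auto simp: card_2_iff)
    have fF: "finite F" by (rule finite_subset[OF FI fin])
    have cF: "c \<notin> F" "c' \<notin> F" using c(1) unfolding nbhd_def by blast+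
    interpret q: two_rooted E F c c' by unfold_locales (use fF cF c(2) irr in \<open>auto intro: sym\<close>)
    have nbin: "w \<in> insert c (insert c' F)" if "w \<in> insert x (insert y I)" "f \<in> F" "E f w" for w f
    proof (cases "w \<in> F")
      case False
      then have "w \<in> nb F" using that by (auto simp: nbhd_def)
      then show ?thesis unfolding c(1) by blast
    qed blast
    have "tf_rooted d E F c c'" unfolding tf_rooted_def
    proof (intro conjI ballI impI)
      show "two_rooted_conn E F c c'"
      proof unfold_locales
        fix F' assume F': "F' \<subseteq> F" "F' \<noteq> {}"
        have "2 \<le> card (nb F')" using cut2[of F'] F' FI by blast
        moreover have "nb F' \<subseteq> q.nb F'" using nbin F'(1) unfolding nbhd_def by blast
        ultimately show "2 \<le> card (q.nb F')" using card_mono[OF q.finite_nb] le_trans by blast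
      qed
    next
      fix v assume v: "v \<in> F"
      have "degree_in E (insert x (insert y I)) v \<le> degree_in E (insert c (insert c' F)) v + 0"
        by (rule degree_in_loss[where B="{w\<in>insert c (insert c' F). E v w}" and Q="{}" and X="{}"])
          (use nbin[OF _ v] fF in auto)
      moreover have "v \<in> I" using v FI by blast
      ultimately show "d \<le> degree_in E (insert c (insert c' F)) v" using dgr[of v] by simp
    next
      fix u v w assume "u \<in> F" "v \<in> F" "w \<in> F" "E u v" "E v w"
      then show "\<not> E u w" using spans_triangle_at_root[of u v w] FI by blast
    qed (rule F(2))
    from less.hyps[OF psubset_card_mono[OF fin F(1)] this] have q: "spans (path_lengths E F c c') (d - 1)" .
    obtain k where "\<forall>n\<in>path_lengths E F c c'. n + k \<in> path_lengths E I x y" using two_cut_shift[OF FI F(2) c] by blast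
    then show ?thesis using spans_shift[OF q, of k] by blast
  next
    case False
    interpret tf_rooted_min E I x y x d
    proof unfold_locales
      show "3 \<le> card (nb F)" if "F \<subset> I" "\<not> F \<subseteq> {x}" for F using False that by blast
      show "\<exists>v\<in>I. v \<noteq> x" using Ine xI by auto
      show "spans (path_lengths E' I' x' y') (d' - 2)" if "card I' < card I" "weak_rooted d' E' I' x' y' s'"
        for d' and E' :: "'a \<Rightarrow> 'a \<Rightarrow> bool" and I' x' y' s' by (rule weak_rooted_spans[OF that(2)])
      show "spans (path_lengths E' I' x' y') (d - 1)" if "card I' < card I" "tf_rooted d E' I' x' y'"
        for E' :: "'a \<Rightarrow> 'a \<Rightarrow> bool" and I' x' y' by (rule less.hyps[OF that])
      show "\<not> E u w" if "u \<in> I" "v \<in> I" "w \<in> I" "E u v" "E v w" for u v w by (rule spans_triangle_at_root[OF that])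
    qed (use dgr xI assms(1) in blast)+
    show ?thesis by (rule spans_tf_rooted_min)
  qed
qed

section \<open>Graphs containing a triangle\<close>

text \<open>A cycle is stored as a path with a closing edge: two ends and the inner vertices make
  \<open>card U + 2\<close>, and \<open>3 \<le> n\<close> excludes an edge traversed back and
  forth.\<close>

definition has_cycle_length :: "('a \<Rightarrow> 'a \<Rightarrow> bool) \<Rightarrow> nat \<Rightarrow> bool" where
  "has_cycle_length E n \<longleftrightarrow> 3 \<le> n \<and> (\<exists>U u v. exact_path E U u v \<and> E v u \<and> n = card U + 2)"

lemma has_cycle_lengthI:
  assumes "m \<in> path_lengths E A x y" "j \<in> path_lengths E B y x" "A \<inter> B = {}" "3 \<le> m + j"
  shows "has_cycle_length E (m + j)"
proof -
  obtain U where U: "U \<subseteq> A" "exact_path E U x y" "m = Suc (card U)" using assms(1) by (auto simp: path_lengths_def)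
  obtain W where W: "W \<subseteq> B" "exact_path E W y x" "j = Suc (card W)" using assms(2) by (auto simp: path_lengths_def)
  note fU = exact_path_facts[OF U(2)] and fW = exact_path_facts[OF W(2)]
  from exact_path_first[OF W(2)] show ?thesis
  proof (elim disjE bexE conjE)
    assume "W = {}" "E y x"
    then show ?thesis unfolding has_cycle_length_def using assms(4) U W by (intro conjI exI[of _ U] exI[of _ x] exI[of _ y]) auto
  next
    fix w assume w: "w \<in> W" "E y w" "exact_path E (W - {w}) w x"
    have d: "(W - {w}) \<inter> U = {}" "w \<notin> U" using U(1) W(1) assms(3) w(1) by auto
    have e: "exact_path E (insert x (W - {w} \<union> U)) w y"
      by (rule exact_path_concat[OF w(3) U(2) d(1)]) (use fU fW w d in auto)
    have "card (insert x (W - {w} \<union> U)) = Suc (card (W - {w}) + card U)"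
      using fU fW d by (simp add: card_Un_disjoint)
    also have "\<dots> = card W + card U" using card.remove[OF fW(1) w(1)] by linarith
    finally have c: "m + j = card (insert x (W - {w} \<union> U)) + 2" using U W by linarith
    show ?thesis unfolding has_cycle_length_def using assms(4) e w(2) c by blast
  qed
qed

text \<open>A length missing from \<open>A\<close> is preceded by one that is present, so the offset
  1 covers it; hence \<open>1 \<le> r\<close>. Beyond the top of the interval the offsets up to
  \<open>r\<close> prolong the run, which makes \<open>m + r + 1\<close> lengths.\<close>

lemma spans_consecutive:
  assumes "spans A m" "1 \<le> r" "k \<le> m + r + 1" "\<And>a i. a \<in> A \<Longrightarrow> i \<le> r \<Longrightarrow> C (a + t + i)"
  shows "\<exists>l. \<forall>i<k. C (l + i)"
proof -
  obtain a b where ab: "a \<in> A" "b \<in> A" "a + m \<le> b" "\<And>n. a \<le> n \<Longrightarrow> n < b \<Longrightarrow> n \<in> A \<or> Suc n \<in> A"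
    using assms(1) unfolding spans_def by blast
  have "C (a + t + i)" if i: "i < k" for i
  proof (cases "a + i < b")
    case True
    show ?thesis
    proof (cases "a + i \<in> A")
      case True
      then show ?thesis using assms(4)[of "a + i" 0] by (simp add: ac_simps)
    next
      case False
      then have "i \<noteq> 0" using ab(1) by (metis add.right_neutral)
      then obtain i' where i': "i = Suc i'" by (cases i) auto
      then have "a + i' \<in> A" using ab(4)[of "a + i'"] False \<open>a + i < b\<close> by auto
      then show ?thesis using assms(4)[of "a + i'" 1] assms(2) i' by (simp add: ac_simps)
    qed
  next
    case False
    then have "a + i - b \<le> r" using i assms(3) ab(3) by linarith
    then have "C (b + t + (a + i - b))" by (rule assms(4)[OF ab(2)])
    moreover have "b + t + (a + i - b) = a + t + i" using False by linarith
    ultimately show ?thesis by (simp only:)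
  qed
  then show ?thesis by blast
qed

lemma exact_path_clique:
  assumes "finite U" "u \<notin> U" "v \<notin> U" "u \<noteq> v" "\<And>p q. p \<in> insert u (insert v U) \<Longrightarrow> q \<in> insert u (insert v U) \<Longrightarrow> p \<noteq> q \<Longrightarrow> E p q"
  shows "exact_path E U u v"
  using assms
proof (induction U arbitrary: u rule: finite_induct)
  case empty
  then show ?case by (intro exact_path.base) auto
next
  case (insert w U)
  have "exact_path E U w v" by (rule insert.IH) (use insert in auto)
  then show ?case using insert by (intro exact_path.step) auto
qed

text \<open>2-connectedness enters as \<open>con\<close>, in the same neighbourhood form as
  \<open>cut2\<close>: a set beyond whose neighbourhood something remains has two
  neighbours.\<close>

locale dense_graph =
  fixes E :: "'a \<Rightarrow> 'a \<Rightarrow> bool" and V :: "'a set" and k :: nat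
  assumes finV: "finite V" and EV: "\<And>u v. E u v \<Longrightarrow> u \<in> V"
    and sym: "\<And>u v. E u v \<Longrightarrow> E v u" and irr: "\<And>u. \<not> E u u"
    and deg: "\<And>v. v \<in> V \<Longrightarrow> k \<le> degree_in E V v" and k6: "6 \<le> k"
    and con: "\<And>F. F \<subseteq> V \<Longrightarrow> F \<noteq> {} \<Longrightarrow> V - F - nbhd E V F \<noteq> {} \<Longrightarrow> 2 \<le> card (nbhd E V F)"
begin

text \<open>A component outside \<open>K\<close>, obtained as a smallest nonempty set with all its
  neighbours in \<open>K\<close>. It has two attachments by \<open>con\<close>, or because it is
  attached to all of \<open>K\<close>.\<close>

lemma minimal_attached_set:
  assumes "K \<subseteq> V" "2 \<le> card K" "V - K \<noteq> {}"
  shows "\<exists>D. D \<subseteq> V - K \<and> D \<noteq> {} \<and> nbhd E V D \<subseteq> K \<and> (\<forall>F. F \<subset> D \<longrightarrow> F \<noteq> {} \<longrightarrow> nbhd E D F \<noteq> {}) \<and> 2 \<le> card (nbhd E V D)"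
proof -
  let ?P = "\<lambda>D. D \<subseteq> V - K \<and> D \<noteq> {} \<and> nbhd E V D \<subseteq> K"
  have "?P (V - K)" using assms by (auto simp: nbhd_def)
  from ex_has_least_nat[of ?P, OF this, of card] obtain D where D: "?P D" "\<And>D'. ?P D' \<Longrightarrow> card D \<le> card D'" by blast
  have fD: "finite D" using D(1) finV finite_subset by blast
  have min: "nbhd E D F \<noteq> {}" if F: "F \<subset> D" "F \<noteq> {}" for F
  proof
    assume e: "nbhd E D F = {}"
    have "w \<in> K" if w: "w \<in> nbhd E V F" for w
    proof (cases "w \<in> D")
      case True
      then have "w \<in> nbhd E D F" using w by (auto simp: nbhd_def)
      then show ?thesis using e by blast
    next
      case False
      then have "w \<in> nbhd E V D" using w F(1) by (auto simp: nbhd_def)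
      then show ?thesis using D(1) by blast
    qed
    then have "?P F" using F D(1) by blast
    then show False using D(2)[of F] psubset_card_mono[OF fD F(1)] by linarith
  qed
  have "2 \<le> card (nbhd E V D)"
  proof (cases "V - D - nbhd E V D = {}")
    case True
    then have "nbhd E V D = K" using D(1) assms(1) by blast
    then show ?thesis using assms(2) by simp
  next
    case False
    then show ?thesis using con[of D] D(1) by blast
  qed
  then show ?thesis using D(1) min by blast
qed

text \<open>The sets \<open>A\<close> and \<open>B\<close> are contracted to the two roots.\<close>
lemma spans_contract_core:
  assumes D: "D \<subseteq> V" "D \<noteq> {}" "\<And>F. F \<subset> D \<Longrightarrow> F \<noteq> {} \<Longrightarrow> nbhd E D F \<noteq> {}"
    and AB: "A \<subseteq> V - D" "B \<subseteq> V - D" "A \<inter> B = {}" "nbhd E V D \<subseteq> A \<union> B" "A \<inter> nbhd E V D \<noteq> {}" "B \<inter> nbhd E V D \<noteq> {}"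
    and loss: "\<And>v. v \<in> D \<Longrightarrow> card {w\<in>A \<union> B. E v w} \<le> (if \<exists>a\<in>A. E a v then 1 else 0) + (if \<exists>b\<in>B. E b v then 1 else 0) + j"
  shows "\<exists>L. spans L (k - j - 2) \<and> (\<forall>n\<in>L. 2 \<le> n \<and> (\<exists>a\<in>A. \<exists>b\<in>B. n \<in> path_lengths E D a b))"
proof -
  obtain p q where pq: "p \<in> A" "q \<in> B" using AB by blast
  have ne: "p \<noteq> q" "p \<notin> D" "q \<notin> D" "p \<notin> B" "q \<notin> A" using pq AB by auto
  have fD: "finite D" using D(1) finV finite_subset by blast
  \<comment> \<open>Edges not meeting \<open>D\<close> are dropped, so every length obtained comes
    from a path with an inner vertex in \<open>D\<close>; this gives
    \<open>2 \<le> n\<close>.\<close>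
  define E0 where "E0 u w \<longleftrightarrow> E u w \<and> (u \<in> D \<or> w \<in> D)" for u w
  define E1 where "E1 = reroot E0 q {w. \<exists>b\<in>B. E0 b w}"
  define E2 where "E2 = reroot E1 p {w. \<exists>a\<in>A. E1 a w}"
  interpret r0: two_rooted E0 D q p by unfold_locales (use fD ne irr in \<open>auto simp: E0_def intro: sym\<close>)
  interpret r1: two_rooted E1 D q p unfolding E1_def by (rule r0.reroot_two_rooted) simp
  interpret r1': two_rooted E1 D p q by (rule r1.swap)
  interpret r2: two_rooted E2 D p q unfolding E2_def by (rule r1'.reroot_two_rooted) simp
  have e0: "E0 u w = E u w" if "u \<in> D \<or> w \<in> D" for u w using that by (simp add: E0_def)
  have e1: "E1 u w = E u w" if "u \<in> D \<or> w \<in> D" "u \<noteq> q" "w \<noteq> q" for u w using that e0 by (auto simp: E1_def reroot_def)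
  have e1q: "E1 v q \<longleftrightarrow> (\<exists>b\<in>B. E b v)" if "v \<in> D" for v using that e0 ne by (auto simp: E1_def reroot_def)
  have e2D: "E2 v w = E v w" if "v \<in> D" "w \<in> D" for v w
  proof -
    have "v \<noteq> p" "w \<noteq> p" "v \<noteq> q" "w \<noteq> q" using that ne by auto
    then show ?thesis using e1[of v w] that by (simp add: E2_def reroot_def)
  qed
  have e2p: "E2 v p \<longleftrightarrow> (\<exists>a\<in>A. E a v)" if "v \<in> D" for v
  proof -
    have v: "v \<noteq> p" "v \<noteq> q" using that ne by auto
    have "E2 v p \<longleftrightarrow> (\<exists>a\<in>A. E1 a v)" using v by (simp add: E2_def reroot_def)
    also have "\<dots> \<longleftrightarrow> (\<exists>a\<in>A. E a v)" using e1[of _ v] that v ne by (metis)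
    finally show ?thesis .
  qed
  have e2q: "E2 v q \<longleftrightarrow> (\<exists>b\<in>B. E b v)" if "v \<in> D" for v
  proof -
    have v: "v \<noteq> p" using that ne by auto
    then show ?thesis using e1q[OF that] ne by (simp add: E2_def reroot_def)
  qed
  have AV: "nbhd E V F \<subseteq> nbhd E D F \<union> A \<union> B" if "F \<subseteq> D" for F
  proof
    fix w assume w: "w \<in> nbhd E V F"
    show "w \<in> nbhd E D F \<union> A \<union> B"
    proof (cases "w \<in> D")
      case True
      then show ?thesis using w by (auto simp: nbhd_def)
    next
      case False
      then have "w \<in> nbhd E V D" using w that by (auto simp: nbhd_def)
      then show ?thesis using AB(4) by blast
    qed
  qed
  have nbD: "nbhd E D F \<subseteq> r2.nb F" if "F \<subseteq> D" for F using that e2D unfolding nbhd_def by blast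
  have nbp: "p \<in> r2.nb F" if F: "F \<subseteq> D" "a \<in> A" "a \<in> nbhd E V F" for F a
  proof -
    obtain f where f: "f \<in> F" "E f a" using F by (auto simp: nbhd_def)
    then have "E2 f p" using e2p[of f] F sym[of f a] by blast
    moreover have "p \<notin> F" using F ne by blast
    ultimately show ?thesis using f by (auto simp: nbhd_def)
  qed
  have nbq: "q \<in> r2.nb F" if F: "F \<subseteq> D" "a \<in> B" "a \<in> nbhd E V F" for F a
  proof -
    obtain f where f: "f \<in> F" "E f a" using F by (auto simp: nbhd_def)
    then have "E2 f q" using e2q[of f] F sym[of f a] by blast
    moreover have "q \<notin> F" using F ne by blast
    ultimately show ?thesis using f by (auto simp: nbhd_def)
  qed
  \<comment> \<open>Naming \<open>p\<close>, which lies outside \<open>D\<close>, as the exceptional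
    vertex expresses that there is none.\<close>
  have "weak_rooted (k - j) E2 D p q p" unfolding weak_rooted_def
  proof (intro conjI allI impI ballI)
    show "two_rooted E2 D p q" by (rule r2.two_rooted_axioms)
  next
    fix v assume v: "v \<in> D" "v \<noteq> p"
    let ?X = "{w\<in>{p, q}. E2 v w}"
    have fAB: "finite (A \<union> B)" using AB finV by (meson Diff_subset finite_UnI finite_subset subset_trans)
    have X: "card ?X = (if \<exists>a\<in>A. E a v then 1 else 0) + (if \<exists>b\<in>B. E b v then 1 else 0)"
    proof -
      have "?X = (if \<exists>a\<in>A. E a v then {p} else {}) \<union> (if \<exists>b\<in>B. E b v then {q} else {})"
        using e2p[OF v(1)] e2q[OF v(1)] by auto
      then show ?thesis using ne(1) by auto
    qed
    have "degree_in E V v \<le> degree_in E2 (insert p (insert q D)) v + j"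
    proof (rule degree_in_loss[where B="{w\<in>D. E v w}" and Q="{w\<in>A \<union> B. E v w}" and X="?X"])
      show "{w \<in> V. E v w} \<subseteq> {w \<in> D. E v w} \<union> {w \<in> A \<union> B. E v w}"
      proof
        fix w assume w: "w \<in> {w \<in> V. E v w}"
        then have "w \<in> D \<or> w \<in> nbhd E V D" using v by (auto simp: nbhd_def)
        then show "w \<in> {w \<in> D. E v w} \<union> {w \<in> A \<union> B. E v w}" using w AB(4) by blast
      qed
      show "{w \<in> D. E v w} \<subseteq> {w \<in> insert p (insert q D). E2 v w}" using e2D[OF v(1)] by auto
      show "{w \<in> D. E v w} \<inter> ?X = {}" using ne by auto
      show "card {w \<in> A \<union> B. E v w} \<le> card ?X + j" using loss[OF v(1)] unfolding X .
    qed (use fD fAB in auto)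
    moreover have "v \<in> V" using v D by blast
    ultimately show "k - j \<le> degree_in E2 (insert p (insert q D)) v" using deg[of v] by linarith
  next
    fix F assume F: "F \<subseteq> D" "\<not> F \<subseteq> {p}"
    have Fne: "F \<noteq> {}" using F by auto
    show "2 \<le> card (r2.nb F)"
    proof (cases "F = D")
      case True
      obtain a b where "a \<in> A" "a \<in> nbhd E V F" "b \<in> B" "b \<in> nbhd E V F" using AB unfolding True by blast
      then have "p \<in> r2.nb F" "q \<in> r2.nb F" using nbp[OF F(1)] nbq[OF F(1)] by blast+
      then show ?thesis using card_ge2I[OF _ _ ne(1) r2.finite_nb] by blast
    next
      case False
      then obtain c where c: "c \<in> nbhd E D F" using D(3)[of F] F(1) Fne by blast
      have c1: "c \<in> r2.nb F" "c \<noteq> p" "c \<noteq> q" using c nbD[OF F(1)] ne by (auto simp: nbhd_def)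
      show ?thesis
      proof (cases "nbhd E V F \<subseteq> nbhd E D F")
        case True
        have "p \<in> V" "p \<notin> F" "p \<notin> nbhd E V F" using pq AB True F ne by (auto simp: nbhd_def)
        then have "V - F - nbhd E V F \<noteq> {}" by blast
        then have "2 \<le> card (nbhd E V F)" using con[of F] F D(1) Fne by blast
        moreover have "nbhd E V F \<subseteq> r2.nb F" using True nbD[OF F(1)] by blast
        ultimately show ?thesis using card_mono[OF r2.finite_nb] le_trans by blast
      next
        case False
        then obtain a where "a \<in> nbhd E V F" "a \<in> A \<union> B" using AV[OF F(1)] by blast
        then have "p \<in> r2.nb F \<or> q \<in> r2.nb F" using nbp[OF F(1)] nbq[OF F(1)] by blast
        then show ?thesis using card_ge2I[OF c1(1) _ _ r2.finite_nb] c1 by blast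
      qed
    qed
  next
    show "\<exists>v\<in>D. v \<noteq> p" using D(2) ne by auto
  next
    fix c assume "D = {p, c}"
    then show "2 \<le> card (r2.nb {p})" using ne by blast
  qed
  from weak_rooted_spans[OF this] have q: "spans (path_lengths E2 D p q) (k - j - 2)" .
  have "2 \<le> n \<and> (\<exists>a\<in>A. \<exists>b\<in>B. n \<in> path_lengths E D a b)" if n: "n \<in> path_lengths E2 D p q" for n
  proof -
    have "\<exists>a\<in>A. n \<in> path_lengths E1 D a q" by (rule reroot_path_lengths_root[OF n[unfolded E2_def]]) (use AB ne in auto)
    then obtain a where a: "a \<in> A" "n \<in> path_lengths E1 D a q" by blast
    then have n1: "n \<in> path_lengths E1 D q a" using path_lengths_sym[of E1 D a q] r1.sym by blast
    have "\<exists>b\<in>B. n \<in> path_lengths E0 D b a" by (rule reroot_path_lengths_root[OF n1[unfolded E1_def]]) (use AB a in auto)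
    then obtain b where b: "b \<in> B" "n \<in> path_lengths E0 D b a" by blast
    then have "n \<in> path_lengths E0 D a b" using path_lengths_sym[of E0 D a b] r0.sym by blast
    then obtain U where U: "U \<subseteq> D" "exact_path E0 U a b" "n = Suc (card U)" by (auto simp: path_lengths_def)
    have abD: "a \<notin> D" "b \<notin> D" using a b AB by auto
    have "U \<noteq> {}"
    proof
      assume "U = {}"
      then have "E0 a b" using exact_path_first[OF U(2)] by auto
      then show False using abD by (auto simp: E0_def)
    qed
    then have "card U \<noteq> 0" using exact_path_facts(1)[OF U(2)] by simp
    moreover have "exact_path E U a b" by (rule exact_path_cong[OF U(2)]) (simp add: E0_def)
    ultimately show ?thesis using U a(1) b(1) path_lengthsI[OF U(1) _ U(3), of E a b] by auto
  qed
  then show ?thesis using q by blast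
qed

text \<open>The balance between degrees and core: a loss of \<open>j\<close> leaves span
  \<open>k - j - 2\<close>, the core supplies the lengths from \<open>t\<close> to
  \<open>t + j + 1\<close>, and \<open>spans_consecutive\<close> with \<open>r = j + 1\<close> gives
  \<open>k\<close> lengths.\<close>

lemma core_cycles:
  assumes D: "D \<subseteq> V - K" "D \<noteq> {}" "\<And>F. F \<subset> D \<Longrightarrow> F \<noteq> {} \<Longrightarrow> nbhd E D F \<noteq> {}"
    and AB: "K \<subseteq> V" "A \<subseteq> K" "B \<subseteq> K" "A \<inter> B = {}" "nbhd E V D \<subseteq> A \<union> B" "A \<inter> nbhd E V D \<noteq> {}" "B \<inter> nbhd E V D \<noteq> {}"
    and loss: "\<And>v. v \<in> D \<Longrightarrow> card {w\<in>A \<union> B. E v w} \<le> (if \<exists>a\<in>A. E a v then 1 else 0) + (if \<exists>b\<in>B. E b v then 1 else 0) + j"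
    and path: "\<And>a b i. a \<in> A \<Longrightarrow> b \<in> B \<Longrightarrow> i \<le> Suc j \<Longrightarrow> t + i \<in> path_lengths E K b a" and t: "1 \<le> t"
  shows "\<exists>l. \<forall>i<k. has_cycle_length E (l + i)"
proof -
  have D': "D \<subseteq> V" "A \<subseteq> V - D" "B \<subseteq> V - D" using D AB by auto
  obtain L where L: "spans L (k - j - 2)" "\<And>n. n \<in> L \<Longrightarrow> 2 \<le> n \<and> (\<exists>a\<in>A. \<exists>b\<in>B. n \<in> path_lengths E D a b)"
    using spans_contract_core[OF D'(1) D(2,3) D'(2,3) AB(4-7) loss] by blast
  show ?thesis
  proof (rule spans_consecutive[OF L(1), of "Suc j" k _ t])
    fix n i assume n: "n \<in> L" and i: "i \<le> Suc j"
    obtain a b where a: "2 \<le> n" "a \<in> A" "b \<in> B" "n \<in> path_lengths E D a b" using L(2)[OF n] by blast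
    have "has_cycle_length E (n + (t + i))"
      by (rule has_cycle_lengthI[OF a(4) path[OF a(2,3) i]]) (use D(1) a(1) t in auto)
    then show "has_cycle_length E (n + t + i)" by (simp add: add.assoc)
  qed auto
qed

section \<open>Cliques, diamonds and triangles as cores\<close>

definition "clique K \<longleftrightarrow> K \<subseteq> V \<and> (\<forall>u\<in>K. \<forall>v\<in>K. u \<noteq> v \<longrightarrow> E u v)"

lemma clique_path_lengths:
  assumes "clique K" "u \<in> K" "v \<in> K" "u \<noteq> v" "1 \<le> j" "j < card K"
  shows "j \<in> path_lengths E K u v"
proof -
  have fK: "finite K" using assms(1) finV finite_subset by (auto simp: clique_def)
  have "card (K - {u, v}) = card K - 2" using assms fK by (simp add: card_Diff_subset)
  then have "j - 1 \<le> card (K - {u, v})" using assms by linarith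
  then obtain U where U: "U \<subseteq> K - {u, v}" "card U = j - 1" using obtain_subset_with_card_n[of "j - 1" "K - {u, v}"] by metis
  have fU: "finite U" using U fK finite_subset by blast
  have "exact_path E U u v" by (rule exact_path_clique[OF fU]) (use assms U in \<open>auto simp: clique_def\<close>)
  then show ?thesis using U assms(5) by (intro path_lengthsI[of U]) auto
qed

text \<open>Take a maximum clique \<open>K\<close> and \<open>j = card K - 3\<close>. An outside
  vertex misses some vertex of \<open>K\<close>, so it loses at most \<open>card K - 1\<close> and,
  if it sees both sides, is refunded two. Inside \<open>K\<close> any two vertices are joined by
  paths of all lengths from 1 to \<open>card K - 1\<close>, just enough for this
  \<open>j\<close>.\<close>

lemma clique_case:
  assumes "clique K0" "4 \<le> card K0" and nc: "\<not> (clique V \<and> card V = k + 1)"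
  shows "\<exists>l. \<forall>i<k. has_cycle_length E (l + i)"
proof -
  have "\<forall>y. clique y \<longrightarrow> card y < Suc (card V)" using card_mono[OF finV] by (auto simp: clique_def less_Suc_eq_le)
  from ex_has_greatest_nat[OF assms(1) this] obtain K where K: "clique K" "\<And>K'. clique K' \<Longrightarrow> card K' \<le> card K" by blast
  have K4: "4 \<le> card K" using K(2)[OF assms(1)] assms(2) by linarith
  have KV: "K \<subseteq> V" using K(1) by (simp add: clique_def)
  have fK: "finite K" using KV finV finite_subset by blast
  show ?thesis
  proof (cases "V - K = {}")
    case True
    then have VK: "V = K" using KV by blast
    obtain u where u: "u \<in> V" using K4 VK by fastforce
    have "k \<le> card {w\<in>V. E u w}" using deg[OF u] by (simp add: degree_in_def)
    also have "\<dots> \<le> card (V - {u})" by (rule card_mono) (use finV irr in auto)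
    also have "\<dots> = card V - 1" using u finV by simp
    finally have "k + 1 \<le> card V" using K4 unfolding VK by linarith
    \<comment> \<open>A complete graph other than the excluded one has at least \<open>k + 2\<close>
      vertices and hence cycles of all lengths from 3 to \<open>k + 2\<close>.\<close>
    then have big: "k + 2 \<le> card V" using nc K(1) VK by auto
    obtain v where v: "v \<in> V" "v \<noteq> u"
    proof -
      have "\<not> V \<subseteq> {u}" using big card_le1I[of V u] by linarith
      then show ?thesis using that by blast
    qed
    have uv: "E v u" using K(1)[unfolded clique_def] u v unfolding VK by blast
    have "has_cycle_length E (3 + i)" if "i < k" for i
    proof -
      have "2 + i \<in> path_lengths E V u v" by (rule clique_path_lengths) (use K(1) VK u v that big in auto)
      moreover have "1 \<in> path_lengths E {} v u" using path_lengths_1[of E v u "{}"] uv v(2) by blast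
      ultimately have "has_cycle_length E (2 + i + 1)" by (rule has_cycle_lengthI) auto
      then show ?thesis by (simp add: numeral_eq_Suc)
    qed
    then show ?thesis by blast
  next
    case False
    from minimal_attached_set[OF KV _ this] K4 obtain D where D: "D \<subseteq> V - K" "D \<noteq> {}" "nbhd E V D \<subseteq> K"
      "\<And>F. F \<subset> D \<Longrightarrow> F \<noteq> {} \<Longrightarrow> nbhd E D F \<noteq> {}" "2 \<le> card (nbhd E V D)" by auto
    obtain a1 a2 where a: "a1 \<in> nbhd E V D" "a2 \<in> nbhd E V D" "a1 \<noteq> a2" using card_ge2E[OF D(5)] by blast
    have aK: "a1 \<in> K" "a2 \<in> K" using a D(3) by auto
    have "\<not> K \<subseteq> {a1, a2}" using K4 card_le2I[of K a1 a2] by linarith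
    then obtain e where e: "e \<in> K" "e \<noteq> a1" "e \<noteq> a2" by blast
    \<comment> \<open>Both sides contain an attached vertex. The sizes 2 and
      \<open>card K - 2\<close> keep the loss within \<open>card K - 3\<close> also for a vertex
      that sees one side only, which uses \<open>4 \<le> card K\<close>.\<close>
    define A where "A = {a1, e}"
    define B where "B = K - A"
    have AK: "A \<subseteq> K" "B \<subseteq> K" "A \<inter> B = {}" "A \<union> B = K" using aK e by (auto simp: A_def B_def)
    have cA: "card A = 2" using e by (simp add: A_def)
    have fAB: "finite A" "finite B" using AK fK finite_subset by blast+
    have cAB: "card A + card B = card K" using card_Un_disjoint[OF fAB AK(3)] AK(4) by simp
    show ?thesis
    proof (rule core_cycles[OF D(1,2,4) KV AK(1-3), of "card K - 3" 1])
      show "nbhd E V D \<subseteq> A \<union> B" using D(3) AK(4) by simp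
      show "A \<inter> nbhd E V D \<noteq> {}" using a by (auto simp: A_def)
      show "B \<inter> nbhd E V D \<noteq> {}" using a aK e by (auto simp: A_def B_def)
      fix v assume v: "v \<in> D"
      have vK: "v \<notin> K" "v \<in> V" using v D(1) by auto
      let ?N = "\<lambda>S. {w\<in>S. E v w}"
      have ex: "(\<exists>a\<in>S. E a v) \<longleftrightarrow> ?N S \<noteq> {}" for S using sym by blast
      have NK: "?N K \<noteq> K"
      proof
        assume h: "?N K = K"
        have "clique (insert v K)" unfolding clique_def
        proof (intro conjI ballI impI)
          fix p q assume pq: "p \<in> insert v K" "q \<in> insert v K" "p \<noteq> q"
          have vw: "E v w" "E w v" if "w \<in> K" for w using h that sym by blast+
          show "E p q" using pq vw K(1) unfolding clique_def by blast
        qed (use KV vK in auto)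
        then show False using K(2)[of "insert v K"] fK vK by simp
      qed
      then have "?N K \<subset> K" by blast
      then have lt: "card (?N K) < card K" using psubset_card_mono[OF fK] by blast
      have sp: "card (?N K) = card (?N A) + card (?N B)"
      proof -
        have "?N K = ?N A \<union> ?N B" "?N A \<inter> ?N B = {}" using AK(3,4) by blast+
        then show ?thesis using card_Un_disjoint[of "?N A" "?N B"] fAB by simp
      qed
      have le: "card (?N A) \<le> card A" "card (?N B) \<le> card B" by (rule card_mono; use fAB in auto)+
      show "card {w\<in>A \<union> B. E v w} \<le> (if \<exists>a\<in>A. E a v then 1 else 0) + (if \<exists>b\<in>B. E b v then 1 else 0) + (card K - 3)"
      proof (cases "?N A = {} \<or> ?N B = {}")
        case True
        have "card (?N K) \<le> (if ?N A \<noteq> {} then 1 else 0) + (if ?N B \<noteq> {} then 1 else 0) + (card K - 3)"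
        proof (cases "?N A = {}")
          case True
          then have "card (?N A) = 0" by (simp only: card.empty)
          moreover have "card (?N B) = 0" if "?N B = {}" using that by (simp only: card.empty)
          ultimately show ?thesis using sp le cA cAB K4 by auto
        next
          case False
          then have "?N B = {}" using True by blast
          then have "card (?N B) = 0" by (simp only: card.empty)
          then show ?thesis using sp le cA cAB K4 False by auto
        qed
        then show ?thesis unfolding AK(4) ex .
      next
        case False
        have "card (?N K) \<le> 1 + 1 + (card K - 3)" using lt K4 by linarith
        then show ?thesis using False unfolding AK(4) ex by simp
      qed
    next
      fix p q i assume "p \<in> A" "q \<in> B" and i: "i \<le> Suc (card K - 3)"
      then have "p \<in> K" "q \<in> K" "p \<noteq> q" using AK by blast+
      then show "1 + i \<in> path_lengths E K q p" using i K4 by (intro clique_path_lengths[OF K(1)]) auto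
    qed auto
  qed
qed

lemmas path_lengths_edge = irrefl_path_lengths_1[of E, OF irr]
lemmas path_lengths_two = irrefl_path_lengths_2[of E, OF irr]
lemmas path_lengths_three = irrefl_path_lengths_3[of E, OF irr]

lemma card_V_gt_six: assumes "v \<in> V" shows "6 < card V"
proof -
  have "6 \<le> card {w\<in>V. E v w}" using deg[OF assms] k6 by (simp add: degree_in_def)
  also have "\<dots> \<le> card (V - {v})" by (rule card_mono) (use finV irr in auto)
  finally show ?thesis using card.remove[OF finV assms] by linarith
qed

text \<open>Two triangles share the edge \<open>a a'\<close>. Between the sides
  \<open>{s, s'}\<close> and \<open>{a, a'}\<close> there are paths of lengths 1, 2 and 3, so a loss
  of one is affordable; and without a clique of size four an outside vertex sees at most three
  vertices of the diamond. If the rest is attached within one side, the two vertices of that side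
  are the roots and nothing is lost.\<close>

lemma diamond_case:
  assumes K4: "\<And>K. clique K \<Longrightarrow> \<not> 4 \<le> card K"
    and e: "E a a'" "E a s" "E a s'" "E a' s" "E a' s'" "s \<noteq> s'"
  shows "\<exists>l. \<forall>i<k. has_cycle_length E (l + i)"
proof -
  have e': "E a' a" "E s a" "E s' a" "E s a'" "E s' a'" using e sym by blast+
  have ne: "a \<noteq> a'" "a \<noteq> s" "a \<noteq> s'" "a' \<noteq> s" "a' \<noteq> s'" using e irr by auto
  have k4: False if "E v a" "E v a'" "E v w" "E w a" "E w a'" for v w
  proof -
    have "clique {v, w, a, a'}" using that that[THEN sym] e(1) e'(1) EV[of v] EV[of w] EV[OF e(1)] EV[OF e'(1)] by (auto simp: clique_def)
    moreover have "v \<noteq> w" "v \<noteq> a" "v \<noteq> a'" "w \<noteq> a" "w \<noteq> a'" using that irr by auto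
    then have "card {v, w, a, a'} = 4" using ne(1) by simp
    ultimately show False using K4[of "{v, w, a, a'}"] by simp
  qed
  define K where "K = {a, a', s, s'}"
  have KV: "K \<subseteq> V" using EV[OF e(1)] EV[OF e'(1)] EV[OF e'(2)] EV[OF e'(3)] by (auto simp: K_def)
  have cK: "card K = 4" using ne e(6) by (simp add: K_def)
  have "V - K \<noteq> {}"
  proof
    assume "V - K = {}"
    then have "card V \<le> 4" using card_mono[of K V] cK by (simp add: K_def)
    then show False using card_V_gt_six[OF EV[OF e(1)]] by simp
  qed
  from minimal_attached_set[OF KV _ this] cK obtain D where D: "D \<subseteq> V - K" "D \<noteq> {}" "nbhd E V D \<subseteq> K"
    "\<And>F. F \<subset> D \<Longrightarrow> F \<noteq> {} \<Longrightarrow> nbhd E D F \<noteq> {}" "2 \<le> card (nbhd E V D)" by auto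
  have two: ?thesis if pq: "nbhd E V D \<subseteq> {p, q}" "p \<in> K" "q \<in> K" "p \<noteq> q" and t: "1 \<le> t" "t \<in> path_lengths E K q p" "Suc t \<in> path_lengths E K q p" for p q t
  proof -
    have "p \<in> nbhd E V D" "q \<in> nbhd E V D"
    proof -
      obtain u v where "u \<in> nbhd E V D" "v \<in> nbhd E V D" "u \<noteq> v" using card_ge2E[OF D(5)] by blast
      then show "p \<in> nbhd E V D" "q \<in> nbhd E V D" using pq(1) by blast+
    qed
    then show ?thesis
    proof (intro core_cycles[OF D(1,2,4) KV, of "{p}" "{q}" 0 t])
      fix v
      have "{w \<in> {p} \<union> {q}. E v w} = (if E p v then {p} else {}) \<union> (if E q v then {q} else {})" using sym by auto
      then show "card {w \<in> {p} \<union> {q}. E v w} \<le> (if \<exists>a\<in>{p}. E a v then 1 else 0) + (if \<exists>b\<in>{q}. E b v then 1 else 0) + 0"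
        using pq(4) by auto
    next
      fix a b i assume "a \<in> {p}" "b \<in> {q}" "i \<le> Suc 0"
      then show "t + i \<in> path_lengths E K b a" using t by (cases i) auto
    qed (use pq t in auto)
  qed
  show ?thesis
  proof (cases "nbhd E V D \<subseteq> {a, a'}")
    case True
    show ?thesis
    proof (rule two[OF True])
      show "1 \<in> path_lengths E K a' a" by (rule path_lengths_edge[OF e'(1)])
      have "2 \<in> path_lengths E K a' a" by (rule path_lengths_two[of a' s]) (use e e' ne in \<open>auto simp: K_def\<close>)
      then show "Suc 1 \<in> path_lengths E K a' a" by (simp add: numeral_2_eq_2)
    qed (use ne in \<open>auto simp: K_def\<close>)
  next
    case nT: False
    show ?thesis
    proof (cases "nbhd E V D \<subseteq> {s, s'}")
      case True
      show ?thesis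
      proof (rule two[OF True])
        show "2 \<in> path_lengths E K s' s" by (rule path_lengths_two[of s' a]) (use e e' ne in \<open>auto simp: K_def\<close>)
        have "3 \<in> path_lengths E K s' s" by (rule path_lengths_three[of s' a a']) (use e e' ne in \<open>auto simp: K_def\<close>)
        then show "Suc 2 \<in> path_lengths E K s' s" by (simp add: numeral_3_eq_3 numeral_2_eq_2)
      qed (use e(6) in \<open>auto simp: K_def\<close>)
    next
      case nS: False
      show ?thesis
      proof (rule core_cycles[OF D(1,2,4) KV, of "{s, s'}" "{a, a'}" 1 1])
        show "nbhd E V D \<subseteq> {s, s'} \<union> {a, a'}" using D(3) by (auto simp: K_def)
        show "{s, s'} \<inter> nbhd E V D \<noteq> {}" "{a, a'} \<inter> nbhd E V D \<noteq> {}" using nT nS D(3)[unfolded K_def] by blast+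
        fix v assume v: "v \<in> D"
        let ?N = "{w \<in> {s, s'} \<union> {a, a'}. E v w}"
        have k1: "\<not> (E v a \<and> E v a' \<and> E v s)" "\<not> (E v a \<and> E v a' \<and> E v s')"
          using k4[of v s] k4[of v s'] e' by blast+
        have ex: "(\<exists>w\<in>{p, q}. E w v) \<longleftrightarrow> E v p \<or> E v q" for p q using sym by auto
        show "card ?N \<le> (if \<exists>a\<in>{s, s'}. E a v then 1 else 0) + (if \<exists>b\<in>{a, a'}. E b v then 1 else 0) + 1"
        proof (cases "(E v s \<or> E v s') \<and> (E v a \<or> E v a')")
          case True
          have "\<exists>p q r. ?N \<subseteq> {p, q, r}" using k1 by blast
          then obtain p q r where "?N \<subseteq> {p, q, r}" by blast
          then have "card ?N \<le> card {p, q, r}" by (intro card_mono) auto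
          also have "\<dots> \<le> 3" by (simp add: card_insert_if)
          finally show ?thesis using True unfolding ex by simp
        next
          case False
          show ?thesis
          proof (cases "E v s \<or> E v s'")
            case True
            then have "?N \<subseteq> {s, s'}" using False by blast
            then show ?thesis using card_le2I[of ?N s s'] True unfolding ex by simp
          next
            case n1: False
            then have N: "?N \<subseteq> {a, a'}" by blast
            show ?thesis
            proof (cases "E v a \<or> E v a'")
              case True
              then show ?thesis using card_le2I[OF N] unfolding ex by simp
            next
              case False
              then have "?N = {}" using N by blast
              then have "card ?N = 0" by (simp only: card.empty)
              then show ?thesis by (simp only: le0)
            qed
          qed
        qed
      next
        fix p q i assume p: "p \<in> {s, s'}" and q: "q \<in> {a, a'}" and i: "i \<le> Suc 1"
        have "\<exists>p'\<in>{s, s'}. p' \<noteq> p" "\<exists>q'\<in>{a, a'}. q' \<noteq> q" using p q e(6) ne(1) by auto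
        then obtain p' q' where p': "p' \<in> {s, s'}" "p' \<noteq> p" and q': "q' \<in> {a, a'}" "q' \<noteq> q" by blast
        have qp: "E q p" "E q p'" "E q' p" "E q' p'" "E p' q" "E p' q'" "E q q'" using p q p' q' e e' by auto
        have inK: "p' \<in> K" "q' \<in> K" using p' q' by (auto simp: K_def)
        have 1: "1 \<in> path_lengths E K q p" by (rule path_lengths_edge[OF qp(1)])
        have 2: "2 \<in> path_lengths E K q p" by (rule path_lengths_two[OF qp(7,3)]) (use qp(1) irr inK in auto)
        have 3: "3 \<in> path_lengths E K q p" by (rule path_lengths_three[OF qp(2,6,3)]) (use qp(1) irr inK p' q' in auto)
        have "i = 0 \<or> i = 1 \<or> i = 2" using i by auto
        then show "1 + i \<in> path_lengths E K q p" using 1 2 3 by (auto simp: numeral_3_eq_3 numeral_2_eq_2)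
      qed (use ne in \<open>auto simp: K_def\<close>)
    qed
  qed
qed

text \<open>The densest available core is taken, because the absence of denser ones bounds how much
  of it an outside vertex sees. Without diamonds this is at most one vertex of a triangle, so
  nothing is lost and the lengths 1 and 2 inside the triangle suffice.\<close>

lemma triangle_case:
  assumes e: "E a1 a2" "E a2 a3" "E a1 a3" and nc: "\<not> (clique V \<and> card V = k + 1)"
  shows "\<exists>l. \<forall>i<k. has_cycle_length E (l + i)"
proof (cases "\<exists>K. clique K \<and> 4 \<le> card K")
  case True
  then show ?thesis using clique_case nc by blast
next
  case n4: False
  show ?thesis
  proof (cases "\<exists>a a' s s'. E a a' \<and> E a s \<and> E a s' \<and> E a' s \<and> E a' s' \<and> s \<noteq> s'")
    case True
    then obtain a a' s s' where ee: "E a a'" "E a s" "E a s'" "E a' s" "E a' s'" "s \<noteq> s'" by blast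
    show ?thesis by (rule diamond_case[OF _ ee]) (use n4 in blast)
  next
    case nd: False
    have e': "E a2 a1" "E a3 a2" "E a3 a1" using e sym by blast+
    have ne: "a1 \<noteq> a2" "a2 \<noteq> a3" "a1 \<noteq> a3" using e irr by auto
    define K where "K = {a1, a2, a3}"
    have KE: "E u v" if "u \<in> K" "v \<in> K" "u \<noteq> v" for u v using that e e' by (auto simp: K_def)
    have KV: "K \<subseteq> V" using EV[OF e(1)] EV[OF e(2)] EV[OF e'(2)] by (auto simp: K_def)
    have cK: "card K = 3" using ne by (simp add: K_def)
    have "V - K \<noteq> {}"
    proof
      assume "V - K = {}"
      then have "card V \<le> 3" using card_mono[of K V] cK by (simp add: K_def)
      then show False using card_V_gt_six[OF EV[OF e(1)]] by simp
    qed
    from minimal_attached_set[OF KV _ this] cK obtain D where D: "D \<subseteq> V - K" "D \<noteq> {}" "nbhd E V D \<subseteq> K"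
      "\<And>F. F \<subset> D \<Longrightarrow> F \<noteq> {} \<Longrightarrow> nbhd E D F \<noteq> {}" "2 \<le> card (nbhd E V D)" by auto
    obtain p q where pq: "p \<in> nbhd E V D" "q \<in> nbhd E V D" "p \<noteq> q" using card_ge2E[OF D(5)] by blast
    have pK: "p \<in> K" "q \<in> K" using pq D(3) by auto
    have un: "u = w" if v: "v \<in> D" and "E v u" "E v w" "u \<in> K" "w \<in> K" for u v w
    proof (rule ccontr)
      assume uw: "u \<noteq> w"
      have "\<not> K \<subseteq> {u, w}" using cK card_le2I[of K u w] by linarith
      then obtain z where z: "z \<in> K" "z \<noteq> u" "z \<noteq> w" by blast
      have "v \<noteq> z" using v z D(1) by blast
      then show False using nd KE[OF that(4,5) uw] KE[OF that(4) z(1)] KE[OF that(5) z(1)] z sym[OF that(2)] sym[OF that(3)] by blast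
    qed
    show ?thesis
    proof (rule core_cycles[OF D(1,2,4) KV, of "{p}" "K - {p}" 0 1])
      show "nbhd E V D \<subseteq> {p} \<union> (K - {p})" using D(3) by auto
      show "(K - {p}) \<inter> nbhd E V D \<noteq> {}" using pq pK by blast
      fix v assume v: "v \<in> D"
      let ?N = "{w \<in> {p} \<union> (K - {p}). E v w}"
      show "card ?N \<le> (if \<exists>a\<in>{p}. E a v then 1 else 0) + (if \<exists>b\<in>K - {p}. E b v then 1 else 0) + 0"
      proof (cases "?N = {}")
        case True
        then have "card ?N = 0" by (simp only: card.empty)
        then show ?thesis by (simp only: le0)
      next
        case False
        then obtain u where u: "u \<in> ?N" by blast
        have "?N \<subseteq> {u}" using un[OF v] u pK by blast
        then have c: "card ?N \<le> 1" by (rule card_le1I)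
        have "(\<exists>a\<in>{p}. E a v) \<or> (\<exists>b\<in>K - {p}. E b v)" using u sym[of v u] by blast
        then show ?thesis using c by auto
      qed
    next
      fix u w i assume a: "u \<in> {p}" "w \<in> K - {p}" "i \<le> Suc 0"
      have uw: "u \<in> K" "w \<in> K" "w \<noteq> u" using a pK by auto
      have 1: "1 \<in> path_lengths E K w u" by (rule path_lengths_edge[OF KE[OF uw(2,1,3)]])
      have "\<not> K \<subseteq> {u, w}" using cK card_le2I[of K u w] by linarith
      then obtain z where z: "z \<in> K" "z \<noteq> u" "z \<noteq> w" by blast
      have 2: "2 \<in> path_lengths E K w u" by (rule path_lengths_two[of w z]) (use KE z uw in auto)
      have "i = 0 \<or> i = 1" using a by auto
      then show "1 + i \<in> path_lengths E K w u" using 1 2 by (auto simp: numeral_2_eq_2)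
    qed (use pK pq in auto)
  qed
qed

end

section \<open>Triangle-free graphs: a shortest non-separating induced odd cycle\<close>

lemma dvd_small_eq_0: "int n dvd z \<Longrightarrow> \<bar>z\<bar> < int n \<Longrightarrow> z = 0"
  using dvd_imp_le_int[of z "int n"] by fastforce

context dense_graph begin

text \<open>A periodic map on the integers lets arcs wrap around without case distinctions and turns
  distances on the cycle into divisibility by \<open>n\<close>. The last clause contains both the
  edges of the cycle and the absence of chords.\<close>

definition "induced_cycle_map c n \<longleftrightarrow> 3 \<le> n \<and> range c \<subseteq> V \<and> (\<forall>i j. c i = c j \<longleftrightarrow> int n dvd j - i)
  \<and> (\<forall>i j. E (c i) (c j) \<longleftrightarrow> int n dvd j - i - 1 \<or> int n dvd j - i + 1)"

definition "cut_connected H \<longleftrightarrow> (\<forall>F. F \<subseteq> H \<longrightarrow> F \<noteq> {} \<longrightarrow> F \<noteq> H \<longrightarrow> nbhd E H F \<noteq> {})"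

end

locale shortest_odd_cycle = dense_graph +
  fixes c :: "int \<Rightarrow> 'a" and n :: nat
  assumes tf: "\<And>u v w. E u v \<Longrightarrow> E v w \<Longrightarrow> \<not> E u w"
    and ic: "induced_cycle_map c n" and on: "odd n" and cn: "cut_connected (V - range c)"
    and least: "\<And>c' n'. induced_cycle_map c' n' \<Longrightarrow> odd n' \<Longrightarrow> cut_connected (V - range c') \<Longrightarrow> n \<le> n'"
begin

definition "H = V - range c"

lemma c_eq_iff: "c i = c j \<longleftrightarrow> int n dvd j - i" using ic by (simp add: induced_cycle_map_def)
lemma c_adj_iff: "E (c i) (c j) \<longleftrightarrow> int n dvd j - i - 1 \<or> int n dvd j - i + 1" using ic by (simp add: induced_cycle_map_def)
lemma c_in_V: "c i \<in> V" using ic by (auto simp: induced_cycle_map_def)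

lemma n_ge_5: "5 \<le> n"
proof -
  have "3 \<le> n" using ic by (simp add: induced_cycle_map_def)
  moreover have "n \<noteq> 3"
  proof
    assume "n = 3"
    then have "E (c 0) (c 1)" "E (c 1) (c 2)" "E (c 0) (c 2)" by (simp_all add: c_adj_iff)
    then show False using tf by blast
  qed
  moreover have "n \<noteq> 4" using on by auto
  ultimately show ?thesis by linarith
qed

lemma c_periodic: "c (i + int n) = c i" by (simp add: c_eq_iff)

lemma H_facts: "H \<subseteq> V" "H \<inter> range c = {}" "finite H" using finV by (auto simp: H_def)

text \<open>A cycle vertex has degree at least 6 and, the cycle being induced, only two neighbours
  on it; so a neighbour in \<open>H\<close> remains even when one vertex \<open>w\<close> is
  forbidden.\<close>

lemma cycle_vertex_neighbour: "\<exists>h\<in>H. E (c j) h \<and> h \<noteq> w"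
proof (rule ccontr)
  assume a: "\<not> ?thesis"
  have "{u\<in>V. E (c j) u} \<subseteq> {c (j - 1), c (j + 1), w}"
  proof
    fix u assume u: "u \<in> {u\<in>V. E (c j) u}"
    show "u \<in> {c (j - 1), c (j + 1), w}"
    proof (cases "u \<in> H")
      case True
      then show ?thesis using a u by blast
    next
      case False
      then obtain l where l: "u = c l" using u by (auto simp: H_def)
      then have "int n dvd l - j - 1 \<or> int n dvd l - j + 1" using u c_adj_iff by blast
      then have "c (j + 1) = u \<or> c (j - 1) = u" unfolding l c_eq_iff by (simp add: algebra_simps)
      then show ?thesis by blast
    qed
  qed
  then have "card {u\<in>V. E (c j) u} \<le> card {c (j - 1), c (j + 1), w}" by (intro card_mono) auto
  also have "\<dots> \<le> 3" by (simp add: card_insert_if)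
  finally show False using deg[OF c_in_V, of j] k6 by (simp add: degree_in_def)
qed

lemma arc_exact_path: "1 \<le> a \<Longrightarrow> a < n \<Longrightarrow> exact_path E (c ` {i+1..<i + int a}) (c i) (c (i + int a))"
proof (induction a arbitrary: i)
  case (Suc a)
  have e: "E (c i) (c (i + 1))" by (simp add: c_adj_iff)
  have ne: "c i \<noteq> c (i + l)" if "0 < l" "l < int n" for l using dvd_small_eq_0[of n l] that by (auto simp: c_eq_iff)
  show ?case
  proof (cases "a = 0")
    case True
    have "c i \<noteq> c (i + 1)" using e irr by metis
    then show ?thesis using True e by (auto intro: exact_path.base)
  next
    case False
    then have ih: "exact_path E (c ` {i+1+1..<i+1 + int a}) (c (i + 1)) (c (i + 1 + int a))" using Suc by (intro Suc.IH) auto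
    have im: "insert (c (i + 1)) (c ` {i+1+1..<i+1 + int a}) = c ` {i+1..<i + int (Suc a)}"
    proof -
      have "{i+1..<i + int (Suc a)} = insert (i + 1) {i+1+1..<i+1 + int a}" using False by auto
      then show ?thesis by simp
    qed
    have "c i \<notin> c ` {i+1..<i + int (Suc a)}"
    proof
      assume "c i \<in> c ` {i+1..<i + int (Suc a)}"
      then obtain l where l: "c i = c l" "i + 1 \<le> l" "l < i + int (Suc a)" by auto
      then show False using ne[of "l - i"] Suc.prems by auto
    qed
    moreover have "c i \<noteq> c (i + 1 + int a)" using ne[of "1 + int a"] Suc.prems by (simp add: add.assoc)
    ultimately have "exact_path E (c ` {i+1..<i + int (Suc a)}) (c i) (c (i + 1 + int a))" using exact_path.step[OF e ih] unfolding im by blast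
    moreover have "i + 1 + int a = i + int (Suc a)" by simp
    ultimately show ?thesis by (simp only:)
  qed
qed simp

lemma arc_lengths: assumes "1 \<le> a" "a < n" shows "a \<in> path_lengths E (range c) (c i) (c (i + int a))"
proof (rule path_lengthsI[OF _ arc_exact_path[OF assms]])
  have "inj_on c {i+1..<i + int a}"
  proof (rule inj_onI)
    fix p q assume a: "p \<in> {i+1..<i + int a}" "q \<in> {i+1..<i + int a}" "c p = c q"
    then have "int n dvd q - p" by (simp add: c_eq_iff)
    then have "q - p = 0" using a assms by (intro dvd_small_eq_0) auto
    then show "p = q" by simp
  qed
  then show "a = Suc (card (c ` {i+1..<i + int a}))" using assms(1) by (simp add: card_image)
qed auto

text \<open>The second length belongs to the complementary arc and follows from periodicity.\<close>

lemma arc_lengths_both: assumes "1 \<le> a" "a < n" shows "a \<in> path_lengths E (range c) (c (i + int a)) (c i)" "n - a \<in> path_lengths E (range c) (c (i + int a)) (c i)"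
proof -
  show "a \<in> path_lengths E (range c) (c (i + int a)) (c i)" using arc_lengths[OF assms, of i] path_lengths_sym[of E "range c" "c i"] sym by blast
  have "n - a \<in> path_lengths E (range c) (c (i + int a)) (c (i + int a + int (n - a)))" by (rule arc_lengths) (use assms in auto)
  moreover have "i + int a + int (n - a) = i + int n" using assms by simp
  ultimately show "n - a \<in> path_lengths E (range c) (c (i + int a)) (c i)" by (simp only: c_periodic)
qed

text \<open>Otherwise \<open>w\<close> and the arc from \<open>c i\<close> to \<open>c (i + g)\<close> form a shorter odd cycle, which is again
  non-separating because every vertex of \<open>c\<close> has a neighbour in \<open>H - {w}\<close>.\<close>
lemma shortcut:
  assumes w: "w \<in> H" "cut_connected (H - {w})" and g: "odd g" "g < n" "E w (c i)" "E w (c (i + int g))"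
    and int: "\<And>l. 0 < l \<Longrightarrow> l < int g \<Longrightarrow> \<not> E w (c (i + l))"
  shows "n \<le> g + 2"
proof (rule ccontr)
  assume "\<not> ?thesis"
  then have gn: "g + 2 < n" by simp
  define m where "m = int g + 2"
  have m3: "3 \<le> m" using g(1) by (cases g) (auto simp: m_def)
  \<comment> \<open>The new cycle has length \<open>m = g + 2\<close>: the residues 0 to
    \<open>g\<close> run along the arc, and the residue \<open>m - 1\<close> is
    \<open>w\<close>.\<close>
  define c' where "c' t = (if t mod m = m - 1 then w else c (i + t mod m))" for t
  have wc: "w \<noteq> c l" "c l \<noteq> w" for l using w H_facts by auto
  have rng: "0 \<le> t mod m" "t mod m < m" for t using m3 by auto
  have wE: "E w (c (i + l)) \<longleftrightarrow> l = 0 \<or> l = int g" if "0 \<le> l" "l \<le> int g" for l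
    using that g(3,4) int[of l] by (cases "l = 0 \<or> l = int g") auto
  have sd: "m dvd z \<longleftrightarrow> z = 0" if "\<bar>z\<bar> < m" for z using dvd_small_eq_0[of "g + 2" z] that by (auto simp: m_def add.commute)
  have sn: "int n dvd z \<longleftrightarrow> z = 0" if "\<bar>z\<bar> < m" for z using dvd_small_eq_0[of n z] that gn by (auto simp: m_def)
  have md: "m dvd t' - t + z \<longleftrightarrow> m dvd (t' mod m) - (t mod m) + z" for t t' z
  proof -
    have "t' - t + z = (t' mod m - t mod m + z) + m * (t' div m - t div m)"
      using mult_div_mod_eq[of m t'] mult_div_mod_eq[of m t] unfolding right_diff_distrib by linarith
    then show ?thesis by (metis dvd_add_left_iff dvd_triv_left)
  qed
  have "induced_cycle_map c' (g + 2)" unfolding induced_cycle_map_def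
  proof (intro conjI allI)
    show "3 \<le> g + 2" using m3 by (simp add: m_def)
    show "range c' \<subseteq> V" using c_in_V w H_facts by (auto simp: c'_def)
    have mm: "int (g + 2) = m" by (simp add: m_def)
    fix t t'
    define r r' where "r = t mod m" and "r' = t' mod m"
    have R: "0 \<le> r" "r < m" "0 \<le> r'" "r' < m" using rng by (auto simp: r_def r'_def)
    have c1: "c' t = (if r = m - 1 then w else c (i + r))" "c' t' = (if r' = m - 1 then w else c (i + r'))"
      by (simp_all add: c'_def r_def r'_def)
    have "c' t = c' t' \<longleftrightarrow> r = r'"
    proof (cases "r = m - 1 \<or> r' = m - 1")
      case True
      then show ?thesis using wc unfolding c1 by auto
    next
      case False
      then have "c' t = c' t' \<longleftrightarrow> int n dvd r' - r" unfolding c1 using c_eq_iff by simp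
      also have "\<dots> \<longleftrightarrow> r' - r = 0" by (rule sn) (use R in linarith)
      finally show ?thesis by auto
    qed
    also have "\<dots> \<longleftrightarrow> m dvd r' - r" using sd[of "r' - r"] R by linarith
    also have "\<dots> \<longleftrightarrow> m dvd t' - t" using md[of t' t 0] by (simp add: r_def r'_def)
    finally show "c' t = c' t' \<longleftrightarrow> int (g + 2) dvd t' - t" unfolding mm .
    have d1: "m dvd r' - r - 1 \<longleftrightarrow> r' = r + 1 \<or> (r = m - 1 \<and> r' = 0)"
    proof (cases "r = m - 1 \<and> r' = 0")
      case False
      have "\<bar>r' - r - 1\<bar> < m" using R False by linarith
      then show ?thesis using sd[of "r' - r - 1"] False by linarith
    qed auto
    have d2: "m dvd r' - r + 1 \<longleftrightarrow> r = r' + 1 \<or> (r' = m - 1 \<and> r = 0)"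
    proof (cases "r' = m - 1 \<and> r = 0")
      case False
      have "\<bar>r' - r + 1\<bar> < m" using R False by linarith
      then show ?thesis using sd[of "r' - r + 1"] False by linarith
    qed auto
    have "E (c' t) (c' t') \<longleftrightarrow> r' = r + 1 \<or> (r = m - 1 \<and> r' = 0) \<or> r = r' + 1 \<or> (r' = m - 1 \<and> r = 0)"
    proof -
      consider "r = m - 1" "r' = m - 1" | "r = m - 1" "r' < m - 1" | "r < m - 1" "r' = m - 1" | "r < m - 1" "r' < m - 1" using R by linarith
      then show ?thesis
      proof cases
        case 1
        then show ?thesis using irr m3 unfolding c1 by simp
      next
        case 2
        then have "E (c' t) (c' t') \<longleftrightarrow> r' = 0 \<or> r' = int g" unfolding c1 using wE[of r'] R by (simp add: m_def)
        then show ?thesis using 2 by (auto simp: m_def)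
      next
        case 3
        then have "E (c' t) (c' t') \<longleftrightarrow> r = 0 \<or> r = int g" unfolding c1 using wE[of r] R sym[of w "c (i + r)"] sym[of "c (i + r)" w] by (auto simp: m_def)
        then show ?thesis using 3 by (auto simp: m_def)
      next
        case 4
        then have "E (c' t) (c' t') \<longleftrightarrow> int n dvd r' - r - 1 \<or> int n dvd r' - r + 1" unfolding c1 using c_adj_iff by simp
        also have "\<dots> \<longleftrightarrow> r' - r - 1 = 0 \<or> r' - r + 1 = 0" using sn[of "r' - r - 1"] sn[of "r' - r + 1"] R 4 by linarith
        finally show ?thesis using 4 R by auto
      qed
    qed
    also have "\<dots> \<longleftrightarrow> m dvd r' - r - 1 \<or> m dvd r' - r + 1" using d1 d2 by blast
    also have "\<dots> \<longleftrightarrow> m dvd t' - t - 1 \<or> m dvd t' - t + 1" using md[of t' t "-1"] md[of t' t 1] by (simp add: r_def r'_def)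
    finally show "E (c' t) (c' t') \<longleftrightarrow> int (g + 2) dvd t' - t - 1 \<or> int (g + 2) dvd t' - t + 1" unfolding mm .
  qed
  moreover have "odd (g + 2)" using g by simp
  moreover have "cut_connected (V - range c')"
  proof -
    define H' where "H' = V - range c'"
    have wr: "w \<in> range c'"
    proof -
      have "(m - 1) mod m = m - 1" using m3 by (intro mod_pos_pos_trivial) auto
      then have "c' (m - 1) = w" by (simp add: c'_def)
      then show ?thesis by blast
    qed
    have sub: "H - {w} \<subseteq> H'"
    proof
      fix h assume h: "h \<in> H - {w}"
      then have "h \<noteq> c' t" for t using H_facts(2) by (auto simp: c'_def)
      then show "h \<in> H'" using h H_facts by (auto simp: H'_def)
    qed
    \<comment> \<open>Every vertex of the old cycle that is released has a neighbour in
      \<open>H - {w}\<close>, which is itself connected by hypothesis.\<close>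
    have rest: "\<exists>h\<in>H - {w}. E v h \<and> E h v" if v: "v \<in> H'" "v \<notin> H - {w}" for v
    proof -
      have "v \<noteq> w" "v \<in> V" using v wr by (auto simp: H'_def)
      then obtain j where j: "v = c j" using v(2) by (auto simp: H_def)
      then show ?thesis using cycle_vertex_neighbour[of j w] sym by blast
    qed
    have "nbhd E H' F \<noteq> {}" if F: "F \<subseteq> H'" "F \<noteq> {}" "F \<noteq> H'" for F
    proof
      assume e: "nbhd E H' F = {}"
      have cl: "w' \<in> F" if "f \<in> F" "E f w'" "w' \<in> H'" for f w'
      proof (rule ccontr)
        assume "w' \<notin> F"
        then have "w' \<in> nbhd E H' F" using that by (auto simp: nbhd_def)
        then show False using e by blast
      qed
      define F' where "F' = F \<inter> (H - {w})"
      have F'ne: "F' \<noteq> {}"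
      proof
        assume z: "F' = {}"
        obtain f where f: "f \<in> F" using F by blast
        then have "f \<in> H'" "f \<notin> H - {w}" using F(1) z by (auto simp: F'_def)
        then obtain h where "h \<in> H - {w}" "E f h" using rest by blast
        then have "h \<in> F'" using cl[OF f] sub by (auto simp: F'_def)
        then show False using z by blast
      qed
      have "F' = H - {w}"
      proof (rule ccontr)
        assume "F' \<noteq> H - {w}"
        moreover have "F' \<subseteq> H - {w}" by (simp add: F'_def)
        ultimately have "nbhd E (H - {w}) F' \<noteq> {}" using w(2)[unfolded cut_connected_def] F'ne by blast
        then obtain v f where v: "v \<in> H - {w}" "v \<notin> F'" "f \<in> F'" "E f v" unfolding nbhd_def by blast
        then have "v \<in> F" using cl[of f v] sub by (auto simp: F'_def)
        then show False using v by (auto simp: F'_def)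
      qed
      then have sF: "H - {w} \<subseteq> F" by (auto simp: F'_def)
      obtain v where v: "v \<in> H'" "v \<notin> F" using F by blast
      then obtain h where "h \<in> H - {w}" "E h v" using rest sF by blast
      then show False using cl[of h v] v sF by blast
    qed
    then show ?thesis unfolding cut_connected_def H'_def by blast
  qed
  ultimately have "n \<le> g + 2" by (rule least)
  then show False using gn by simp
qed

text \<open>Two neighbours of \<open>w\<close> split the cycle into an odd and an even arc. At the
  least odd distance \<open>g\<close> no further neighbour lies strictly between, as it would split
  off a smaller odd part; so \<open>shortcut\<close> applies, and every odd arc between neighbours
  has length at least \<open>n - 2\<close>. The even arc then has length 2.\<close>

lemma cycle_neighbours_distance_two:
  assumes w: "w \<in> H" "cut_connected (H - {w})" and ij: "E w (c i)" "E w (c j)" "c i \<noteq> c j"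
  shows "int n dvd j - i - 2 \<or> int n dvd j - i + 2"
proof -
  let ?P = "\<lambda>g. odd g \<and> (\<exists>i. E w (c i) \<and> E w (c (i + int g)))"
  have big: "n \<le> a + 2" if a: "?P a" "a < n" for a
  proof -
    define g where "g = (LEAST g. ?P g)"
    have Pg: "?P g" unfolding g_def by (rule LeastI[of ?P, OF a(1)])
    have ga: "g \<le> a" unfolding g_def by (rule Least_le[of ?P, OF a(1)])
    have lst: "g \<le> g'" if "?P g'" for g' unfolding g_def by (rule Least_le[of ?P, OF that])
    obtain i where i: "E w (c i)" "E w (c (i + int g))" using Pg by blast
    have "n \<le> g + 2"
    proof (rule shortcut[OF w _ _ i])
      show "odd g" "g < n" using Pg ga a by auto
      fix l assume l: "0 < l" "l < int g"
      show "\<not> E w (c (i + l))"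
      proof
        assume h: "E w (c (i + l))"
        define p where "p = nat l"
        have p: "l = int p" "0 < p" "p < g" using l by (auto simp: p_def)
        show False
        proof (cases "odd p")
          case True
          then have "?P p" using i h p(1) by blast
          then show False using lst[of p] p by simp
        next
          case False
          then have "odd (g - p)" using Pg p by simp
          moreover have "E w (c (i + l + int (g - p)))" using i(2) p by simp
          ultimately have "?P (g - p)" using h by blast
          then have "g \<le> g - p" by (rule lst)
          then show False using p by linarith
        qed
      qed
    qed
    then show ?thesis using ga by linarith
  qed
  \<comment> \<open>\<open>d\<close> is the length of the arc from \<open>c i\<close> forward to
    \<open>c j\<close>; if it is even, the complementary arc of length \<open>n - d\<close> is
    odd.\<close>
  define d where "d = nat ((j - i) mod int n)"
  have n0: "0 < int n" using n_ge_5 by simp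
  have dm: "int d = (j - i) mod int n" using n0 by (simp add: d_def)
  have dn: "d < n" using dm n0 by (metis of_nat_less_iff pos_mod_bound)
  have dj: "int n dvd j - i - int d" unfolding dm by simp
  then have cj: "c (i + int d) = c j" by (simp add: c_eq_iff algebra_simps)
  have d0: "d \<noteq> 0"
  proof
    assume "d = 0"
    then show False using cj ij(3) by simp
  qed
  show ?thesis
  proof (cases "odd d")
    case True
    then have "n \<le> d + 2" using big[of d] dn ij cj by metis
    moreover have "n \<noteq> d + 1" using True on by auto
    ultimately have "int n = int d + 2" using dn by linarith
    then have "j - i + 2 = (j - i - int d) + int n" by simp
    then show ?thesis using dj by (metis dvd_add dvd_refl)
  next
    case False
    have "i - (j + int (n - d)) = - (j - i - int d) - int n" using dn by simp
    then have "int n dvd i - (j + int (n - d))" using dj by (metis dvd_diff dvd_minus_iff dvd_refl)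
    then have "c (j + int (n - d)) = c i" by (simp only: c_eq_iff)
    then have "E w (c (j + int (n - d)))" using ij by simp
    moreover have "odd (n - d)" using on False dn by simp
    ultimately have "n \<le> (n - d) + 2" using big[of "n - d"] ij(2) d0 dn by auto
    then have "d \<le> 2" using dn by linarith
    then have "d = 2" using d0 False by (cases "d = 1") auto
    then show ?thesis using dj by simp
  qed
qed

end

text \<open>\<open>F\<close> plays the part of an end block of \<open>H\<close> with cut vertex
  \<open>b\<close>; \<open>Fmin\<close> provides the cut condition for the roots \<open>b\<close>
  and a vertex of \<open>F\<close>. By \<open>out\<close> the cycle can also be reached from a
  vertex outside \<open>F\<close>.\<close>

locale gated_odd_cycle = shortest_odd_cycle +
  fixes F :: "'a set" and b :: 'a
  assumes FH: "F \<subseteq> H" and Fne: "F \<noteq> {}" and bH: "b \<in> H" and bF: "b \<notin> F" and nbF: "nbhd E H F \<subseteq> {b}"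
    and Fmin: "\<And>F'. F' \<subset> F \<Longrightarrow> F' \<noteq> {} \<Longrightarrow> 2 \<le> card (nbhd E H F')"
    and out: "\<exists>h\<in>H - F. \<exists>i. E h (c i)"
begin

section \<open>The end part behind its gate\<close>

lemma finF: "finite F" by (rule finite_subset[OF FH H_facts(3)])

lemma connected_H: "cut_connected H" using cn by (simp add: H_def)

lemma F_boundary: "f \<in> F \<Longrightarrow> w \<in> H \<Longrightarrow> E f w \<Longrightarrow> w \<in> insert b F"
  using nbF unfolding nbhd_def by blast

lemma one: "F' \<subset> F \<Longrightarrow> F' \<noteq> {} \<Longrightarrow> nbhd E H F' \<subseteq> {u} \<Longrightarrow> False"
  using Fmin[of F'] card_le1I[of "nbhd E H F'" u] by linarith

text \<open>This makes \<open>cycle_neighbours_distance_two\<close> applicable to the vertices of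
  \<open>F\<close>. Of the two sides separated by \<open>w\<close>, consider the one without
  \<open>b\<close>. If it meets \<open>F\<close>, the intersection is a proper subset of
  \<open>F\<close> whose only possible neighbour is \<open>w\<close>, against \<open>Fmin\<close>;
  if not, it was separated in \<open>H\<close> already.\<close>

lemma connected_remove: assumes w: "w \<in> F" shows "cut_connected (H - {w})"
  unfolding cut_connected_def
proof (intro allI impI notI)
  fix S assume S: "S \<subseteq> H - {w}" "S \<noteq> {}" "S \<noteq> H - {w}" "nbhd E (H - {w}) S = {}"
  have key: False if T: "T \<subseteq> H - {w}" "T \<noteq> {}" "nbhd E H T \<subseteq> {w}" "b \<notin> T" for T
  proof (cases "T \<inter> F = {}")
    case False
    have "T \<inter> F \<subset> F" using T w by blast
    moreover have "nbhd E H (T \<inter> F) \<subseteq> {w}"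
    proof
      fix v assume "v \<in> nbhd E H (T \<inter> F)"
      then obtain f where v: "v \<in> H" "v \<notin> T \<inter> F" "f \<in> T" "f \<in> F" "E f v" unfolding nbhd_def by blast
      show "v \<in> {w}"
      proof (cases "v \<in> T")
        case True
        then show ?thesis using F_boundary[OF v(4,1,5)] v T by blast
      next
        case False
        then have "v \<in> nbhd E H T" using v by (auto simp: nbhd_def)
        then show ?thesis using T by blast
      qed
    qed
    ultimately show False using one False by blast
  next
    case True
    have "nbhd E H T = {}"
    proof (rule ccontr)
      assume "nbhd E H T \<noteq> {}"
      then obtain f where "f \<in> T" "E f w" using T(3) unfolding nbhd_def by blast
      then have "f \<in> insert b F" using F_boundary[OF w, of f] sym[of f w] T(1) by blast
      then show False using \<open>f \<in> T\<close> True T(4) by blast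
    qed
    then show False using connected_H T bH unfolding cut_connected_def by blast
  qed
  have nS: "nbhd E H S \<subseteq> {w}"
  proof
    fix v assume v: "v \<in> nbhd E H S"
    then have "v \<in> {w} \<or> v \<in> nbhd E (H - {w}) S" unfolding nbhd_def by blast
    then show "v \<in> {w}" using S by blast
  qed
  show False
  proof (cases "b \<in> S")
    case False
    then show False using key[OF S(1,2) nS] by blast
  next
    case True
    define T where "T = H - {w} - S"
    have "nbhd E H T \<subseteq> {w}"
    proof
      fix v assume "v \<in> nbhd E H T"
      then obtain f where v: "v \<in> H" "v \<notin> T" "f \<in> T" "E f v" unfolding nbhd_def by blast
      show "v \<in> {w}"
      proof (rule ccontr)
        assume "v \<notin> {w}"
        then have "v \<in> S" using v by (auto simp: T_def)
        moreover have "E v f" using v sym by blast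
        ultimately have "f \<in> nbhd E (H - {w}) S" using v(3) by (auto simp: nbhd_def T_def)
        then show False using S by blast
      qed
    qed
    moreover have "T \<noteq> {}" using S by (auto simp: T_def)
    ultimately show False using key[of T] True by (auto simp: T_def)
  qed
qed

lemma F_cycle_neighbours_distance_two: "w \<in> F \<Longrightarrow> E w (c i) \<Longrightarrow> E w (c j) \<Longrightarrow> c i \<noteq> c j \<Longrightarrow> int n dvd j - i - 2 \<or> int n dvd j - i + 2"
  using cycle_neighbours_distance_two[of w i j] connected_remove[of w] FH by blast

lemma n_not_dvd: "\<not> int n dvd 2" "\<not> int n dvd 6"
proof -
  show "\<not> int n dvd 2" using dvd_small_eq_0[of n 2] n_ge_5 by auto
  have "n = 5 \<or> 7 \<le> n" using n_ge_5 on by presburger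
  then show "\<not> int n dvd 6" using dvd_small_eq_0[of n 6] by auto
qed

text \<open>Three neighbours would be pairwise at distance two, so \<open>n\<close> would divide 2
  or 6 or two of them would coincide; \<open>n\<close> is odd and at least 5.\<close>

lemma at_most_two_cycle_neighbours: assumes w: "w \<in> F" shows "card {u\<in>range c. E w u} \<le> 2"
proof (cases "\<exists>i j. E w (c i) \<and> E w (c j) \<and> c i \<noteq> c j")
  case False
  then have un: "u = v" if "u \<in> {u\<in>range c. E w u}" "v \<in> {u\<in>range c. E w u}" for u v using that by blast
  show ?thesis
  proof (cases "{u\<in>range c. E w u} = {}")
    case False
    then obtain u where "u \<in> {u\<in>range c. E w u}" by blast
    then have "{u\<in>range c. E w u} \<subseteq> {u}" using un by blast
    then have "card {u\<in>range c. E w u} \<le> 1" by (rule card_le1I)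
    then show ?thesis by linarith
  qed (simp only: card.empty)
next
  case True
  then obtain i j where ij: "E w (c i)" "E w (c j)" "c i \<noteq> c j" by blast
  have "{u\<in>range c. E w u} \<subseteq> {c i, c j}"
  proof
    fix u assume "u \<in> {u\<in>range c. E w u}"
    then obtain l where l: "u = c l" "E w (c l)" by blast
    show "u \<in> {c i, c j}"
    proof (rule ccontr)
      assume "u \<notin> {c i, c j}"
      then have ne: "c i \<noteq> c l" "c j \<noteq> c l" using l by auto
      have 1: "int n dvd j - i - 2 \<or> int n dvd j - i + 2" by (rule F_cycle_neighbours_distance_two[OF w ij])
      have 2: "int n dvd l - i - 2 \<or> int n dvd l - i + 2" by (rule F_cycle_neighbours_distance_two[OF w ij(1) l(2) ne(1)])
      have 3: "int n dvd l - j - 2 \<or> int n dvd l - j + 2" by (rule F_cycle_neighbours_distance_two[OF w ij(2) l(2) ne(2)])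
      have no: "\<not> int n dvd l - j" using ne(2) c_eq_iff by blast
      have df: "int n dvd a - b" if "int n dvd a" "int n dvd b" for a b using that by (rule dvd_diff)
      have no4: "\<not> int n dvd l - j - 4" "\<not> int n dvd l - j + 4"
      proof -
        show "\<not> int n dvd l - j - 4"
        proof
          assume h: "int n dvd l - j - 4"
          show False using 3
          proof
            assume "int n dvd l - j - 2"
            from df[OF this h] show False using n_not_dvd by simp
          next
            assume "int n dvd l - j + 2"
            from df[OF this h] show False using n_not_dvd by simp
          qed
        qed
        show "\<not> int n dvd l - j + 4"
        proof
          assume h: "int n dvd l - j + 4"
          show False using 3
          proof
            assume "int n dvd l - j - 2"
            from df[OF h this] show False using n_not_dvd by simp
          next
            assume "int n dvd l - j + 2"
            from df[OF h this] show False using n_not_dvd by simp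
          qed
        qed
      qed
      from 1 2 show False
      proof (elim disjE)
        assume a: "int n dvd j - i - 2" "int n dvd l - i - 2"
        from df[OF a(2,1)] show False using no by simp
      next
        assume a: "int n dvd j - i - 2" "int n dvd l - i + 2"
        from df[OF a(2,1)] show False using no4 by (simp add: algebra_simps)
      next
        assume a: "int n dvd j - i + 2" "int n dvd l - i - 2"
        from df[OF a(2,1)] show False using no4 by (simp add: algebra_simps)
      next
        assume a: "int n dvd j - i + 2" "int n dvd l - i + 2"
        from df[OF a(2,1)] show False using no by simp
      qed
    qed
  qed
  then show ?thesis by (rule card_le2I)
qed

lemma degF:
  assumes v: "v \<in> F" shows "k \<le> card {w\<in>insert b F. E v w} + card {u\<in>range c. E v u}"
proof -
  have "{w\<in>V. E v w} \<subseteq> {w\<in>insert b F. E v w} \<union> {u\<in>range c. E v u}"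
    using F_boundary[OF v] unfolding H_def by blast
  moreover have fin: "finite {w\<in>insert b F. E v w}" using finF by simp
  moreover have fC: "finite {u\<in>range c. E v u}" by (rule finite_subset[OF _ finV]) (use c_in_V in auto)
  ultimately have "card {w\<in>V. E v w} \<le> card ({w\<in>insert b F. E v w} \<union> {u\<in>range c. E v u})" by (intro card_mono) auto
  also have "\<dots> \<le> card {w\<in>insert b F. E v w} + card {u\<in>range c. E v u}" by (rule card_Un_le)
  finally show ?thesis using deg[of v] v FH H_facts(1) unfolding degree_in_def by force
qed

lemma two_rooted_F: assumes "x \<in> F" shows "two_rooted E (F - {x}) x b" "insert x (insert b (F - {x})) = insert b F"
proof -
  show "two_rooted E (F - {x}) x b" by unfold_locales (use finF bF assms irr in \<open>auto intro: sym\<close>)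
  show "insert x (insert b (F - {x})) = insert b F" using assms by blast
qed

text \<open>Neighbours in \<open>H\<close> of a subset of \<open>F\<close> stay within
  \<open>insert b F\<close>, so \<open>Fmin\<close> turns into the cut condition for the roots
  \<open>x\<close> and \<open>b\<close>.\<close>

lemma F_two_cut: assumes "F' \<subseteq> F - {x}" "x \<in> F" "F' \<noteq> {}" shows "2 \<le> card (nbhd E (insert b F) F')"
proof -
  have "F' \<subset> F" using assms by blast
  then have "2 \<le> card (nbhd E H F')" using assms(3) by (rule Fmin)
  moreover have "nbhd E H F' \<subseteq> nbhd E (insert b F) F'" using F_boundary assms(1) unfolding nbhd_def by blast
  moreover have "finite (nbhd E (insert b F) F')" using finF by (simp add: nbhd_def)
  ultimately show ?thesis using card_mono[of "nbhd E (insert b F) F'" "nbhd E H F'"] by linarith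
qed

text \<open>At most two neighbours of \<open>x\<close> lie on the cycle, so at least four lie in
  \<open>insert b F\<close>.\<close>

lemma other: assumes "x \<in> F" shows "\<exists>v\<in>F - {x}. v \<noteq> h"
proof (rule ccontr)
  assume "\<not> ?thesis"
  then have "{w\<in>insert b F. E x w} \<subseteq> {b, h}" using irr[of x] by blast
  then have "card {w\<in>insert b F. E x w} \<le> 2" by (rule card_le2I)
  then show False using degF[OF assms] at_most_two_cycle_neighbours[OF assms] k6 by linarith
qed

text \<open>\<open>F\<close> can be left only through \<open>b\<close>, so by connectedness of
  \<open>H\<close> the vertices \<open>b\<close> and \<open>h\<close> are joined outside
  \<open>F\<close>; \<open>q\<close> is the length of that connection, 0 if they coincide.\<close>

lemma extend_outside_F:
  assumes h: "h \<in> H - F" and x: "x \<in> F"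
  shows "\<exists>q. \<forall>p\<in>path_lengths E (F - {x}) x b. p + q \<in> path_lengths E (H - {x, h}) x h"
proof (cases "h = b")
  case True
  have "F - {x} \<subseteq> H - {x, h}" using FH h by blast
  then have "path_lengths E (F - {x}) x b \<subseteq> path_lengths E (H - {x, h}) x b" by (rule path_lengths_mono)
  then show ?thesis using True by (intro exI[of _ 0]) auto
next
  case False
  define Q where "Q = reach E (H - F) h"
  have QH: "Q \<subseteq> H - F" using reach_sub[of E "H - F" h] h by (auto simp: Q_def)
  have "b \<in> Q"
  proof (rule ccontr)
    assume b: "b \<notin> Q"
    have "nbhd E H Q = {}"
    proof (rule ccontr)
      assume "nbhd E H Q \<noteq> {}"
      then obtain v f where v: "v \<in> H" "v \<notin> Q" "f \<in> Q" "E f v" unfolding nbhd_def by blast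
      then have "v \<notin> H - F" using reach_step[of f E "H - F" h v] by (auto simp: Q_def)
      then have "v \<in> F" using v by blast
      then have "f \<in> insert b F" using F_boundary[of v f] sym[OF v(4)] v QH by blast
      then show False using v QH b by blast
    qed
    moreover have "h \<in> Q" by (simp add: Q_def)
    ultimately show False using connected_H QH b bH unfolding cut_connected_def by blast
  qed
  then obtain U where "U \<subseteq> reach E (H - F) h \<inter> (H - F) - {b, h}" and U2: "exact_path E U h b"
    using reach_exact_path[of b E "H - F" h] False unfolding Q_def by metis
  then have U: "U \<subseteq> H - F - {b, h}" "exact_path E U h b" by blast+
  have q: "Suc (card U) \<in> path_lengths E (H - F - {b, h}) b h" by (rule path_lengthsI[OF U(1)]) (use exact_path_sym[OF sym U(2)] in auto)
  have "p + Suc (card U) \<in> path_lengths E (H - {x, h}) x h" if p: "p \<in> path_lengths E (F - {x}) x b" for p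
    by (rule path_lengths_concat[OF p q]) (use FH h x bH bF False in auto)
  then show ?thesis by blast
qed

text \<open>A path from \<open>x\<close> to \<open>h\<close> off the cycle is closed by the edge
  from \<open>h\<close> to \<open>c t\<close>, an arc, and the edge from \<open>c j\<close> to
  \<open>x\<close>; the two edges are the 2 in \<open>t0 + 2\<close>.\<close>

lemma fin:
  assumes xh: "x \<in> H" "h \<in> H" and sp: "spans (path_lengths E (H - {x, h}) x h) m" and h: "E h (c t)"
    and r: "1 \<le> r" "k \<le> m + r + 1" and arcs: "\<And>i. i \<le> r \<Longrightarrow> \<exists>j. E x (c j) \<and> t0 + i \<in> path_lengths E (range c) (c t) (c j)"
  shows "\<exists>l. \<forall>i<k. has_cycle_length E (l + i)"
proof (rule spans_consecutive[OF sp r, of _ "t0 + 2"])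
  fix p i assume p: "p \<in> path_lengths E (H - {x, h}) x h" and i: "i \<le> r"
  from arcs[OF i] obtain j where j: "E x (c j)" "t0 + i \<in> path_lengths E (range c) (c t) (c j)" by blast
  then obtain U where U: "U \<subseteq> range c" "exact_path E U (c t) (c j)" "t0 + i = Suc (card U)" by (auto simp: path_lengths_def)
  have nC: "x \<notin> range c" "h \<notin> range c" using xh H_facts by auto
  obtain W where "exact_path E W x h" using p by (auto simp: path_lengths_def)
  then have ne: "x \<noteq> h" by (rule exact_path_facts)
  note f = exact_path_facts[OF U(2)]
  have cjx: "E (c j) x" using j sym by blast
  have a: "t0 + i \<in> path_lengths E U (c t) (c j)" using U by (intro path_lengthsI[of U]) auto
  have b: "1 + (t0 + i) \<in> path_lengths E (insert (c t) U) h (c j)"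
    by (rule path_lengths_concat[OF path_lengths_edge[OF h, of "{}"] a]) (use nC U f in auto)
  have "1 + (t0 + i) + 1 \<in> path_lengths E (range c) h x"
    by (rule path_lengths_concat[OF b path_lengths_edge[OF cjx, of "{}"]]) (use nC U ne in auto)
  then have "has_cycle_length E (p + (1 + (t0 + i) + 1))"
    by (rule has_cycle_lengthI[OF p]) (use H_facts U(3) in auto)
  moreover have "p + (1 + (t0 + i) + 1) = p + (t0 + 2) + i" by simp
  ultimately show "has_cycle_length E (p + (t0 + 2) + i)" by (simp only:)
qed

text \<open>The vertex opposite to the common neighbour of \<open>c i\<close> and \<open>c j\<close> on the cycle is joined to \<open>x\<close> by arcs of four consecutive lengths, which
  compensates for the two neighbours that a vertex of \<open>F\<close> may have on the cycle.\<close>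
lemma cycles_two_cycle_neighbours:
  assumes x: "x \<in> F" "E x (c i)" "E x (c j)" "c i \<noteq> c j"
  shows "\<exists>l. \<forall>i<k. has_cycle_length E (l + i)"
proof -
  obtain s where s: "n = 2 * s + 1" using on by (auto elim: oddE)
  have s2: "2 \<le> s" using s n_ge_5 by linarith
  have "\<exists>i. E x (c i) \<and> E x (c (i + 2))"
    using F_cycle_neighbours_distance_two[OF x]
  proof
    assume "int n dvd j - i - 2"
    then have "c (i + 2) = c j" by (simp add: c_eq_iff algebra_simps)
    then show ?thesis using x by metis
  next
    assume "int n dvd j - i + 2"
    moreover have "i - (j + 2) = - (j - i + 2)" by simp
    ultimately have "c (j + 2) = c i" by (simp only: c_eq_iff dvd_minus_iff)
    then show ?thesis using x by metis
  qed
  then obtain i where i: "E x (c i)" "E x (c (i + 2))" by blast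
  \<comment> \<open>Opposite to \<open>c (i + 1)\<close>: as \<open>n = 2 * s + 1\<close>, the arcs
    from \<open>c t\<close> to \<open>c i\<close> have lengths \<open>s\<close> and
    \<open>s + 1\<close>, and those to \<open>c (i + 2)\<close> have lengths \<open>s - 1\<close>
    and \<open>s + 2\<close>.\<close>
  define t where "t = i + 1 + int s"
  obtain h where h: "h \<in> H" "E (c t) h" "h \<noteq> x" using cycle_vertex_neighbour[of t x] by blast
  have xH: "x \<in> H" using x FH by blast
  have arcs: "\<exists>j. E x (c j) \<and> (s - 1) + r \<in> path_lengths E (range c) (c t) (c j)" if r: "r \<le> 3" for r
  proof -
    have t1: "t = i + int (s + 1)" "t = i + 2 + int (s - 1)" using s2 by (auto simp: t_def)
    have 1: "s + 1 \<in> path_lengths E (range c) (c t) (c i)" "n - (s + 1) \<in> path_lengths E (range c) (c t) (c i)"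
      unfolding t1(1) by (rule arc_lengths_both; use s s2 in simp)+
    have 2: "s - 1 \<in> path_lengths E (range c) (c t) (c (i + 2))" "n - (s - 1) \<in> path_lengths E (range c) (c t) (c (i + 2))"
      unfolding t1(2) by (rule arc_lengths_both; use s s2 in simp)+
    have "r = 0 \<or> r = 1 \<or> r = 2 \<or> r = 3" using r by linarith
    then show ?thesis
    proof (elim disjE)
      assume "r = 0" then show ?thesis using 2(1) i by auto
    next
      assume "r = 1"
      then have "s - 1 + r = n - (s + 1)" using s s2 by simp
      then show ?thesis using 1(2) i by auto
    next
      assume "r = 2"
      then have "s - 1 + r = s + 1" using s2 by simp
      then show ?thesis using 1(1) i by auto
    next
      assume "r = 3"
      then have "s - 1 + r = n - (s - 1)" using s s2 by simp
      then show ?thesis using 2(2) i by auto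
    qed
  qed
  have dg2: "k - 2 \<le> degree_in E (insert b F) v" if "v \<in> F" for v
    using degF[OF that] at_most_two_cycle_neighbours[OF that] by (simp add: degree_in_def)
  \<comment> \<open>Up to two degrees are lost to the cycle, so the bound \<open>k - 2\<close> gives
    span \<open>k - 4\<close>, which the four arc lengths complete to \<open>k\<close>.\<close>
  have "spans (path_lengths E (H - {x, h}) x h) (k - 4)"
  proof (cases "h \<in> F")
    case False
    interpret two_rooted E "F - {x}" x b by (rule two_rooted_F(1)[OF x(1)])
    have "weak_rooted (k - 2) E (F - {x}) x b x" unfolding weak_rooted_def two_rooted_F(2)[OF x(1)]
    proof (intro conjI allI impI ballI)
      show "two_rooted E (F - {x}) x b" by (rule two_rooted_axioms)
      show "2 \<le> card (nbhd E (insert b F) F')" if "F' \<subseteq> F - {x}" "\<not> F' \<subseteq> {x}" for F'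
        using F_two_cut[OF that(1) x(1)] that(2) by blast
      show "\<exists>v\<in>F - {x}. v \<noteq> x" using other[OF x(1)] by blast
    qed (use dg2 in blast)+
    from weak_rooted_spans[OF this] have q: "spans (path_lengths E (F - {x}) x b) (k - 4)" by simp
    obtain q where "\<forall>p\<in>path_lengths E (F - {x}) x b. p + q \<in> path_lengths E (H - {x, h}) x h" using extend_outside_F[of h x] h x False by blast
    then show ?thesis using spans_shift[OF q, of q] by blast
  next
    case hF: True
    \<comment> \<open>If \<open>h\<close> lies in \<open>F\<close> too, the roots are
      \<open>x\<close> and \<open>h\<close>, and the gate \<open>b\<close>, for which no degree
      bound is known, becomes the exceptional inner vertex.\<close>
    define D where "D = insert b F - {x, h}"
    have bD: "b \<in> D" using bF x hF by (auto simp: D_def)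
    have VD: "insert x (insert h D) = insert b F" using x hF by (auto simp: D_def)
    have fD: "finite D" using finF by (simp add: D_def)
    interpret two_rooted E D x h by unfold_locales (use fD h irr in \<open>auto simp: D_def intro: sym\<close>)
    have "weak_rooted (k - 2) E D x h b" unfolding weak_rooted_def VD
    proof (intro conjI allI impI ballI)
      show "two_rooted E D x h" by (rule two_rooted_axioms)
    next
      fix v assume "v \<in> D" "v \<noteq> b"
      then show "k - 2 \<le> degree_in E (insert b F) v" using dg2 by (auto simp: D_def)
    next
      fix F' assume F': "F' \<subseteq> D" "\<not> F' \<subseteq> {b}"
      define F2 where "F2 = F' - {b}"
      have F2: "F2 \<subseteq> F - {x}" "F2 \<noteq> {}" "h \<notin> F2" using F' by (auto simp: F2_def D_def)
      have c2: "2 \<le> card (nbhd E (insert b F) F2)" by (rule F_two_cut[OF F2(1) x(1) F2(2)])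
      have fn: "finite (nbhd E (insert b F) F')" using finite_nb[of F'] unfolding VD .
      show "2 \<le> card (nbhd E (insert b F) F')"
      proof (rule ccontr)
        assume k: "\<not> ?thesis"
        then have un: "u = v" if "u \<in> nbhd E (insert b F) F'" "v \<in> nbhd E (insert b F) F'" for u v
          using card_ge2I[OF that _ fn] by blast
        have bF': "b \<in> F'"
        proof (rule ccontr)
          assume "b \<notin> F'"
          then have "F2 = F'" by (auto simp: F2_def)
          then show False using c2 k by simp
        qed
        have sub: "nbhd E (insert b F) F2 - {b} \<subseteq> nbhd E (insert b F) F'" by (auto simp: nbhd_def F2_def)
        obtain p q where pq: "p \<in> nbhd E (insert b F) F2" "q \<in> nbhd E (insert b F) F2" "p \<noteq> q" using card_ge2E[OF c2] by blast
        then obtain u where u: "u \<in> nbhd E (insert b F) F'" using sub by blast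
        have only: "v = u" if "v \<in> nbhd E (insert b F) F'" for v using un[OF that u] .
        \<comment> \<open>A set \<open>F'\<close> violating the cut condition contains
          \<open>b\<close> and sees a single vertex \<open>u\<close>; then the remainder
          \<open>T\<close> of \<open>F\<close> hangs on \<open>u\<close>, against the minimality of
          \<open>F\<close>.\<close>
        define T where "T = F - F2 - {u}"
        have "x \<in> F - F2" "h \<in> F - F2" using x hF F2 by auto
        then have Tne: "T \<noteq> {}" using h(3) by (auto simp: T_def)
        have TF: "T \<subset> F" using F2 by (auto simp: T_def)
        have "nbhd E H T \<subseteq> {u}"
        proof
          fix v assume "v \<in> nbhd E H T"
          then obtain f where v: "v \<in> H" "v \<notin> T" "f \<in> T" "E f v" unfolding nbhd_def by blast
          have f: "f \<in> F" "f \<notin> F2" "f \<noteq> u" using v(3) by (auto simp: T_def)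
          have "f \<notin> F'" using f bF by (auto simp: F2_def)
          have "v \<notin> F'"
          proof
            assume "v \<in> F'"
            then have "f \<in> nbhd E (insert b F) F'" using sym[OF v(4)] f \<open>f \<notin> F'\<close> by (auto simp: nbhd_def)
            then show False using only f by blast
          qed
          moreover have "v \<in> insert b F" using F_boundary[OF f(1) v(1,4)] .
          ultimately show "v \<in> {u}" using v(2) bF' by (auto simp: T_def F2_def)
        qed
        then show False using one[OF TF Tne] by blast
      qed
    next
      show "\<exists>v\<in>D. v \<noteq> b" using other[OF x(1), of h] bF by (auto simp: D_def)
    next
      fix v assume D2: "D = {b, v}" "v \<noteq> b"
      have v: "v \<in> F" using D2 by (auto simp: D_def)
      have "insert b F = {x, h, b, v}" using VD unfolding D2(1) by simp
      then have "{w\<in>insert b F. E v w} \<subseteq> {x, h, b}" using irr[of v] by auto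
      then have "card {w\<in>insert b F. E v w} \<le> card {x, h, b}" by (intro card_mono) auto
      also have "\<dots> \<le> 3" by (simp add: card_insert_if)
      finally show "2 \<le> card (nbhd E (insert b F) {b})" using dg2[OF v] k6 by (simp add: degree_in_def)
    qed
    from weak_rooted_spans[OF this] have q: "spans (path_lengths E D x h) (k - 4)" by simp
    have "D \<subseteq> H - {x, h}" using FH bH by (auto simp: D_def)
    then show ?thesis using spans_mono[OF q path_lengths_mono] by blast
  qed
  then show ?thesis
    by (rule fin[OF xH h(1) _ sym[OF h(2)], of _ 3 "s - 1"]) (use k6 arcs in auto)
qed

text \<open>If \<open>j + s\<close> avoided the indices seen from outside \<open>F\<close> for all \<open>j\<close> seen from \<open>F\<close>, the latter would be closed under adding
  \<open>2 s = n - 1\<close>, hence be everything.\<close>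
lemma cycles_one_cycle_neighbour:
  assumes x2: "\<And>x i j. x \<in> F \<Longrightarrow> E x (c i) \<Longrightarrow> E x (c j) \<Longrightarrow> c i = c j"
  shows "\<exists>l. \<forall>i<k. has_cycle_length E (l + i)"
proof -
  obtain s where s: "n = 2 * s + 1" using on by (auto elim: oddE)
  have s2: "2 \<le> s" using s n_ge_5 by linarith
  define J where "J = {j. \<exists>f\<in>F. E f (c j)}"
  define I where "I = {i. \<exists>h\<in>H - F. E h (c i)}"
  have IJ: "i \<in> I \<or> i \<in> J" for i
  proof -
    obtain h where "h \<in> H" "E (c i) h" using cycle_vertex_neighbour[of i] by blast
    then show ?thesis using sym by (auto simp: I_def J_def)
  qed
  obtain i0 where i0: "i0 \<in> I" using out by (auto simp: I_def)
  \<comment> \<open>Otherwise \<open>b\<close> alone would separate \<open>F\<close> from the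
    cycle.\<close>
  have "J \<noteq> {}"
  proof
    assume J0: "J = {}"
    have nbV: "nbhd E V F \<subseteq> {b}"
    proof
      fix v assume "v \<in> nbhd E V F"
      then obtain f where v: "v \<in> V" "v \<notin> F" "f \<in> F" "E f v" unfolding nbhd_def by blast
      have "v \<notin> range c" using v J0 by (auto simp: J_def)
      then show "v \<in> {b}" using F_boundary[of f v] v by (auto simp: H_def)
    qed
    have c1: "card (nbhd E V F) \<le> 1" "c 0 \<notin> nbhd E V F" using card_le1I[OF nbV] nbV bH H_facts(2) by auto
    have "c 0 \<in> V - F - nbhd E V F" using c1 c_in_V FH H_facts(2) by auto
    then have "2 \<le> card (nbhd E V F)" using con[of F] Fne FH H_facts(1) by blast
    then show False using c1 by linarith
  qed
  then obtain j0 where j0: "j0 \<in> J" by blast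
  have Jper: "i \<in> J \<longleftrightarrow> j \<in> J" if "c i = c j" for i j using that by (auto simp: J_def)
  have "\<exists>j\<in>J. j + int s \<in> I"
  proof (rule ccontr)
    assume no: "\<not> ?thesis"
    then have st: "j + int s \<in> J" if "j \<in> J" for j using IJ that by blast
    have dec: "j - 1 \<in> J" if "j \<in> J" for j
    proof -
      have "j + int s + int s \<in> J" using st[OF st[OF that]] .
      moreover have "j + int s + int s = j - 1 + int n" using s by simp
      ultimately show ?thesis using Jper[OF c_periodic[of "j - 1"]] by simp
    qed
    have decs: "j0 - int m \<in> J" for m
    proof (induction m)
      case (Suc m)
      have "j0 - int (Suc m) = j0 - int m - 1" by simp
      then show ?case using dec[OF Suc] by (simp only:)
    qed (use j0 in simp)
    define m where "m = nat ((j0 - (i0 - int s)) mod int n)"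
    have "int m = (j0 - (i0 - int s)) mod int n" using n_ge_5 by (simp add: m_def)
    then have "int n dvd (j0 - (i0 - int s)) - int m" by simp
    then have "c (i0 - int s) = c (j0 - int m)" unfolding c_eq_iff by (simp add: algebra_simps)
    then have "i0 - int s \<in> J" using Jper decs by blast
    then show False using no i0 by force
  qed
  then obtain j where j: "j \<in> J" "j + int s \<in> I" by blast
  obtain x where x: "x \<in> F" "E x (c j)" using j by (auto simp: J_def)
  obtain h where h: "h \<in> H - F" "E h (c (j + int s))" using j by (auto simp: I_def)
  have xH: "x \<in> H" "h \<in> H" using x FH h by auto
  \<comment> \<open>At most one degree is lost to the cycle, and \<open>k - 1 \<ge> 5\<close>. The
    resulting span \<open>k - 2\<close> together with the arcs of lengths \<open>s\<close> and
    \<open>s + 1\<close> amounts to \<open>k\<close>.\<close>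
  have "tf_rooted (k - 1) E (F - {x}) x b" unfolding tf_rooted_def two_rooted_F(2)[OF x(1)]
  proof (intro conjI ballI impI)
    interpret two_rooted E "F - {x}" x b by (rule two_rooted_F(1)[OF x(1)])
    show "two_rooted_conn E (F - {x}) x b"
    proof unfold_locales
      fix F' assume "F' \<subseteq> F - {x}" "F' \<noteq> {}"
      then show "2 \<le> card (nb F')" unfolding two_rooted_F(2)[OF x(1)] using F_two_cut[OF _ x(1)] by blast
    qed
    show "F - {x} \<noteq> {}" using other[OF x(1)] by blast
  next
    fix v assume v: "v \<in> F - {x}"
    have "card {u\<in>range c. E v u} \<le> 1"
    proof (cases "{u\<in>range c. E v u} = {}")
      case False
      then obtain i where "E v (c i)" by blast
      then have "{u\<in>range c. E v u} \<subseteq> {c i}" using x2[of v] v by blast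
      then show ?thesis by (rule card_le1I)
    qed (simp only: card.empty)
    then show "k - 1 \<le> degree_in E (insert b F) v" using degF[of v] v by (simp add: degree_in_def)
  next
    fix u v w assume "E u v" "E v w"
    then show "\<not> E u w" by (rule tf)
  qed
  then have q: "spans (path_lengths E (F - {x}) x b) (k - 1 - 1)" by (intro tf_rooted_spans) (use k6 in auto)
  obtain q where "\<forall>p\<in>path_lengths E (F - {x}) x b. p + q \<in> path_lengths E (H - {x, h}) x h" using extend_outside_F[OF h(1) x(1)] by blast
  then have q: "spans (path_lengths E (H - {x, h}) x h) (k - 1 - 1)" using spans_shift[OF q, of q] by blast
  show ?thesis
  proof (rule fin[OF xH q h(2), of 1 s])
    fix i :: nat assume i: "i \<le> 1"
    have "s \<in> path_lengths E (range c) (c (j + int s)) (c j)" "n - s \<in> path_lengths E (range c) (c (j + int s)) (c j)"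
      by (rule arc_lengths_both; use s s2 in simp)+
    moreover have "n - s = s + 1" using s by simp
    ultimately have "s + i \<in> path_lengths E (range c) (c (j + int s)) (c j)" using i by (cases i) auto
    then show "\<exists>j'. E x (c j') \<and> s + i \<in> path_lengths E (range c) (c (j + int s)) (c j')" using x by blast
  qed (use k6 in auto)
qed

lemma gated_consecutive_cycles: "\<exists>l. \<forall>i<k. has_cycle_length E (l + i)"
  using cycles_one_cycle_neighbour cycles_two_cycle_neighbours by blast

end

section \<open>Existence of an end part with a gate\<close>

context shortest_odd_cycle begin

text \<open>A smallest \<open>F\<close> with at most one neighbour has every property except
  possibly \<open>out\<close>. If no vertex outside \<open>F\<close> sees the cycle, then by
  2-connectedness only the gate lies outside, so \<open>F\<close> has all but one vertex of
  \<open>H\<close>. Leaving out a vertex \<open>h0\<close> that sees the cycle instead gives a set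
  of the same, hence least, size.\<close>

lemma gate_exists: "\<exists>F b. gated_odd_cycle E V k c n F b"
proof -
  let ?P = "\<lambda>F. F \<subseteq> H \<and> F \<noteq> {} \<and> F \<noteq> H \<and> card (nbhd E H F) \<le> 1"
  have one: "?P (H - {h}) \<and> nbhd E H (H - {h}) \<subseteq> {h}" if h: "h \<in> H" for h
  proof -
    obtain h' where h': "h' \<in> H" "h' \<noteq> h" using cycle_vertex_neighbour[of 0 h] by blast
    have s: "nbhd E H (H - {h}) \<subseteq> {h}" by (auto simp: nbhd_def)
    then show ?thesis using card_le1I[OF s] h h' by blast
  qed
  obtain h0 where h0: "h0 \<in> H" "E (c 0) h0" using cycle_vertex_neighbour[of 0] by blast
  have "?P (H - {h0})" using one[OF h0(1)] by blast
  from ex_has_least_nat[of ?P, OF this, of card] obtain F where F: "?P F" "\<And>F'. ?P F' \<Longrightarrow> card F \<le> card F'" by blast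
  have mk: ?thesis if G: "?P F1" "card F1 \<le> card F" "nbhd E H F1 \<subseteq> {b}" "b \<in> H" "b \<notin> F1" "\<exists>h\<in>H - F1. \<exists>i. E h (c i)" for F1 b
  proof -
    have fF: "finite F1" using G(1) H_facts(3) finite_subset by blast
    have "gated_odd_cycle E V k c n F1 b"
    proof unfold_locales
      fix F' assume F': "F' \<subset> F1" "F' \<noteq> {}"
      show "2 \<le> card (nbhd E H F')"
      proof (rule ccontr)
        assume "\<not> ?thesis"
        then have "?P F'" using F' G(1) by auto
        then have "card F \<le> card F'" by (rule F(2))
        then show False using psubset_card_mono[OF fF F'(1)] G(2) by linarith
      qed
    qed (use G in auto)
    then show ?thesis by blast
  qed
  have "nbhd E H F \<noteq> {}" using cn F(1) unfolding cut_connected_def H_def[symmetric] by blast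
  then obtain b where b: "b \<in> nbhd E H F" by blast
  have fn: "finite (nbhd E H F)" using H_facts(3) by (simp add: nbhd_def)
  have nb: "nbhd E H F \<subseteq> {b}"
  proof
    fix v assume "v \<in> nbhd E H F"
    then show "v \<in> {b}" using card_ge2I[OF _ b _ fn, of v] F(1) by auto
  qed
  have bH: "b \<in> H" "b \<notin> F" using b by (auto simp: nbhd_def)
  show ?thesis
  proof (cases "\<exists>h\<in>H - F. \<exists>i. E h (c i)")
    case True
    show ?thesis by (rule mk[OF F(1) order_refl nb bH True])
  next
    case no: False
    have "H - F \<subseteq> {b}"
    proof (rule ccontr)
      assume a: "\<not> ?thesis"
      define Q where "Q = H - F - {b}"
      have Q: "Q \<noteq> {}" "Q \<subseteq> V" using a H_facts(1) by (auto simp: Q_def)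
      have nbQ: "nbhd E V Q \<subseteq> {b}"
      proof
        fix v assume "v \<in> nbhd E V Q"
        then obtain f where v: "v \<in> V" "v \<notin> Q" "f \<in> Q" "E f v" unfolding nbhd_def by blast
        have f: "f \<in> H - F" "f \<noteq> b" using v by (auto simp: Q_def)
        have "v \<notin> range c" using no f v by blast
        then have vH: "v \<in> H" using v by (simp add: H_def)
        have "v \<notin> F"
        proof
          assume "v \<in> F"
          then have "f \<in> nbhd E H F" using sym[OF v(4)] f by (auto simp: nbhd_def)
          then show False using nb f by blast
        qed
        then show "v \<in> {b}" using v(2) vH by (auto simp: Q_def)
      qed
      obtain f where f: "f \<in> F" using F(1) by blast
      have "f \<in> V" "f \<noteq> b" "f \<notin> Q" using f F(1) H_facts(1) bH by (auto simp: Q_def)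
      then have "V - Q - nbhd E V Q \<noteq> {}" using nbQ by blast
      then have "2 \<le> card (nbhd E V Q)" using con[OF Q(2,1)] by blast
      then show False using card_le1I[OF nbQ] by linarith
    qed
    then have FH: "F = H - {b}" using bH F(1) by blast
    have "card (H - {h0}) = card F" unfolding FH using h0(1) bH(1) H_facts(3) by simp
    moreover have "\<exists>h\<in>H - (H - {h0}). \<exists>i. E h (c i)" using h0 sym by blast
    ultimately show ?thesis using mk[of "H - {h0}" h0] one[OF h0(1)] h0(1) by simp
  qed
qed

lemma triangle_free_consecutive_cycles: "\<exists>l. \<forall>i<k. has_cycle_length E (l + i)"
proof -
  obtain F b where "gated_odd_cycle E V k c n F b" using gate_exists by blast
  then show ?thesis by (rule gated_odd_cycle.gated_consecutive_cycles)
qed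

end

context dense_graph begin

theorem consecutive_cycles:
  assumes "induced_cycle_map c n" "odd n" "cut_connected (V - range c)" and nc: "\<not> (clique V \<and> card V = k + 1)"
  shows "\<exists>l. \<forall>i<k. has_cycle_length E (l + i)"
proof (cases "\<exists>u v w. E u v \<and> E v w \<and> E u w")
  case True
  then show ?thesis using triangle_case nc by blast
next
  case False
  let ?P = "\<lambda>n. \<exists>c. induced_cycle_map c n \<and> odd n \<and> cut_connected (V - range c)"
  have ex: "?P n" using assms by blast
  obtain c' where c': "induced_cycle_map c' (LEAST n. ?P n)" "odd (LEAST n. ?P n)" "cut_connected (V - range c')" using LeastI[of ?P, OF ex] by blast
  have "shortest_odd_cycle E V k c' (LEAST n. ?P n)"
  proof unfold_locales
    show "\<not> E u w" if "E u v" "E v w" for u v w using False that by blast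
    show "(LEAST n. ?P n) \<le> n'" if "induced_cycle_map c2 n'" "odd n'" "cut_connected (V - range c2)" for c2 n'
      by (rule Least_le) (use that in blast)
  qed (use c' in blast)+
  then show ?thesis by (rule shortest_odd_cycle.triangle_free_consecutive_cycles)
qed

end

section \<open>Transfer to symmetric digraphs\<close>

definition adj :: "('a,'b) pre_digraph \<Rightarrow> 'a \<Rightarrow> 'a \<Rightarrow> bool" where
  "adj G u v \<longleftrightarrow> (u, v) \<in> arcs_ends G"

lemma adj_arc: "adj G u v \<longleftrightarrow> (\<exists>e\<in>arcs G. tail G e = u \<and> head G e = v)"
  by (auto simp: adj_def arcs_ends_conv)

context graph begin

lemma adj_sym: "adj G u v \<Longrightarrow> adj G v u"
  using sym_arcs by (auto simp: adj_def symmetric_def dest: symD)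

text \<open>\<open>connected\<close> means reachability in the symmetric closure, so the cut form
  follows by induction along a walk that starts in \<open>F\<close>.\<close>

lemma connected_induce:
  assumes "connected (G \<restriction> S)" "F \<subseteq> S" "F \<noteq> {}" "F \<noteq> S"
  shows "nbhd (adj G) S F \<noteq> {}"
proof
  assume e: "nbhd (adj G) S F = {}"
  obtain f w where fw: "f \<in> F" "w \<in> S" "w \<notin> F" using assms by blast
  let ?A = "parcs (mk_symmetric (G \<restriction> S))"
  have "(f, w) \<in> rtrancl_on S ?A"
    using assms(1,2) fw by (auto simp: connected_def strongly_connected_def reachable_def mk_symmetric_def)
  then have "w \<in> F"
  proof (induction rule: rtrancl_on_induct)
    case (step y z)
    obtain a where a: "a \<in> arcs G" "(y, z) = (tail G a, head G a) \<or> (y, z) = (head G a, tail G a)"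
      using step(2) by (auto simp: mk_symmetric_def)
    have "adj G (tail G a) (head G a)" using a(1) by (auto simp: adj_arc)
    then have "adj G y z" using a(2) adj_sym by auto
    show ?case
    proof (rule ccontr)
      assume "z \<notin> F"
      then have "z \<in> nbhd (adj G) S F" using step \<open>adj G y z\<close> by (auto simp: nbhd_def)
      then show False using e by blast
    qed
  qed (use fw in simp)
  then show False using fw by blast
qed

text \<open>Without parallel arcs \<open>head G\<close> is injective on the arcs leaving
  \<open>v\<close>.\<close>

lemma out_degree_adj: "out_degree G v = degree_in (adj G) (verts G) v"
proof -
  have "inj_on (head G) (out_arcs G v)"
    by (rule inj_onI) (auto simp: out_arcs_def arc_to_ends_def intro: no_multi_arcs)
  moreover have "head G ` out_arcs G v = {w\<in>verts G. adj G v w}" by (auto simp: out_arcs_def adj_arc)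
  ultimately show ?thesis unfolding out_degree_def degree_in_def by (metis card_image)
qed

text \<open>The neighbourhood of \<open>F\<close> separates \<open>F\<close> from whatever lies
  beyond it, so \<open>vertex_connected 2 G\<close> yields the condition \<open>con\<close>.\<close>

lemma dense_graph_adj:
  assumes "6 \<le> k" "vertex_connected 2 G" "k \<le> min_degree G"
  shows "dense_graph (adj G) (verts G) k"
proof unfold_locales
  show "adj G u v \<Longrightarrow> u \<in> verts G" for u v by (auto simp: adj_arc)
  show "\<not> adj G u u" for u unfolding adj_arc using no_loops by metis
  fix v assume "v \<in> verts G"
  then have "min_degree G \<le> out_degree G v" by (simp add: min_degree_def)
  then show "k \<le> degree_in (adj G) (verts G) v" using assms(3) out_degree_adj by simp
next
  fix F assume F: "F \<subseteq> verts G" "F \<noteq> {}" "verts G - F - nbhd (adj G) (verts G) F \<noteq> {}"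
  define X where "X = nbhd (adj G) (verts G) F"
  show "2 \<le> card (nbhd (adj G) (verts G) F)"
  proof (rule ccontr)
    assume "\<not> ?thesis"
    then have "connected (G \<restriction> (verts G - X))"
      using assms(2) by (auto simp: vertex_connected_def delete_verts_def X_def nbhd_def)
    moreover have "F \<subseteq> verts G - X" "F \<noteq> verts G - X" using F by (auto simp: X_def nbhd_def)
    ultimately have "nbhd (adj G) (verts G - X) F \<noteq> {}" using F(2) by (intro connected_induce)
    then show False by (auto simp: X_def nbhd_def)
  qed
qed (use assms(1) adj_sym in auto)

lemma exact_path_apath:
  assumes "exact_path (adj G) U u v"
  shows "\<exists>p. apath u p v \<and> set (awalk_verts u p) = insert u (insert v U) \<and> length p = Suc (card U)"
  using assms
proof (induction)
  case (base x y)
  then obtain e where "e \<in> arcs G" "tail G e = x" "head G e = y" by (auto simp: adj_arc)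
  then show ?case using base by (intro exI[of _ "[e]"]) (auto simp: apath_def awalk_def)
next
  case (step x w U y)
  obtain p where p: "apath w p y" "set (awalk_verts w p) = insert w (insert y U)" "length p = Suc (card U)" using step by blast
  obtain e where e: "e \<in> arcs G" "tail G e = x" "head G e = w" using step by (auto simp: adj_arc)
  note f = exact_path_facts[OF step(2)]
  have "card (insert w U) = Suc (card U)" using f by simp
  moreover have "apath x (e # p) y" using p e step by (auto simp: apath_def awalk_def)
  moreover have "set (awalk_verts x (e # p)) = insert x (insert y (insert w U))" using p e by auto
  ultimately show ?case using p(3) by (intro exI[of _ "e # p"]) simp
qed

lemma has_cycle_length_ucycle:
  assumes "has_cycle_length (adj G) n" shows "\<exists>p. ucycle G p \<and> length p = n"
proof -
  obtain U u v where U: "exact_path (adj G) U u v" "adj G v u" "n = card U + 2" "3 \<le> n" using assms by (auto simp: has_cycle_length_def)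
  obtain p where p: "apath u p v" "length p = Suc (card U)" using exact_path_apath[OF U(1)] by blast
  obtain e where e: "e \<in> arcs G" "tail G e = v" "head G e = u" using U by (auto simp: adj_arc)
  \<comment> \<open>With the closing arc in front, the vertices after the first one are exactly
    those of the path \<open>p\<close>, as \<open>cycle\<close> demands them to be distinct.\<close>
  have "awalk v (e # p) v" "distinct (tl (awalk_verts v (e # p)))" using p e by (auto simp: apath_def awalk_def)
  then have "cycle (e # p)" unfolding cycle_def by blast
  then show ?thesis using p U by (intro exI[of _ "e # p"]) (auto simp: ucycle_def)
qed

section \<open>Parametrising a given induced cycle\<close>

lemma head_cas_nth: "cas u p v \<Longrightarrow> i < length p \<Longrightarrow> head G (p ! i) = (if Suc i < length p then tail G (p ! Suc i) else v)"
proof (induction p arbitrary: u i)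
  case (Cons e p)
  show ?case
  proof (cases i)
    case 0
    then show ?thesis using Cons.prems by (cases p) auto
  next
    case (Suc i')
    then show ?thesis using Cons.IH[of "head G e" i'] Cons.prems by auto
  qed
qed simp

text \<open>\<open>c i\<close> is the tail of the arc with index \<open>i\<close> modulo the length,
  and the head of that arc is \<open>c (i + 1)\<close>. A chord would be an arc of the induced
  subgraph on \<open>cycle_verts G p\<close>, hence of \<open>cycle_graph G p\<close>, where every
  arc joins consecutive vertices.\<close>

lemma induced_cycle_parametrisation:
  assumes uc: "ucycle G p" and ind: "induced_cycle G p" and dense_graph: "dense_graph (adj G) (verts G) k"
  shows "\<exists>c. dense_graph.induced_cycle_map (adj G) (verts G) c (length p) \<and> range c = cycle_verts G p"
proof -
  interpret g: dense_graph "adj G" "verts G" k by (rule dense_graph)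
  obtain u where u: "awalk u p u" "distinct (tl (awalk_verts u p))" "p \<noteq> []" "3 \<le> length p"
    using uc by (auto simp: ucycle_def cycle_def)
  define n where "n = length p"
  have n3: "3 \<le> n" using u by (simp add: n_def)
  have cas: "cas u p u" and arcs: "set p \<subseteq> arcs G" using u(1) by (auto simp: awalk_def)
  \<comment> \<open>Distinctness is given for the vertices after the first one; since the walk is
    closed, the first vertex equals the last, so all tails are distinct.\<close>
  have dis: "distinct (map (tail G) p)"
  proof -
    obtain e q where p: "p = e # q" using u(3) by (cases p) auto
    have "awalk_verts u p = map (tail G) p @ [u]"
      using awlast_if_cas[OF cas] u(3) by (simp add: awalk_verts_conv)
    then have "distinct (map (tail G) q @ [u])" using u(2) p by simp
    then show ?thesis using cas p by auto
  qed
  define c where "c i = tail G (p ! nat (i mod int n))" for i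
  have rng: "0 \<le> i mod int n" "nat (i mod int n) < n" for i using n3 by (auto simp: nat_less_iff)
  have c_eq_iff: "c i = c j \<longleftrightarrow> int n dvd j - i" for i j
  proof -
    have "c i = c j \<longleftrightarrow> nat (i mod int n) = nat (j mod int n)"
      using nth_eq_iff_index_eq[OF dis] rng(2)[of i] rng(2)[of j] by (simp add: c_def n_def)
    also have "\<dots> \<longleftrightarrow> j mod int n = i mod int n" using rng(1)[of i] rng(1)[of j] by auto
    finally show ?thesis by (simp add: mod_eq_dvd_iff)
  qed
  have cm: "c (int m) = tail G (p ! m)" if "m < n" for m using that by (simp add: c_def)
  have hd: "head G (p ! m) = c (int m + 1)" if m: "m < n" for m
  proof (cases "Suc m < n")
    case True
    then show ?thesis using head_cas_nth[OF cas, of m] cm[of "Suc m"] by (simp add: n_def add.commute)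
  next
    case False
    then have "int m + 1 = int n" using m by simp
    then have "c (int m + 1) = c (int 0)" by (simp add: c_eq_iff)
    also have "\<dots> = u" using cm[of 0] n3 cas u(3) by (cases p) auto
    finally show ?thesis using head_cas_nth[OF cas, of m] m False by (simp add: n_def)
  qed
  have nx: "adj G (c i) (c (i + 1))" for i
  proof -
    define m where "m = nat (i mod int n)"
    have m: "m < n" "int m = i mod int n" using rng[of i] by (auto simp: m_def)
    have "int n dvd i - int m" unfolding m(2) by simp
    then have "c (int m) = c i" "c (int m + 1) = c (i + 1)" by (simp_all add: c_eq_iff)
    moreover have "adj G (c (int m)) (c (int m + 1))"
      unfolding cm[OF m(1)] hd[OF m(1), symmetric] adj_arc
      by (rule bexI[of _ "p ! m"]) (use arcs m(1) in \<open>auto simp: n_def\<close>)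
    ultimately show ?thesis by simp
  qed
  have cr: "range c = cycle_verts G p"
  proof
    show "range c \<subseteq> cycle_verts G p" using rng(2) by (auto simp: c_def cycle_verts_def n_def)
    show "cycle_verts G p \<subseteq> range c"
    proof
      fix v assume "v \<in> cycle_verts G p"
      then obtain m where "m < n" "v = tail G (p ! m)" by (auto simp: cycle_verts_def in_set_conv_nth n_def)
      then show "v \<in> range c" using cm by (metis rangeI)
    qed
  qed
  have "g.induced_cycle_map c n" unfolding g.induced_cycle_map_def
  proof (intro conjI allI)
    show "3 \<le> n" by (rule n3)
    show "range c \<subseteq> verts G" using cr arcs by (auto simp: cycle_verts_def)
    fix i j
    show "c i = c j \<longleftrightarrow> int n dvd j - i" by (rule c_eq_iff)
    show "adj G (c i) (c j) \<longleftrightarrow> int n dvd j - i - 1 \<or> int n dvd j - i + 1"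
    proof
      assume "int n dvd j - i - 1 \<or> int n dvd j - i + 1"
      then show "adj G (c i) (c j)"
      proof
        assume "int n dvd j - i - 1"
        then have "c (i + 1) = c j" by (simp add: c_eq_iff algebra_simps)
        then show ?thesis using nx[of i] by simp
      next
        assume "int n dvd j - i + 1"
        then have "c i = c (j + 1)" by (simp add: c_eq_iff algebra_simps)
        then show ?thesis using adj_sym[OF nx[of j]] by simp
      qed
    next
      assume "adj G (c i) (c j)"
      then obtain e where e: "e \<in> arcs G" "tail G e = c i" "head G e = c j" by (auto simp: adj_arc)
      have "e \<in> arcs (G \<restriction> cycle_verts G p)" using e cr by auto
      then have "e \<in> arcs (cycle_graph G p)" using ind unfolding induced_cycle_def by metis
      then obtain f where f: "f \<in> set p" "(c i, c j) = (tail G f, head G f) \<or> (c i, c j) = (head G f, tail G f)"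
        using e by (auto simp: cycle_graph_def)
      then obtain m where m: "m < n" "f = p ! m" by (auto simp: in_set_conv_nth n_def)
      have f2: "tail G f = c (int m)" "head G f = c (int m + 1)" using cm[OF m(1)] hd[OF m(1)] m(2) by simp_all
      from f(2) show "int n dvd j - i - 1 \<or> int n dvd j - i + 1"
      proof
        assume "(c i, c j) = (tail G f, head G f)"
        then have "int n dvd int m - i" "int n dvd j - (int m + 1)" using c_eq_iff[of i "int m"] c_eq_iff[of "int m + 1" j] unfolding f2 by auto
        then have "int n dvd (int m - i) + (j - (int m + 1))" by (rule dvd_add)
        then show ?thesis by (simp add: algebra_simps)
      next
        assume "(c i, c j) = (head G f, tail G f)"
        then have "int n dvd int m + 1 - i" "int n dvd j - int m" using c_eq_iff[of i "int m + 1"] c_eq_iff[of "int m" j] unfolding f2 by auto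
        then have "int n dvd (int m + 1 - i) + (j - int m)" by (rule dvd_add)
        then show ?thesis by (simp add: algebra_simps)
      qed
    qed
  qed
  then show ?thesis using cr unfolding n_def by blast
qed

end

theorem theorem3p2:
  fixes G :: "('a,'b) pre_digraph" and k :: nat
  assumes "6 \<le> k"
    and "graph G"
    and "vertex_connected 2 G"
    and "\<exists>C. nonseparating_cycle G C \<and> induced_cycle G C \<and> odd_cycle G C"
    and "k \<le> min_degree G"
    and "\<not> complete_digraph (k + 1) G"
  shows "\<exists>l::nat. \<forall>i \<in> {0..k - 1}. \<exists>p. ucycle G p \<and> length p = l + i"
proof -
  interpret graph G by fact
  have dense_graph: "dense_graph (adj G) (verts G) k" by (rule dense_graph_adj[OF assms(1,3,5)])
  interpret g: dense_graph "adj G" "verts G" k by (rule dense_graph)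
  obtain C where C: "nonseparating_cycle G C" "induced_cycle G C" "odd_cycle G C" using assms(4) by blast
  have uc: "ucycle G C" using C(1) by (simp add: nonseparating_cycle_def)
  obtain c where c: "g.induced_cycle_map c (length C)" "range c = cycle_verts G C" using induced_cycle_parametrisation[OF uc C(2) dense_graph] by blast
  have "g.cut_connected (verts G - range c)" unfolding g.cut_connected_def c(2)
    using connected_induce C(1) unfolding nonseparating_cycle_def delete_verts_def by blast
  moreover have "odd (length C)" using C(3) by (simp add: odd_cycle_def)
  moreover have "\<not> (g.clique (verts G) \<and> card (verts G) = k + 1)"
  proof
    assume a: "g.clique (verts G) \<and> card (verts G) = k + 1"
    have "arcs_ends G = {(u,v). (u,v) \<in> verts G \<times> verts G \<and> u \<noteq> v}"
    proof (rule set_eqI)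
      fix e :: "'a \<times> 'a"
      obtain u v where e: "e = (u, v)" by (cases e)
      have "adj G u v \<longleftrightarrow> u \<in> verts G \<and> v \<in> verts G \<and> u \<noteq> v"
        using a[unfolded g.clique_def] g.irr[of u] g.EV[of u v] g.EV[of v u] adj_sym[of u v] by blast
      then show "e \<in> arcs_ends G \<longleftrightarrow> e \<in> {(u,v). (u,v) \<in> verts G \<times> verts G \<and> u \<noteq> v}" by (simp add: e adj_def)
    qed
    then have "complete_digraph (k + 1) G" using a assms(2) by (simp add: complete_digraph_def)
    then show False using assms(6) by blast
  qed
  ultimately obtain l where l: "\<And>i. i < k \<Longrightarrow> has_cycle_length (adj G) (l + i)" using g.consecutive_cycles[OF c(1)] by blast
  have "\<exists>p. ucycle G p \<and> length p = l + i" if "i \<in> {0..k - 1}" for i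
    using has_cycle_length_ucycle[OF l[of i]] that assms(1) by auto
  then show ?thesis by blast
qed

end
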